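(* Fix $\beta>0$. Let $F\in\mathcal H_\beta$, $\eta\in H^1(\mu_T)$, and set $w=\mathcal U(F,\eta)$. Then $w$ has an occupation mild jet, and $$\|D_x^2w\|_{\mathcal H_\beta}^2+2\beta\int_0^Tr_\beta(t)\operatorname{Var}\bigl(\nabla_xw(t,X_t)\bigr)\,dt=\operatorname{Var}(\nabla\eta(X_T))-2\int_0^Tr_\beta(t)\int F(t,x)\,\mathcal A_t^\mu Q_t^{\mathrm{aff}}w(t,x)\,\mu_t(dx)\,dt .$$ Moreover, $$\|D_x^2w\|_{\mathcal H_\beta}\le2\sqrt2\,\|F\|_{\mathcal H_\beta}+\operatorname{Var}(\nabla\eta(X_T))^{1/2}.$$
   Context: Fix $T>0$, $d\in\mathbb N^+$, $x_0\in\mathbb R^d$. $W$ is a $d$-dimensional Brownian motion, $X_t=x_0+W_t$, $\mu_t$ is the law of $X_t$ (for $t>0$, $\mu_t=N(x_0,tI_d)$ with density $p_t$), $P_r\varphi(x)=\mathbb E[\varphi(x+W_r)]$. $r_\beta(t)=e^{-2\beta(T-t)}$, $\nu_\beta(dt,dx)=r_\beta(t)p_t(x)\,dt\,dx$ on $(0,T)\times\mathbb R^d$, $\mathcal H_\beta=L^2(\nu_\beta)$ (also for vector- and matrix-valued functions; matrices carry the Frobenius norm). $H^1(\mu_T)$ is the Gaussian Sobolev space. For a square-integrable random vector $U$, $\operatorname{Var}(U)=\mathbb E|U-\mathbb EU|^2$. $\mathcal U(F,\eta)(t,x)=P_{T-t}\eta(x)+\int_t^TP_{r-t}F(r,\cdot)(x)\,dr$.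 A measurable $v:(0,T)\times\mathbb R^d\to\mathbb R$ has an occupation mild jet if $v\in\mathcal H_\beta$ and its first- and second-order spatial distributional derivatives on $(0,T)\times\mathbb R^d$ (tested against $C_c^\infty((0,T)\times\mathbb R^d)$) are represented by $D_xv=\nabla_xv\in\mathcal H_\beta$ and a symmetric-matrix-valued $D_x^2v\in\mathcal H_\beta$. For $t>0$: $\langle\phi\rangle_t=\int\phi\,d\mu_t$, $(\Pi_t^{\mathrm{aff}}\phi)(x)=\langle\phi\rangle_t+\langle\nabla\phi\rangle_t\cdot(x-x_0)$, $Q_t^{\mathrm{aff}}=I-\Pi_t^{\mathrm{aff}}$, and $\mathcal A_t^\mu\phi=p_t^{-1}\nabla\cdot(p_t\nabla\phi)=\Delta\phi-\frac{x-x_0}t\cdot\nabla\phi$. For smooth data $F\in C_c^\infty((0,T)\times\mathbb R^d)$, $\eta\in C_c^\infty(\mathbb R^d)$, $\mathcal A_t^\mu Q_t^{\mathrm{aff}}w$ is the classical expression applied to $w(t,\cdot)$. For general $(F,\eta)\in\mathcal H_\beta\times H^1(\mu_T)$, $\mathcal A_\cdot^\mu Q_\cdot^{\mathrm{aff}}w\in\mathcal H_\beta$ denotes the value at $(F,\eta)$ of the unique continuous extension to $\mathcal H_\beta\times H^1(\mu_T)\to\mathcal H_\beta$ of the map $(F,\eta)\mapsto\mathcal A_\cdot^\mu Q_\cdot^{\mathrm{aff}}\,\mathcal U(F,\eta)$ defined on smooth data (this extension exists), i.e. the $\mathcal H_\beta$-limit along smooth data converging to $(F,\eta)$. *)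

theory Defs
  imports "HOL-Probability.Probability"
begin

section \<open>Square-integrable functions\<close>

text \<open>Elements of an $L^2$ space are represented by functions, not by almost-everywhere classes.
  The norm is used only for functions satisfying \<open>square_integrable\<close>; for matrix-valued functions
  (type \<open>real^'n^'n\<close>) the library norm is the Frobenius norm.\<close>

definition square_integrable :: "'a measure \<Rightarrow> ('a \<Rightarrow> 'b::euclidean_space) \<Rightarrow> bool" where
  "square_integrable N f \<longleftrightarrow> f \<in> borel_measurable N \<and> integrable N (\<lambda>z. (norm (f z))\<^sup>2)"

definition L2_norm :: "'a measure \<Rightarrow> ('a \<Rightarrow> 'b::euclidean_space) \<Rightarrow> real" where
  "L2_norm N f = sqrt (LINT z|N. (norm (f z))\<^sup>2)"

definition L2_converges ::
    "'a measure \<Rightarrow> (nat \<Rightarrow> 'a \<Rightarrow> 'b::euclidean_space) \<Rightarrow> ('a \<Rightarrow> 'b) \<Rightarrow> bool" where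
  "L2_converges N f g \<longleftrightarrow>
     square_integrable N g \<and> (\<forall>k. square_integrable N (f k)) \<and>
     (\<lambda>k. L2_norm N (\<lambda>z. f k z - g z)) \<longlonglongrightarrow> 0"

definition vec_variance :: "'w measure \<Rightarrow> ('w \<Rightarrow> 'b::euclidean_space) \<Rightarrow> real" where
  "vec_variance M U = (LINT \<omega>|M. (norm (U \<omega> - (LINT \<omega>'|M. U \<omega>')))\<^sup>2)"

section \<open>Classical derivatives and test functions\<close>

fun iter_deriv ::
    "'a list \<Rightarrow> ('a::euclidean_space \<Rightarrow> 'b::euclidean_space) \<Rightarrow> 'a \<Rightarrow> 'b" where
  "iter_deriv [] f = f"
| "iter_deriv (v # vs) f = (\<lambda>x. frechet_derivative (iter_deriv vs f) (at x) v)"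

text \<open>All iterated directional derivatives are everywhere Frechet differentiable, i.e. $C^\infty$.\<close>

definition smooth :: "('a::euclidean_space \<Rightarrow> 'b::euclidean_space) \<Rightarrow> bool" where
  "smooth f \<longleftrightarrow> (\<forall>vs x. iter_deriv vs f differentiable (at x))"

text \<open>$C_c^\infty(D)$ for open \<open>D\<close>, its elements being extended by zero to the whole space.\<close>

definition test_function :: "'a::euclidean_space set \<Rightarrow> ('a \<Rightarrow> real) \<Rightarrow> bool" where
  "test_function D \<phi> \<longleftrightarrow>
     smooth \<phi> \<and> compact (closure {x. \<phi> x \<noteq> 0}) \<and> closure {x. \<phi> x \<noteq> 0} \<subseteq> D"

definition partial :: "'n::finite \<Rightarrow> (real^'n \<Rightarrow> real) \<Rightarrow> real^'n \<Rightarrow> real" where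
  "partial i \<phi> x = frechet_derivative \<phi> (at x) (axis i 1)"

definition grad :: "(real^'n::finite \<Rightarrow> real) \<Rightarrow> real^'n \<Rightarrow> real^'n" where
  "grad \<phi> x = (\<chi> i. partial i \<phi> x)"

definition divergence :: "(real^'n::finite \<Rightarrow> real^'n) \<Rightarrow> real^'n \<Rightarrow> real" where
  "divergence V x = (\<Sum>i\<in>UNIV. partial i (\<lambda>y. V y $ i) x)"

definition spatial_partial ::
    "'n::finite \<Rightarrow> (real \<times> (real^'n) \<Rightarrow> real) \<Rightarrow> real \<times> (real^'n) \<Rightarrow> real" where
  "spatial_partial i \<phi> z = frechet_derivative \<phi> (at z) (0, axis i 1)"

section \<open>Brownian motion and the associated measures\<close>

text \<open>Density of $N(m, tI)$, for \<open>t > 0\<close>.\<close>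

definition gauss_density :: "real^'n::finite \<Rightarrow> real \<Rightarrow> real^'n \<Rightarrow> real" where
  "gauss_density m t x =
     (2 * pi * t) powr (- real CARD('n) / 2) * exp (- (norm (x - m))\<^sup>2 / (2 * t))"

definition brownian_motion :: "'w measure \<Rightarrow> (real \<Rightarrow> 'w \<Rightarrow> real^'n::finite) \<Rightarrow> bool" where
  "brownian_motion M W \<longleftrightarrow>
     prob_space M \<and>
     (\<forall>t\<ge>0. W t \<in> borel_measurable M) \<and>
     (AE \<omega> in M. W 0 \<omega> = 0) \<and>
     (\<forall>s t. 0 \<le> s \<and> s < t \<longrightarrow>
        distributed M lborel (\<lambda>\<omega>. W t \<omega> - W s \<omega>) (\<lambda>x. ennreal (gauss_density 0 (t - s) x))) \<and>
     (\<forall>(n::nat) \<tau>. 0 \<le> \<tau> 0 \<and> (\<forall>i<n. \<tau> i < \<tau> (Suc i)) \<longrightarrow>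
        prob_space.indep_vars M (\<lambda>_. borel) (\<lambda>i \<omega>. W (\<tau> (Suc i)) \<omega> - W (\<tau> i) \<omega>) {..<n}) \<and>
     (AE \<omega> in M. continuous_on {0..} (\<lambda>t. W t \<omega>))"

text \<open>The law $\mu_t$ of $X_t = x_0 + W_t$.\<close>

definition mu ::
    "'w measure \<Rightarrow> (real \<Rightarrow> 'w \<Rightarrow> real^'n::finite) \<Rightarrow> real^'n \<Rightarrow> real \<Rightarrow> (real^'n) measure" where
  "mu M W x0 t = distr M borel (\<lambda>\<omega>. x0 + W t \<omega>)"

definition cylinder :: "real \<Rightarrow> (real \<times> (real^'n::finite)) set" where
  "cylinder T = {0<..<T} \<times> UNIV"

definition rfac :: "real \<Rightarrow> real \<Rightarrow> real \<Rightarrow> real" where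
  "rfac T \<beta> t = exp (- 2 * \<beta> * (T - t))"

text \<open>Its underlying space is \<open>cylinder T\<close>, so that values of a function off the domain are
  irrelevant; $\mathcal H_\beta$ is \<open>square_integrable (nu T x0 \<beta>)\<close>.\<close>

definition nu :: "real \<Rightarrow> real^'n::finite \<Rightarrow> real \<Rightarrow> (real \<times> (real^'n)) measure" where
  "nu T x0 \<beta> = density (restrict_space lborel (cylinder T))
     (\<lambda>(t, x). ennreal (rfac T \<beta> t * gauss_density x0 t x))"

section \<open>Gaussian Sobolev space, mild solution map, occupation mild jets\<close>

text \<open>\<open>\<eta>\<close> belongs to $H^1(\mu)$ and \<open>D\<eta>\<close> represents its weak gradient. The distributional
  derivative is taken with respect to Lebesgue measure; \<open>\<mu>\<close> is meant to be a nondegenerate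
  Gaussian, so that square \<open>\<mu>\<close>-integrable functions are locally Lebesgue integrable.\<close>

definition gaussian_H1 ::
    "(real^'n::finite) measure \<Rightarrow> (real^'n \<Rightarrow> real) \<Rightarrow> (real^'n \<Rightarrow> real^'n) \<Rightarrow> bool" where
  "gaussian_H1 \<mu> \<eta> D\<eta> \<longleftrightarrow>
     square_integrable \<mu> \<eta> \<and> square_integrable \<mu> D\<eta> \<and>
     (\<forall>\<phi> i. test_function UNIV \<phi> \<longrightarrow>
        (LINT x|lborel. \<eta> x * partial i \<phi> x) = - (LINT x|lborel. D\<eta> x $ i * \<phi> x))"

definition heat ::
    "'w measure \<Rightarrow> (real \<Rightarrow> 'w \<Rightarrow> real^'n::finite) \<Rightarrow> real \<Rightarrow> (real^'n \<Rightarrow> real) \<Rightarrow> real^'n \<Rightarrow> real"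
  where "heat M W r \<phi> x = (LINT \<omega>|M. \<phi> (x + W r \<omega>))"

definition mild_map ::
    "'w measure \<Rightarrow> (real \<Rightarrow> 'w \<Rightarrow> real^'n::finite) \<Rightarrow> real \<Rightarrow>
     (real \<times> (real^'n) \<Rightarrow> real) \<Rightarrow> (real^'n \<Rightarrow> real) \<Rightarrow> real \<times> (real^'n) \<Rightarrow> real" where
  "mild_map M W T F \<eta> = (\<lambda>(t, x).
     heat M W (T - t) \<eta> x + (LINT r:{t<..<T}|lborel. heat M W (r - t) (\<lambda>y. F (r, y)) x))"

definition occupation_mild_jet ::
    "real \<Rightarrow> real^'n::finite \<Rightarrow> real \<Rightarrow> (real \<times> (real^'n) \<Rightarrow> real) \<Rightarrow>
     (real \<times> (real^'n) \<Rightarrow> real^'n) \<Rightarrow> (real \<times> (real^'n) \<Rightarrow> real^'n^'n) \<Rightarrow> bool" where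
  "occupation_mild_jet T x0 \<beta> v Dv D2v \<longleftrightarrow>
     square_integrable (nu T x0 \<beta>) v \<and>
     square_integrable (nu T x0 \<beta>) Dv \<and>
     square_integrable (nu T x0 \<beta>) D2v \<and>
     (\<forall>z\<in>cylinder T. transpose (D2v z) = D2v z) \<and>
     (\<forall>\<phi> i. test_function (cylinder T) \<phi> \<longrightarrow>
        (LINT z:cylinder T|lborel. v z * spatial_partial i \<phi> z) =
        - (LINT z:cylinder T|lborel. Dv z $ i * \<phi> z)) \<and>
     (\<forall>\<phi> i j. test_function (cylinder T) \<phi> \<longrightarrow>
        (LINT z:cylinder T|lborel. v z * spatial_partial i (spatial_partial j \<phi>) z) =
        (LINT z:cylinder T|lborel. D2v z $ i $ j * \<phi> z))"

section \<open>The operator $\mathcal A^\mu Q^{\mathrm{aff}}$\<close>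

definition aff_proj ::
    "'w measure \<Rightarrow> (real \<Rightarrow> 'w \<Rightarrow> real^'n::finite) \<Rightarrow> real^'n \<Rightarrow> real \<Rightarrow>
     (real^'n \<Rightarrow> real) \<Rightarrow> real^'n \<Rightarrow> real" where
  "aff_proj M W x0 t \<phi> x =
     (LINT y|mu M W x0 t. \<phi> y) + (LINT y|mu M W x0 t. grad \<phi> y) \<bullet> (x - x0)"

definition gen :: "real^'n::finite \<Rightarrow> real \<Rightarrow> (real^'n \<Rightarrow> real) \<Rightarrow> real^'n \<Rightarrow> real" where
  "gen x0 t \<phi> x =
     divergence (\<lambda>y. gauss_density x0 t y *\<^sub>R grad \<phi> y) x / gauss_density x0 t x"

definition AQ_classical ::
    "'w measure \<Rightarrow> (real \<Rightarrow> 'w \<Rightarrow> real^'n::finite) \<Rightarrow> real^'n \<Rightarrow>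
     (real \<times> (real^'n) \<Rightarrow> real) \<Rightarrow> real \<times> (real^'n) \<Rightarrow> real" where
  "AQ_classical M W x0 v = (\<lambda>(t, x).
     gen x0 t (\<lambda>y. v (t, y) - aff_proj M W x0 t (\<lambda>y'. v (t, y')) y) x)"

text \<open>\<open>G\<close> is the value at \<open>(F, \<eta>)\<close> of the continuous extension of
  $(F,\eta) \mapsto \mathcal A^\mu Q^{\mathrm{aff}}\,\mathcal U(F,\eta)$, i.e. the
  $\mathcal H_\beta$-limit along all smooth data converging to \<open>(F, \<eta>)\<close> in
  $\mathcal H_\beta \times H^1(\mu_T)$. Such data are dense, so \<open>G\<close> is unique up to null sets.\<close>

definition AQ_limit ::
    "'w measure \<Rightarrow> (real \<Rightarrow> 'w \<Rightarrow> real^'n::finite) \<Rightarrow> real \<Rightarrow> real^'n \<Rightarrow> real \<Rightarrow>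
     (real \<times> (real^'n) \<Rightarrow> real) \<Rightarrow> (real^'n \<Rightarrow> real) \<Rightarrow> (real^'n \<Rightarrow> real^'n) \<Rightarrow>
     (real \<times> (real^'n) \<Rightarrow> real) \<Rightarrow> bool" where
  "AQ_limit M W T x0 \<beta> F \<eta> D\<eta> G \<longleftrightarrow>
     square_integrable (nu T x0 \<beta>) G \<and>
     (\<forall>Fs \<eta>s.
        (\<forall>k. test_function (cylinder T) (Fs k)) \<and> (\<forall>k. test_function UNIV (\<eta>s k)) \<and>
        L2_converges (nu T x0 \<beta>) Fs F \<and>
        L2_converges (mu M W x0 T) \<eta>s \<eta> \<and>
        L2_converges (mu M W x0 T) (\<lambda>k. grad (\<eta>s k)) D\<eta> \<longrightarrow>
        L2_converges (nu T x0 \<beta>) (\<lambda>k. AQ_classical M W x0 (mild_map M W T (Fs k) (\<eta>s k))) G)"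


lemma mu_eq_density: assumes "brownian_motion M W" "t>0"
  shows "mu M W x0 t = density lborel (\<lambda>x. ennreal (gauss_density x0 t x))"
proof -
  interpret prob_space M using assms by (simp add: brownian_motion_def)
  have m: "W t \<in> borel_measurable M" "W 0 \<in> borel_measurable M"
    using assms by (auto simp: brownian_motion_def)
  have d: "distributed M lborel (\<lambda>\<omega>. W t \<omega> - W 0 \<omega>) (\<lambda>x. ennreal (gauss_density 0 (t - 0) x))"
    using assms unfolding brownian_motion_def by blast
  have "mu M W x0 t = distr (distr M borel (W t)) borel (\<lambda>y. x0 + y)"
    unfolding mu_def using m by (subst distr_distr) (auto simp: comp_def)
  also have "distr M borel (W t) = distr M lborel (\<lambda>\<omega>. W t \<omega> - W 0 \<omega>)"
  proof -
    have "distr M borel (W t) = distr M borel (\<lambda>\<omega>. W t \<omega> - W 0 \<omega>)"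
    proof (rule distr_cong_AE)
      show "AE \<omega> in M. W t \<omega> = W t \<omega> - W 0 \<omega>"
        using assms by (auto simp: brownian_motion_def)
    qed (use m in auto)
    also have "\<dots> = distr M lborel (\<lambda>\<omega>. W t \<omega> - W 0 \<omega>)"
      by (rule distr_cong) auto
    finally show ?thesis .
  qed
  also have "\<dots> = density lborel (\<lambda>x. ennreal (gauss_density 0 t x))"
    using d by (simp add: distributed_def)
  also have "distr (density lborel (\<lambda>x. ennreal (gauss_density 0 t x))) borel (\<lambda>y. x0 + y)
    = density (distr lborel borel ((+) x0)) (\<lambda>x. ennreal (gauss_density x0 t x))"
  proof -
    have [measurable]: "(\<lambda>x. ennreal (gauss_density x0 t x)) \<in> borel_measurable borel"
      by (simp add: gauss_density_def)
    show ?thesis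
      by (subst density_distr) (auto simp: gauss_density_def)
  qed
  also have "\<dots> = density lborel (\<lambda>x. ennreal (gauss_density x0 t x))"
    using lborel_distr_plus[of x0] by (simp)
  finally show ?thesis .
qed

lemma gen_eq_drift_form:
  fixes x0 x :: "real^'n::finite"
  assumes "t > 0" and d: "\<And>i. partial i \<phi> differentiable (at x)"
  shows "gen x0 t \<phi> x = (\<Sum>i\<in>UNIV. partial i (partial i \<phi>) x) - ((x - x0) \<bullet> grad \<phi> x) / t"
proof -
  let ?p = "gauss_density x0 t"
  have p: "?p x > 0" using assms by (simp add: gauss_density_def)
  have dp: "(?p has_derivative (\<lambda>h. - ?p x * ((x-x0) \<bullet> h) / t)) (at x)"
    unfolding gauss_density_def power2_norm_eq_inner using \<open>t>0\<close>
    by (auto intro!: derivative_eq_intros ext simp: field_simps inner_commute)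
  have *: "partial i (\<lambda>y. (?p y *\<^sub>R grad \<phi> y) $ i) x
     = ?p x * (partial i (partial i \<phi>) x - (x - x0) $ i * partial i \<phi> x / t)" for i
  proof -
    have D: "(partial i \<phi> has_derivative frechet_derivative (partial i \<phi>) (at x)) (at x)"
      using d frechet_derivative_works by blast
    have "((\<lambda>y. ?p y * partial i \<phi> y) has_derivative
      (\<lambda>h. ?p x * frechet_derivative (partial i \<phi>) (at x) h + (- ?p x * ((x-x0) \<bullet> h) / t) * partial i \<phi> x)) (at x)"
      by (rule has_derivative_mult[OF dp D])
    from fun_cong[OF frechet_derivative_at[OF this], of "axis i 1"]
    show ?thesis
      unfolding partial_def[of i "\<lambda>y. (?p y *\<^sub>R grad \<phi> y) $ i"] partial_def[of i "partial i \<phi>"]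
      by (simp add: grad_def inner_axis add_divide_distrib diff_divide_distrib algebra_simps)
  qed
  show ?thesis unfolding gen_def divergence_def * using p
    by (simp add: sum_distrib_left[symmetric] sum_subtractf inner_vec_def grad_def sum_divide_distrib)
qed
end

theory Submission
  imports Defs "HOL-Computational_Algebra.Polynomial"
begin

text \<open>For smooth data, \<open>w\<close> solves \<open>w_t + (1/2) \<Delta> w = - F\<close> and so do its spatial derivatives. Differentiating
  \<open>Var (\<nabla> w (t, X_t))\<close> in \<open>t\<close> and integrating by parts against the Gaussian density gives
  \<open>E |D\<^sup>2 w|\<^sup>2 + 2 E F A Q w\<close>; integration with the weight \<open>r\<close> is the identity. The Gaussian Bochner formula
  together with Poincare's inequality bounds \<open>A Q w\<close> by \<open>sqrt 2\<close> times the Hessian, which turns the identity into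
  the estimate. Differences of smooth data then make the jets and \<open>A Q w\<close> Cauchy, the mild map itself is
  continuous in \<open>L\<^sup>2\<close>, and both claims pass to the limit along dense smooth data; the limit of the jets is
  the only weak jet because the density of \<open>nu\<close> is bounded below on compact sets.\<close>

subsection \<open>Square-integrable functions\<close>

text \<open>Every law in the problem is the image of one standard Gaussian under
  \<open>x0 + sqrt t *\<^sub>R z\<close>. Time then sits in the integrand alone: a time derivative
  produces \<open>z / (2 * sqrt t)\<close> against a gradient, and the factor \<open>z\<close> is
  traded for one more space derivative. The source term is likewise an integral over a fixed
  time-to-go interval, so derivatives fall on the data, and the gradient and Hessian of a mild
  solution are mild solutions again.

  The drift of the operator is singular like \<open>1 / t\<close>. The affine projection tames it by
  centring the gradient: the singular part of the squared norm becomes the variance divided by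
  \<open>t\<close>, and the variance is at most \<open>t\<close> times the squared Hessian. Hence
  the factor 2 = 1 + 1 under the root. With \<open>h\<close>, \<open>f\<close>, \<open>v\<close> for
  the Hessian norm, the source norm and the terminal variance, completing the square in
  \<open>h\<^sup>2 \<le> v + 2 * sqrt 2 * f * h\<close> gives the constant
  \<open>2 * sqrt 2\<close>. At time 0 the law is a point mass, so no boundary term appears there.

  The theorem speaks of every jet and every limit of the operator, not of chosen representatives;
  hence the care about uniqueness and null sets.\<close>

abbreviation (input) "L2 \<equiv> square_integrable"
abbreviation (input) "dx \<equiv> spatial_partial"
abbreviation (input) "Leb T \<equiv> restrict_space lborel {0..T::real}"

lemmas Lintegrable_bound = Bochner_Integration.integrable_bound
lemmas Lintegral_cong = Bochner_Integration.integral_cong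
lemmas Lintegrable_add = Bochner_Integration.integrable_add
lemmas Lintegrable_diff = Bochner_Integration.integrable_diff
lemmas Lintegral_add = Bochner_Integration.integral_add
lemmas Lintegral_diff = Bochner_Integration.integral_diff
lemmas Lintegral_nonneg = Bochner_Integration.integral_nonneg

lemma sqintD [measurable_dest]:
  "L2 N f ==> f \<in> borel_measurable N"
  by (simp add: square_integrable_def)

lemma sqint_norm2:
  "L2 N f ==> integrable N (\<lambda>z. (norm (f z))\<^sup>2)"
  by (simp add: square_integrable_def)

lemma sqint_bound:
  assumes "integrable N g" "f \<in> borel_measurable N" "AE z in N. (norm (f z))\<^sup>2 \<le> g z"
  shows "L2 N f"
  unfolding square_integrable_def
  using assms by (auto intro!: Lintegrable_bound[OF assms(1)])

lemma sqint_prod_norm: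
  assumes "L2 N f" "L2 N g"
  shows "integrable N (\<lambda>z. norm (f z) * norm (g z))"
proof (rule Lintegrable_bound)
  show "integrable N (\<lambda>z. (norm (f z))\<^sup>2 + (norm (g z))\<^sup>2)"
    using assms by (auto simp: square_integrable_def)
  show "AE z in N. norm (norm (f z) * norm (g z)) \<le> norm ((norm (f z))\<^sup>2 + (norm (g z))\<^sup>2)"
  proof (rule AE_I2)
    fix z
    have "2 * (norm (f z) * norm (g z)) \<le> (norm (f z))\<^sup>2 + (norm (g z))\<^sup>2"
      using sum_squares_bound[of "norm (f z)" "norm (g z)"] by (simp add: mult.assoc)
    moreover have "0 \<le> norm (f z) * norm (g z)" by simp
    ultimately show "norm (norm (f z) * norm (g z)) \<le> norm ((norm (f z))\<^sup>2 + (norm (g z))\<^sup>2)"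
      unfolding real_norm_def by linarith
  qed
qed (use assms in \<open>auto dest!: sqintD\<close>)

lemma sqint_inner:
  assumes "L2 N f" "L2 N g"
  shows "integrable N (\<lambda>z. f z \<bullet> g z)"
  by (rule Lintegrable_bound[OF sqint_prod_norm[OF assms]])
     (use assms in \<open>auto dest!: sqintD simp: Cauchy_Schwarz_ineq2 abs_mult\<close>)

lemma sqint_mult:
  fixes f g :: "_ => real"
  assumes "L2 N f" "L2 N g"
  shows "integrable N (\<lambda>z. f z * g z)"
  using sqint_inner[OF assms] by simp

lemma sqint_add:
  assumes "L2 N f" "L2 N g"
  shows "L2 N (\<lambda>z. f z + g z)"
proof (rule sqint_bound)
  show "integrable N (\<lambda>z. (norm (f z))\<^sup>2 + 2 * (norm (f z) * norm (g z)) + (norm (g z))\<^sup>2)"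
    using assms sqint_prod_norm[OF assms] by (auto simp: square_integrable_def)
  show "AE z in N. (norm (f z + g z))\<^sup>2 \<le> (norm (f z))\<^sup>2 + 2 * (norm (f z) * norm (g z)) + (norm (g z))\<^sup>2"
  proof (rule AE_I2)
    fix z
    have "(norm (f z + g z))\<^sup>2 \<le> (norm (f z) + norm (g z))\<^sup>2"
      by (simp add: norm_triangle_ineq power_mono)
    then show "(norm (f z + g z))\<^sup>2 \<le> (norm (f z))\<^sup>2 + 2 * (norm (f z) * norm (g z)) + (norm (g z))\<^sup>2"
      by (simp add: power2_sum)
  qed
qed (use assms in \<open>auto dest!: sqintD\<close>)

lemma sqint_scaleR:
  "L2 N f ==> L2 N (\<lambda>z. (c::real) *\<^sub>R f z)"
  by (auto simp: square_integrable_def power_mult_distrib)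

lemma sqint_minus:
  "L2 N f ==> L2 N (\<lambda>z. - f z)"
  by (auto simp: square_integrable_def)

lemma sqint_diff:
  assumes "L2 N f" "L2 N g"
  shows "L2 N (\<lambda>z. f z - g z)"
  using sqint_add[OF assms(1) sqint_minus[OF assms(2)]] by simp

lemma sqint_component:
  fixes f :: "_ => real^'n::finite"
  shows "L2 N f ==> L2 N (\<lambda>z. f z $ i)"
  unfolding cart_eq_inner_axis
  by (rule sqint_bound[OF sqint_norm2])
     (auto dest!: sqintD intro!: power_mono
       simp: abs_le_square_iff[symmetric] Basis_le_norm axis_in_Basis_iff)

lemma sqint_bounded:
  assumes "finite_measure N" "f \<in> borel_measurable N" "\<And>z. z \<in> space N ==> norm (f z) \<le> C"
  shows "L2 N f"
proof -
  interpret finite_measure N by fact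
  show ?thesis
    by (rule sqint_bound[where g="\<lambda>_. C\<^sup>2"])
       (use assms(2,3) in \<open>auto intro!: power_mono\<close>)
qed

lemma sqint_integrable:
  assumes "finite_measure N" "L2 N f"
  shows "integrable N f"
proof -
  interpret finite_measure N by fact
  have "L2 N (\<lambda>_. 1::real)"
    by (rule sqint_bounded[OF assms(1), where C=1]) auto
  from sqint_prod_norm[OF assms(2) this]
  have "integrable N (\<lambda>z. norm (f z))" by simp
  then show ?thesis using assms(2) by (auto dest!: sqintD simp: integrable_norm_iff)
qed

lemma L2_norm_nonneg [simp]: "0 \<le> L2_norm N f"
  by (simp add: L2_norm_def)

lemma L2_norm_power2: "(L2_norm N f)\<^sup>2 = (LINT z|N. (norm (f z))\<^sup>2)"
  by (simp add: L2_norm_def)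

lemma L2_norm_norm [simp]: "L2_norm N (\<lambda>z. norm (f z)) = L2_norm N f"
  by (simp add: L2_norm_def)

lemma L2_norm_minus [simp]: "L2_norm N (\<lambda>z. - f z) = L2_norm N f"
  by (simp add: L2_norm_def)

lemma L2_norm_minus_commute: "L2_norm N (\<lambda>z. f z - g z) = L2_norm N (\<lambda>z. g z - f z)"
  by (simp add: L2_norm_def norm_minus_commute)

lemma L2_norm_scaleR: "L2_norm N (\<lambda>z. c *\<^sub>R f z) = \<bar>c\<bar> * L2_norm N f"
  by (simp add: L2_norm_def power_mult_distrib real_sqrt_mult)

lemma L2_norm_zero [simp]: "L2_norm N (\<lambda>z. 0) = 0"
  by (simp add: L2_norm_def)

lemma L2_norm_AE_cong:
  assumes "f \<in> borel_measurable N" "g \<in> borel_measurable N" "AE z in N. f z = g z"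
  shows "L2_norm N f = L2_norm N g"
  unfolding L2_norm_def
  by (intro arg_cong[where f=sqrt] integral_cong_AE) (use assms in auto)

lemma L2_norm_cong: "(\<And>z. z \<in> space N ==> f z = g z) ==> L2_norm N f = L2_norm N g"
  unfolding L2_norm_def by (auto intro!: arg_cong[where f=sqrt] Lintegral_cong)

lemma L2_norm_mono:
  assumes "L2 N g" "AE z in N. norm (f z) \<le> norm (g z)"
  shows "L2_norm N f \<le> L2_norm N g"
proof -
  have "(LINT z|N. (norm (f z))\<^sup>2) \<le> (LINT z|N. (norm (g z))\<^sup>2)"
    by (rule integral_mono_AE')
      (use assms in \<open>auto simp: square_integrable_def power_mono\<close>)
  then show ?thesis by (simp add: L2_norm_def)
qed

text \<open>The weighted inequality between arithmetic and geometric mean holds pointwise with any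
  weight \<open>c\<close>; it is integrated first and optimised over \<open>c\<close>
  afterwards.\<close>

lemma L2_Cauchy_Schwarz_norm:
  assumes f: "L2 N f" and g: "L2 N g"
  shows "(LINT z|N. norm (f z) * norm (g z)) \<le> L2_norm N f * L2_norm N g"
proof -
  let ?a = "L2_norm N f" and ?b = "L2_norm N g"
  have key: "(LINT z|N. norm (f z) * norm (g z)) \<le> (c * ?a\<^sup>2 + ?b\<^sup>2 / c) / 2" if c: "c > 0" for c
  proof -
    have "(LINT z|N. norm (f z) * norm (g z))
       \<le> (LINT z|N. (c * (norm (f z))\<^sup>2 + (norm (g z))\<^sup>2 / c) / 2)"
    proof (rule integral_mono)
      fix z
      have "0 \<le> (c * norm (f z) - norm (g z))\<^sup>2 / (2 * c)" using c by simp
      also have "\<dots> = (c * (norm (f z))\<^sup>2 + (norm (g z))\<^sup>2 / c) / 2 - norm (f z) * norm (g z)"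
        using c by (simp add: power2_diff field_simps power2_eq_square)
      finally show "norm (f z) * norm (g z) \<le> (c * (norm (f z))\<^sup>2 + (norm (g z))\<^sup>2 / c) / 2" by simp
    qed (use f g sqint_prod_norm[OF f g] in \<open>auto simp: square_integrable_def\<close>)
    also have "\<dots> = (c * ?a\<^sup>2 + ?b\<^sup>2 / c) / 2"
      using f g by (simp add: L2_norm_power2 square_integrable_def)
    finally show ?thesis .
  qed
  show ?thesis
  proof (rule field_le_epsilon)
    fix e :: real assume e: "e > 0"
    \<comment> \<open>The optimal weight is \<open>?b / ?a\<close>; both norms are perturbed to keep it positive and finite.\<close>
    define d where "d = min 1 (e / (?a + ?b + 1))"
    have d: "d > 0" "d \<le> 1" "d * (?a + ?b + 1) \<le> e"
      using e by (auto simp: d_def min_def field_simps add_nonneg_pos add_pos_nonneg)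
    have ab: "0 \<le> ?a" "0 \<le> ?b" by simp_all
    define c where "c = (?b + d) / (?a + d)"
    have p: "?a + d > 0" "?b + d > 0" using ab d(1) by linarith+
    then have c: "c > 0" by (simp add: c_def)
    have "c * ?a\<^sup>2 \<le> (?a + d) * (?b + d)"
    proof -
      have "c * ?a\<^sup>2 \<le> c * (?a + d)\<^sup>2" using c d(1) ab by (intro mult_left_mono power_mono) auto
      also have "\<dots> = (?a + d) * (?b + d)" using p by (simp add: c_def power2_eq_square)
      finally show ?thesis .
    qed
    moreover have "?b\<^sup>2 / c \<le> (?a + d) * (?b + d)"
    proof -
      have "?b\<^sup>2 / c \<le> (?b + d)\<^sup>2 / c" using c d(1) ab by (intro divide_right_mono power_mono) auto
      also have "\<dots> = (?a + d) * (?b + d)" using p by (simp add: c_def power2_eq_square)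
      finally show ?thesis .
    qed
    ultimately have "(LINT z|N. norm (f z) * norm (g z)) \<le> (?a + d) * (?b + d)"
      using key[OF c] by simp
    also have "\<dots> = ?a * ?b + d * (?a + ?b + d)" by (simp add: algebra_simps)
    also have "\<dots> \<le> ?a * ?b + d * (?a + ?b + 1)" using d by (intro add_left_mono mult_left_mono) auto
    finally show "(LINT z|N. norm (f z) * norm (g z)) \<le> ?a * ?b + e" using d(3) by linarith
  qed
qed

lemma L2_Cauchy_Schwarz:
  assumes f: "L2 N f" and g: "L2 N g"
  shows "\<bar>LINT z|N. f z \<bullet> g z\<bar> \<le> L2_norm N f * L2_norm N g"
proof -
  have "\<bar>LINT z|N. f z \<bullet> g z\<bar> \<le> (LINT z|N. norm (f z) * norm (g z))"
    by (rule order_trans[OF integral_abs_bound integral_mono])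
      (use f g sqint_inner[OF f g] sqint_prod_norm[OF f g]
        in \<open>auto simp: Cauchy_Schwarz_ineq2\<close>)
  with L2_Cauchy_Schwarz_norm[OF f g] show ?thesis by simp
qed

lemma L2_Cauchy_Schwarz_mult:
  fixes f g :: "_ => real"
  assumes "L2 N f" "L2 N g"
  shows "\<bar>LINT z|N. f z * g z\<bar> \<le> L2_norm N f * L2_norm N g"
  using L2_Cauchy_Schwarz[OF assms] by simp

lemma L2_norm_triangle:
  assumes f: "L2 N f" and g: "L2 N g"
  shows "L2_norm N (\<lambda>z. f z + g z) \<le> L2_norm N f + L2_norm N g"
proof (rule power2_le_imp_le)
  have "(L2_norm N (\<lambda>z. f z + g z))\<^sup>2 = (LINT z|N. (norm (f z))\<^sup>2 + 2 * (f z \<bullet> g z) + (norm (g z))\<^sup>2)"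
    unfolding L2_norm_power2 power2_norm_eq_inner
    by (intro Lintegral_cong) (auto simp: inner_add inner_commute)
  also have "\<dots> = (L2_norm N f)\<^sup>2 + 2 * (LINT z|N. f z \<bullet> g z) + (L2_norm N g)\<^sup>2"
    using f g sqint_inner[OF f g] by (simp add: L2_norm_power2 square_integrable_def)
  also have "\<dots> \<le> (L2_norm N f)\<^sup>2 + 2 * (L2_norm N f * L2_norm N g) + (L2_norm N g)\<^sup>2"
    using L2_Cauchy_Schwarz[OF f g] by simp
  finally show "(L2_norm N (\<lambda>z. f z + g z))\<^sup>2 \<le> (L2_norm N f + L2_norm N g)\<^sup>2"
    by (simp add: power2_sum)
qed simp

lemma L2_norm_triangle_diff:
  assumes f: "L2 N f" and g: "L2 N g"
  shows "L2_norm N (\<lambda>z. f z - g z) \<le> L2_norm N f + L2_norm N g"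
  using L2_norm_triangle[OF f sqint_minus[OF g]] by simp

lemma L2_norm_triangle3:
  assumes "L2 N f" "L2 N g" "L2 N h"
  shows "L2_norm N (\<lambda>z. f z - h z) \<le> L2_norm N (\<lambda>z. f z - g z) + L2_norm N (\<lambda>z. g z - h z)"
  using L2_norm_triangle[OF sqint_diff[OF assms(1,2)] sqint_diff[OF assms(2,3)]]
  by simp

lemma L2_norm_reverse_triangle:
  assumes f: "L2 N f" and g: "L2 N g"
  shows "\<bar>L2_norm N f - L2_norm N g\<bar> \<le> L2_norm N (\<lambda>z. f z - g z)"
  using L2_norm_triangle[OF sqint_diff[OF f g] g]
    L2_norm_triangle[OF sqint_diff[OF g f] f] L2_norm_minus_commute[of N f g]
  by simp

lemma L2_norm_eq_0_AE:
  assumes "L2 N f" "L2_norm N f = 0"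
  shows "AE z in N. f z = 0"
proof -
  have "(LINT z|N. (norm (f z))\<^sup>2) = 0" using assms by (simp add: L2_norm_def)
  then show ?thesis
    by (subst (asm) integral_nonneg_eq_0_iff_AE) (use assms in \<open>auto simp: square_integrable_def\<close>)
qed

lemma L2_convergesD:
  assumes "L2_converges N f g"
  shows "L2 N g" "L2 N (f k)"
    "(\<lambda>k. L2_norm N (\<lambda>z. f k z - g z)) \<longlonglongrightarrow> 0"
  using assms by (auto simp: L2_converges_def)

lemma L2_converges_norm:
  assumes "L2_converges N f g"
  shows "(\<lambda>k. L2_norm N (f k)) \<longlonglongrightarrow> L2_norm N g"
proof (rule LIM_zero_cancel, rule Lim_null_comparison)
  show "\<forall>\<^sub>F k in sequentially. norm (L2_norm N (f k) - L2_norm N g) \<le> L2_norm N (\<lambda>z. f k z - g z)"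
    using L2_norm_reverse_triangle[OF L2_convergesD(2,1)[OF assms]] by simp
qed (use assms in \<open>auto simp: L2_converges_def\<close>)

lemma L2_converges_inner:
  assumes f: "L2_converges N f f'" and g: "L2_converges N g g'"
  shows "(\<lambda>k. LINT z|N. f k z \<bullet> g k z) \<longlonglongrightarrow> (LINT z|N. f' z \<bullet> g' z)"
proof (rule LIM_zero_cancel, rule Lim_null_comparison)
  show "\<forall>\<^sub>F k in sequentially. norm ((LINT z|N. f k z \<bullet> g k z) - (LINT z|N. f' z \<bullet> g' z))
     \<le> L2_norm N (\<lambda>z. f k z - f' z) * L2_norm N (g k) + L2_norm N f' * L2_norm N (\<lambda>z. g k z - g' z)"
  proof (rule always_eventually, rule allI)
    fix k
    note s = L2_convergesD(1,2)[OF f] L2_convergesD(1,2)[OF g]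
    have "(LINT z|N. f k z \<bullet> g k z) - (LINT z|N. f' z \<bullet> g' z)
      = (LINT z|N. (f k z - f' z) \<bullet> g k z + f' z \<bullet> (g k z - g' z))"
      using s by (subst Lintegral_diff[symmetric])
        (auto intro!: sqint_inner Lintegral_cong simp: inner_diff)
    also have "\<dots> = (LINT z|N. (f k z - f' z) \<bullet> g k z) + (LINT z|N. f' z \<bullet> (g k z - g' z))"
      by (rule Lintegral_add; intro sqint_inner sqint_diff s)
    finally show "norm ((LINT z|N. f k z \<bullet> g k z) - (LINT z|N. f' z \<bullet> g' z))
     \<le> L2_norm N (\<lambda>z. f k z - f' z) * L2_norm N (g k) + L2_norm N f' * L2_norm N (\<lambda>z. g k z - g' z)"
      using L2_Cauchy_Schwarz[OF sqint_diff[OF s(2)[of k] s(1)] s(4)[of k]]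
        L2_Cauchy_Schwarz[OF s(1) sqint_diff[OF s(4)[of k] s(3)]]
      by simp
  qed
  show "(\<lambda>k. L2_norm N (\<lambda>z. f k z - f' z) * L2_norm N (g k) + L2_norm N f' * L2_norm N (\<lambda>z. g k z - g' z))
     \<longlonglongrightarrow> 0"
    using tendsto_add[OF tendsto_mult[OF L2_convergesD(3)[OF f] L2_converges_norm[OF g]]
        tendsto_mult[OF tendsto_const[of "L2_norm N f'"] L2_convergesD(3)[OF g]]] by simp
qed

lemma L2_converges_mult:
  fixes f g :: "_ => _ => real"
  assumes "L2_converges N f f'" "L2_converges N g g'"
  shows "(\<lambda>k. LINT z|N. f k z * g k z) \<longlonglongrightarrow> (LINT z|N. f' z * g' z)"
  using L2_converges_inner[OF assms] by simp

lemma L2_converges_const: "L2 N f ==> L2_converges N (\<lambda>_. f) f"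
  by (simp add: L2_converges_def)

text \<open>Closeness is asked for along the sequence and not to the limit, so approximations can be
  stacked: mollification on top of a cutoff, or one approximating sequence against another.\<close>

lemma L2_converges_trans:
  fixes f g :: "nat => 'a => 'b::euclidean_space"
  assumes g: "L2_converges N g h" and f: "\<And>k. L2 N (f k)"
    and le: "\<And>k. L2_norm N (\<lambda>z. f k z - g k z) \<le> e k" and e: "e \<longlonglongrightarrow> 0"
  shows "L2_converges N f h"
proof -
  note s = L2_convergesD[OF g]
  have b: "L2_norm N (\<lambda>z. f k z - h z) \<le> e k + L2_norm N (\<lambda>z. g k z - h z)" for k
    using L2_norm_triangle3[OF f s(2) s(1), of k k] le[of k] by linarith
  have "(\<lambda>k. e k + L2_norm N (\<lambda>z. g k z - h z)) \<longlonglongrightarrow> 0"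
    using tendsto_add[OF e s(3)] by simp
  from tendsto_sandwich[OF _ always_eventually[OF allI[OF b]] tendsto_const this]
  have "(\<lambda>k. L2_norm N (\<lambda>z. f k z - h z)) \<longlonglongrightarrow> 0" by simp
  then show ?thesis using s f unfolding L2_converges_def by simp
qed

text \<open>The Riesz-Fischer argument: a subsequence with geometrically small gaps has summable
  increments and converges almost everywhere; Fatou's lemma then shows that the pointwise limit is a
  limit in norm.\<close>

lemma L2_complete:
  fixes f :: "nat => 'a => 'b::euclidean_space"
  assumes fin: "finite_measure N"
    and sq: "\<And>k. L2 N (f k)"
    and cau: "\<And>e. e > 0 ==> \<exists>n. \<forall>k\<ge>n. \<forall>l\<ge>n. L2_norm N (\<lambda>z. f k z - f l z) < e"
  shows "\<exists>g. L2_converges N f g"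
proof -
  interpret finite_measure N by fact
  have [measurable]: "f k \<in> borel_measurable N" for k using sq by (auto dest: sqintD)
  have "\<exists>s. \<forall>n. (\<forall>k\<ge>s n. \<forall>l\<ge>s n. L2_norm N (\<lambda>z. f k z - f l z) < (1/2)^n) \<and> s n < s (Suc n)"
  proof (rule dependent_nat_choice)
    show "\<exists>x. \<forall>k\<ge>x. \<forall>l\<ge>x. L2_norm N (\<lambda>z. f k z - f l z) < (1/2)^0" using cau[of 1] by simp
    fix x n
    obtain m where "\<forall>k\<ge>m. \<forall>l\<ge>m. L2_norm N (\<lambda>z. f k z - f l z) < (1/2)^Suc n"
      using cau[of "(1/2)^Suc n"] by auto
    then show "\<exists>y. (\<forall>k\<ge>y. \<forall>l\<ge>y. L2_norm N (\<lambda>z. f k z - f l z) < (1/2)^Suc n) \<and> x < y"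
      by (intro exI[of _ "max m (Suc x)"]) auto
  qed
  then obtain s where s: "\<And>n k l. k \<ge> s n ==> l \<ge> s n ==> L2_norm N (\<lambda>z. f k z - f l z) < (1/2)^n"
    and inc: "\<And>n. s n < s (Suc n)" by blast
  have mono: "strict_mono s" using inc by (simp add: strict_mono_Suc_iff)
  define h where "h n z = norm (f (s (Suc n)) z - f (s n) z)" for n z
  have [measurable]: "h n \<in> borel_measurable N" for n unfolding h_def by measurable
  define C where "C = L2_norm N (\<lambda>_. 1::real)"
  have one: "L2 N (\<lambda>_. 1::real)"
    by (rule sqint_bounded[OF fin, where C=1]) auto
  have hsq: "L2 N (\<lambda>z. f (s (Suc n)) z - f (s n) z)" for n
    by (intro sqint_diff sq)
  have hint: "integrable N (h n)" for n
    unfolding h_def by (intro integrable_norm sqint_integrable[OF fin] hsq)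
  have hle: "(LINT z|N. h n z) \<le> C * (1/2)^n" for n
  proof -
    have "(LINT z|N. h n z) \<le> L2_norm N (\<lambda>z. f (s (Suc n)) z - f (s n) z) * C"
      using L2_Cauchy_Schwarz_norm[OF hsq[of n] one] by (simp add: h_def C_def)
    also have "\<dots> \<le> (1/2)^n * C"
      using s[of n "s (Suc n)" "s n"] inc[of n] by (intro mult_right_mono) (auto simp: C_def)
    finally show ?thesis by (simp add: mult.commute)
  qed
  \<comment> \<open>Finiteness of the measure enters here: pairing with the constant one bounds the
    integral of each increment by its norm, so the series of increments has a finite
    integral.\<close>
  have "(\<integral>\<^sup>+z. (\<Sum>n. ennreal (h n z)) \<partial>N) = (\<Sum>n. \<integral>\<^sup>+z. ennreal (h n z) \<partial>N)"
    by (rule nn_integral_suminf) simp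
  also have "\<dots> \<le> (\<Sum>n. ennreal (C * (1/2)^n))"
  proof (intro suminf_le)
    show "(\<integral>\<^sup>+z. ennreal (h n z) \<partial>N) \<le> ennreal (C * (1/2)^n)" for n
      using ennreal_leI[OF hle[of n]] nn_integral_eq_integral[OF hint[of n]] by (simp add: h_def[abs_def])
  qed auto
  also have "\<dots> < \<infinity>"
  proof -
    have "summable (\<lambda>n. C * (1/2::real)^n)" by (intro summable_mult summable_geometric) simp
    then have "(\<Sum>n. ennreal (C * (1/2)^n)) \<noteq> \<infinity>"
      by (subst suminf_ennreal2) (auto simp: C_def)
    then show ?thesis by (simp add: top.not_eq_extremum)
  qed
  finally have "AE z in N. (\<Sum>n. ennreal (h n z)) \<noteq> \<infinity>"
    by (intro nn_integral_PInf_AE) auto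
  then have conv: "AE z in N. convergent (\<lambda>n. f (s n) z)"
  proof eventually_elim
    case (elim z)
    then have "summable (\<lambda>n. h n z)"
      by (intro summable_suminf_not_top) (auto simp: h_def)
    then have "summable (\<lambda>n. f (s (Suc n)) z - f (s n) z)"
      unfolding h_def by (rule summable_norm_cancel)
    then obtain l where "(\<lambda>m. \<Sum>n<m. f (s (Suc n)) z - f (s n) z) \<longlonglongrightarrow> l"
      by (auto simp: summable_def sums_def)
    then have "(\<lambda>m. f (s m) z - f (s 0) z) \<longlonglongrightarrow> l"
      using sum_lessThan_telescope[of "\<lambda>n. f (s n) z"] by simp
    then have "(\<lambda>m. (f (s m) z - f (s 0) z) + f (s 0) z) \<longlonglongrightarrow> l + f (s 0) z"
      by (intro tendsto_intros)
    then show ?case by (auto simp: convergent_def)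
  qed
  define g where "g z = lim (\<lambda>n. f (s n) z)" for z
  have g_m[measurable]: "g \<in> borel_measurable N" unfolding g_def by measurable
  have lim: "AE z in N. (\<lambda>n. f (s n) z) \<longlonglongrightarrow> g z"
    using conv by eventually_elim (simp add: g_def convergent_LIMSEQ_iff)
  \<comment> \<open>Fatou is applied to the distance from an arbitrary late member
    \<open>f k\<close>, not only from members of the subsequence; this yields convergence of the
    whole sequence.\<close>
  have fatou: "(\<integral>\<^sup>+z. ennreal ((norm (g z - f k z))\<^sup>2) \<partial>N) \<le> ennreal (((1/2)^n)\<^sup>2)" if k: "k \<ge> s n" for k n
  proof -
    have "(\<integral>\<^sup>+z. ennreal ((norm (g z - f k z))\<^sup>2) \<partial>N)
        = (\<integral>\<^sup>+z. liminf (\<lambda>m. ennreal ((norm (f (s m) z - f k z))\<^sup>2)) \<partial>N)"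
    proof (rule nn_integral_cong_AE, use lim in eventually_elim)
      fix z assume "(\<lambda>n. f (s n) z) \<longlonglongrightarrow> g z"
      then have "(\<lambda>m. ennreal ((norm (f (s m) z - f k z))\<^sup>2)) \<longlonglongrightarrow> ennreal ((norm (g z - f k z))\<^sup>2)"
        by (intro tendsto_intros)
      then show "ennreal ((norm (g z - f k z))\<^sup>2) = liminf (\<lambda>m. ennreal ((norm (f (s m) z - f k z))\<^sup>2))"
        by (intro lim_imp_Liminf[symmetric]) auto
    qed
    also have "\<dots> \<le> liminf (\<lambda>m. \<integral>\<^sup>+z. ennreal ((norm (f (s m) z - f k z))\<^sup>2) \<partial>N)"
      by (rule nn_integral_liminf) simp
    also have "\<dots> \<le> ennreal (((1/2)^n)\<^sup>2)"
    proof (rule Liminf_le)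
      show "\<forall>\<^sub>F m in sequentially. (\<integral>\<^sup>+z. ennreal ((norm (f (s m) z - f k z))\<^sup>2) \<partial>N) \<le> ennreal (((1/2)^n)\<^sup>2)"
        using eventually_ge_at_top[of n]
      proof eventually_elim
        case (elim m)
        then have "s n \<le> s m" using mono by (simp add: strict_mono_less_eq)
        then have "L2_norm N (\<lambda>z. f (s m) z - f k z) \<le> (1/2)^n" using s k by (simp add: less_imp_le)
        then have "(L2_norm N (\<lambda>z. f (s m) z - f k z))\<^sup>2 \<le> ((1/2)^n)\<^sup>2" by (intro power_mono) auto
        then show ?case
          by (subst nn_integral_eq_integral)
            (auto intro!: sqint_norm2 sqint_diff sq ennreal_leI simp: L2_norm_power2)
      qed
    qed simp
    finally show ?thesis .
  qed
  have dsq: "L2 N (\<lambda>z. g z - f k z)" if k: "k \<ge> s n" for k n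
    unfolding square_integrable_def
    using fatou[OF k] by (auto intro!: integrableI_bounded intro: le_less_trans)
  have dle: "L2_norm N (\<lambda>z. f k z - g z) \<le> (1/2)^n" if k: "k \<ge> s n" for k n
  proof -
    have "(L2_norm N (\<lambda>z. g z - f k z))\<^sup>2 \<le> ((1/2)^n)\<^sup>2"
      using fatou[OF k] dsq[OF k] unfolding L2_norm_power2
      by (subst (asm) nn_integral_eq_integral) (auto simp: square_integrable_def)
    then show ?thesis by (subst L2_norm_minus_commute, rule power2_le_imp_le) auto
  qed
  have "L2 N (\<lambda>z. (g z - f (s 0) z) + f (s 0) z)"
    by (intro sqint_add sq dsq[of 0]) simp
  then have gsq: "L2 N g" by simp
  have "(\<lambda>k. L2_norm N (\<lambda>z. f k z - g z)) \<longlonglongrightarrow> 0"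
  proof (rule LIMSEQ_I)
    fix e :: real assume "e > 0"
    then obtain n where n: "(1/2)^n < e" using real_arch_pow_inv[of e "1/2"] by auto
    have "norm (L2_norm N (\<lambda>z. f k z - g z) - 0) < e" if "k \<ge> s n" for k
      using dle[OF that] n by simp
    then show "\<exists>no. \<forall>k\<ge>no. norm (L2_norm N (\<lambda>z. f k z - g z) - 0) < e" by blast
  qed
  with gsq sq show ?thesis by (auto simp: L2_converges_def)
qed

lemma L2_norm_tendsto_0_dominated:
  assumes g: "L2 N g"
    and m: "\<And>k. f k \<in> borel_measurable N"
    and lim: "AE z in N. (\<lambda>k. f k z) \<longlonglongrightarrow> 0"
    and le: "\<And>k. AE z in N. norm (f k z) \<le> norm (g z)"
  shows "(\<lambda>k. L2_norm N (f k)) \<longlonglongrightarrow> 0"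
proof -
  have "(\<lambda>k. LINT z|N. (norm (f k z))\<^sup>2) \<longlonglongrightarrow> (LINT z|N. 0)"
  proof (rule integral_dominated_convergence[where w="\<lambda>z. (norm (g z))\<^sup>2"])
    show "AE z in N. (\<lambda>k. (norm (f k z))\<^sup>2) \<longlonglongrightarrow> 0"
      using lim
    proof eventually_elim
      case (elim z)
      from tendsto_power[OF tendsto_norm[OF elim], of 2] show ?case by simp
    qed
    show "AE z in N. norm ((norm (f k z))\<^sup>2) \<le> (norm (g z))\<^sup>2" for k
      using le[of k] by eventually_elim (simp add: power_mono)
  qed (use g m in \<open>auto simp: square_integrable_def\<close>)
  then show ?thesis unfolding L2_norm_def using tendsto_real_sqrt by fastforce
qed

subsection \<open>Smooth functions\<close>

text \<open>One step of \<open>iter_deriv\<close> as an operator on functions;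
  \<open>partial\<close> and \<open>spatial_partial\<close> are its instances along coordinate
  directions, so one calculus serves both.\<close>

definition dir_deriv :: "'a::euclidean_space => ('a => 'b::euclidean_space) => 'a => 'b" where
  "dir_deriv v f = (\<lambda>x. frechet_derivative f (at x) v)"

lemma iter_deriv_Cons_dir: "iter_deriv (v # vs) f = dir_deriv v (iter_deriv vs f)"
  by (simp add: dir_deriv_def)

lemma iter_deriv_append: "iter_deriv (us @ vs) f = iter_deriv us (iter_deriv vs f)"
  by (induction us) auto

lemma dir_derivI: "(f has_derivative f') (at x) ==> dir_deriv v f x = f' v"
  unfolding dir_deriv_def by (metis frechet_derivative_at)

lemma dir_deriv_cong_has_derivative:
  "(\<And>x. (f has_derivative f' x) (at x)) ==> dir_deriv v f = (\<lambda>x. f' x v)"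
  by (auto intro!: dir_derivI)

lemma has_derivative_dir_deriv:
  "f differentiable (at x) ==> (f has_derivative (\<lambda>h. dir_deriv h f x)) (at x)"
  by (simp add: dir_deriv_def frechet_derivative_works)

lemma partial_eq: "partial i = dir_deriv (axis i 1)"
  by (simp add: partial_def dir_deriv_def fun_eq_iff)

lemma dx_eq: "dx i = dir_deriv (0, axis i 1)"
  by (simp add: spatial_partial_def dir_deriv_def fun_eq_iff)

lemma smooth_differentiable: "smooth f ==> f differentiable (at x)"
  unfolding smooth_def by (metis iter_deriv.simps(1))

lemma smooth_iter_deriv: "smooth f ==> smooth (iter_deriv vs f)"
  unfolding smooth_def by (metis iter_deriv_append)

lemma smooth_dir_deriv: "smooth f ==> smooth (dir_deriv v f)"
  using smooth_iter_deriv[of f "[v]"] by (simp add: dir_deriv_def)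

lemma smooth_has_derivative: "smooth f ==> (f has_derivative (\<lambda>h. dir_deriv h f x)) (at x)"
  by (intro has_derivative_dir_deriv smooth_differentiable)

lemma smooth_continuous_on: "smooth f ==> continuous_on S f"
  by (meson continuous_at_imp_continuous_on differentiable_imp_continuous_within smooth_differentiable)

lemma smooth_borel [measurable_dest]: "smooth f ==> f \<in> borel_measurable borel"
  by (intro borel_measurable_continuous_onI smooth_continuous_on)

lemma dir_deriv_linear: "smooth f ==> linear (\<lambda>v. dir_deriv v f x)"
  using smooth_has_derivative has_derivative_linear by blast

text \<open>Smoothness is proved coinductively, from classes whose derivatives are finite sums of
  members of the class.\<close>

inductive_set fun_sums :: "('a => 'b::plus) set => ('a => 'b) set" for S where
  base: "f \<in> S ==> f \<in> fun_sums S"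
| add: "f \<in> fun_sums S ==> g \<in> fun_sums S ==> (\<lambda>x. f x + g x) \<in> fun_sums S"

lemma dir_deriv_add:
  assumes "f differentiable (at x)" "g differentiable (at x)"
  shows "dir_deriv v (\<lambda>x. f x + g x) x = dir_deriv v f x + dir_deriv v g x"
  by (rule dir_derivI) (intro has_derivative_add has_derivative_dir_deriv assms)

lemma iter_deriv_fun_sums:
  assumes d: "\<And>g x. g \<in> S ==> g differentiable (at x)"
    and D: "\<And>g v. g \<in> S ==> dir_deriv v g \<in> fun_sums S"
    and f: "f \<in> S"
  shows "iter_deriv vs f \<in> fun_sums S"
proof -
  have d': "g differentiable (at x)" if "g \<in> fun_sums S" for g x
    using that by induction (auto intro: d)
  have D': "dir_deriv v g \<in> fun_sums S" if "g \<in> fun_sums S" for g v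
    using that
  proof induction
    case (add f g)
    have "dir_deriv v (\<lambda>x. f x + g x) = (\<lambda>x. dir_deriv v f x + dir_deriv v g x)"
      using add by (intro ext dir_deriv_add d')
    with add show ?case by (auto intro: fun_sums.add)
  qed (rule D)
  show ?thesis
    by (induction vs) (auto simp: iter_deriv_Cons_dir f D' intro: fun_sums.base simp del: iter_deriv.simps(2))
qed

lemma smooth_coinduct:
  assumes d: "\<And>g x. g \<in> S ==> g differentiable (at x)"
    and D: "\<And>g v. g \<in> S ==> dir_deriv v g \<in> fun_sums S"
    and f: "f \<in> S"
  shows "smooth f"
  unfolding smooth_def
proof (intro allI)
  have "g differentiable (at x)" if "g \<in> fun_sums S" for g x
    using that by induction (auto intro: d)
  then show "iter_deriv vs f differentiable (at x)" for vs x
    using iter_deriv_fun_sums[of S, OF d D f] by blast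
qed

lemma dir_deriv_const: "dir_deriv v (\<lambda>x. c) = (\<lambda>x. 0)"
  by (rule dir_deriv_cong_has_derivative) simp

lemma smooth_const: "smooth (\<lambda>x. c)"
  by (rule smooth_coinduct[of "range (\<lambda>c x. c)"]) (auto simp: dir_deriv_const intro: fun_sums.base)

lemma smooth_add:
  assumes "smooth f" "smooth g"
  shows "smooth (\<lambda>x. f x + g x)"
proof (rule smooth_coinduct[of "{f. smooth f}\<union>{\<lambda>x. f x + g x |f g. smooth f \<and> smooth g}"])
  fix h v assume "h \<in> {f. smooth f}\<union>{\<lambda>x. f x + g x |f g. smooth f \<and> smooth g}"
  then consider "smooth h" | f g where "h = (\<lambda>x. f x + g x)" "smooth f" "smooth g" by auto
  then show "dir_deriv v h \<in> fun_sums ({f. smooth f}\<union>{\<lambda>x. f x + g x |f g. smooth f \<and> smooth g})"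
  proof cases
    case 1 then show ?thesis by (auto intro!: fun_sums.base smooth_dir_deriv)
  next
    case 2
    then have "dir_deriv v h = (\<lambda>x. dir_deriv v f x + dir_deriv v g x)"
      by (auto intro!: dir_deriv_add smooth_differentiable)
    with 2 show ?thesis by (auto intro!: fun_sums.add fun_sums.base smooth_dir_deriv)
  qed
next
  fix h x assume "h \<in> {f. smooth f}\<union>{\<lambda>x. f x + g x |f g. smooth f \<and> smooth g}"
  then show "h differentiable (at x)"
    by (auto intro: smooth_differentiable differentiable_add)
qed (use assms in auto)

lemma dir_deriv_mult:
  fixes f g :: "_ => real"
  assumes "f differentiable (at x)" "g differentiable (at x)"
  shows "dir_deriv v (\<lambda>x. f x * g x) x = f x * dir_deriv v g x + dir_deriv v f x * g x"
  by (rule dir_derivI) (intro has_derivative_mult has_derivative_dir_deriv assms)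

lemma smooth_mult:
  fixes f g :: "'a::euclidean_space => real"
  assumes "smooth f" "smooth g"
  shows "smooth (\<lambda>x. f x * g x)"
proof (rule smooth_coinduct[of "{\<lambda>x. f x * g x |f g. smooth f \<and> smooth g}"])
  fix h :: "'a => real" and v assume "h \<in> {\<lambda>x. f x * g x |f g. smooth f \<and> smooth g}"
  then obtain f g where fg: "h = (\<lambda>x. f x * g x)" "smooth f" "smooth g" by auto
  then have "dir_deriv v h = (\<lambda>x. f x * dir_deriv v g x + dir_deriv v f x * g x)"
    by (auto intro!: dir_deriv_mult smooth_differentiable)
  moreover have "(\<lambda>x. f x * dir_deriv v g x + dir_deriv v f x * g x) \<in> fun_sums {\<lambda>x. f x * g x |f g. smooth f \<and> smooth g}"
    by (rule fun_sums.add; rule fun_sums.base) (use fg(2,3) smooth_dir_deriv in fast)+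
  ultimately show "dir_deriv v h \<in> fun_sums {\<lambda>x. f x * g x |f g. smooth f \<and> smooth g}" by simp
  show "h differentiable (at x)" for x
    unfolding fg(1) by (intro differentiable_mult smooth_differentiable fg)
qed (use assms in auto)

lemma smooth_cmult:
  fixes f :: "'a::euclidean_space => real" shows "smooth f ==> smooth (\<lambda>x. c * f x)"
  by (intro smooth_mult smooth_const)

lemma smooth_diff:
  fixes f g :: "'a::euclidean_space => real"
  assumes "smooth f" "smooth g" shows "smooth (\<lambda>x. f x - g x)"
  using smooth_add[OF assms(1) smooth_cmult[OF assms(2), of "-1"]] by simp

lemma smooth_sum:
  fixes f :: "'i => 'a::euclidean_space => real"
  assumes "\<And>i. i \<in> I ==> smooth (f i)" shows "smooth (\<lambda>x. \<Sum>i\<in>I. f i x)"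
  using assms by (induction I rule: infinite_finite_induct) (auto intro: smooth_add smooth_const)

lemma smooth_prod:
  fixes f :: "'i => 'a::euclidean_space => real"
  assumes "\<And>i. i \<in> I ==> smooth (f i)" shows "smooth (\<lambda>x. \<Prod>i\<in>I. f i x)"
  using assms by (induction I rule: infinite_finite_induct) (auto intro: smooth_mult smooth_const)

lemma dir_deriv_affine:
  assumes "bounded_linear L" "f differentiable (at (a + L x))"
  shows "dir_deriv v (\<lambda>x. f (a + L x)) x = dir_deriv (L v) f (a + L x)"
proof (rule dir_derivI)
  have "((\<lambda>x. a + L x) has_derivative L) (at x)"
    using has_derivative_add[OF has_derivative_const[of a] bounded_linear_imp_has_derivative[OF assms(1)], of "at x"] by simp
  from has_derivative_compose[OF this has_derivative_dir_deriv[OF assms(2)]]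
  show "((\<lambda>x. f (a + L x)) has_derivative (\<lambda>v. dir_deriv (L v) f (a + L x))) (at x)" .
qed

lemma affine_differentiable:
  fixes f :: "'a::euclidean_space => 'b::euclidean_space"
  assumes "bounded_linear L" "f differentiable (at (a + L x))"
  shows "(\<lambda>x. f (a + L x)) differentiable (at x)"
proof -
  have "((\<lambda>x. a + L x) has_derivative L) (at x)"
    using has_derivative_add[OF has_derivative_const[of a] bounded_linear_imp_has_derivative[OF assms(1)], of "at x"] by simp
  from has_derivative_compose[OF this has_derivative_dir_deriv[OF assms(2)]]
  show ?thesis by (auto simp: differentiable_def)
qed

lemma smooth_affine:
  fixes f :: "'a::euclidean_space => 'b::euclidean_space"
  assumes "bounded_linear L" "smooth f" shows "smooth (\<lambda>x. f (a + L x))"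
proof (rule smooth_coinduct[of "{\<lambda>x. f (a + L x) |f. smooth f}"])
  fix g v assume "g \<in> {\<lambda>x. f (a + L x) |f. smooth f}"
  then obtain f where f: "g = (\<lambda>x. f (a + L x))" "smooth f" by auto
  then have "dir_deriv v g = (\<lambda>x. dir_deriv (L v) f (a + L x))"
    by (auto intro!: dir_deriv_affine assms(1) smooth_differentiable)
  with f show "dir_deriv v g \<in> fun_sums {\<lambda>x. f (a + L x) |f. smooth f}"
    by (auto intro!: fun_sums.base smooth_dir_deriv)
  show "g differentiable (at x)" for x
    unfolding f(1) by (intro affine_differentiable assms(1) smooth_differentiable f)
qed (use assms in blast)

lemma smooth_inner: "smooth (\<lambda>x. x \<bullet> b)"
proof (rule smooth_coinduct[of "{\<lambda>x. x \<bullet> b} \<union> {f. smooth f}"])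
  fix g v assume "g \<in> {\<lambda>x. x \<bullet> b} \<union> {f. smooth f}"
  moreover have "dir_deriv v (\<lambda>x. x \<bullet> b) = (\<lambda>x. v \<bullet> b)"
    by (rule dir_deriv_cong_has_derivative) (auto intro!: derivative_eq_intros)
  ultimately have "smooth (dir_deriv v g)" by (auto intro: smooth_dir_deriv smooth_const)
  then show "dir_deriv v g \<in> fun_sums ({\<lambda>x. x \<bullet> b} \<union> {f. smooth f})"
    by (auto intro: fun_sums.base)
qed (auto intro: smooth_differentiable)

lemma smooth_inner_self: "smooth (\<lambda>x::'a::euclidean_space. x \<bullet> x)"
proof -
  have "(\<lambda>x::'a. x \<bullet> x) = (\<lambda>x. \<Sum>b\<in>Basis. (x \<bullet> b) * (x \<bullet> b))"
    by (rule ext, rule euclidean_inner)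
  then show ?thesis by (auto intro!: smooth_sum smooth_mult smooth_inner)
qed

lemma has_derivative_compose_real:
  fixes s :: "real => real" and g :: "'a::euclidean_space => real"
  assumes "smooth s" "smooth g"
  shows "((\<lambda>x. s (g x)) has_derivative (\<lambda>v. dir_deriv 1 s (g x) * dir_deriv v g x)) (at x)"
proof -
  have *: "dir_deriv c s y = dir_deriv 1 s y * c" for c y
    using linear_cmul[OF dir_deriv_linear[OF assms(1), of y], of c 1] by simp
  from has_derivative_compose[OF smooth_has_derivative[OF assms(2)] smooth_has_derivative[OF assms(1)], of x]
  show ?thesis by (rule has_derivative_eq_rhs) (rule ext, rule *)
qed

text \<open>The chain rule multiplies by a derivative of \<open>g\<close>, so compositions alone are
  not closed under differentiation. The coinduction runs over products of a composition with an
  arbitrary smooth factor.\<close>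

lemma smooth_compose_real:
  fixes s :: "real => real" and g :: "'a::euclidean_space => real"
  assumes "smooth s" and g: "smooth g"
  shows "smooth (\<lambda>x. s (g x))"
proof (rule smooth_coinduct[of "{\<lambda>x. s (g x) * q x |s q. smooth s \<and> smooth q}"])
  fix h :: "'a => real" assume "h \<in> {\<lambda>x. s (g x) * q x |s q. smooth s \<and> smooth q}"
  then obtain s q where h: "h = (\<lambda>x. s (g x) * q x)" "smooth s" "smooth q" by auto
  have d: "(h has_derivative (\<lambda>v. s (g x) * dir_deriv v q x + (dir_deriv 1 s (g x) * dir_deriv v g x) * q x)) (at x)" for x
    unfolding h(1) by (intro has_derivative_mult has_derivative_compose_real smooth_has_derivative h g)
  then show "h differentiable (at x)" for x by (auto simp: differentiable_def)
  from dir_deriv_cong_has_derivative[OF d]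
  have "dir_deriv v h = (\<lambda>x. s (g x) * dir_deriv v q x + dir_deriv 1 s (g x) * (dir_deriv v g x * q x))" for v
    by (simp add: mult.assoc)
  moreover have "(\<lambda>x. s (g x) * dir_deriv v q x + dir_deriv 1 s (g x) * (dir_deriv v g x * q x))
      \<in> fun_sums {\<lambda>x. s (g x) * q x |s q. smooth s \<and> smooth q}" for v
  proof (rule fun_sums.add; rule fun_sums.base)
    show "(\<lambda>x. s (g x) * dir_deriv v q x) \<in> {\<lambda>x. s (g x) * q x |s q. smooth s \<and> smooth q}"
      using h smooth_dir_deriv[OF h(3), of v] by auto
    show "(\<lambda>x. dir_deriv 1 s (g x) * (dir_deriv v g x * q x)) \<in> {\<lambda>x. s (g x) * q x |s q. smooth s \<and> smooth q}"
      using smooth_dir_deriv[OF h(2), of 1] smooth_mult[OF smooth_dir_deriv[OF g, of v] h(3)] by auto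
  qed
  ultimately show "dir_deriv v h \<in> fun_sums {\<lambda>x. s (g x) * q x |s q. smooth s \<and> smooth q}" for v
    by simp
next
  show "(\<lambda>x. s (g x)) \<in> {\<lambda>x. s (g x) * q x |s q. smooth s \<and> smooth q}"
    by (intro CollectI exI[of _ s] exI[of _ "\<lambda>_. 1"] conjI smooth_const assms(1)) simp
qed

text \<open>Two uses of the mean value theorem: first along \<open>u\<close> for the difference of
  \<open>f\<close> in direction \<open>v\<close>, then along \<open>v\<close> for the derivative in
  direction \<open>u\<close>.\<close>

lemma second_difference_mean_value:
  fixes f :: "'a::euclidean_space => real"
  assumes f: "smooth f" and c: "c > 0"
  shows "\<exists>s t. 0 < s \<and> s < c \<and> 0 < t \<and> t < c \<and>
    f (x + c *\<^sub>R u + c *\<^sub>R v) - f (x + c *\<^sub>R u) - f (x + c *\<^sub>R v) + f x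
      = c * c * dir_deriv v (dir_deriv u f) (x + s *\<^sub>R u + t *\<^sub>R v)"
proof -
  have line: "((\<lambda>s. g (y + s *\<^sub>R w)) has_real_derivative dir_deriv w g (y + s *\<^sub>R w)) (at s)"
    if "smooth g" for g :: "'a => real" and y w s
  proof -
    have "((\<lambda>s. y + s *\<^sub>R w) has_derivative (\<lambda>h. h *\<^sub>R w)) (at s)"
      by (auto intro!: derivative_eq_intros)
    from has_derivative_compose[OF this smooth_has_derivative[OF that]]
    have "((\<lambda>s. g (y + s *\<^sub>R w)) has_derivative (\<lambda>h. dir_deriv (h *\<^sub>R w) g (y + s *\<^sub>R w))) (at s)" .
    then show ?thesis
      by (simp add: has_field_derivative_def linear_cmul[OF dir_deriv_linear[OF that]] mult.commute[of _ "dir_deriv w g _"])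
  qed
  have "\<exists>s>0. s < c \<and> (f (x + c *\<^sub>R v + c *\<^sub>R u) - f (x + c *\<^sub>R u)) - (f (x + c *\<^sub>R v + 0 *\<^sub>R u) - f (x + 0 *\<^sub>R u))
      = (c - 0) * (dir_deriv u f (x + c *\<^sub>R v + s *\<^sub>R u) - dir_deriv u f (x + s *\<^sub>R u))"
  proof -
    have d: "((\<lambda>s. f (x + c *\<^sub>R v + s *\<^sub>R u) - f (x + s *\<^sub>R u)) has_real_derivative
      dir_deriv u f (x + c *\<^sub>R v + s *\<^sub>R u) - dir_deriv u f (x + s *\<^sub>R u)) (at s)" for s
      by (intro DERIV_diff line f)
    from MVT2[OF c d] show ?thesis by fastforce
  qed
  then obtain s where s: "0 < s" "s < c" and 1: "f (x + c *\<^sub>R u + c *\<^sub>R v) - f (x + c *\<^sub>R u) - f (x + c *\<^sub>R v) + f x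
      = c * (dir_deriv u f (x + s *\<^sub>R u + c *\<^sub>R v) - dir_deriv u f (x + s *\<^sub>R u + 0 *\<^sub>R v))"
    by (auto simp: algebra_simps)
  obtain t where "0 < t" "t < c" "dir_deriv u f (x + s *\<^sub>R u + c *\<^sub>R v) - dir_deriv u f (x + s *\<^sub>R u + 0 *\<^sub>R v)
      = (c - 0) * dir_deriv v (dir_deriv u f) (x + s *\<^sub>R u + t *\<^sub>R v)"
    using MVT2[OF c, of "\<lambda>t. dir_deriv u f (x + s *\<^sub>R u + t *\<^sub>R v)"
      "\<lambda>t. dir_deriv v (dir_deriv u f) (x + s *\<^sub>R u + t *\<^sub>R v)"]
    by (auto intro!: line smooth_dir_deriv f)
  with s 1 show ?thesis by (intro exI[of _ s] exI[of _ t]) simp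
qed

text \<open>The second difference is symmetric in the two directions, so both orders of
  differentiation agree at points that converge to \<open>x\<close>; continuity of the second
  derivatives finishes.\<close>

lemma dir_deriv_commute:
  fixes f :: "'a::euclidean_space => real"
  assumes f: "smooth f"
  shows "dir_deriv v (dir_deriv u f) x = dir_deriv u (dir_deriv v f) x"
proof -
  have lim: "(\<lambda>n. g (x + a n *\<^sub>R u' + b n *\<^sub>R v')) \<longlonglongrightarrow> g x"
    if "smooth g" "\<And>n. 0 < a n \<and> a n < inverse (Suc n)" "\<And>n. 0 < b n \<and> b n < inverse (Suc n)"
    for g :: "'a => real" and a b u' v'
  proof -
    have "a \<longlonglongrightarrow> 0" "b \<longlonglongrightarrow> 0"
      using that by (auto intro!: tendsto_sandwich[OF _ _ tendsto_const LIMSEQ_inverse_real_of_nat]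
          always_eventually less_imp_le simp del: inverse_eq_divide)
    then have "(\<lambda>n. x + a n *\<^sub>R u' + b n *\<^sub>R v') \<longlonglongrightarrow> x + 0 *\<^sub>R u' + 0 *\<^sub>R v'"
      by (intro tendsto_intros)
    moreover have "isCont g x"
      using smooth_continuous_on[OF that(1), of UNIV] by (simp add: continuous_on_eq_continuous_at)
    ultimately show ?thesis using isCont_tendsto_compose[of x g] by simp
  qed
  let ?c = "\<lambda>n. inverse (real (Suc n))"
  let ?\<Delta> = "\<lambda>n. f (x + ?c n *\<^sub>R u + ?c n *\<^sub>R v) - f (x + ?c n *\<^sub>R u) - f (x + ?c n *\<^sub>R v) + f x"
  have "\<exists>s t. 0 < s \<and> s < ?c n \<and> 0 < t \<and> t < ?c n \<and>
      ?\<Delta> n = ?c n * ?c n * dir_deriv v (dir_deriv u f) (x + s *\<^sub>R u + t *\<^sub>R v)" for n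
    by (rule second_difference_mean_value[OF f]) simp
  then obtain s t where 1: "\<And>n. 0 < s n \<and> s n < ?c n" "\<And>n. 0 < t n \<and> t n < ?c n"
    "\<And>n. ?\<Delta> n = ?c n * ?c n * dir_deriv v (dir_deriv u f) (x + s n *\<^sub>R u + t n *\<^sub>R v)" by metis
  have "\<exists>s t. 0 < s \<and> s < ?c n \<and> 0 < t \<and> t < ?c n \<and>
      ?\<Delta> n = ?c n * ?c n * dir_deriv u (dir_deriv v f) (x + s *\<^sub>R v + t *\<^sub>R u)" for n
    using second_difference_mean_value[OF f, of "?c n" x v u] by (simp add: algebra_simps)
  then obtain s' t' where 2: "\<And>n. 0 < s' n \<and> s' n < ?c n" "\<And>n. 0 < t' n \<and> t' n < ?c n"
    "\<And>n. ?\<Delta> n = ?c n * ?c n * dir_deriv u (dir_deriv v f) (x + s' n *\<^sub>R v + t' n *\<^sub>R u)" by metis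
  have "dir_deriv v (dir_deriv u f) (x + s n *\<^sub>R u + t n *\<^sub>R v)
      = dir_deriv u (dir_deriv v f) (x + s' n *\<^sub>R v + t' n *\<^sub>R u)" for n
    using 1(3)[of n] 2(3)[of n] by simp
  moreover have "(\<lambda>n. dir_deriv v (dir_deriv u f) (x + s n *\<^sub>R u + t n *\<^sub>R v)) \<longlonglongrightarrow> dir_deriv v (dir_deriv u f) x"
    "(\<lambda>n. dir_deriv u (dir_deriv v f) (x + s' n *\<^sub>R v + t' n *\<^sub>R u)) \<longlonglongrightarrow> dir_deriv u (dir_deriv v f) x"
    by (intro lim smooth_dir_deriv f 1(1,2) 2(1,2))+
  ultimately show ?thesis by (auto intro: LIMSEQ_unique)
qed

subsection \<open>Smooth functions with bounded derivatives and test functions\<close>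

text \<open>The working class of data: it contains the test functions and is preserved by the mild
  solution operator at each time, and its bounds provide constant or linear dominating functions for
  differentiation under the Gaussian integral.\<close>

definition bsmooth :: "('a::euclidean_space => real) => bool" where
  "bsmooth f \<longleftrightarrow> smooth f \<and> (\<forall>vs. \<exists>C. \<forall>x. \<bar>iter_deriv vs f x\<bar> \<le> C)"

lemma bsmoothD: "bsmooth f ==> smooth f" by (simp add: bsmooth_def)

lemma bsmooth_bounded: "bsmooth f ==> \<exists>C. \<forall>x. \<bar>f x\<bar> \<le> C"
  unfolding bsmooth_def by (metis iter_deriv.simps(1))

lemma bsmooth_dir_deriv: "bsmooth f ==> bsmooth (dir_deriv v f)"
  unfolding bsmooth_def using smooth_dir_deriv
  by (metis iter_deriv.simps(1) iter_deriv_Cons_dir iter_deriv_append)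

lemma bsmooth_coinduct:
  assumes d: "\<And>g x. g \<in> S ==> g differentiable (at x)"
    and D: "\<And>g v. g \<in> S ==> dir_deriv v g \<in> fun_sums S"
    and b: "\<And>g. g \<in> S ==> \<exists>C. \<forall>x. \<bar>g x\<bar> \<le> C"
    and f: "f \<in> S"
  shows "bsmooth f"
  unfolding bsmooth_def
proof (intro conjI allI)
  show "smooth f" by (rule smooth_coinduct[of S, OF d D f])
  have "\<exists>C. \<forall>x. \<bar>g x\<bar> \<le> C" if "g \<in> fun_sums S" for g
    using that
  proof induction
    case (add f g)
    then obtain C D where "\<forall>x. \<bar>f x\<bar> \<le> C" "\<forall>x. \<bar>g x\<bar> \<le> D" by blast
    then have "\<forall>x. \<bar>f x + g x\<bar> \<le> C + D"
      by (meson abs_triangle_ineq add_mono order_trans)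
    then show ?case ..
  qed (rule b)
  then show "\<exists>C. \<forall>x. \<bar>iter_deriv vs f x\<bar> \<le> C" for vs
    using iter_deriv_fun_sums[of S, OF d D f] by blast
qed

lemma bsmooth_affine:
  assumes "bounded_linear L" "bsmooth f" shows "bsmooth (\<lambda>x. f (a + L x))"
proof (rule bsmooth_coinduct[of "{\<lambda>x. f (a + L x) |f. bsmooth f}"])
  fix g v assume "g \<in> {\<lambda>x. f (a + L x) |f. bsmooth f}"
  then obtain f where f: "g = (\<lambda>x. f (a + L x))" "bsmooth f" by auto
  then have "dir_deriv v g = (\<lambda>x. dir_deriv (L v) f (a + L x))"
    by (auto intro!: dir_deriv_affine assms(1) smooth_differentiable bsmoothD)
  with f show "dir_deriv v g \<in> fun_sums {\<lambda>x. f (a + L x) |f. bsmooth f}"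
    by (auto intro!: fun_sums.base bsmooth_dir_deriv)
  show "\<exists>C. \<forall>x. \<bar>g x\<bar> \<le> C" using bsmooth_bounded[OF f(2)] f(1) by auto
  show "g differentiable (at x)" for x
    unfolding f(1) by (intro affine_differentiable assms(1) smooth_differentiable bsmoothD f)
qed (use assms in blast)

lemma bsmooth_mult:
  fixes f g :: "'a::euclidean_space => real"
  assumes "bsmooth f" "bsmooth g"
  shows "bsmooth (\<lambda>x. f x * g x)"
proof (rule bsmooth_coinduct[of "{\<lambda>x. f x * g x |f g. bsmooth f \<and> bsmooth g}"])
  fix h :: "'a => real" and v assume "h \<in> {\<lambda>x. f x * g x |f g. bsmooth f \<and> bsmooth g}"
  then obtain f g where fg: "h = (\<lambda>x. f x * g x)" "bsmooth f" "bsmooth g" by auto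
  then have "dir_deriv v h = (\<lambda>x. f x * dir_deriv v g x + dir_deriv v f x * g x)"
    by (auto intro!: dir_deriv_mult smooth_differentiable bsmoothD)
  moreover have "(\<lambda>x. f x * dir_deriv v g x + dir_deriv v f x * g x) \<in> fun_sums {\<lambda>x. f x * g x |f g. bsmooth f \<and> bsmooth g}"
    by (rule fun_sums.add; rule fun_sums.base) (use fg(2,3) bsmooth_dir_deriv in fast)+
  ultimately show "dir_deriv v h \<in> fun_sums {\<lambda>x. f x * g x |f g. bsmooth f \<and> bsmooth g}" by simp
  show "h differentiable (at x)" for x
    unfolding fg(1) by (intro differentiable_mult smooth_differentiable bsmoothD fg)
  obtain C D where "\<And>x. \<bar>f x\<bar> \<le> C" "\<And>x. \<bar>g x\<bar> \<le> D"
    using bsmooth_bounded[OF fg(2)] bsmooth_bounded[OF fg(3)] by blast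
  then have "\<bar>h x\<bar> \<le> C * D" for x
    unfolding fg(1) abs_mult by (intro mult_mono order_trans[OF abs_ge_zero]) auto
  then show "\<exists>C. \<forall>x. \<bar>h x\<bar> \<le> C" by blast
qed (use assms in auto)

lemma testfun_smooth: "test_function D f ==> smooth f" by (simp add: test_function_def)

lemma testfun_mono: "test_function D f ==> D \<subseteq> E ==> test_function E f"
  by (auto simp: test_function_def)

lemma test_functionI:
  fixes f :: "'a::euclidean_space => real"
  assumes "smooth f" "closed K" "bounded K" "K \<subseteq> D" "\<And>x. f x \<noteq> 0 ==> x \<in> K"
  shows "test_function D f"
proof -
  have "closure {x. f x \<noteq> 0} \<subseteq> K" using assms by (intro closure_minimal) auto
  moreover from this have "bounded (closure {x. f x \<noteq> 0})" using assms(3) bounded_subset by blast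
  ultimately show ?thesis
    using assms by (auto simp: test_function_def compact_eq_bounded_closed)
qed

lemma testfun_zero_outside: "test_function D f ==> x \<notin> D ==> f x = 0"
  unfolding test_function_def using closure_subset[of "{x. f x \<noteq> 0}"] by blast

lemma testfun_support:
  assumes "test_function D f" "x \<notin> closure {x. f x \<noteq> 0}"
  shows "f x = 0" "dir_deriv v f x = 0"
proof -
  have z: "f y = 0" if "y \<notin> closure {x. f x \<noteq> 0}" for y
    using that closure_subset[of "{x. f x \<noteq> 0}"] by blast
  show "f x = 0" by (rule z) fact
  have "\<forall>\<^sub>F y in nhds x. y \<in> - closure {x. f x \<noteq> 0}"
    using assms(2) by (intro eventually_nhds_in_open) auto
  then have "\<forall>\<^sub>F y in nhds x. f y = 0"
    by eventually_elim (rule z, simp only: Compl_iff not_False_eq_True)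
  then have "\<forall>\<^sub>F y in at x. f y = 0" by (simp add: eventually_nhds_conv_at)
  then have "\<forall>\<^sub>F y in at x. 0 = f y" by eventually_elim simp
  then have "(f has_derivative (\<lambda>_. 0)) (at x)"
    by (rule has_derivative_transform_eventually[OF has_derivative_const]) (simp_all add: \<open>f x = 0\<close>)
  then show "dir_deriv v f x = 0" by (rule dir_derivI)
qed

lemma testfun_same_support:
  fixes f g :: "'a::euclidean_space => real"
  assumes "test_function D f" "smooth g" "\<And>x. x \<notin> closure {x. f x \<noteq> 0} ==> g x = 0"
  shows "test_function D g"
proof (rule test_functionI[where K="closure {x. f x \<noteq> 0}"])
  show "x \<in> closure {x. f x \<noteq> 0}" if "g x \<noteq> 0" for x using assms(3) that by blast
qed (use assms(1,2) in \<open>simp_all add: test_function_def compact_eq_bounded_closed\<close>)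

lemma testfun_dir_deriv:
  assumes "test_function D f" shows "test_function D (dir_deriv v f)"
  by (rule testfun_same_support[OF assms])
    (intro smooth_dir_deriv testfun_smooth[OF assms] testfun_support[OF assms])+

lemma testfun_mult_smooth:
  assumes "test_function D f" "smooth g" shows "test_function D (\<lambda>x. g x * f x)"
proof (rule testfun_same_support[OF assms(1)])
  show "smooth (\<lambda>x. g x * f x)" by (intro smooth_mult assms(2) testfun_smooth[OF assms(1)])
  fix x assume "x \<notin> closure {x. f x \<noteq> 0}"
  then have "f x = 0" by (rule testfun_support(1)[OF assms(1)])
  then show "g x * f x = 0" by (simp only: mult_zero_right)
qed

lemma testfun_cmult: "test_function D f ==> test_function D (\<lambda>x. c * f x)"
  by (rule testfun_mult_smooth) (auto intro: smooth_const)

lemma testfun_add: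
  assumes "test_function D f" "test_function D g" shows "test_function D (\<lambda>x. f x + g x)"
proof (rule test_functionI[where K="closure {x. f x \<noteq> 0} \<union> closure {x. g x \<noteq> 0}"])
  show "x \<in> closure {x. f x \<noteq> 0} \<union> closure {x. g x \<noteq> 0}" if "f x + g x \<noteq> 0" for x
  proof -
    have "f x \<noteq> 0 \<or> g x \<noteq> 0" using that by auto
    then show ?thesis
      using testfun_support(1)[OF assms(1), of x] testfun_support(1)[OF assms(2), of x] by blast
  qed
qed (use assms in \<open>auto simp: test_function_def compact_eq_bounded_closed intro: smooth_add\<close>)

lemma testfun_diff:
  assumes "test_function D f" "test_function D g" shows "test_function D (\<lambda>x. f x - g x)"
  using testfun_add[OF assms(1) testfun_cmult[OF assms(2), of "-1"]] by simp

lemma testfun_zero: "test_function D (\<lambda>x. 0)"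
  by (rule test_functionI[where K="{}"]) (auto intro: smooth_const)

lemma testfun_bounded:
  fixes f :: "'a::euclidean_space => real"
  assumes f: "test_function D f" shows "\<exists>C. \<forall>x. \<bar>f x\<bar> \<le> C"
proof -
  have "bounded (f ` closure {x. f x \<noteq> 0})"
    using f by (intro compact_imp_bounded compact_continuous_image)
      (auto simp: test_function_def intro: smooth_continuous_on)
  then obtain C where "\<And>x. x \<in> closure {x. f x \<noteq> 0} ==> \<bar>f x\<bar> \<le> C"
    by (force simp: bounded_iff)
  then have "f x = 0 \<or> \<bar>f x\<bar> \<le> C" for x
    using testfun_support(1)[OF f, of x] by blast
  then have "\<bar>f x\<bar> \<le> max C 0" for x
    by (metis abs_zero max.cobounded1 max.cobounded2 order_trans)
  then show ?thesis by blast
qed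

lemma testfun_bsmooth: "test_function D f ==> bsmooth f"
  by (rule bsmooth_coinduct[of "{f. test_function D f}"])
    (auto intro: testfun_smooth smooth_differentiable testfun_dir_deriv fun_sums.base testfun_bounded)

subsection \<open>Bump functions\<close>

definition exp_cutoff :: "real => real" where
  "exp_cutoff x = (if x > 0 then exp (- (1 / x)) else 0)"

lemma poly_div_exp_tendsto_0:
  fixes P :: "real poly"
  shows "((\<lambda>y. y ^ k * poly P y * exp (- y)) \<longlongrightarrow> 0) at_top"
proof (induction P arbitrary: k)
  case (pCons a p)
  have "((\<lambda>y::real. a * (y ^ k / exp y) + y ^ Suc k * poly p y * exp (- y)) \<longlongrightarrow> a * 0 + 0) at_top"
    by (intro tendsto_intros tendsto_power_div_exp_0 pCons.IH)
  then show ?case by (simp add: algebra_simps exp_minus divide_inverse)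
qed simp

text \<open>The functions \<open>P (1 / x) * exp (- (1 / x))\<close> with a polynomial
  \<open>P\<close>, continued by zero, form a class closed under differentiation; the cutoff is the
  member with \<open>P = 1\<close>.\<close>

lemma smooth_exp_cutoff: "smooth exp_cutoff"
proof -
  define e where "e P x = (if x > 0 then poly P (1 / x) * exp (- (1 / x)) else 0)" for P and x :: real
  \<comment> \<open>Flatness at the origin: the difference quotient at 0 of every member of the
    class tends to 0, because the exponential beats any power of \<open>1 / x\<close>.\<close>
  have lim: "((\<lambda>x. e P x / x) \<longlongrightarrow> 0) (at 0)" for P
  proof -
    have "((\<lambda>x. e P x / x) \<longlongrightarrow> 0) (at_right 0)"
    proof (rule Lim_transform_eventually)
      have "((\<lambda>x. (inverse x) ^ 1 * poly P (inverse x) * exp (- inverse x)) \<longlongrightarrow> 0) (at_right (0::real))"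
        by (rule filterlim_compose[OF poly_div_exp_tendsto_0 filterlim_inverse_at_top_right])
      then show "((\<lambda>x. (inverse x) ^ 1 * poly P (inverse x) * exp (- inverse x)) \<longlongrightarrow> 0) (at_right (0::real))" .
      show "\<forall>\<^sub>F x in at_right 0. (inverse x) ^ 1 * poly P (inverse x) * exp (- inverse x) = e P x / x"
        by (auto simp: eventually_at_filter e_def divide_inverse)
    qed
    moreover have "((\<lambda>x. e P x / x) \<longlongrightarrow> 0) (at_left 0)"
      by (rule Lim_transform_eventually[OF tendsto_const]) (auto simp: eventually_at_filter e_def)
    ultimately show ?thesis by (simp add: filterlim_at_split)
  qed
  \<comment> \<open>With \<open>y = 1 / x\<close> the derivative of \<open>P y * exp (- y)\<close>
    in \<open>x\<close> is \<open>y\<^sup>2 * (P y - P' y) * exp (- y)\<close>, which is again of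
    the same form.\<close>
  let ?D = "\<lambda>P. monom 1 2 * (P - pderiv P)"
  have der: "(e P has_real_derivative e (?D P) x) (at x)" for P x
  proof -
    consider "x > 0" | "x < 0" | "x = 0" by linarith
    then show ?thesis
    proof cases
      case 1
      have "((\<lambda>x. poly P (1 / x) * exp (- (1 / x))) has_real_derivative
          poly (pderiv P) (1 / x) * (- (1 / x^2)) * exp (- (1 / x)) + poly P (1 / x) * (exp (- (1 / x)) * (1 / x^2))) (at x)"
        using 1 by (auto intro!: derivative_eq_intros DERIV_chain2[of "poly P", OF poly_DERIV]
            simp: power2_eq_square)
      then have "((\<lambda>x. poly P (1 / x) * exp (- (1 / x))) has_real_derivative e (?D P) x) (at x)"
        using 1 by (simp add: e_def poly_monom power2_eq_square algebra_simps)
      then show ?thesis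
        by (rule DERIV_cong_ev[THEN iffD1, rotated 3])
          (use eventually_nhds_in_open[of "{0<..}" x] 1 in \<open>auto simp: e_def elim!: eventually_mono\<close>)
    next
      case 2
      have "((\<lambda>x. 0::real) has_real_derivative e (?D P) x) (at x)" using 2 by (simp add: e_def)
      then show ?thesis
        by (rule DERIV_cong_ev[THEN iffD1, rotated 3])
          (use eventually_nhds_in_open[of "{..<0}" x] 2 in \<open>auto simp: e_def elim!: eventually_mono\<close>)
    next
      case 3
      then show ?thesis using lim[of P] by (simp add: has_field_derivative_iff e_def)
    qed
  qed
  have "smooth (e 1)"
  proof (rule smooth_coinduct[of "range e"])
    fix g v assume "g \<in> range e"
    then obtain P where g: "g = e P" by auto
    have d: "(g has_derivative (\<lambda>h. e (smult h (?D P)) x)) (at x)" for x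
      using der[of P x] unfolding has_field_derivative_def g
      by (rule has_derivative_eq_rhs) (auto simp: e_def fun_eq_iff)
    then show "g differentiable (at x)" for x by (auto simp: differentiable_def)
    from dir_deriv_cong_has_derivative[OF d, of v] show "dir_deriv v g \<in> fun_sums (range e)"
      by (auto intro: fun_sums.base)
  qed auto
  moreover have "e 1 = exp_cutoff" by (auto simp: e_def exp_cutoff_def)
  ultimately show ?thesis by simp
qed

lemma exp_cutoff_bounds: "0 \<le> exp_cutoff x" "exp_cutoff x \<le> 1"
  by (auto simp: exp_cutoff_def)

lemma exp_cutoff_pos_iff: "0 < exp_cutoff x \<longleftrightarrow> x > 0"
  by (auto simp: exp_cutoff_def)

lemma exp_cutoff_tendsto_1:
  assumes "c > 0" shows "(\<lambda>k. exp_cutoff (real k * c - 1)) \<longlonglongrightarrow> 1"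
proof -
  have "filterlim (\<lambda>k. real k * c - 1) at_top sequentially"
    using filterlim_tendsto_pos_mult_at_top[OF tendsto_const[of c] assms filterlim_real_sequentially]
      filterlim_tendsto_add_at_top[OF tendsto_const[of "-1::real"]]
    by (simp add: mult.commute add.commute)
  note lim = this
  have l: "(\<lambda>k. exp (- (1 / (real k * c - 1)))) \<longlonglongrightarrow> exp (- 0)"
    by (intro tendsto_intros real_tendsto_divide_at_top[OF tendsto_const] lim)
  have ev: "\<forall>\<^sub>F k in sequentially. 0 < real k * c - 1"
    using lim by (simp only: filterlim_at_top_dense)
  show ?thesis
    by (rule Lim_transform_eventually[OF l[simplified]]) (use ev in \<open>eventually_elim, auto simp: exp_cutoff_def\<close>)
qed

text \<open>The shift by 1 in the arguments keeps the support at distance \<open>1 / k\<close> from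
  every face of the box, so it is compact inside the open box, while the values still tend to 1 at
  each interior point.\<close>

definition box_bump :: "'a::euclidean_space => 'a => nat => 'a => real" where
  "box_bump a b k x = (\<Prod>i\<in>Basis. exp_cutoff (real k * ((x - a) \<bullet> i) - 1) * exp_cutoff (real k * ((b - x) \<bullet> i) - 1))"

lemma box_bump_bounds: "0 \<le> box_bump a b k x" "box_bump a b k x \<le> 1"
  unfolding box_bump_def
  by (auto intro!: prod_nonneg prod_le_1 mult_le_one exp_cutoff_bounds mult_nonneg_nonneg)

lemma testfun_box_bump: "test_function (box a b) (box_bump a b k)"
proof (rule test_functionI)
  let ?K = "cbox (a + (\<Sum>i\<in>Basis. (1 / real k) *\<^sub>R i)) (b - (\<Sum>i\<in>Basis. (1 / real k) *\<^sub>R i))"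
  have Bs: "(\<Sum>i\<in>Basis. (1 / real k) *\<^sub>R i) \<bullet> i = 1 / real k" if "i \<in> Basis" for i :: 'a
    using that by (simp add: inner_sum_left inner_Basis if_distrib cong: if_cong)
  show "smooth (box_bump a b k)"
  proof -
    have a: "smooth (\<lambda>x. exp_cutoff (real k * ((x - a) \<bullet> i) - 1))" for i
    proof (rule smooth_compose_real[OF smooth_exp_cutoff])
      have "(\<lambda>x. real k * ((x - a) \<bullet> i) - 1) = (\<lambda>x. real k * (x \<bullet> i) - (real k * (a \<bullet> i) + 1))"
        by (auto simp: algebra_simps inner_diff_left)
      then show "smooth (\<lambda>x. real k * ((x - a) \<bullet> i) - 1)"
        by (auto intro!: smooth_diff smooth_cmult smooth_inner smooth_const)
    qed
    have b: "smooth (\<lambda>x. exp_cutoff (real k * ((b - x) \<bullet> i) - 1))" for i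
    proof (rule smooth_compose_real[OF smooth_exp_cutoff])
      have "(\<lambda>x. real k * ((b - x) \<bullet> i) - 1) = (\<lambda>x. (real k * (b \<bullet> i) - 1) - real k * (x \<bullet> i))"
        by (auto simp: algebra_simps inner_diff_left)
      then show "smooth (\<lambda>x. real k * ((b - x) \<bullet> i) - 1)"
        by (auto intro!: smooth_diff smooth_cmult smooth_inner smooth_const)
    qed
    show ?thesis unfolding box_bump_def by (intro smooth_prod smooth_mult a b)
  qed
  \<comment> \<open>For \<open>k = 0\<close> division by zero makes \<open>?K\<close> the closed box
    itself, which need not lie in the open one. The bump is identically zero in that case, so the
    empty set serves instead.\<close>
  show "closed (if k = 0 then {} else ?K)" "bounded (if k = 0 then {} else ?K)" by auto
  have K: "x \<in> ?K \<longleftrightarrow> (\<forall>i\<in>Basis. 1 / real k \<le> (x - a) \<bullet> i \<and> 1 / real k \<le> (b - x) \<bullet> i)" for x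
    unfolding mem_box by (intro ball_cong) (auto simp: Bs inner_add_left inner_diff_left)
  show "(if k = 0 then {} else ?K) \<subseteq> box a b"
  proof (cases "k = 0")
    case False
    have "x \<in> box a b" if x: "x \<in> ?K" for x
      unfolding mem_box
    proof
      fix i :: 'a assume "i \<in> Basis"
      with x have "1 / real k \<le> (x - a) \<bullet> i" "1 / real k \<le> (b - x) \<bullet> i" unfolding K by auto
      moreover have "1 / real k > 0" using False by simp
      ultimately show "a \<bullet> i < x \<bullet> i \<and> x \<bullet> i < b \<bullet> i" unfolding inner_diff_left by linarith
    qed
    with False show ?thesis by auto
  qed simp
  fix x assume "box_bump a b k x \<noteq> 0"
  then have "exp_cutoff (real k * ((x - a) \<bullet> i) - 1) \<noteq> 0 \<and> exp_cutoff (real k * ((b - x) \<bullet> i) - 1) \<noteq> 0" if "i \<in> Basis" for i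
    using that by (auto simp: box_bump_def)
  then have *: "real k * ((x - a) \<bullet> i) > 1 \<and> real k * ((b - x) \<bullet> i) > 1" if "i \<in> Basis" for i
    using that by (force simp: exp_cutoff_def split: if_splits)
  have k: "k \<noteq> 0" using *[OF SOME_Basis] by (cases k) auto
  then have "1 / real k \<le> (x - a) \<bullet> i \<and> 1 / real k \<le> (b - x) \<bullet> i" if "i \<in> Basis" for i
    using *[OF that] by (simp add: divide_le_eq mult.commute less_imp_le)
  then show "x \<in> (if k = 0 then {} else ?K)"
    unfolding K if_not_P[OF k] by blast
qed

lemma box_bump_tendsto: "(\<lambda>k. box_bump a b k x) \<longlonglongrightarrow> indicator (box a b) x"
proof (cases "x \<in> box a b")
  case True
  then have "(\<lambda>k. box_bump a b k x) \<longlonglongrightarrow> (\<Prod>i\<in>(Basis::'a set). 1 * 1)"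
    unfolding box_bump_def by (intro tendsto_intros exp_cutoff_tendsto_1) (auto simp: mem_box inner_diff_left)
  with True show ?thesis by simp
next
  case False
  then have "box_bump a b k x = 0" for k using testfun_zero_outside[OF testfun_box_bump] by blast
  with False show ?thesis by simp
qed

definition ball_bump :: "'a::euclidean_space => real" where
  "ball_bump x = exp_cutoff (1 - x \<bullet> x)"

lemma testfun_ball_bump: "test_function UNIV ball_bump"
proof (rule test_functionI[where K="cball 0 1"])
  show "smooth (ball_bump :: 'a => real)" unfolding ball_bump_def[abs_def]
    by (intro smooth_compose_real[OF smooth_exp_cutoff] smooth_diff smooth_const smooth_inner_self)
  show "x \<in> cball 0 1" if "ball_bump x \<noteq> 0" for x :: 'a
  proof -
    have "(norm x)\<^sup>2 < 1"
      using that by (auto simp: ball_bump_def exp_cutoff_def power2_norm_eq_inner split: if_splits)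
    then show ?thesis by (simp add: power2_less_1_iff less_imp_le)
  qed
qed auto

subsection \<open>Integration by parts and differentiation under the integral\<close>

lemma lborel_translate:
  fixes f :: "'a::euclidean_space => 'b::{banach, second_countable_topology}"
  assumes "f \<in> borel_measurable borel"
  shows "integrable lborel (\<lambda>x. f (x + c)) \<longleftrightarrow> integrable lborel f"
    and "(LINT x|lborel. f (x + c)) = (LINT x|lborel. f x)"
proof -
  have *: "(\<lambda>x. f (x + c)) = (\<lambda>x. f ((+) c x))" by (simp add: add.commute)
  show "integrable lborel (\<lambda>x. f (x + c)) \<longleftrightarrow> integrable lborel f"
    using integrable_distr_eq[of "(+) c" lborel borel f] assms unfolding * by (simp add: lborel_distr_plus)
  show "(LINT x|lborel. f (x + c)) = (LINT x|lborel. f x)"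
    using integral_distr[of "(+) c" lborel borel f] assms unfolding * by (simp add: lborel_distr_plus)
qed

lemma DERIV_line:
  fixes f f' :: "'a::real_normed_vector => real"
  assumes "\<And>x. ((\<lambda>s. f (x + s *\<^sub>R v)) has_real_derivative f' x) (at 0)"
  shows "((\<lambda>s. f (x + s *\<^sub>R v)) has_real_derivative f' (x + s *\<^sub>R v)) (at s)"
proof -
  have "((\<lambda>h. f (x + (h + s) *\<^sub>R v)) has_real_derivative f' (x + s *\<^sub>R v)) (at 0)"
    using assms[of "x + s *\<^sub>R v"] by (simp add: algebra_simps)
  then show ?thesis using DERIV_shift[of "\<lambda>s. f (x + s *\<^sub>R v)" _ 0 s] by simp
qed

text \<open>Translation invariance gives \<open>\<integral> (f (x + v) - f x) dx = 0\<close>; the integrand is the integral of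
  the derivative over the segment, so Fubini yields the claim.\<close>

lemma integral_directional_derivative_eq_0:
  fixes f f' :: "'a::euclidean_space => real"
  assumes der: "\<And>x. ((\<lambda>s. f (x + s *\<^sub>R v)) has_real_derivative f' x) (at 0)"
    and cont: "continuous_on UNIV f'"
    and f: "integrable lborel f" and f': "integrable lborel f'"
  shows "(LINT x|lborel. f' x) = 0"
proof -
  have [measurable]: "f' \<in> borel_measurable borel" by (rule borel_measurable_continuous_onI[OF cont])
  have [measurable]: "f \<in> borel_measurable borel" using borel_measurable_integrable[OF f] by simp
  let ?h = "\<lambda>(s, x). f' (x + s *\<^sub>R v) * indicator {0..1::real} s"
  have int: "integrable (lborel \<Otimes>\<^sub>M lborel) ?h"
  proof (rule lborel_pair.Fubini_integrable)
    show "?h \<in> borel_measurable (lborel \<Otimes>\<^sub>M lborel)" by measurable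
    have "(LINT x|lborel. norm (?h (s, x))) = (LINT x|lborel. \<bar>f' x\<bar>) * indicator {0..1} s" for s
      using lborel_translate(2)[of "\<lambda>x. \<bar>f' x\<bar>" "s *\<^sub>R v"] by (simp add: abs_mult)
    then show "integrable lborel (\<lambda>s. LINT x|lborel. norm (?h (s, x)))"
      by (simp add: mult.commute[of _ "indicator _ _"])
    show "AE s in lborel. integrable lborel (\<lambda>x. ?h (s, x))"
      using lborel_translate(1)[of f'] f' by simp
  qed
  have FTC: "(LINT s|lborel. ?h (s, x)) = f (x + v) - f x" for x
  proof -
    have "isCont (\<lambda>s. f' (x + s *\<^sub>R v)) s" for s
      using continuous_on_compose2[OF cont, of UNIV "\<lambda>s. x + s *\<^sub>R v"]
      by (simp add: continuous_on_eq_continuous_at continuous_intros)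
    from integral_FTC_Icc_real[of 0 1, OF _ DERIV_line[OF der] this] show ?thesis by simp
  qed
  have "(LINT x|lborel. f' x) = (LINT s|lborel. (LINT x|lborel. ?h (s, x)))"
  proof -
    have "(LINT x|lborel. ?h (s, x)) = (LINT x|lborel. f' x) * indicator {0..1} s" for s
      using lborel_translate(2)[of f' "s *\<^sub>R v"] by simp
    then have "(LINT s|lborel. (LINT x|lborel. ?h (s, x))) = (LINT s|lborel. (LINT x|lborel. f' x) * indicator {0..1::real} s)"
      by (simp only:)
    moreover have "(LINT s|lborel. c * indicator {0..1::real} s) = c" for c :: real by simp
    ultimately show ?thesis by (simp only:)
  qed
  also have "\<dots> = (LINT x|lborel. (LINT s|lborel. ?h (s, x)))"
    using lborel_pair.Fubini_integral[of "\<lambda>s x. ?h (s, x)"] int by simp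
  also have "\<dots> = (LINT x|lborel. f (x + v) - f x)" by (simp only: FTC)
  also have "\<dots> = 0"
    using lborel_translate[of f v] f by simp
  finally show ?thesis .
qed

lemma integration_by_parts_smooth:
  fixes f g :: "'a::euclidean_space => real"
  assumes g: "test_function D g"
    and f: "continuous_on UNIV f" "continuous_on UNIV f'"
    and der: "\<And>x. x \<in> D ==> ((\<lambda>s. f (x + s *\<^sub>R v)) has_real_derivative f' x) (at 0)"
  shows "(LINT x|lborel. f x * dir_deriv v g x) = - (LINT x|lborel. f' x * g x)"
proof -
  have ci: "integrable lborel (\<lambda>x. h x * k x)" if h: "continuous_on UNIV h" and k: "test_function D k"
    for h k :: "'a => real"
  proof -
    let ?K = "closure {x. k x \<noteq> 0}"
    have "integrable lborel (\<lambda>x. indicator ?K x *\<^sub>R (h x * k x))"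
    proof (rule borel_integrable_compact)
      show "compact ?K" using k by (simp add: test_function_def)
      show "continuous_on ?K (\<lambda>x. h x * k x)"
        by (intro continuous_on_mult continuous_on_subset[OF h] smooth_continuous_on testfun_smooth[OF k]) auto
    qed
    also have "(\<lambda>x. indicator ?K x *\<^sub>R (h x * k x)) = (\<lambda>x. h x * k x)"
    proof
      show "indicator ?K x *\<^sub>R (h x * k x) = h x * k x" for x
        using testfun_support(1)[OF k, of x] by (cases "x \<in> ?K") auto
    qed
    finally show ?thesis .
  qed
  note g' = testfun_dir_deriv[OF g, of v]
  have "(LINT x|lborel. f x * dir_deriv v g x + f' x * g x) = 0"
  proof (rule integral_directional_derivative_eq_0)
    show "((\<lambda>s. f (x + s *\<^sub>R v) * g (x + s *\<^sub>R v)) has_real_derivative f x * dir_deriv v g x + f' x * g x) (at 0)" for x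
    proof -
      have "((\<lambda>s. x + s *\<^sub>R v) has_derivative (\<lambda>h. h *\<^sub>R v)) (at 0)"
        by (auto intro!: derivative_eq_intros)
      from has_derivative_compose[OF this smooth_has_derivative[OF testfun_smooth[OF g]]]
      have dg: "((\<lambda>s. g (x + s *\<^sub>R v)) has_real_derivative dir_deriv v g x) (at 0)"
        by (simp add: has_field_derivative_def linear_cmul[OF dir_deriv_linear[OF testfun_smooth[OF g]]]
            mult.commute[of _ "dir_deriv v g _"])
      show ?thesis
      proof (cases "x \<in> D")
        case True
        from DERIV_mult[OF der[OF True] dg] show ?thesis by (simp add: algebra_simps)
      next
        \<comment> \<open>A point outside \<open>D\<close> is outside the closed support of
          \<open>g\<close>, so near it the product is identically zero along the line and has
          derivative zero.\<close>
        case False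
        have "x \<notin> closure {x. g x \<noteq> 0}" using False g by (auto simp: test_function_def)
        then have "open (- closure {x. g x \<noteq> 0})" "x \<in> - closure {x. g x \<noteq> 0}" by auto
        moreover have "((\<lambda>s. x + s *\<^sub>R v) \<longlongrightarrow> x + 0 *\<^sub>R v) (nhds 0)"
          by (intro tendsto_intros filterlim_ident)
        ultimately have "\<forall>\<^sub>F s in nhds 0. x + s *\<^sub>R v \<in> - closure {x. g x \<noteq> 0}"
          by (intro topological_tendstoD) auto
        then have ev: "\<forall>\<^sub>F s in nhds 0. 0 = f (x + s *\<^sub>R v) * g (x + s *\<^sub>R v)"
        proof eventually_elim
          case (elim s)
          then have "g (x + s *\<^sub>R v) = 0" by (intro testfun_support(1)[OF g]) auto
          then show ?case by simp
        qed
        have "f x * dir_deriv v g x + f' x * g x = 0"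
          using testfun_zero_outside[OF g False] testfun_zero_outside[OF g' False] by simp
        moreover have "((\<lambda>s. 0::real) has_real_derivative 0) (at 0)" by simp
        ultimately show ?thesis using DERIV_cong_ev[OF refl ev refl] by simp
      qed
    qed
    show "continuous_on UNIV (\<lambda>x. f x * dir_deriv v g x + f' x * g x)"
      by (intro continuous_intros f smooth_continuous_on testfun_smooth[OF g] testfun_smooth[OF g'])
  qed (intro ci f g g' Lintegrable_add)+
  then show ?thesis
    using ci[OF f(1) g'] ci[OF f(2) g] by simp
qed

text \<open>The bound on the derivative becomes a Lipschitz bound by the mean value inequality, so
  the normalised remainders are dominated by \<open>2 * g\<close> and dominated convergence applies.
  The parameter may be a pair of time and space, which gives both derivatives jointly.\<close>

lemma has_derivative_integral_dominated:
  fixes f :: "'a::euclidean_space => 'z => real"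
  assumes e: "e > 0"
    and meas: "\<And>x. f x \<in> borel_measurable N"
    and int0: "integrable N (f x0)"
    and der: "\<And>z x. z \<in> space N ==> x \<in> ball x0 e ==> ((\<lambda>x. f x z) has_derivative f' x z) (at x)"
    and bd: "\<And>z x h. z \<in> space N ==> x \<in> ball x0 e ==> norm (f' x z h) \<le> g z * norm h"
    and g: "integrable N g"
    and meas': "\<And>h. (\<lambda>z. f' x0 z h) \<in> borel_measurable N"
  shows "((\<lambda>x. LINT z|N. f x z) has_derivative (\<lambda>h. LINT z|N. f' x0 z h)) (at x0)"
proof -
  have x0: "x0 \<in> ball x0 e" using e by simp
  have lip: "norm (f y z - f x0 z) \<le> g z * norm (y - x0)" if z: "z \<in> space N" and y: "y \<in> ball x0 e" for y z
  proof (rule differentiable_bound[of "ball x0 e" "\<lambda>x. f x z" "\<lambda>x. f' x z"])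
    show "((\<lambda>x. f x z) has_derivative f' x z) (at x within ball x0 e)" if "x \<in> ball x0 e" for x
      using der[OF z that] by (rule has_derivative_at_withinI)
    show "onorm (f' x z) \<le> g z" if "x \<in> ball x0 e" for x
      using bd[OF z that] by (rule onorm_le)
  qed (use y x0 in auto)
  have intf: "integrable N (f y)" if y: "y \<in> ball x0 e" for y
  proof -
    have "integrable N (\<lambda>z. f y z - f x0 z)"
      by (rule Lintegrable_bound[of N "\<lambda>z. g z * norm (y - x0)"])
        (use g meas lip[OF _ y] in \<open>auto intro!: AE_I2 intro: order_trans[OF _ abs_ge_self]\<close>)
    from Lintegrable_add[OF this int0] show ?thesis by simp
  qed
  have intf': "integrable N (\<lambda>z. f' x0 z h)" for h
    by (rule Lintegrable_bound[of N "\<lambda>z. g z * norm h"])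
      (use g meas' bd[OF _ x0] in \<open>auto intro!: AE_I2 intro: order_trans[OF _ abs_ge_self]\<close>)
  have lin: "bounded_linear (f' x0 z)" if "z \<in> space N" for z
    using der[OF that x0] by (rule has_derivative_bounded_linear)
  show ?thesis
    unfolding has_derivative_at_within
  proof
    show "bounded_linear (\<lambda>h. LINT z|N. f' x0 z h)"
    proof (rule bounded_linear_intro[where K="LINT z|N. g z"])
      show "(LINT z|N. f' x0 z (a + b)) = (LINT z|N. f' x0 z a) + (LINT z|N. f' x0 z b)" for a b
      proof -
        have "(LINT z|N. f' x0 z (a + b)) = (LINT z|N. f' x0 z a + f' x0 z b)"
          by (rule Lintegral_cong[OF refl]) (simp add: lin bounded_linear.linear linear_add)
        then show ?thesis using intf' by simp
      qed
      show "(LINT z|N. f' x0 z (r *\<^sub>R a)) = r *\<^sub>R (LINT z|N. f' x0 z a)" for r a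
      proof -
        have "(LINT z|N. f' x0 z (r *\<^sub>R a)) = (LINT z|N. r *\<^sub>R f' x0 z a)"
          by (rule Lintegral_cong[OF refl]) (simp add: lin bounded_linear.linear linear_cmul)
        then show ?thesis by simp
      qed
      show "norm (LINT z|N. f' x0 z h) \<le> norm h * (LINT z|N. g z)" for h
      proof -
        have "norm (LINT z|N. f' x0 z h) \<le> (LINT z|N. norm (f' x0 z h))" by (rule integral_norm_bound)
        also have "\<dots> \<le> (LINT z|N. g z * norm h)"
          using intf' g bd[OF _ x0] by (intro integral_mono) auto
        finally show ?thesis by (simp add: mult.commute)
      qed
    qed
    show "((\<lambda>y. ((LINT z|N. f y z) - (LINT z|N. f x0 z) - (LINT z|N. f' x0 z (y - x0))) /\<^sub>R norm (y - x0)) \<longlongrightarrow> 0) (at x0)"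
      unfolding tendsto_at_iff_sequentially
    proof (intro allI impI)
      fix X assume X: "\<forall>i. X i \<in> UNIV - {x0}" "X \<longlonglongrightarrow> x0"
      define q where "q y z = (f y z - f x0 z - f' x0 z (y - x0)) /\<^sub>R norm (y - x0)" for y z
      \<comment> \<open>Finitely many members of the sequence may lie outside the ball, where no
        bound is known; setting the quotient to zero there makes the domination hold for every
        index.\<close>
      define Q where "Q i z = (if X i \<in> ball x0 e then q (X i) z else 0)" for i z
      have Xe: "\<forall>\<^sub>F i in sequentially. X i \<in> ball x0 e"
        using X(2) e by (simp add: tendsto_iff dist_commute)
      have lim: "(\<lambda>i. LINT z|N. Q i z) \<longlonglongrightarrow> (LINT z|N. 0)"
      proof (rule integral_dominated_convergence[where w="\<lambda>z. 2 * g z"])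
        show "AE z in N. (\<lambda>i. Q i z) \<longlonglongrightarrow> 0"
        proof (rule AE_I2)
          fix z assume z: "z \<in> space N"
          have "((\<lambda>y. q y z) \<longlongrightarrow> 0) (at x0)"
            using der[OF z x0] unfolding has_derivative_at_within q_def by simp
          then have "(\<lambda>i. q (X i) z) \<longlonglongrightarrow> 0"
            using X unfolding tendsto_at_iff_sequentially by (auto simp: comp_def)
          then show "(\<lambda>i. Q i z) \<longlonglongrightarrow> 0"
            by (rule Lim_transform_eventually) (use Xe in \<open>eventually_elim, simp add: Q_def\<close>)
        qed
        show "AE z in N. norm (Q i z) \<le> 2 * g z" for i
        proof (rule AE_I2)
          fix z assume z: "z \<in> space N"
          have pos: "norm (X i - x0) > 0" using X(1) by simp
          have g0: "0 \<le> g z"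
          proof -
            have "0 \<le> g z * norm (X i - x0)" using bd[OF z x0, of "X i - x0"] norm_ge_zero order_trans by blast
            with pos show ?thesis by (simp add: zero_le_mult_iff)
          qed
          show "norm (Q i z) \<le> 2 * g z"
          proof (cases "X i \<in> ball x0 e")
            case True
            have "norm (f (X i) z - f x0 z - f' x0 z (X i - x0)) \<le> 2 * g z * norm (X i - x0)"
              using norm_triangle_ineq4[of "f (X i) z - f x0 z" "f' x0 z (X i - x0)"]
                lip[OF z True] bd[OF z x0, of "X i - x0"] by linarith
            then show ?thesis using pos True by (simp add: Q_def q_def divide_simps mult.commute)
          qed (use g0 in \<open>simp add: Q_def\<close>)
        qed
        have "q y \<in> borel_measurable N" for y unfolding q_def using meas meas' by auto
        then show "Q i \<in> borel_measurable N" for i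
          by (cases "X i \<in> ball x0 e") (simp_all add: Q_def[abs_def])
      qed (use g in auto)
      have eq: "(LINT z|N. Q i z) = ((LINT z|N. f (X i) z) - (LINT z|N. f x0 z) - (LINT z|N. f' x0 z (X i - x0))) /\<^sub>R norm (X i - x0)"
        if "X i \<in> ball x0 e" for i
      proof -
        have "(LINT z|N. Q i z) = (LINT z|N. q (X i) z)" using that by (simp add: Q_def)
        then show ?thesis unfolding q_def using intf[OF that] int0 intf' by simp
      qed
      show "((\<lambda>y. ((LINT z|N. f y z) - (LINT z|N. f x0 z) - (LINT z|N. f' x0 z (y - x0))) /\<^sub>R norm (y - x0)) \<circ> X) \<longlonglongrightarrow> 0"
        unfolding comp_def
        by (rule Lim_transform_eventually[OF lim[unfolded integral_zero] eventually_mono[OF Xe eq]])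
    qed
  qed
qed

subsection \<open>The standard Gaussian measure\<close>

text \<open>The reference measure: the law at time \<open>t\<close> is its image under scaling by
  \<open>sqrt t\<close> and translation by \<open>x0\<close>, so the measure itself never depends on
  time.\<close>

definition gauss :: "(real^'n::finite) measure" where
  "gauss = density lborel (\<lambda>x. ennreal (gauss_density 0 1 x))"

lemma gauss_density_measurable [measurable]: "gauss_density m t \<in> borel_measurable borel"
  unfolding gauss_density_def[abs_def] by measurable

lemma gauss_density_nonneg [simp]: "0 \<le> gauss_density m t x"
  by (simp add: gauss_density_def)

lemma gauss_density_pos: "t > 0 ==> 0 < gauss_density m t x"
  by (simp add: gauss_density_def)

lemma space_gauss [simp]: "space gauss = UNIV"
  by (simp add: gauss_def)

lemma sets_gauss [simp, measurable_cong]: "sets gauss = sets borel"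
  by (simp add: gauss_def)

text \<open>The factorisation over coordinates reduces total mass and second moments to the known
  one-dimensional integrals.\<close>

lemma gauss_density_prod:
  "gauss_density 0 1 (x::real^'n::finite) = (\<Prod>b\<in>Basis. std_normal_density (x \<bullet> b))"
proof -
  have "(\<Prod>b\<in>(Basis::(real^'n) set). std_normal_density (x \<bullet> b))
      = (1 / sqrt (2 * pi)) ^ CARD('n) * exp (\<Sum>b\<in>Basis. - (x \<bullet> b)\<^sup>2 / 2)"
    by (simp add: std_normal_density_def prod.distrib exp_sum prod_dividef power_divide)
  also have "(\<Sum>b\<in>Basis. - (x \<bullet> b)\<^sup>2 / 2) = - (norm x)\<^sup>2 / 2"
    by (simp add: norm_eq_sqrt_inner euclidean_inner[of x x] sum_nonneg power2_eq_square
        sum_negf sum_divide_distrib)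
  also have "(1 / sqrt (2 * pi)) ^ CARD('n) = (2 * pi) powr (- real CARD('n) / 2)"
    by (simp add: powr_half_sqrt[symmetric] powr_minus_divide[symmetric] powr_realpow[symmetric] powr_powr)
  finally show ?thesis by (simp add: gauss_density_def)
qed

lemma prob_space_gauss: "prob_space (gauss :: (real^'n::finite) measure)"
proof
  have "(\<integral>\<^sup>+x. ennreal (gauss_density 0 1 x) \<partial>(lborel :: (real^'n) measure))
      = (\<integral>\<^sup>+x. (\<Prod>b\<in>Basis. ennreal (std_normal_density (x \<bullet> b))) \<partial>(lborel :: (real^'n) measure))"
    by (simp add: gauss_density_prod prod_ennreal)
  also have "\<dots> = (\<Prod>b\<in>(Basis :: (real^'n) set). \<integral>\<^sup>+x. ennreal (std_normal_density x) \<partial>lborel)"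
    by (rule nn_integral_lborel_prod) auto
  also have "\<dots> = 1"
    by (simp add: nn_integral_eq_integral)
  finally show "emeasure (gauss :: (real^'n) measure) (space gauss) = 1"
    by (simp add: gauss_def emeasure_density)
qed

interpretation gauss: prob_space "gauss :: (real^'n::finite) measure"
  by (rule prob_space_gauss)

lemma integrable_gauss_component_power2:
  "integrable (gauss :: (real^'n::finite) measure) (\<lambda>z. (z \<bullet> b)\<^sup>2)" if b: "b \<in> Basis"
proof (rule integrableI_bounded)
  let ?f = "\<lambda>c x. ennreal (std_normal_density x) * (if c = b then ennreal (x\<^sup>2) else 1)"
  have "(\<integral>\<^sup>+z. ennreal (norm ((z \<bullet> b)\<^sup>2)) \<partial>(gauss :: (real^'n) measure))
      = (\<integral>\<^sup>+z. (\<Prod>c\<in>Basis. ?f c (z \<bullet> c)) \<partial>(lborel :: (real^'n) measure))"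
    unfolding gauss_def using b
    by (subst nn_integral_density)
      (auto simp: gauss_density_prod prod_ennreal prod.distrib prod.delta' intro!: nn_integral_cong)
  also have "\<dots> = (\<Prod>c\<in>(Basis :: (real^'n) set). \<integral>\<^sup>+x. ?f c x \<partial>lborel)"
    by (rule nn_integral_lborel_prod) auto
  also have "\<dots> < \<infinity>"
  proof -
    have "(\<integral>\<^sup>+x. ?f c x \<partial>lborel) < \<infinity>" for c
    proof (cases "c = b")
      case True
      have "(\<integral>\<^sup>+x. ?f c x \<partial>lborel) = (\<integral>\<^sup>+x. ennreal (std_normal_density x * x^2) \<partial>lborel)"
        using True by (simp add: ennreal_mult)
      also have "\<dots> < \<infinity>"
        using integrable_std_normal_moment[of 2]
        by (subst nn_integral_eq_integral) auto
      finally show ?thesis .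
    next
      case False
      then show ?thesis by (simp add: nn_integral_eq_integral)
    qed
    then show ?thesis
      by (intro finite_induct[OF finite_Basis, where P="\<lambda>A. (\<Prod>c\<in>A. \<integral>\<^sup>+x. ?f c x \<partial>lborel) < \<infinity>"])
        (simp_all add: ennreal_mult_less_top del: if_split)
  qed
  finally show "(\<integral>\<^sup>+z. ennreal (norm ((z \<bullet> b)\<^sup>2)) \<partial>(gauss :: (real^'n) measure)) < \<infinity>" .
qed simp

lemma integrable_gauss_norm_power2:
  "integrable (gauss :: (real^'n::finite) measure) (\<lambda>z. (norm z)\<^sup>2)"
proof -
  have *: "(\<lambda>z::real^'n. (norm z)\<^sup>2) = (\<lambda>z. \<Sum>b\<in>Basis. (z \<bullet> b)\<^sup>2)"
  proof
    show "(norm z)\<^sup>2 = (\<Sum>b\<in>Basis. (z \<bullet> b)\<^sup>2)" for z :: "real^'n"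
      using euclidean_inner[of z z] unfolding power2_norm_eq_inner by (simp add: power2_eq_square)
  qed
  show ?thesis unfolding * by (intro Bochner_Integration.integrable_sum integrable_gauss_component_power2)
qed

lemma integrable_gauss_growth2:
  "integrable (gauss :: (real^'n::finite) measure) (\<lambda>z. (1 + norm z)\<^sup>2)"
proof (rule Lintegrable_bound)
  show "integrable (gauss :: (real^'n) measure) (\<lambda>z. 2 + 2 * (norm z)\<^sup>2)"
    using integrable_gauss_norm_power2 by auto
  show "AE z::real^'n in gauss. norm ((1 + norm z)\<^sup>2) \<le> norm (2 + 2 * (norm z)\<^sup>2)"
  proof (rule AE_I2)
    fix z :: "real^'n"
    have "(1 + norm z)\<^sup>2 \<le> 2 + 2 * (norm z)\<^sup>2"
      using zero_le_power2[of "1 - norm z"] by (simp add: power2_sum power2_diff)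
    then show "norm ((1 + norm z)\<^sup>2) \<le> norm (2 + 2 * (norm z)\<^sup>2)" by (simp add: abs_of_nonneg)
  qed
qed simp

lemma integrable_gauss_quadratic:
  fixes f :: "real^'n::finite => real"
  assumes "f \<in> borel_measurable borel" "\<And>z. \<bar>f z\<bar> \<le> C * (1 + norm z)\<^sup>2"
  shows "integrable gauss f"
proof (rule Lintegrable_bound)
  show "integrable (gauss :: (real^'n) measure) (\<lambda>z. C * (1 + norm z)\<^sup>2)"
    using integrable_gauss_growth2 by auto
  show "AE z in gauss. norm (f z) \<le> norm (C * (1 + norm z)\<^sup>2)"
    using assms(2) by (auto intro!: AE_I2 order_trans[OF _ abs_ge_self])
qed (use assms(1) in simp)

lemma integrable_gauss_linear:
  fixes f :: "real^'n::finite => real"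
  assumes f: "f \<in> borel_measurable borel" "\<And>z. \<bar>f z\<bar> \<le> C * (1 + norm z)"
  shows "integrable gauss f"
proof (rule integrable_gauss_quadratic[OF f(1), where C=C])
  fix z :: "real^'n"
  have C: "0 \<le> C"
    using f(2)[of 0] by (simp add: order_trans[OF abs_ge_zero])
  have "1 + norm z \<le> (1 + norm z)\<^sup>2" by (simp add: power2_eq_square algebra_simps)
  from order_trans[OF f(2)[of z] mult_left_mono[OF this C]]
  show "\<bar>f z\<bar> \<le> C * (1 + norm z)\<^sup>2" .
qed

lemma integrable_gauss_bounded:
  fixes f :: "real^'n::finite => real"
  assumes "f \<in> borel_measurable borel" "\<And>z. \<bar>f z\<bar> \<le> C"
  shows "integrable gauss f"
  using assms by (intro gauss.integrable_const_bound[where B=C]) auto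

lemma integrable_gauss_norm: "integrable (gauss :: (real^'n::finite) measure) norm"
  by (rule integrable_gauss_linear[where C=1]) auto

lemma gauss_integral:
  fixes f :: "real^'n::finite => real"
  assumes "f \<in> borel_measurable borel"
  shows "(LINT z|gauss. f z) = (LINT z|lborel. gauss_density 0 1 z * f z)"
    and "integrable gauss f \<longleftrightarrow> integrable lborel (\<lambda>z. gauss_density 0 1 z * f z)"
  unfolding gauss_def using assms
  by (subst integral_density integrable_density; simp)+

lemma DERIV_gauss_density:
  "((\<lambda>s. gauss_density 0 1 (z + s *\<^sub>R axis i 1 :: real^'n::finite)) has_real_derivative
     - (z $ i) * gauss_density 0 1 z) (at 0)"
proof -
  have *: "(norm (z + s *\<^sub>R axis i 1))\<^sup>2 = (norm z)\<^sup>2 + 2 * s * (z $ i) + s\<^sup>2" for s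
    unfolding power2_norm_eq_inner
    by (simp add: inner_add inner_axis inner_commute[of "axis i 1" z] power2_eq_square algebra_simps)
  show ?thesis unfolding gauss_density_def
    by (auto simp: * intro!: derivative_eq_intros)
qed

text \<open>Along the coordinate axis the product of the density with \<open>f\<close> has
  derivative density times \<open>f' z - z $ i * f z\<close>, and the integral of a directional
  derivative vanishes. Linear growth is allowed because the identity is later applied to functions
  of the form \<open>z $ j * f z\<close>.\<close>

lemma stein_identity:
  fixes f f' :: "real^'n::finite => real"
  assumes der: "\<And>z. ((\<lambda>s. f (z + s *\<^sub>R axis i 1)) has_real_derivative f' z) (at 0)"
    and cont: "continuous_on UNIV f" "continuous_on UNIV f'"
    and bd: "\<And>z. \<bar>f z\<bar> \<le> C * (1 + norm z)" "\<And>z. \<bar>f' z\<bar> \<le> C * (1 + norm z)"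
  shows "(LINT z|gauss. z $ i * f z) = (LINT z|gauss. f' z)"
    and "integrable gauss (\<lambda>z. z $ i * f z)"
proof -
  have [measurable]: "f \<in> borel_measurable borel" "f' \<in> borel_measurable borel"
    using cont by (auto intro: borel_measurable_continuous_onI)
  show i1: "integrable gauss (\<lambda>z. z $ i * f z)"
  proof (rule integrable_gauss_quadratic[where C=C])
    fix z
    have "\<bar>z $ i * f z\<bar> \<le> norm z * (C * (1 + norm z))"
      unfolding abs_mult by (intro mult_mono component_le_norm_cart bd) auto
    also have "\<dots> \<le> (1 + norm z) * (C * (1 + norm z))"
      using order_trans[OF abs_ge_zero bd(1)[of z]] by (intro mult_right_mono) auto
    finally show "\<bar>z $ i * f z\<bar> \<le> C * (1 + norm z)\<^sup>2" by (simp add: power2_eq_square ac_simps)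
  qed simp
  have i2: "integrable gauss f'" by (rule integrable_gauss_linear[OF _ bd(2)]) simp
  have i3: "integrable gauss f" by (rule integrable_gauss_linear[OF _ bd(1)]) simp
  have "(LINT z|lborel. gauss_density 0 1 z * (f' z - z $ i * f z)) = 0"
  proof (rule integral_directional_derivative_eq_0)
    show "((\<lambda>s. gauss_density 0 1 (z + s *\<^sub>R axis i 1) * f (z + s *\<^sub>R axis i 1)) has_real_derivative
        gauss_density 0 1 z * (f' z - z $ i * f z)) (at 0)" for z
      using DERIV_mult[OF DERIV_gauss_density[of z i] der[of z]] by (simp add: algebra_simps)
    show "continuous_on UNIV (\<lambda>z. gauss_density 0 1 z * (f' z - z $ i * f z))"
      unfolding gauss_density_def by (intro continuous_intros cont) auto
    show "integrable lborel (\<lambda>z. gauss_density 0 1 z * f z)"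
      using i3 gauss_integral(2)[of f] by simp
    show "integrable lborel (\<lambda>z. gauss_density 0 1 z * (f' z - z $ i * f z))"
      using Lintegrable_diff[OF i2 i1] gauss_integral(2)[of "\<lambda>z. f' z - z $ i * f z"] by simp
  qed
  then show "(LINT z|gauss. z $ i * f z) = (LINT z|gauss. f' z)"
    using i1 i2 gauss_integral(1)[of "\<lambda>z. f' z - z $ i * f z"] by simp
qed

text \<open>The Jacobian \<open>sqrt t ^ CARD('n)\<close> of the scaling cancels the power of
  \<open>t\<close> in the normalising constant.\<close>

lemma distr_gauss_affine:
  fixes x0 :: "real^'n::finite"
  assumes t: "t > 0"
  shows "distr gauss borel (\<lambda>z. x0 + sqrt t *\<^sub>R z) = density lborel (\<lambda>x. ennreal (gauss_density x0 t x))"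
proof -
  let ?c = "sqrt t" and ?T = "\<lambda>z. x0 + sqrt t *\<^sub>R z"
  have g: "?c ^ CARD('n) * gauss_density x0 t (?T z) = gauss_density 0 1 z" for z
  proof -
    have "(2 * pi * t) powr (- real CARD('n) / 2) = (2 * pi) powr (- real CARD('n) / 2) * t powr (- real CARD('n) / 2)"
      using t by (simp add: powr_mult)
    moreover have "?c ^ CARD('n) * t powr (- real CARD('n) / 2) = 1"
      using t by (simp add: powr_half_sqrt[symmetric] powr_realpow[symmetric] powr_powr powr_add[symmetric])
    moreover have "(norm (?T z - x0))\<^sup>2 / (2 * t) = (norm z)\<^sup>2 / 2"
      using t by (simp add: power_mult_distrib)
    ultimately show ?thesis unfolding gauss_density_def by (simp add: mult.assoc[symmetric])
  qed
  have "density lborel (\<lambda>x. ennreal (gauss_density x0 t x))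
     = density (density (distr lborel borel ?T) (\<lambda>_. ennreal (\<bar>?c\<bar> ^ DIM(real^'n)))) (\<lambda>x. ennreal (gauss_density x0 t x))"
    using t by (subst lborel_affine[of ?c x0]) auto
  also have "\<dots> = density (distr lborel borel ?T) (\<lambda>x. ennreal (?c ^ CARD('n) * gauss_density x0 t x))"
    using t by (subst density_density_eq) (auto simp: ennreal_mult)
  also have "\<dots> = distr (density lborel (\<lambda>z. ennreal (?c ^ CARD('n) * gauss_density x0 t (?T z)))) borel ?T"
    by (rule density_distr) auto
  also have "\<dots> = distr gauss borel ?T"
    unfolding g gauss_def ..
  finally show ?thesis ..
qed

lemma mu_eq_distr_gauss:
  assumes "brownian_motion M W" "t > 0"
  shows "mu M W x0 t = distr gauss borel (\<lambda>z. x0 + sqrt t *\<^sub>R z)"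
  unfolding mu_eq_density[OF assms] distr_gauss_affine[OF assms(2)] ..

lemma integral_mu:
  fixes f :: "real^'n::finite => 'b::{banach, second_countable_topology}" and W :: "real => 'w => real^'n"
  assumes "brownian_motion M W" "t > 0" "f \<in> borel_measurable borel"
  shows "(LINT x|mu M W x0 t. f x) = (LINT z|gauss. f (x0 + sqrt t *\<^sub>R z))"
    and "integrable (mu M W x0 t) f \<longleftrightarrow> integrable gauss (\<lambda>z. f (x0 + sqrt t *\<^sub>R z))"
  using assms by (simp_all add: mu_eq_distr_gauss integral_distr integrable_distr_eq)

lemma integral_brownian:
  fixes f :: "real^'n::finite => 'b::{banach, second_countable_topology}" and W :: "real => 'w => real^'n"
  assumes "brownian_motion M W" "t > 0" "f \<in> borel_measurable borel"
  shows "(LINT \<omega>|M. f (x0 + W t \<omega>)) = (LINT z|gauss. f (x0 + sqrt t *\<^sub>R z))"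
proof -
  have [measurable]: "W t \<in> borel_measurable M" using assms by (auto simp: brownian_motion_def)
  have "(LINT \<omega>|M. f (x0 + W t \<omega>)) = (LINT x|mu M W x0 t. f x)"
    unfolding mu_def using assms(3) by (subst integral_distr) auto
  then show ?thesis using integral_mu[OF assms] by simp
qed

lemma vec_variance_brownian:
  fixes f :: "real^'n::finite => 'b::euclidean_space"
  assumes "brownian_motion M W" "t > 0" "f \<in> borel_measurable borel"
  shows "vec_variance M (\<lambda>\<omega>. f (x0 + W t \<omega>)) = vec_variance gauss (\<lambda>z. f (x0 + sqrt t *\<^sub>R z))"
  unfolding vec_variance_def integral_brownian[OF assms]
  using assms(3) by (intro integral_brownian[OF assms(1,2)]) auto

lemma heat_eq_gauss:
  assumes "brownian_motion M W" "r > 0" "f \<in> borel_measurable borel"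
  shows "heat M W r f x = (LINT z|gauss. f (x + sqrt r *\<^sub>R z))"
  unfolding heat_def by (rule integral_brownian[OF assms])

text \<open>Chapman--Kolmogorov, read off from the independence of the increments.\<close>

lemma gauss_convolution:
  fixes f :: "real^'n::finite => ennreal" and W :: "real => 'w => real^'n"
  assumes bm: "brownian_motion M W" and st: "0 < s" "s < t"
    and [measurable]: "f \<in> borel_measurable borel"
  shows "(\<integral>\<^sup>+z. \<integral>\<^sup>+z'. f (x0 + sqrt s *\<^sub>R z + sqrt (t - s) *\<^sub>R z') \<partial>gauss \<partial>gauss)
    = (\<integral>\<^sup>+z. f (x0 + sqrt t *\<^sub>R z) \<partial>gauss)"
proof -
  interpret prob_space M using bm by (simp add: brownian_motion_def)
  have W[measurable]: "W r \<in> borel_measurable M" if "r \<ge> 0" for r using bm that by (simp add: brownian_motion_def)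
  note W[of 0, simplified, measurable] W[of s, measurable] W[of t, measurable]
  have [measurable]: "W s \<in> borel_measurable M" "W t \<in> borel_measurable M" "W 0 \<in> borel_measurable M"
    using st by (auto intro!: W)
  have inc: "distr M borel (\<lambda>\<omega>. W b \<omega> - W a \<omega>) = distr gauss borel (\<lambda>z. sqrt (b - a) *\<^sub>R z)"
    if ab: "0 \<le> a" "a < b" for a b
  proof -
    have "distributed M lborel (\<lambda>\<omega>. W b \<omega> - W a \<omega>) (\<lambda>x. ennreal (gauss_density 0 (b - a) x))"
      using bm ab by (simp add: brownian_motion_def)
    then have "distr M lborel (\<lambda>\<omega>. W b \<omega> - W a \<omega>) = density lborel (\<lambda>x. ennreal (gauss_density 0 (b - a) x))"
      by (simp add: distributed_def)
    moreover have "distr M lborel (\<lambda>\<omega>. W b \<omega> - W a \<omega>) = distr M borel (\<lambda>\<omega>. W b \<omega> - W a \<omega>)"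
      by (rule distr_cong) auto
    moreover have "distr gauss borel (\<lambda>z. 0 + sqrt (b - a) *\<^sub>R z)
        = density lborel (\<lambda>x. ennreal (gauss_density (0::real^'n) (b - a) x))"
      using ab by (intro distr_gauss_affine) simp
    ultimately show ?thesis by simp
  qed
  \<comment> \<open>The time grid 0, \<open>s\<close>, \<open>t\<close>, whose two increments are
    the independent variables of the convolution.\<close>
  define \<tau> where "\<tau> i = (if i = 0 then 0 else if i = 1 then s else t)" for i :: nat
  have "\<forall>i<2. \<tau> i < \<tau> (Suc i)" using st by (auto simp: \<tau>_def less_2_cases_iff)
  moreover have "0 \<le> \<tau> 0" by (simp add: \<tau>_def)
  moreover have "\<forall>(n::nat) \<tau>. 0 \<le> \<tau> 0 \<and> (\<forall>i<n. \<tau> i < \<tau> (Suc i)) \<longrightarrow>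
      indep_vars (\<lambda>_. borel) (\<lambda>i \<omega>. W (\<tau> (Suc i)) \<omega> - W (\<tau> i) \<omega>) {..<n}"
    using bm unfolding brownian_motion_def by (elim conjE)
  ultimately have ind: "indep_vars (\<lambda>_. borel) (\<lambda>i \<omega>. W (\<tau> (Suc i)) \<omega> - W (\<tau> i) \<omega>) {..<2}"
    by blast
  have "indep_var borel ((\<lambda>f. f 0) \<circ> (\<lambda>\<omega>. restrict (\<lambda>i. W (\<tau> (Suc i)) \<omega> - W (\<tau> i) \<omega>) {0}))
     borel ((\<lambda>f. f 1) \<circ> (\<lambda>\<omega>. restrict (\<lambda>i. W (\<tau> (Suc i)) \<omega> - W (\<tau> i) \<omega>) {1}))"
    by (rule indep_var_compose[OF indep_var_restrict[OF ind]]) auto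
  then have "indep_var borel (\<lambda>\<omega>. W s \<omega> - W 0 \<omega>) borel (\<lambda>\<omega>. W t \<omega> - W s \<omega>)"
    by (simp add: comp_def \<tau>_def)
  then have eq: "distr M borel (\<lambda>\<omega>. W s \<omega> - W 0 \<omega>) \<Otimes>\<^sub>M distr M borel (\<lambda>\<omega>. W t \<omega> - W s \<omega>)
     = distr M (borel \<Otimes>\<^sub>M borel) (\<lambda>\<omega>. (W s \<omega> - W 0 \<omega>, W t \<omega> - W s \<omega>))"
    by (simp add: indep_var_distribution_eq)
  interpret Y: prob_space "distr M borel (\<lambda>\<omega>. W t \<omega> - W s \<omega>)" by (rule prob_space_distr) simp
  \<comment> \<open>Increments from time 0 are used instead of the values of \<open>W\<close>,
    because \<open>W 0\<close> vanishes only almost everywhere.\<close>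
  have "(\<integral>\<^sup>+z. f (x0 + sqrt t *\<^sub>R z) \<partial>gauss) = (\<integral>\<^sup>+y. f (x0 + y) \<partial>distr M borel (\<lambda>\<omega>. W t \<omega> - W 0 \<omega>))"
    using inc[of 0 t] st by (simp add: nn_integral_distr)
  also have "\<dots> = (\<integral>\<^sup>+\<omega>. f (x0 + (W s \<omega> - W 0 \<omega>) + (W t \<omega> - W s \<omega>)) \<partial>M)"
    by (subst nn_integral_distr) (auto simp: algebra_simps)
  also have "\<dots> = (\<integral>\<^sup>+p. f (x0 + fst p + snd p) \<partial>distr M (borel \<Otimes>\<^sub>M borel) (\<lambda>\<omega>. (W s \<omega> - W 0 \<omega>, W t \<omega> - W s \<omega>)))"
    by (subst nn_integral_distr) auto
  also have "\<dots> = (\<integral>\<^sup>+x. \<integral>\<^sup>+y. f (x0 + x + y) \<partial>distr M borel (\<lambda>\<omega>. W t \<omega> - W s \<omega>) \<partial>distr M borel (\<lambda>\<omega>. W s \<omega> - W 0 \<omega>))"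
    unfolding eq[symmetric] by (subst Y.nn_integral_fst[symmetric]) auto
  also have "\<dots> = (\<integral>\<^sup>+z. \<integral>\<^sup>+z'. f (x0 + sqrt s *\<^sub>R z + sqrt (t - s) *\<^sub>R z') \<partial>gauss \<partial>gauss)"
    using inc[of 0 s] inc[of s t] st by (simp add: nn_integral_distr)
  finally show ?thesis ..
qed

text \<open>The heat equation in weak form: along \<open>x0 + sqrt t Z\<close> the time derivative of the scaling is
  turned into half the Laplacian by Stein's identity.\<close>

lemma heat_evolution:
  fixes u ut :: "real => real^'n::finite => real" and ux :: "real => real^'n => real^'n"
    and uxx :: "real => real^'n => 'n => real"
  assumes t: "0 \<le> a" "a < t" "t < b"
    and der: "\<And>s x. a < s ==> s < b ==>
        ((\<lambda>(s, x). u s x) has_derivative (\<lambda>(\<tau>, h). \<tau> * ut s x + h \<bullet> ux s x)) (at (s, x))"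
    and dxx: "\<And>s x i. a < s ==> s < b ==>
        ((\<lambda>r. ux s (x + r *\<^sub>R axis i 1) $ i) has_real_derivative uxx s x i) (at 0)"
    and bd: "\<And>s x. a < s ==> s < b ==> \<bar>u s x\<bar> \<le> C" "\<And>s x. a < s ==> s < b ==> \<bar>ut s x\<bar> \<le> C"
      "\<And>s x. a < s ==> s < b ==> norm (ux s x) \<le> C" "\<And>s x i. a < s ==> s < b ==> \<bar>uxx s x i\<bar> \<le> C"
    and cont: "\<And>s. continuous_on UNIV (u s)" "\<And>s. a < s ==> s < b ==> continuous_on UNIV (ut s)"
      "\<And>s. a < s ==> s < b ==> continuous_on UNIV (ux s)"
      "\<And>s i. a < s ==> s < b ==> continuous_on UNIV (\<lambda>x. uxx s x i)"
  shows "((\<lambda>s. LINT z|gauss. u s (x0 + sqrt s *\<^sub>R z)) has_real_derivative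
     (LINT z|gauss. ut t (x0 + sqrt t *\<^sub>R z) + (\<Sum>i\<in>UNIV. uxx t (x0 + sqrt t *\<^sub>R z) i) / 2)) (at t)"
proof -
  define y where "y s z = x0 + sqrt s *\<^sub>R z" for s and z :: "real^'n"
  have ycont: "continuous_on UNIV (y s)" for s unfolding y_def by (intro continuous_intros)
  have comp: "(\<lambda>z. f (y s z)) \<in> borel_measurable borel" if "continuous_on UNIV f" for f :: "real^'n => 'c::euclidean_space" and s
    using that ycont by (intro borel_measurable_continuous_onI continuous_on_compose2[OF that ycont]) auto
  \<comment> \<open>All times in the ball of radius \<open>e\<close> exceed \<open>c > 0\<close>, so
    the factor \<open>1 / (2 * sqrt s)\<close> from differentiating the scaling is bounded
    there.\<close>
  define c where "c = (a + t) / 2"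
  have c: "0 < c" "a < c" "c < t" using t by (auto simp: c_def)
  define e where "e = min (t - c) (b - t)"
  have e: "e > 0" using c t by (auto simp: e_def)
  have ball: "c < s" "a < s" "s < b" "0 < s" if "s \<in> ball t e" for s
    using that c t unfolding e_def mem_ball dist_real_def by linarith+
  let ?f' = "\<lambda>s z h. h * ut s (y s z) + (h / (2 * sqrt s)) * (z \<bullet> ux s (y s z))"
  have C: "0 \<le> C" using order_trans[OF abs_ge_zero bd(1)[of t x0]] t by simp
  have D: "((\<lambda>s. LINT z|gauss. u s (y s z)) has_derivative (\<lambda>h. LINT z|gauss. ?f' t z h)) (at t)"
  proof (rule has_derivative_integral_dominated[OF e, where g="\<lambda>z. C + C * norm z / (2 * sqrt c)"])
    show "(\<lambda>z. u s (y s z)) \<in> borel_measurable gauss" for s using comp[OF cont(1)] by simp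
    show "integrable gauss (\<lambda>z. u t (y t z))"
      by (rule integrable_gauss_bounded[OF comp[OF cont(1)]]) (use bd(1) t in auto)
    show "integrable gauss (\<lambda>z::real^'n. C + C * norm z / (2 * sqrt c))"
      by (intro Lintegrable_add integrable_divide integrable_mult_right integrable_gauss_norm) auto
    show "(\<lambda>z. ?f' t z h) \<in> borel_measurable gauss" for h
      using comp[OF cont(2)[of t]] comp[OF cont(3)[of t]] t by auto
    fix z :: "real^'n" and s assume s: "s \<in> ball t e"
    note s' = ball[OF s]
    have "((\<lambda>s. (s, y s z)) has_derivative (\<lambda>h. (h, (h / (2 * sqrt s)) *\<^sub>R z))) (at s)"
    proof -
      have "(sqrt has_derivative (\<lambda>h. h / (2 * sqrt s))) (at s)"
        using DERIV_real_sqrt[of s] s' unfolding has_field_derivative_def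
        by (rule_tac has_derivative_eq_rhs) (auto simp: fun_eq_iff field_simps)
      then have "(y' has_derivative (\<lambda>h. 0 + (h / (2 * sqrt s)) *\<^sub>R z)) (at s)"
        if "y' = (\<lambda>s. x0 + sqrt s *\<^sub>R z)" for y'
        unfolding that by (intro has_derivative_add has_derivative_const has_derivative_scaleR_left)
      from has_derivative_Pair[OF has_derivative_ident this[OF refl]] show ?thesis by (simp add: y_def)
    qed
    from has_derivative_compose[OF this der[of s "y s z"]] s'
    have "((\<lambda>s. u s (y s z)) has_derivative (\<lambda>h. h * ut s (y s z) + ((h / (2 * sqrt s)) *\<^sub>R z) \<bullet> ux s (y s z))) (at s)"
      by simp
    then show "((\<lambda>s. u s (y s z)) has_derivative (\<lambda>h. ?f' s z h)) (at s)" by simp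
    fix h :: real
    have "norm (?f' s z h) \<le> \<bar>h\<bar> * \<bar>ut s (y s z)\<bar> + \<bar>h\<bar> / (2 * sqrt s) * \<bar>z \<bullet> ux s (y s z)\<bar>"
      using abs_triangle_ineq[of "h * ut s (y s z)" "(h / (2 * sqrt s)) * (z \<bullet> ux s (y s z))"] s'
      by (simp add: abs_mult)
    also have "\<dots> \<le> \<bar>h\<bar> * C + \<bar>h\<bar> / (2 * sqrt c) * (norm z * C)"
    proof (intro add_mono mult_mono divide_left_mono)
      show "\<bar>z \<bullet> ux s (y s z)\<bar> \<le> norm z * C"
        by (rule order_trans[OF Cauchy_Schwarz_ineq2 mult_left_mono]) (use bd(3) s' in auto)
    qed (use s' c bd(2) C in auto)
    finally show "norm (?f' s z h) \<le> (C + C * norm z / (2 * sqrt c)) * norm h"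
      by (simp add: algebra_simps)
  qed
  \<comment> \<open>Each component of the gradient, viewed as a function of \<open>z\<close>,
    carries an inner derivative \<open>sqrt t\<close>. It cancels the root in
    \<open>h / (2 * sqrt t)\<close> and leaves exactly half the Laplacian.\<close>
  have stein: "(LINT z|gauss. z $ i * ux t (y t z) $ i) = (LINT z|gauss. sqrt t * uxx t (y t z) i)"
    "integrable gauss (\<lambda>z. z $ i * ux t (y t z) $ i)" for i
  proof -
    have 1: "((\<lambda>s. ux t (y t (z + s *\<^sub>R axis i 1)) $ i) has_real_derivative sqrt t * uxx t (y t z) i) (at 0)" for z
    proof -
      have "((\<lambda>r. ux t (y t z + r *\<^sub>R axis i 1) $ i) has_real_derivative uxx t (y t z) i) (at (sqrt t * 0))"
        using dxx[of t "y t z" i] t by simp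
      moreover have "((\<lambda>s. sqrt t * s) has_real_derivative sqrt t) (at 0)"
        by (auto intro!: derivative_eq_intros)
      ultimately have "((\<lambda>s. ux t (y t z + (sqrt t * s) *\<^sub>R axis i 1) $ i) has_real_derivative uxx t (y t z) i * sqrt t) (at 0)"
        by (rule DERIV_chain2)
      then show ?thesis by (simp add: y_def algebra_simps)
    qed
    have 2: "continuous_on UNIV (\<lambda>z. ux t (y t z) $ i)"
      using continuous_on_compose2[OF cont(3) ycont] t by (auto intro!: continuous_intros)
    have 3: "continuous_on UNIV (\<lambda>z. sqrt t * uxx t (y t z) i)"
      using continuous_on_compose2[OF cont(4)[of t i] ycont] t by (auto intro!: continuous_intros)
    have 4: "\<bar>ux t (y t z) $ i\<bar> \<le> (C + sqrt t * C) * (1 + norm z)" for z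
    proof -
      have "\<bar>ux t (y t z) $ i\<bar> \<le> C * 1"
        using order_trans[OF component_le_norm_cart bd(3)[of t]] t by simp
      also have "\<dots> \<le> (C + sqrt t * C) * (1 + norm z)" using C t by (intro mult_mono) auto
      finally show ?thesis .
    qed
    have 5: "\<bar>sqrt t * uxx t (y t z) i\<bar> \<le> (C + sqrt t * C) * (1 + norm z)" for z
    proof -
      have "\<bar>sqrt t * uxx t (y t z) i\<bar> \<le> sqrt t * C * 1"
        using bd(4)[of t "y t z" i] t by (simp add: abs_mult)
      also have "\<dots> \<le> (C + sqrt t * C) * (1 + norm z)" using C t by (intro mult_mono) auto
      finally show ?thesis .
    qed
    show "(LINT z|gauss. z $ i * ux t (y t z) $ i) = (LINT z|gauss. sqrt t * uxx t (y t z) i)"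
      "integrable gauss (\<lambda>z. z $ i * ux t (y t z) $ i)"
      by (rule stein_identity[OF 1 2 3 4 5])+
  qed
  have iut: "integrable gauss (\<lambda>z. ut t (y t z))"
    by (rule integrable_gauss_bounded[OF comp[OF cont(2)]]) (use bd(2) t in auto)
  have iuxx: "integrable gauss (\<lambda>z. uxx t (y t z) i)" for i
    by (rule integrable_gauss_bounded[OF comp[OF cont(4)]]) (use bd(4) t in auto)
  have "(LINT z|gauss. ?f' t z h) = h * (LINT z|gauss. ut t (y t z) + (\<Sum>i\<in>UNIV. uxx t (y t z) i) / 2)" for h
  proof -
    have "(LINT z|gauss. ?f' t z h)
       = (LINT z|gauss. h * ut t (y t z) + (h / (2 * sqrt t)) * (\<Sum>i\<in>UNIV. z $ i * ux t (y t z) $ i))"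
      by (simp add: inner_vec_def)
    also have "\<dots> = h * (LINT z|gauss. ut t (y t z)) + (h / (2 * sqrt t)) * (\<Sum>i\<in>UNIV. LINT z|gauss. sqrt t * uxx t (y t z) i)"
      using iut stein by simp
    also have "\<dots> = h * (LINT z|gauss. ut t (y t z)) + h / 2 * (\<Sum>i\<in>UNIV. LINT z|gauss. uxx t (y t z) i)"
      using t by (simp add: sum_distrib_left[symmetric])
    also have "\<dots> = h * (LINT z|gauss. ut t (y t z) + (\<Sum>i\<in>UNIV. uxx t (y t z) i) / 2)"
      using iut iuxx by (simp add: algebra_simps)
    finally show ?thesis .
  qed
  with D show ?thesis
    by (simp add: has_field_derivative_def y_def mult.commute[of _ "integral\<^sup>L _ _"])
qed

subsection \<open>The mild solution map on smooth data\<close>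

lemma continuous_on_integral_bounded:
  fixes f :: "'a::metric_space => 'z => real"
  assumes "finite_measure N"
    and c: "\<And>z. z \<in> space N ==> continuous_on S (\<lambda>x. f x z)"
    and m: "\<And>x. f x \<in> borel_measurable N"
    and b: "\<And>x z. \<bar>f x z\<bar> \<le> C"
  shows "continuous_on S (\<lambda>x. LINT z|N. f x z)"
  unfolding continuous_on_sequentially
proof (intro allI ballI impI)
  interpret finite_measure N by fact
  fix X x assume x: "x \<in> S" and X: "(\<forall>n. X n \<in> S) \<and> X \<longlonglongrightarrow> x"
  have "(\<lambda>n. LINT z|N. f (X n) z) \<longlonglongrightarrow> (LINT z|N. f x z)"
  proof (rule integral_dominated_convergence[where w="\<lambda>_. C"])
    show "AE z in N. (\<lambda>n. f (X n) z) \<longlonglongrightarrow> f x z"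
    proof (rule AE_I2)
      fix z assume "z \<in> space N"
      from c[OF this] x X show "(\<lambda>n. f (X n) z) \<longlonglongrightarrow> f x z"
        unfolding continuous_on_sequentially by (auto simp: comp_def)
    qed
  qed (use m b in auto)
  then show "((\<lambda>x. LINT z|N. f x z) \<circ> X) \<longlonglongrightarrow> (LINT z|N. f x z)" by (simp add: comp_def)
qed

lemma dir_deriv_sum_scaleR:
  fixes f :: "'a::euclidean_space => real"
  assumes "smooth f" "finite I"
  shows "dir_deriv (\<Sum>i\<in>I. c i *\<^sub>R v i) f x = (\<Sum>i\<in>I. c i * dir_deriv (v i) f x)"
  using linear_sum[OF dir_deriv_linear[OF assms(1)], of "\<lambda>i. c i *\<^sub>R v i" I]
  by (simp add: linear_cmul[OF dir_deriv_linear[OF assms(1)]])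

lemma dir_deriv_vec:
  fixes f :: "real^'n::finite => real"
  assumes "smooth f" shows "dir_deriv h f x = (\<Sum>i\<in>UNIV. h $ i * partial i f x)"
proof -
  have "h = (\<Sum>i\<in>UNIV. h $ i *\<^sub>R axis i 1)" using basis_expansion[of h] by (simp add: scalar_mult_eq_scaleR)
  then show ?thesis
    using dir_deriv_sum_scaleR[OF assms, of UNIV "\<lambda>i. h $ i" "\<lambda>i. axis i 1" x]
    by (simp add: partial_eq)
qed

lemma dir_deriv_space_vec:
  fixes F :: "real \<times> (real^'n::finite) => real"
  assumes "smooth F" shows "dir_deriv (0, h) F z = (\<Sum>i\<in>UNIV. h $ i * dx i F z)"
proof -
  have "(0::real, h) = (\<Sum>i\<in>UNIV. h $ i *\<^sub>R (0, axis i 1))"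
    using basis_expansion[of h] by (simp add: scalar_mult_eq_scaleR sum_prod)
  then show ?thesis
    using dir_deriv_sum_scaleR[OF assms, of UNIV "\<lambda>i. h $ i" "\<lambda>i. (0, axis i 1)" z]
    by (simp add: dx_eq)
qed

lemma dir_deriv_time_space:
  fixes F :: "real \<times> (real^'n::finite) => real"
  assumes "smooth F"
  shows "dir_deriv (\<tau>, h) F z = \<tau> * dir_deriv (1, 0) F z + (\<Sum>i\<in>UNIV. h $ i * dx i F z)"
proof -
  have "(\<tau>, h) = \<tau> *\<^sub>R (1, 0) + (0, h)" by simp
  then show ?thesis
    by (metis dir_deriv_space_vec[OF assms] linear_add[OF dir_deriv_linear[OF assms]]
        linear_cmul[OF dir_deriv_linear[OF assms]] real_scaleR_def)
qed

text \<open>Expanding the direction in the finite basis turns the separate bounds into one that is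
  uniform in the point and linear in the direction, as domination of the Frechet derivative
  requires.\<close>

lemma bsmooth_derivative_bound:
  fixes f :: "'a::euclidean_space => real"
  assumes f: "bsmooth f" shows "\<exists>C\<ge>0. \<forall>v x. \<bar>dir_deriv v f x\<bar> \<le> C * norm v"
proof -
  obtain c where c: "\<And>b x. \<bar>dir_deriv b f x\<bar> \<le> c b"
    using bsmooth_bounded[OF bsmooth_dir_deriv[OF f]] by metis
  have "\<bar>dir_deriv v f x\<bar> \<le> (\<Sum>b\<in>Basis. c b) * norm v" for v x
  proof -
    have "dir_deriv v f x = (\<Sum>b\<in>Basis. (v \<bullet> b) * dir_deriv b f x)"
      using dir_deriv_sum_scaleR[OF bsmoothD[OF f], of Basis "\<lambda>b. v \<bullet> b" "\<lambda>b. b" x]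
      by (simp add: euclidean_representation)
    also have "\<bar>\<dots>\<bar> \<le> (\<Sum>b\<in>Basis. \<bar>(v \<bullet> b) * dir_deriv b f x\<bar>)" by (rule sum_abs)
    also have "\<dots> \<le> (\<Sum>b\<in>Basis. norm v * c b)"
      unfolding abs_mult by (intro sum_mono mult_mono Basis_le_norm c) auto
    finally show ?thesis by (simp add: sum_distrib_left mult.commute)
  qed
  moreover have "0 \<le> c b" for b using order_trans[OF abs_ge_zero c[of b]] .
  ultimately show ?thesis by (intro exI[of _ "\<Sum>b\<in>Basis. c b"]) (auto intro: sum_nonneg)
qed

lemma bsmooth_partial: "bsmooth f ==> bsmooth (partial i f)"
  by (simp add: partial_eq bsmooth_dir_deriv)

lemma bsmooth_spatial_partial: "bsmooth f ==> bsmooth (dx i f)"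
  by (simp add: dx_eq bsmooth_dir_deriv)

lemma testfun_partial: "test_function D f ==> test_function D (partial i f)"
  by (simp add: partial_eq testfun_dir_deriv)

lemma testfun_spatial_partial: "test_function D f ==> test_function D (dx i f)"
  by (simp add: dx_eq testfun_dir_deriv)

lemma smooth_compose_cont:
  "smooth f ==> continuous_on S g ==> continuous_on S (\<lambda>x. f (g x))"
  using continuous_on_compose2[OF smooth_continuous_on[of f UNIV]] by auto

section \<open>The mild solution as an integral against a fixed measure\<close>

definition time_gauss :: "real => (real \<times> (real^'n::finite)) measure" where
  "time_gauss T = Leb T \<Otimes>\<^sub>M gauss"

definition heat_terminal :: "real => (real^'n::finite => real) => real => real^'n => real" where
  "heat_terminal T \<eta> t x = (LINT z|gauss. \<eta> (x + sqrt (T - t) *\<^sub>R z))"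

text \<open>The source integral in the time-to-go variable \<open>fst p\<close>. For
  \<open>F\<close> supported in the cylinder the integrand vanishes once
  \<open>t + fst p \<ge> T\<close>, so the range can be the fixed interval from 0 to
  \<open>T\<close> and \<open>(t, x)\<close> enters only as a translation.\<close>

definition heat_source :: "real => (real \<times> (real^'n::finite) => real) => real => real^'n => real" where
  "heat_source T F t x = (LINT p|time_gauss T. F ((t, x) + (fst p, sqrt (fst p) *\<^sub>R snd p)))"

definition mild :: "real => (real \<times> (real^'n::finite) => real) => (real^'n => real) => real => real^'n => real" where
  "mild T F \<eta> t x = heat_terminal T \<eta> t x + heat_source T F t x"

abbreviation (input) "Mild T F \<eta> \<equiv> \<lambda>q. mild T F \<eta> (fst q) (snd q)"

lemma finite_measure_Icc: "finite_measure (restrict_space lborel {0..T::real})"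
  by (intro finite_measureI) (simp add: emeasure_restrict_space space_restrict_space emeasure_lborel_Icc_eq)

lemma finite_measure_time_gauss: "finite_measure (time_gauss T :: (real \<times> (real^'n::finite)) measure)"
  unfolding time_gauss_def
  using finite_measure_pair_measure[OF gauss.finite_measure_axioms finite_measure_Icc] .

lemma time_gauss_measurable:
  "f \<in> borel_measurable borel ==> f \<in> borel_measurable (time_gauss T)"
proof -
  have "(\<lambda>p. p) \<in> time_gauss T \<rightarrow>\<^sub>M (borel :: (real \<times> (real^'n::finite)) measure)"
    unfolding time_gauss_def borel_prod[symmetric]
    by (intro measurable_Pair[of fst _ _ snd, simplified])
      (auto intro: measurable_compose[OF measurable_fst measurable_restrict_space1]
        measurable_compose[OF measurable_snd])
  from measurable_compose[OF this] show "f \<in> borel_measurable borel ==> f \<in> borel_measurable (time_gauss T)" .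
qed

lemma measure_time_gauss:
  assumes "T \<ge> 0" shows "measure (time_gauss T :: (real \<times> (real^'n::finite)) measure) (space (time_gauss T)) = T"
proof -
  interpret I: finite_measure "Leb T" by (rule finite_measure_Icc)
  have "emeasure (time_gauss T :: (real \<times> (real^'n)) measure) (space (time_gauss T))
      = emeasure (Leb T) {0..T} * emeasure (gauss :: (real^'n) measure) UNIV"
    unfolding time_gauss_def space_pair_measure
    by (subst gauss.emeasure_pair_measure_Times[symmetric]) (auto simp: space_restrict_space sets_restrict_space)
  also have "\<dots> = ennreal T"
    using assms gauss.emeasure_space_1[where 'n='n] by (simp add: emeasure_restrict_space)
  finally show ?thesis using assms by (simp add: measure_def)
qed

lemma integrable_time_gauss_bounded:
  fixes f :: "real \<times> (real^'n::finite) => real"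
  assumes "f \<in> borel_measurable borel" "\<And>z. \<bar>f z\<bar> \<le> C"
  shows "integrable (time_gauss T) f"
proof -
  interpret finite_measure "time_gauss T :: (real \<times> (real^'n)) measure" by (rule finite_measure_time_gauss)
  show ?thesis by (rule integrable_const_bound[where B=C]) (use assms time_gauss_measurable in auto)
qed

lemma heat_source_shift_measurable:
  fixes F :: "real \<times> (real^'n::finite) => real"
  assumes "smooth F" shows "(\<lambda>p. F ((t, x) + (fst p, sqrt (fst p) *\<^sub>R snd p))) \<in> borel_measurable borel"
  by (intro borel_measurable_continuous_onI smooth_compose_cont[OF assms] continuous_intros)

lemma heat_terminal_shift_measurable:
  fixes f :: "real^'n::finite => real"
  assumes "smooth f" shows "(\<lambda>z. f (x + c *\<^sub>R z)) \<in> borel_measurable borel"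
  by (intro borel_measurable_continuous_onI smooth_compose_cont[OF assms] continuous_intros)

lemma integrable_heat_source:
  fixes F :: "real \<times> (real^'n::finite) => real"
  assumes "bsmooth F" shows "integrable (time_gauss T) (\<lambda>p. F ((t, x) + (fst p, sqrt (fst p) *\<^sub>R snd p)))"
proof -
  obtain C where "\<And>z. \<bar>F z\<bar> \<le> C" using bsmooth_bounded[OF assms] by blast
  then show ?thesis
    by (intro integrable_time_gauss_bounded heat_source_shift_measurable bsmoothD assms)
qed

lemma integrable_heat_terminal:
  fixes f :: "real^'n::finite => real"
  assumes "bsmooth f" shows "integrable gauss (\<lambda>z. f (x + c *\<^sub>R z))"
proof -
  obtain C where "\<And>z. \<bar>f z\<bar> \<le> C" using bsmooth_bounded[OF assms] by blast
  then show ?thesis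
    by (intro integrable_gauss_bounded heat_terminal_shift_measurable bsmoothD assms)
qed

lemma heat_source_linear:
  assumes "bsmooth F" "bsmooth G"
  shows "heat_source T (\<lambda>z. F z + G z) t x = heat_source T F t x + heat_source T G t x"
    and "heat_source T (\<lambda>z. F z - G z) t x = heat_source T F t x - heat_source T G t x"
    and "heat_source T (\<lambda>z. c * F z) t x = c * heat_source T F t x"
  unfolding heat_source_def
  using integrable_heat_source[OF assms(1)] integrable_heat_source[OF assms(2)] by simp_all

lemma heat_terminal_linear:
  assumes "bsmooth f" "bsmooth g"
  shows "heat_terminal T (\<lambda>z. f z + g z) t x = heat_terminal T f t x + heat_terminal T g t x"
    and "heat_terminal T (\<lambda>z. f z - g z) t x = heat_terminal T f t x - heat_terminal T g t x"
    and "heat_terminal T (\<lambda>z. c * f z) t x = c * heat_terminal T f t x"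
  unfolding heat_terminal_def
  using integrable_heat_terminal[OF assms(1)] integrable_heat_terminal[OF assms(2)] by simp_all

lemma mild_diff:
  assumes "bsmooth F" "bsmooth G" "bsmooth f" "bsmooth g"
  shows "mild T (\<lambda>z. F z - G z) (\<lambda>z. f z - g z) t x = mild T F f t x - mild T G g t x"
  unfolding mild_def heat_source_linear(2)[OF assms(1,2)] heat_terminal_linear(2)[OF assms(3,4)] by simp

text \<open>Since \<open>(t, x)\<close> is added to the argument of \<open>F\<close>, the joint
  derivative in time and space is the same integral with \<open>F\<close> replaced by its
  derivative.\<close>

lemma heat_source_has_derivative:
  fixes F :: "real \<times> (real^'n::finite) => real"
  assumes F: "bsmooth F"
  shows "((\<lambda>(t, x). heat_source T F t x) has_derivative
     (\<lambda>v. heat_source T (dir_deriv v F) t x)) (at (t, x))"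
proof -
  let ?a = "\<lambda>p::real \<times> (real^'n). (fst p, sqrt (fst p) *\<^sub>R snd p)"
  obtain C where C: "\<And>v x. \<bar>dir_deriv v F x\<bar> \<le> C * norm v" using bsmooth_derivative_bound[OF F] by blast
  have "((\<lambda>q. LINT p|time_gauss T. F (q + ?a p)) has_derivative
      (\<lambda>v. LINT p|time_gauss T. dir_deriv v F ((t, x) + ?a p))) (at (t, x))"
  proof (rule has_derivative_integral_dominated[where e=1 and g="\<lambda>_. C" and f'="\<lambda>q p v. dir_deriv v F (q + ?a p)"])
    show "integrable (time_gauss T :: (real \<times> (real^'n)) measure) (\<lambda>_. C)"
      using finite_measure.integrable_const[OF finite_measure_time_gauss] .
    show "(\<lambda>p. F (q + ?a p)) \<in> borel_measurable (time_gauss T)" for q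
      using heat_source_shift_measurable[OF bsmoothD[OF F], of "fst q" "snd q"]
      by (intro time_gauss_measurable) simp
    show "(\<lambda>p. dir_deriv v F ((t, x) + ?a p)) \<in> borel_measurable (time_gauss T)" for v
      by (intro time_gauss_measurable heat_source_shift_measurable smooth_dir_deriv bsmoothD F)
    show "((\<lambda>q. F (q + ?a p)) has_derivative (\<lambda>v. dir_deriv v F (q + ?a p))) (at q)" for p q
    proof -
      have "((\<lambda>q. q + ?a p) has_derivative (\<lambda>v. v)) (at q)" by (auto intro!: derivative_eq_intros)
      from has_derivative_compose[OF this smooth_has_derivative[OF bsmoothD[OF F]]] show ?thesis .
    qed
  qed (use C integrable_heat_source[OF F] in auto)
  then show ?thesis unfolding heat_source_def case_prod_beta' prod.collapse .
qed

lemma heat_terminal_has_derivative_space: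
  fixes f :: "real^'n::finite => real"
  assumes f: "bsmooth f"
  shows "((\<lambda>x. heat_terminal T f t x) has_derivative (\<lambda>h. heat_terminal T (dir_deriv h f) t x)) (at x)"
proof -
  let ?a = "\<lambda>z::real^'n. sqrt (T - t) *\<^sub>R z"
  obtain C where C: "\<And>v x. \<bar>dir_deriv v f x\<bar> \<le> C * norm v" using bsmooth_derivative_bound[OF f] by blast
  have "((\<lambda>q. LINT z|gauss. f (q + ?a z)) has_derivative (\<lambda>v. LINT z|gauss. dir_deriv v f (x + ?a z))) (at x)"
  proof (rule has_derivative_integral_dominated[where e=1 and g="\<lambda>_. C" and f'="\<lambda>q z v. dir_deriv v f (q + ?a z)"])
    show "(\<lambda>z. f (q + ?a z)) \<in> borel_measurable gauss" for q
      using heat_terminal_shift_measurable[OF bsmoothD[OF f]] by simp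
    show "(\<lambda>z. dir_deriv v f (x + ?a z)) \<in> borel_measurable gauss" for v
      using heat_terminal_shift_measurable[OF smooth_dir_deriv[OF bsmoothD[OF f]]] by simp
    show "((\<lambda>q. f (q + ?a z)) has_derivative (\<lambda>v. dir_deriv v f (q + ?a z))) (at q)" for z q
    proof -
      have "((\<lambda>q. q + ?a z) has_derivative (\<lambda>v. v)) (at q)" by (auto intro!: derivative_eq_intros)
      from has_derivative_compose[OF this smooth_has_derivative[OF bsmoothD[OF f]]] show ?thesis .
    qed
  qed (use C integrable_heat_terminal[OF f] in auto)
  then show ?thesis by (simp add: heat_terminal_def)
qed

lemma DERIV_partial:
  fixes f :: "real^'n::finite => real"
  assumes "smooth f"
  shows "((\<lambda>r. f (x + r *\<^sub>R axis i 1)) has_real_derivative partial i f x) (at 0)"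
proof -
  have "((\<lambda>r. x + r *\<^sub>R axis i 1) has_derivative (\<lambda>h. h *\<^sub>R axis i (1::real))) (at 0)"
    by (auto intro!: derivative_eq_intros)
  from has_derivative_compose[OF this smooth_has_derivative[OF assms]]
  show ?thesis
    by (simp add: has_field_derivative_def linear_cmul[OF dir_deriv_linear[OF assms]]
        partial_eq mult.commute[of _ "dir_deriv (axis i 1) f _"])
qed

lemma stein_bsmooth:
  fixes f :: "real^'n::finite => real"
  assumes f: "bsmooth f"
  shows "(LINT z|gauss. z $ i * f (x + s *\<^sub>R z)) = s * (LINT z|gauss. partial i f (x + s *\<^sub>R z))"
    and "integrable gauss (\<lambda>z. z $ i * f (x + s *\<^sub>R z))"
proof -
  note sm = bsmoothD[OF f] bsmoothD[OF bsmooth_partial[OF f]]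
  obtain A B where AB: "\<And>y. \<bar>f y\<bar> \<le> A" "\<And>y. \<bar>partial i f y\<bar> \<le> B"
    using bsmooth_bounded[OF f] bsmooth_bounded[OF bsmooth_partial[OF f]] by blast
  have A0: "0 \<le> A" "0 \<le> B" using order_trans[OF abs_ge_zero AB(1)] order_trans[OF abs_ge_zero AB(2)] by auto
  have 1: "((\<lambda>r. f (x + s *\<^sub>R (z + r *\<^sub>R axis i 1))) has_real_derivative s * partial i f (x + s *\<^sub>R z)) (at 0)" for z
  proof -
    have "((\<lambda>r. f (x + s *\<^sub>R z + r *\<^sub>R axis i 1)) has_real_derivative partial i f (x + s *\<^sub>R z)) (at (s * 0))"
      using DERIV_partial[OF sm(1)] by simp
    moreover have "((\<lambda>r. s * r) has_real_derivative s) (at 0)" by (auto intro!: derivative_eq_intros)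
    ultimately have "((\<lambda>r. f (x + s *\<^sub>R z + (s * r) *\<^sub>R axis i 1)) has_real_derivative partial i f (x + s *\<^sub>R z) * s) (at 0)"
      by (rule DERIV_chain2)
    then show ?thesis by (simp add: algebra_simps)
  qed
  have 2: "continuous_on UNIV (\<lambda>z. f (x + s *\<^sub>R z))" "continuous_on UNIV (\<lambda>z. s * partial i f (x + s *\<^sub>R z))"
    by (intro continuous_intros smooth_compose_cont[OF sm(1)] smooth_compose_cont[OF sm(2)])+
  have m: "A * 1 \<le> (A + \<bar>s\<bar> * B) * (1 + norm z)" "\<bar>s\<bar> * B * 1 \<le> (A + \<bar>s\<bar> * B) * (1 + norm z)" for z :: "real^'n"
    using A0 by (intro mult_mono; simp)+
  have b: "\<bar>s * partial i f y\<bar> \<le> \<bar>s\<bar> * B" for y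
    unfolding abs_mult by (intro mult_left_mono AB) simp
  have 3: "\<bar>f (x + s *\<^sub>R z)\<bar> \<le> (A + \<bar>s\<bar> * B) * (1 + norm z)"
    "\<bar>s * partial i f (x + s *\<^sub>R z)\<bar> \<le> (A + \<bar>s\<bar> * B) * (1 + norm z)" for z
    using m[of z] AB(1)[of "x + s *\<^sub>R z"] b[of "x + s *\<^sub>R z"] by linarith+
  show "(LINT z|gauss. z $ i * f (x + s *\<^sub>R z)) = s * (LINT z|gauss. partial i f (x + s *\<^sub>R z))"
    using stein_identity(1)[OF 1 2 3] by simp
  show "integrable gauss (\<lambda>z. z $ i * f (x + s *\<^sub>R z))" by (rule stein_identity(2)[OF 1 2 3])
qed

text \<open>Here time enters through the scaling \<open>sqrt (T - t)\<close>. Its derivative brings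
  in \<open>z\<close>, which Stein's identity turns into minus half the Laplacian of the data, so no
  time derivative of the data appears.\<close>

lemma heat_terminal_has_derivative:
  fixes f :: "real^'n::finite => real"
  assumes f: "bsmooth f" and t: "t < T"
  shows "((\<lambda>(t, x). heat_terminal T f t x) has_derivative
     (\<lambda>(\<tau>, h). heat_terminal T (dir_deriv h f) t x
        - \<tau> / 2 * (\<Sum>i\<in>UNIV. heat_terminal T (partial i (partial i f)) t x))) (at (t, x))"
proof -
  note sf = bsmoothD[OF f]
  obtain C where C0: "0 \<le> C" and C: "\<And>v x. \<bar>dir_deriv v f x\<bar> \<le> C * norm v"
    using bsmooth_derivative_bound[OF f] by blast
  \<comment> \<open>Within this radius the remaining time stays above \<open>e\<close>, which bounds
    the derivative of the root away from its singularity at \<open>T\<close>.\<close>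
  define e where "e = (T - t) / 2"
  have e: "e > 0" using t by (simp add: e_def)
  let ?y = "\<lambda>q z. snd q + sqrt (T - fst q) *\<^sub>R z"
  let ?v = "\<lambda>q z w. snd w - (fst w / (2 * sqrt (T - fst q))) *\<^sub>R z"
  have D: "((\<lambda>q. LINT z|gauss. f (?y q z)) has_derivative
     (\<lambda>w. LINT z|gauss. dir_deriv (?v (t, x) z w) f (?y (t, x) z))) (at (t, x))"
  proof (rule has_derivative_integral_dominated[OF e, where g="\<lambda>z. C + C / (2 * sqrt e) * norm z"
        and f'="\<lambda>q z w. dir_deriv (?v q z w) f (?y q z)"])
    show "(\<lambda>z. f (?y q z)) \<in> borel_measurable gauss" for q
      using heat_terminal_shift_measurable[OF sf] by simp
    show "integrable gauss (\<lambda>z. f (?y (t, x) z))"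
      using integrable_heat_terminal[OF f] by simp
    show "integrable gauss (\<lambda>z::real^'n. C + C / (2 * sqrt e) * norm z)"
      by (intro Lintegrable_add integrable_mult_right integrable_gauss_norm) auto
    have "(\<lambda>z. dir_deriv (?v (t, x) z w) f (?y (t, x) z)) =
       (\<lambda>z. \<Sum>i\<in>UNIV. ?v (t, x) z w $ i * partial i f (?y (t, x) z))" for w
      by (simp only: dir_deriv_vec[OF sf])
    also have "\<dots> w \<in> borel_measurable gauss" for w
      using heat_terminal_shift_measurable[OF smooth_dir_deriv[OF sf]] by (auto simp: partial_eq)
    finally show "(\<lambda>z. dir_deriv (?v (t, x) z w) f (?y (t, x) z)) \<in> borel_measurable gauss" for w .
    fix z :: "real^'n" and q assume q: "q \<in> ball (t, x) e"
    have "\<bar>t - fst q\<bar> < e" using q dist_fst_le[of "(t, x)" q] by (simp add: dist_real_def)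
    then have "fst q - t < e" by linarith
    then have q': "e < T - fst q" by (simp add: e_def field_simps)
    have "((\<lambda>q. sqrt (T - fst q)) has_derivative (\<lambda>w. - fst w / (2 * sqrt (T - fst q)))) (at q)"
    proof -
      have "((\<lambda>q. T - fst q) has_derivative (\<lambda>w. - fst w)) (at q)"
        by (auto intro!: derivative_eq_intros)
      moreover have "(sqrt has_derivative (\<lambda>h. h / (2 * sqrt (T - fst q)))) (at (T - fst q))"
        using DERIV_real_sqrt[of "T - fst q"] q' e unfolding has_field_derivative_def
        by (rule_tac has_derivative_eq_rhs) (auto simp: fun_eq_iff field_simps)
      ultimately show ?thesis by (rule has_derivative_compose)
    qed
    from has_derivative_add[OF has_derivative_snd[OF has_derivative_ident] has_derivative_scaleR_left[OF this, of z]]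
    have "((\<lambda>q. ?y q z) has_derivative (\<lambda>w. ?v q z w)) (at q)" by simp
    from has_derivative_compose[OF this smooth_has_derivative[OF sf]]
    show "((\<lambda>q. f (?y q z)) has_derivative (\<lambda>w. dir_deriv (?v q z w) f (?y q z))) (at q)" .
    fix w :: "real \<times> (real^'n)"
    have "norm (dir_deriv (?v q z w) f (?y q z)) \<le> C * norm (?v q z w)" using C by simp
    also have "\<dots> \<le> C * (norm (snd w) + norm ((fst w / (2 * sqrt (T - fst q))) *\<^sub>R z))"
      by (intro mult_left_mono C0 norm_triangle_ineq4)
    also have "\<dots> \<le> C * (norm w + norm w / (2 * sqrt e) * norm z)"
    proof -
      have "\<bar>fst w\<bar> \<le> norm w" "norm (snd w) \<le> norm w"
        using norm_fst_le[of "fst w" "snd w"] norm_snd_le[of "snd w" "fst w"] by simp_all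
      moreover have "\<bar>fst w\<bar> / (2 * sqrt (T - fst q)) \<le> norm w / (2 * sqrt e)"
        by (intro frac_le) (use q' e calculation in auto)
      moreover have "norm ((fst w / (2 * sqrt (T - fst q))) *\<^sub>R z) = \<bar>fst w\<bar> / (2 * sqrt (T - fst q)) * norm z"
        using q' e by simp
      ultimately show ?thesis
        by (metis C0 add_mono mult_left_mono mult_right_mono norm_ge_zero)
    qed
    finally show "norm (dir_deriv (?v q z w) f (?y q z)) \<le> (C + C / (2 * sqrt e) * norm z) * norm w"
      by (simp add: algebra_simps)
  qed
  have "(LINT z|gauss. dir_deriv (?v (t, x) z w) f (?y (t, x) z))
     = heat_terminal T (dir_deriv (snd w) f) t x
        - fst w / 2 * (\<Sum>i\<in>UNIV. heat_terminal T (partial i (partial i f)) t x)" for w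
  proof -
    let ?s = "sqrt (T - t)"
    have s: "?s > 0" using t by simp
    have st: "(LINT z|gauss. z $ i * partial i f (x + ?s *\<^sub>R z)) = ?s * (LINT z|gauss. partial i (partial i f) (x + ?s *\<^sub>R z))"
      "integrable gauss (\<lambda>z. z $ i * partial i f (x + ?s *\<^sub>R z))" for i
      by (rule stein_bsmooth[OF bsmooth_partial[OF f]])+
    have i0: "integrable gauss (\<lambda>z. dir_deriv (snd w) f (x + ?s *\<^sub>R z))"
      by (intro integrable_heat_terminal bsmooth_dir_deriv f)
    have "dir_deriv (?v (t, x) z w) f (?y (t, x) z)
      = dir_deriv (snd w) f (x + ?s *\<^sub>R z) - fst w / (2 * ?s) * (\<Sum>i\<in>UNIV. z $ i * partial i f (x + ?s *\<^sub>R z))" for z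
      unfolding linear_diff[OF dir_deriv_linear[OF sf]] linear_cmul[OF dir_deriv_linear[OF sf]]
      by (simp add: dir_deriv_vec[OF sf, of z])
    then have "(LINT z|gauss. dir_deriv (?v (t, x) z w) f (?y (t, x) z))
      = (LINT z|gauss. dir_deriv (snd w) f (x + ?s *\<^sub>R z))
        - fst w / (2 * ?s) * (\<Sum>i\<in>UNIV. LINT z|gauss. z $ i * partial i f (x + ?s *\<^sub>R z))"
      using i0 st(2) by simp
    also have "\<dots> = heat_terminal T (dir_deriv (snd w) f) t x
        - fst w / 2 * (\<Sum>i\<in>UNIV. heat_terminal T (partial i (partial i f)) t x)"
      unfolding st(1) using s by (simp add: heat_terminal_def sum_distrib_left[symmetric])
    finally show ?thesis .
  qed
  with D show ?thesis by (simp add: heat_terminal_def case_prod_beta')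
qed

lemma measure_gauss_UNIV [simp]: "measure gauss UNIV = 1"
  using gauss.prob_space by simp

lemma gauss_measurableI: "f \<in> borel_measurable borel ==> f \<in> borel_measurable gauss"
  by simp

lemma uniform_bound_finite:
  fixes f :: "'i::finite => 'a => real"
  assumes "\<And>i. \<exists>C. \<forall>x. \<bar>f i x\<bar> \<le> C"
  shows "\<exists>C\<ge>0. \<forall>i x. \<bar>f i x\<bar> \<le> C"
proof -
  obtain c where c: "\<And>i x. \<bar>f i x\<bar> \<le> c i" using assms by metis
  have "\<bar>f i x\<bar> \<le> (\<Sum>i\<in>UNIV. \<bar>c i\<bar>)" for i x
  proof -
    have "\<bar>f i x\<bar> \<le> \<bar>c i\<bar>" using c[of i x] by linarith
    also have "\<dots> \<le> (\<Sum>i\<in>UNIV. \<bar>c i\<bar>)" by (rule member_le_sum) auto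
    finally show ?thesis .
  qed
  then show ?thesis by (intro exI[of _ "\<Sum>i\<in>UNIV. \<bar>c i\<bar>"]) (auto intro: sum_nonneg)
qed

lemma norm_vec_lambda_le:
  fixes f :: "'n::finite => real"
  assumes "\<And>i. \<bar>f i\<bar> \<le> C" shows "norm (\<chi> i. f i) \<le> real CARD('n) * C"
proof -
  have "norm (\<chi> i. f i) \<le> (\<Sum>i\<in>UNIV. \<bar>(\<chi> i. f i) $ i\<bar>)" by (rule norm_le_l1_cart)
  also have "\<dots> \<le> (\<Sum>i\<in>(UNIV::'n set). C)" using assms by (intro sum_mono) simp
  finally show ?thesis by simp
qed

lemma power2_norm_vec: "(norm (v::real^'n::finite))\<^sup>2 = (\<Sum>i\<in>UNIV. (v $ i)\<^sup>2)"
  unfolding power2_norm_eq_inner inner_vec_def by (simp add: power2_eq_square)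

lemma heat_source_dir_deriv:
  assumes F: "bsmooth F"
  shows "heat_source T (dir_deriv (0, h) F) t x = (\<Sum>i\<in>UNIV. h $ i * heat_source T (dx i F) t x)"
proof -
  have "dir_deriv (0, h) F = (\<lambda>z. \<Sum>i\<in>UNIV. h $ i * dx i F z)"
    by (rule ext) (rule dir_deriv_space_vec[OF bsmoothD[OF F]])
  then show ?thesis
    using integrable_heat_source[OF bsmooth_spatial_partial[OF F]] by (simp add: heat_source_def)
qed

lemma heat_terminal_dir_deriv:
  assumes f: "bsmooth f"
  shows "heat_terminal T (dir_deriv h f) t x = (\<Sum>i\<in>UNIV. h $ i * heat_terminal T (partial i f) t x)"
proof -
  have "dir_deriv h f = (\<lambda>z. \<Sum>i\<in>UNIV. h $ i * partial i f z)"
    by (rule ext) (rule dir_deriv_vec[OF bsmoothD[OF f]])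
  then show ?thesis
    using integrable_heat_terminal[OF bsmooth_partial[OF f]] by (simp add: heat_terminal_def)
qed

lemma heat_source_time_space_dir_deriv:
  assumes F: "bsmooth F"
  shows "heat_source T (dir_deriv (\<tau>, h) F) t x
    = \<tau> * heat_source T (dir_deriv (1, 0) F) t x + (\<Sum>i\<in>UNIV. h $ i * heat_source T (dx i F) t x)"
proof -
  have "dir_deriv (\<tau>, h) F z = \<tau> * dir_deriv (1, 0) F z + dir_deriv (0, h) F z" for z
    unfolding dir_deriv_space_vec[OF bsmoothD[OF F]] by (rule dir_deriv_time_space[OF bsmoothD[OF F]])
  then have "heat_source T (dir_deriv (\<tau>, h) F) t x
    = \<tau> * heat_source T (dir_deriv (1, 0) F) t x + heat_source T (dir_deriv (0, h) F) t x"
    using integrable_heat_source[OF bsmooth_dir_deriv[OF F]] by (simp add: heat_source_def)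
  then show ?thesis unfolding heat_source_dir_deriv[OF F] .
qed

lemma mild_has_derivative_space:
  assumes "bsmooth F" "bsmooth \<eta>"
  shows "(mild T F \<eta> t has_derivative (\<lambda>h. mild T (dir_deriv (0, h) F) (dir_deriv h \<eta>) t x)) (at x)"
proof -
  have "((\<lambda>x. (t, x)) has_derivative (\<lambda>h. (0, h))) (at x)" by (auto intro!: derivative_eq_intros)
  from has_derivative_compose[OF this heat_source_has_derivative[OF assms(1)]]
  have "(heat_source T F t has_derivative (\<lambda>h. heat_source T (dir_deriv (0, h) F) t x)) (at x)" by simp
  from has_derivative_add[OF heat_terminal_has_derivative_space[OF assms(2)] this]
  show ?thesis by (simp add: mild_def[abs_def])
qed

lemma dir_deriv_mild:
  assumes "bsmooth F" "bsmooth \<eta>"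
  shows "dir_deriv h (mild T F \<eta> t) = mild T (dir_deriv (0, h) F) (dir_deriv h \<eta>) t"
  by (rule dir_deriv_cong_has_derivative) (rule mild_has_derivative_space[OF assms])

lemma partial_mild:
  assumes "bsmooth F" "bsmooth \<eta>"
  shows "partial i (mild T F \<eta> t) = mild T (dx i F) (partial i \<eta>) t"
  by (simp add: partial_eq dx_eq dir_deriv_mild[OF assms])

lemma mild_bounded:
  assumes T: "T \<ge> 0" and F: "bsmooth F" and \<eta>: "bsmooth \<eta>"
  shows "\<exists>C. \<forall>q. \<bar>mild T F \<eta> (fst q) (snd q)\<bar> \<le> C"
proof -
  obtain A where A: "\<And>z. \<bar>F z\<bar> \<le> A" using bsmooth_bounded[OF F] by blast
  obtain B where B: "\<And>z. \<bar>\<eta> z\<bar> \<le> B" using bsmooth_bounded[OF \<eta>] by blast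
  have "\<bar>heat_source T F t x\<bar> \<le> A * T" for t x
  proof -
    interpret finite_measure "time_gauss T :: (real \<times> (real^'a)) measure" by (rule finite_measure_time_gauss)
    have "\<bar>heat_source T F t x\<bar> \<le> (LINT p|time_gauss T. \<bar>F ((t, x) + (fst p, sqrt (fst p) *\<^sub>R snd p))\<bar>)"
      unfolding heat_source_def by (rule integral_abs_bound)
    also have "\<dots> \<le> (LINT p|(time_gauss T :: (real \<times> (real^'a)) measure). A)"
      using integrable_heat_source[OF F] A by (intro integral_mono) auto
    finally show ?thesis by (simp add: measure_time_gauss[OF T] mult.commute)
  qed
  moreover have "\<bar>heat_terminal T \<eta> t x\<bar> \<le> B" for t x
  proof -
    have "\<bar>heat_terminal T \<eta> t x\<bar> \<le> (LINT z|gauss. \<bar>\<eta> (x + sqrt (T - t) *\<^sub>R z)\<bar>)"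
      unfolding heat_terminal_def by (rule integral_abs_bound)
    also have "\<dots> \<le> (LINT z|(gauss :: (real^'a) measure). B)"
      using integrable_heat_terminal[OF \<eta>] B by (intro integral_mono) auto
    finally show ?thesis by simp
  qed
  ultimately have "\<bar>mild T F \<eta> (fst q) (snd q)\<bar> \<le> B + A * T" for q
    unfolding mild_def by (intro order_trans[OF abs_triangle_ineq] add_mono)
  then show ?thesis by blast
qed

text \<open>Space derivatives of a mild solution are mild solutions with differentiated data, so
  these functions form a class closed under differentiation whose members are all bounded.\<close>

lemma bsmooth_mild:
  assumes T: "T \<ge> 0" and F: "bsmooth F" and \<eta>: "bsmooth \<eta>"
  shows "bsmooth (mild T F \<eta> t)"
proof (rule bsmooth_coinduct[of "{mild T F \<eta> t |F \<eta>. bsmooth F \<and> bsmooth \<eta>}"])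
  fix g assume "g \<in> {mild T F \<eta> t |F \<eta>. bsmooth F \<and> bsmooth \<eta>}"
  then obtain F \<eta> where g: "g = mild T F \<eta> t" "bsmooth F" "bsmooth \<eta>" by blast
  show "g differentiable (at x)" for x
    using mild_has_derivative_space[OF g(2,3)] g(1) by (auto simp: differentiable_def)
  show "dir_deriv v g \<in> fun_sums {mild T F \<eta> t |F \<eta>. bsmooth F \<and> bsmooth \<eta>}" for v
    unfolding g(1) dir_deriv_mild[OF g(2,3)]
    by (intro fun_sums.base CollectI exI[of _ "dir_deriv (0, v) F"] exI[of _ "dir_deriv v \<eta>"] conjI refl
        bsmooth_dir_deriv g)
  obtain C where "\<And>q. \<bar>mild T F \<eta> (fst q) (snd q)\<bar> \<le> C" using mild_bounded[OF T g(2,3)] by blast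
  then have "\<bar>g x\<bar> \<le> C" for x unfolding g(1) by (metis fst_conv snd_conv)
  then show "\<exists>C. \<forall>x. \<bar>g x\<bar> \<le> C" by blast
qed (use F \<eta> in blast)

lemma continuous_on_mild:
  assumes F: "bsmooth F" and \<eta>: "bsmooth \<eta>"
  shows "continuous_on S (Mild T F \<eta>)"
proof -
  obtain B where B: "\<And>z. \<bar>\<eta> z\<bar> \<le> B" using bsmooth_bounded[OF \<eta>] by blast
  \<comment> \<open>Dominated convergence, which also covers \<open>t = T\<close>; the formula for
    the time derivative of this term assumes \<open>t < T\<close>.\<close>
  have "continuous_on S (\<lambda>q. heat_terminal T \<eta> (fst q) (snd q))"
    unfolding heat_terminal_def
    by (rule continuous_on_integral_bounded[OF gauss.finite_measure_axioms _ _ B])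
      (auto intro!: smooth_compose_cont[OF bsmoothD[OF \<eta>]] continuous_intros
         gauss_measurableI heat_terminal_shift_measurable bsmoothD[OF \<eta>])
  moreover have "continuous_on S (\<lambda>q. heat_source T F (fst q) (snd q))"
  proof (rule continuous_at_imp_continuous_on, rule ballI)
    fix q
    show "isCont (\<lambda>q. heat_source T F (fst q) (snd q)) q"
      using has_derivative_continuous[OF heat_source_has_derivative[OF F, of T "fst q" "snd q"]]
      by (simp add: case_prod_beta')
  qed
  ultimately show ?thesis unfolding mild_def by (rule continuous_on_add)
qed

lemma continuous_on_mild_compose:
  assumes "bsmooth F" "bsmooth \<eta>" "continuous_on S f" "continuous_on S g"
  shows "continuous_on S (\<lambda>z. mild T F \<eta> (f z) (g z))"
  using continuous_on_compose2[OF continuous_on_mild[OF assms(1,2), of UNIV T] continuous_on_Pair[OF assms(3,4)]]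
  by simp

lemma heat_source_iterated:
  assumes F: "bsmooth F"
  shows "heat_source T F t x = (LINT s:{0..T}|lborel. LINT z|gauss. F (t + s, x + sqrt s *\<^sub>R z))"
proof -
  interpret I: finite_measure "Leb T" by (rule finite_measure_Icc)
  interpret pair_sigma_finite "Leb T" gauss ..
  have "heat_source T F t x = (LINT s|Leb T. LINT z|gauss. F (t + s, x + sqrt s *\<^sub>R z))"
    using integral_fst'[OF integrable_heat_source[OF F, of T t x, unfolded time_gauss_def]]
    by (simp add: heat_source_def time_gauss_def)
  then show ?thesis by (simp add: integral_restrict_space set_lebesgue_integral_def)
qed

text \<open>The integrand of \<open>heat_source\<close> is a total derivative in the time-to-go variable.\<close>

lemma heat_source_pde:
  assumes T: "T > 0" and F: "test_function (cylinder T) F" and t: "0 \<le> t"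
  shows "heat_source T (dir_deriv (1, 0) F) t x
      + (\<Sum>i\<in>UNIV. heat_source T (dx i (dx i F)) t x) / 2 = - F (t, x)"
proof -
  note bF = testfun_bsmooth[OF F]
  define H where "H z = dir_deriv (1, 0) F z + (\<Sum>i\<in>UNIV. dx i (dx i F) z) / 2" for z
  have b: "bsmooth (dir_deriv (1, 0) F)" "bsmooth (dx i (dx i F))" "bsmooth (dx i F)" for i
    by (intro bsmooth_dir_deriv bsmooth_spatial_partial bF)+
  have tH: "test_function (cylinder T) H"
  proof -
    have "test_function (cylinder T) (\<lambda>z. \<Sum>i\<in>I. dx i (dx i F) z)" for I :: "'a set"
    proof (induction I rule: infinite_finite_induct)
      case (insert i I)
      then show ?case
        using testfun_add[OF testfun_spatial_partial[OF testfun_spatial_partial[OF F]] insert.IH]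
        by simp
    qed (auto intro: testfun_zero)
    from testfun_add[OF testfun_dir_deriv[OF F, of "(1,0)"] testfun_cmult[OF this[of UNIV], of "1/2"]]
    show ?thesis by (simp add: H_def[abs_def])
  qed
  have bH: "bsmooth H" by (rule testfun_bsmooth[OF tH])
  have "heat_source T H t x = heat_source T (dir_deriv (1, 0) F) t x
      + (\<Sum>i\<in>UNIV. heat_source T (dx i (dx i F)) t x) / 2"
    unfolding heat_source_def H_def using integrable_heat_source[OF b(1)] integrable_heat_source[OF b(2)] by simp
  moreover have "heat_source T H t x = - F (t, x)"
  proof -
    \<comment> \<open>\<open>E s\<close> is the mean of \<open>F\<close> along the heat flow started
      at \<open>(t, x)\<close> after time \<open>s\<close>. By \<open>heat_evolution\<close> its
      derivative is the mean \<open>K s\<close> of \<open>H\<close>, the time derivative plus half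
      the Laplacian of \<open>F\<close>.\<close>
    define E where "E s = (LINT z|gauss. F (t + s, x + sqrt s *\<^sub>R z))" for s
    define K where "K s = (LINT z|gauss. H (t + s, x + sqrt s *\<^sub>R z))" for s
    have cont: "continuous_on {0..T} (\<lambda>s. LINT z|gauss. G (t + s, x + sqrt s *\<^sub>R z))" if G: "bsmooth G" for G
    proof -
      obtain C where C: "\<And>z. \<bar>G z\<bar> \<le> C" using bsmooth_bounded[OF G] by blast
      show ?thesis
        by (rule continuous_on_integral_bounded[OF gauss.finite_measure_axioms _ _ C])
          (auto intro!: smooth_compose_cont[OF bsmoothD[OF G]] continuous_intros
            gauss_measurableI borel_measurable_continuous_onI)
    qed
    have der: "(E has_real_derivative K s) (at s)" if s: "0 < s" "s < T" for s
    proof -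
      obtain C0 where C0: "\<And>z. \<bar>F z\<bar> \<le> C0" using bsmooth_bounded[OF bF] by blast
      obtain C1 where C1: "\<And>z. \<bar>dir_deriv (1, 0) F z\<bar> \<le> C1" using bsmooth_bounded[OF b(1)] by blast
      obtain C2 where C2: "0 \<le> C2" "\<And>i z. \<bar>dx i F z\<bar> \<le> C2"
        using uniform_bound_finite[of "\<lambda>i z. dx i F z", OF bsmooth_bounded[OF b(3)]] by blast
      obtain C3 where C3: "0 \<le> C3" "\<And>i z. \<bar>dx i (dx i F) z\<bar> \<le> C3"
        using uniform_bound_finite[of "\<lambda>i z. dx i (dx i F) z", OF bsmooth_bounded[OF b(2)]] by blast
      have C01: "0 \<le> C0" "0 \<le> C1" using order_trans[OF abs_ge_zero C0] order_trans[OF abs_ge_zero C1] by auto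
      let ?C = "C0 + C1 + real CARD('a) * C2 + C3"
      have CC: "C0 \<le> ?C" "C1 \<le> ?C" "real CARD('a) * C2 \<le> ?C" "C3 \<le> ?C" using C01 C2(1) C3(1) by auto
      have "((\<lambda>s. LINT z|gauss. (\<lambda>s y. F (t + s, y)) s (x + sqrt s *\<^sub>R z)) has_real_derivative
         (LINT z|gauss. (\<lambda>s y. dir_deriv (1, 0) F (t + s, y)) s (x + sqrt s *\<^sub>R z)
            + (\<Sum>i\<in>UNIV. (\<lambda>s y i. dx i (dx i F) (t + s, y)) s (x + sqrt s *\<^sub>R z) i) / 2)) (at s)"
      proof (rule heat_evolution[where a=0 and b=T and ux="\<lambda>s y. \<chi> i. dx i F (t + s, y)" and C="?C"
            and u="\<lambda>s y. F (t + s, y)" and ut="\<lambda>s y. dir_deriv (1, 0) F (t + s, y)"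
            and uxx="\<lambda>s y i. dx i (dx i F) (t + s, y)"])
        show "((\<lambda>(s, x). F (t + s, x)) has_derivative
            (\<lambda>(\<tau>, h). \<tau> * dir_deriv (1, 0) F (t + s, y) + h \<bullet> (\<chi> i. dx i F (t + s, y)))) (at (s, y))" for s y
        proof -
          have "((\<lambda>q. (t, 0) + q) has_derivative (\<lambda>v. v)) (at (s, y))" by (auto intro!: derivative_eq_intros)
          from has_derivative_compose[OF this smooth_has_derivative[OF bsmoothD[OF bF]]]
          have "((\<lambda>q. F ((t, 0) + q)) has_derivative (\<lambda>v. dir_deriv v F (t + s, y))) (at (s, y))" by simp
          moreover have "(\<lambda>q. F ((t, 0) + q)) = (\<lambda>(s, x). F (t + s, x))" by auto
          moreover have "(\<lambda>v. dir_deriv v F (t + s, y)) = (\<lambda>(\<tau>, h). \<tau> * dir_deriv (1, 0) F (t + s, y) + h \<bullet> (\<chi> i. dx i F (t + s, y)))"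
          proof (rule ext, clarify)
            show "dir_deriv (\<tau>, h) F (t + s, y) = \<tau> * dir_deriv (1, 0) F (t + s, y) + h \<bullet> (\<chi> i. dx i F (t + s, y))"
              for \<tau> h unfolding dir_deriv_time_space[OF bsmoothD[OF bF], of \<tau> h] by (simp add: inner_vec_def)
          qed
          ultimately show ?thesis by simp
        qed
        show "((\<lambda>r. (\<chi> j. dx j F (t + s, y + r *\<^sub>R axis i 1)) $ i) has_real_derivative
           dx i (dx i F) (t + s, y)) (at 0)" for s y i
        proof -
          let ?G = "\<lambda>y. dx i F ((t + s, 0) + (0, y))"
          have bl: "bounded_linear (\<lambda>y. (0::real, y::real^'a))"
            by (rule bounded_linear_Pair[OF bounded_linear_zero bounded_linear_ident])
          have sG: "smooth ?G" using smooth_affine[OF bl bsmoothD[OF b(3)]] .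
          have "dir_deriv (axis i 1) ?G y = dir_deriv (0, axis i 1) (dx i F) ((t + s, 0) + (0, y))"
            by (rule dir_deriv_affine[OF bl smooth_differentiable[OF bsmoothD[OF b(3)]]])
          then have "partial i ?G y = dx i (dx i F) ((t + s, 0) + (0, y))"
            by (simp add: partial_eq dx_eq)
          with DERIV_partial[OF sG, of y i] show ?thesis by simp
        qed
        show "norm (\<chi> i. dx i F (t + s, y)) \<le> ?C" for s y
          using norm_vec_lambda_le[of "\<lambda>i. dx i F (t + s, y)" C2] C2(2) CC(3) by force
        show "\<bar>F (t + s, y)\<bar> \<le> ?C" for s y using C0 CC(1) order_trans by blast
        show "\<bar>dir_deriv (1, 0) F (t + s, y)\<bar> \<le> ?C" for s y using C1 CC(2) order_trans by blast
        show "\<bar>dx i (dx i F) (t + s, y)\<bar> \<le> ?C" for s y i using C3 CC(4) order_trans by blast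
      qed (use s in \<open>auto intro!: continuous_intros continuous_on_vec_lambda
            smooth_compose_cont[OF bsmoothD[OF bF]] smooth_compose_cont[OF bsmoothD[OF b(1)]]
            smooth_compose_cont[OF bsmoothD[OF b(2)]] smooth_compose_cont[OF bsmoothD[OF b(3)]]\<close>)
      then show ?thesis by (simp add: E_def[abs_def] K_def H_def)
    qed
    have Kc: "continuous_on {0..T} K" unfolding K_def by (rule cont[OF bH])
    \<comment> \<open>The root is not differentiable at \<open>s = 0\<close>, so the version with
      derivatives in the interior and continuity at the endpoints is used.\<close>
    have "(K has_integral (E T - E 0)) {0..T}"
    proof (rule fundamental_theorem_of_calculus_interior)
      show "continuous_on {0..T} E" unfolding E_def by (rule cont[OF bF])
    qed (use T der in \<open>auto simp: has_real_derivative_iff_has_vector_derivative\<close>)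
    moreover have "heat_source T H t x = integral {0..T} K"
      unfolding heat_source_iterated[OF bH] K_def[symmetric]
      by (rule set_borel_integral_eq_integral(2)[OF borel_integrable_atLeastAtMost'[OF Kc]])
    ultimately have "heat_source T H t x = E T - E 0" by (simp add: integral_unique)
    \<comment> \<open>At \<open>s = T\<close> the time \<open>t + T\<close> is beyond the support of
      \<open>F\<close>; at \<open>s = 0\<close> the scaling is zero and the mean is the value at the
      starting point.\<close>
    also have "E T = 0"
      unfolding E_def using t by (simp add: testfun_zero_outside[OF F] cylinder_def)
    also have "E 0 = F (t, x)" unfolding E_def using gauss.prob_space by simp
    finally show ?thesis by simp
  qed
  ultimately show ?thesis by simp
qed

text \<open>The backward heat equation is built into the statement: the coefficient of \<tau> is
  minus the source minus half the Laplacian, both for the terminal part by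
  \<open>heat_terminal_has_derivative\<close> and for the source part by
  \<open>heat_source_pde\<close>.\<close>

lemma mild_has_derivative:
  assumes F: "test_function (cylinder T) F" and \<eta>: "bsmooth \<eta>" and t: "0 < t" "t < T"
  shows "((\<lambda>(t, x). mild T F \<eta> t x) has_derivative
     (\<lambda>(\<tau>, h). \<tau> * (- F (t, x) - (\<Sum>i\<in>UNIV. mild T (dx i (dx i F)) (partial i (partial i \<eta>)) t x) / 2)
        + h \<bullet> (\<chi> i. mild T (dx i F) (partial i \<eta>) t x))) (at (t, x))"
proof -
  note bF = testfun_bsmooth[OF F]
  have "((\<lambda>q. (case q of (t, x) => heat_terminal T \<eta> t x) + (case q of (t, x) => heat_source T F t x)) has_derivative
     (\<lambda>v. (case v of (\<tau>, h) => heat_terminal T (dir_deriv h \<eta>) t x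
        - \<tau> / 2 * (\<Sum>i\<in>UNIV. heat_terminal T (partial i (partial i \<eta>)) t x)) + heat_source T (dir_deriv v F) t x)) (at (t, x))"
    by (intro has_derivative_add heat_terminal_has_derivative heat_source_has_derivative \<eta> bF t)
  moreover have "(\<lambda>q. (case q of (t, x) => heat_terminal T \<eta> t x) + (case q of (t, x) => heat_source T F t x)) = (\<lambda>(t, x). mild T F \<eta> t x)"
    by (auto simp: mild_def)
  moreover have "(\<lambda>v. (case v of (\<tau>, h) => heat_terminal T (dir_deriv h \<eta>) t x
        - \<tau> / 2 * (\<Sum>i\<in>UNIV. heat_terminal T (partial i (partial i \<eta>)) t x)) + heat_source T (dir_deriv v F) t x)
     = (\<lambda>(\<tau>, h). \<tau> * (- F (t, x) - (\<Sum>i\<in>UNIV. mild T (dx i (dx i F)) (partial i (partial i \<eta>)) t x) / 2)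
        + h \<bullet> (\<chi> i. mild T (dx i F) (partial i \<eta>) t x))"
  proof (rule ext, clarify)
    fix \<tau> :: real and h :: "real^'a"
    have pde: "heat_source T (dir_deriv (1, 0) F) t x
       = - F (t, x) - (\<Sum>i\<in>UNIV. heat_source T (dx i (dx i F)) t x) / 2"
      using heat_source_pde[OF _ F, of t x] t by simp
    show "heat_terminal T (dir_deriv h \<eta>) t x
        - \<tau> / 2 * (\<Sum>i\<in>UNIV. heat_terminal T (partial i (partial i \<eta>)) t x) + heat_source T (dir_deriv (\<tau>, h) F) t x
     = \<tau> * (- F (t, x) - (\<Sum>i\<in>UNIV. mild T (dx i (dx i F)) (partial i (partial i \<eta>)) t x) / 2)
        + h \<bullet> (\<chi> i. mild T (dx i F) (partial i \<eta>) t x)"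
      unfolding heat_source_time_space_dir_deriv[OF bF, of T \<tau> h t x] heat_terminal_dir_deriv[OF \<eta>] pde
      by (simp add: mild_def inner_vec_def sum.distrib algebra_simps add_divide_distrib)
  qed
  ultimately show ?thesis by simp
qed

lemma DERIV_mild:
  assumes "T \<ge> 0" "bsmooth F" "bsmooth \<eta>"
  shows "((\<lambda>r. mild T F \<eta> t (x + r *\<^sub>R axis i 1)) has_real_derivative
     mild T (dx i F) (partial i \<eta>) t x) (at 0)"
  using DERIV_partial[OF bsmoothD[OF bsmooth_mild[OF assms]], of t x i]
  by (simp add: partial_mild[OF assms(2,3)])

text \<open>Ito's formula in mean. The quadratic with free coefficients serves two purposes:
  \<open>a = 1, b = 0\<close> evolves the second moment and \<open>a = 0, b = 1\<close> the mean,
  which together evolve the variance.\<close>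

lemma mild_quadratic_evolution:
  fixes F :: "real \<times> (real^'n::finite) => real" and a b :: real
  assumes F: "test_function (cylinder T) F" and \<eta>: "bsmooth \<eta>" and t: "0 < t" "t < T"
  shows "((\<lambda>s. LINT z|gauss. a * (mild T F \<eta> s (x0 + sqrt s *\<^sub>R z))\<^sup>2 + b * mild T F \<eta> s (x0 + sqrt s *\<^sub>R z)) has_real_derivative
     (LINT z|gauss. a * (\<Sum>i\<in>UNIV. (mild T (dx i F) (partial i \<eta>) t (x0 + sqrt t *\<^sub>R z))\<^sup>2)
        - (2 * a * mild T F \<eta> t (x0 + sqrt t *\<^sub>R z) + b) * F (t, x0 + sqrt t *\<^sub>R z))) (at t)"
proof -
  note bF = testfun_bsmooth[OF F]
  have T: "T \<ge> 0" using t by simp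
  define u where "u s y = mild T F \<eta> s y" for s y
  define ui where "ui i s y = mild T (dx i F) (partial i \<eta>) s y" for i s y
  define uii where "uii i s y = mild T (dx i (dx i F)) (partial i (partial i \<eta>)) s y" for i s y
  note b1 = bsmooth_spatial_partial[OF bF] bsmooth_partial[OF \<eta>]
  note b2 = bsmooth_spatial_partial[OF b1(1)] bsmooth_partial[OF b1(2)]
  obtain C0 where C0: "\<And>s y. \<bar>u s y\<bar> \<le> C0"
    using mild_bounded[OF T bF \<eta>] unfolding u_def by (metis fst_conv snd_conv)
  obtain C1 where C1: "0 \<le> C1" "\<And>i s y. \<bar>ui i s y\<bar> \<le> C1"
    using uniform_bound_finite[of "\<lambda>i q. mild T (dx i F) (partial i \<eta>) (fst q) (snd q)", OF mild_bounded[OF T b1]]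
    unfolding ui_def by (metis fst_conv snd_conv)
  obtain C2 where C2: "0 \<le> C2" "\<And>i s y. \<bar>uii i s y\<bar> \<le> C2"
    using uniform_bound_finite[of "\<lambda>i q. mild T (dx i (dx i F)) (partial i (partial i \<eta>)) (fst q) (snd q)",
        OF mild_bounded[OF T b2]]
    unfolding uii_def by (metis fst_conv snd_conv)
  obtain C3 where C3: "\<And>z. \<bar>F z\<bar> \<le> C3" using bsmooth_bounded[OF bF] by blast
  have nn: "0 \<le> C0" "0 \<le> C3" using order_trans[OF abs_ge_zero C0] order_trans[OF abs_ge_zero C3] by auto
  let ?N = "real CARD('n)"
  define L where "L = 2 * \<bar>a\<bar> * C0 + \<bar>b\<bar>"
  have L: "\<bar>2 * a * u s y + b\<bar> \<le> L" "0 \<le> L" for s y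
  proof -
    have "\<bar>2 * a * u s y + b\<bar> \<le> 2 * \<bar>a\<bar> * \<bar>u s y\<bar> + \<bar>b\<bar>" by (rule order_trans[OF abs_triangle_ineq]) (simp add: abs_mult)
    also have "\<dots> \<le> L" unfolding L_def using C0 by (intro add_right_mono mult_left_mono) auto
    finally show "\<bar>2 * a * u s y + b\<bar> \<le> L" .
    show "0 \<le> L" using nn by (simp add: L_def)
  qed
  define ut where "ut s y = (2 * a * u s y + b) * (- F (s, y) - (\<Sum>i\<in>UNIV. uii i s y) / 2)" for s y
  define ux where "ux s y = (2 * a * u s y + b) *\<^sub>R (\<chi> i. ui i s y)" for s y
  define uxx where "uxx s y i = (2 * a * u s y + b) * uii i s y + 2 * a * (ui i s y)\<^sup>2" for s y i
  define B where "B = (\<bar>a\<bar> * C0\<^sup>2 + \<bar>b\<bar> * C0) + L * (C3 + ?N * C2) + L * (?N * C1) + (L * C2 + 2 * \<bar>a\<bar> * C1\<^sup>2)"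
  have B: "\<bar>a\<bar> * C0\<^sup>2 + \<bar>b\<bar> * C0 \<le> B" "L * (C3 + ?N * C2) \<le> B" "L * (?N * C1) \<le> B" "L * C2 + 2 * \<bar>a\<bar> * C1\<^sup>2 \<le> B"
    using nn C1(1) C2(1) L(2) unfolding B_def by (simp_all add: add_nonneg_nonneg)
  have cu: "continuous_on UNIV (u s)" "continuous_on UNIV (ui i s)" "continuous_on UNIV (uii i s)"
    "continuous_on UNIV (\<lambda>y. F (s, y))" for s i
    unfolding u_def ui_def uii_def
    by (auto intro!: continuous_on_mild_compose bF \<eta> b1 b2 continuous_intros smooth_compose_cont[OF bsmoothD[OF bF]])
  have "((\<lambda>s. LINT z|gauss. (\<lambda>s y. a * (u s y)\<^sup>2 + b * u s y) s (x0 + sqrt s *\<^sub>R z)) has_real_derivative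
     (LINT z|gauss. ut t (x0 + sqrt t *\<^sub>R z) + (\<Sum>i\<in>UNIV. uxx t (x0 + sqrt t *\<^sub>R z) i) / 2)) (at t)"
  proof (rule heat_evolution[where a=0 and b=T and ux=ux and C=B and ut=ut and uxx=uxx
        and u="\<lambda>s y. a * (u s y)\<^sup>2 + b * u s y"])
    fix s y assume s: "0 < s" "s < T"
    have d: "((\<lambda>q. u (fst q) (snd q)) has_derivative
       (\<lambda>(\<tau>, h). \<tau> * (- F (s, y) - (\<Sum>i\<in>UNIV. uii i s y) / 2) + h \<bullet> (\<chi> i. ui i s y))) (at (s, y))"
      using mild_has_derivative[OF F \<eta> s, of y] unfolding u_def ui_def uii_def by (simp add: case_prod_beta')
    show "((\<lambda>(s, x). a * (u s x)\<^sup>2 + b * u s x) has_derivative (\<lambda>(\<tau>, h). \<tau> * ut s y + h \<bullet> ux s y)) (at (s, y))"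
      using has_derivative_add[OF has_derivative_mult_right[OF has_derivative_mult[OF d d], of a]
          has_derivative_mult_right[OF d, of b]]
      unfolding case_prod_beta' power2_eq_square
      by (rule has_derivative_eq_rhs) (auto simp: ut_def ux_def algebra_simps)
    show "\<bar>a * (u s y)\<^sup>2 + b * u s y\<bar> \<le> B"
    proof -
      have "\<bar>a * (u s y)\<^sup>2 + b * u s y\<bar> \<le> \<bar>a\<bar> * \<bar>u s y\<bar>\<^sup>2 + \<bar>b\<bar> * \<bar>u s y\<bar>"
        by (rule order_trans[OF abs_triangle_ineq]) (simp add: abs_mult power_abs)
      also have "\<dots> \<le> \<bar>a\<bar> * C0\<^sup>2 + \<bar>b\<bar> * C0"
        using C0 by (intro add_mono mult_left_mono power_mono) auto
      finally show ?thesis using B(1) by linarith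
    qed
    show "\<bar>ut s y\<bar> \<le> B"
    proof -
      have "\<bar>- F (s, y) - (\<Sum>i\<in>UNIV. uii i s y) / 2\<bar> \<le> C3 + ?N * C2"
      proof -
        have "\<bar>\<Sum>i\<in>UNIV. uii i s y\<bar> \<le> ?N * C2"
          by (rule order_trans[OF sum_abs sum_bounded_above]) (rule C2(2))
        then show ?thesis using C3[of "(s, y)"] by linarith
      qed
      then have "\<bar>ut s y\<bar> \<le> L * (C3 + ?N * C2)"
        unfolding ut_def abs_mult using L by (intro mult_mono) auto
      then show ?thesis using B(2) by linarith
    qed
    show "norm (ux s y) \<le> B"
    proof -
      have "norm (ux s y) \<le> L * (?N * C1)"
        unfolding ux_def norm_scaleR real_norm_def using L C1 by (intro mult_mono norm_vec_lambda_le) auto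
      then show ?thesis using B(3) by linarith
    qed
    fix i
    show "((\<lambda>r. ux s (y + r *\<^sub>R axis i 1) $ i) has_real_derivative uxx s y i) (at 0)"
    proof -
      have du: "((\<lambda>r. u s (y + r *\<^sub>R axis i 1)) has_real_derivative ui i s y) (at 0)"
        unfolding u_def ui_def by (rule DERIV_mild[OF T bF \<eta>])
      have dui: "((\<lambda>r. ui i s (y + r *\<^sub>R axis i 1)) has_real_derivative uii i s y) (at 0)"
        unfolding ui_def uii_def by (rule DERIV_mild[OF T b1])
      have "((\<lambda>r. 2 * a * u s (y + r *\<^sub>R axis i 1) + b) has_real_derivative 2 * a * ui i s y) (at 0)"
        using DERIV_add[OF DERIV_cmult[OF du, of "2 * a"] DERIV_const[of b]] by simp
      from DERIV_mult[OF this dui] show ?thesis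
        by (simp add: ux_def uxx_def power2_eq_square algebra_simps)
    qed
    show "\<bar>uxx s y i\<bar> \<le> B"
    proof -
      have "\<bar>uxx s y i\<bar> \<le> \<bar>2 * a * u s y + b\<bar> * \<bar>uii i s y\<bar> + 2 * \<bar>a\<bar> * \<bar>ui i s y\<bar>\<^sup>2"
        unfolding uxx_def by (rule order_trans[OF abs_triangle_ineq]) (simp add: abs_mult power_abs)
      also have "\<dots> \<le> L * C2 + 2 * \<bar>a\<bar> * C1\<^sup>2"
        using L C1 C2 by (intro add_mono mult_mono mult_left_mono power_mono) auto
      finally show ?thesis using B(4) by linarith
    qed
  qed (use t in \<open>auto simp: ut_def ux_def uxx_def intro!: continuous_intros cu continuous_on_vec_lambda\<close>)
  \<comment> \<open>The second derivatives cancel: the time derivative contributes minus half the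
    Laplacian times \<open>2 * a * u + b\<close>, and half the Laplacian of the quadratic
    contributes the same with a plus sign, together with the squared gradient.\<close>
  moreover have "ut t y + (\<Sum>i\<in>UNIV. uxx t y i) / 2 = a * (\<Sum>i\<in>UNIV. (ui i t y)\<^sup>2) - (2 * a * u t y + b) * F (t, y)" for y
    by (simp add: ut_def uxx_def sum.distrib sum_distrib_left[symmetric] add_divide_distrib algebra_simps)
  ultimately show ?thesis by (simp add: u_def ui_def)
qed

subsection \<open>Energy identities for smooth data\<close>

text \<open>Meant for functions that differ from a member of the class by a constant, such as the
  centred gradient components.\<close>

lemma bsmoothI_derivative:
  fixes f :: "'a::euclidean_space => real"
  assumes "\<exists>C. \<forall>x. \<bar>f x\<bar> \<le> C" "\<And>x. f differentiable (at x)" "\<And>v. bsmooth (dir_deriv v f)"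
  shows "bsmooth f"
proof (rule bsmooth_coinduct[of "insert f {f. bsmooth f}"])
  fix g assume "g \<in> insert f {f. bsmooth f}"
  then consider "g = f" | "bsmooth g" by auto
  note c = this
  show "g differentiable (at x)" for x
    using c by cases (auto intro: assms(2) smooth_differentiable bsmoothD)
  have "bsmooth (dir_deriv v g)" for v
    using c by cases (auto intro: assms(3) bsmooth_dir_deriv)
  then show "dir_deriv v g \<in> fun_sums (insert f {f. bsmooth f})" for v
    by (auto intro: fun_sums.base)
  show "\<exists>C. \<forall>x. \<bar>g x\<bar> \<le> C"
    using c by cases (use assms(1) bsmooth_bounded in auto)
qed simp

lemma integral_vec_component:
  fixes U :: "'a => real^'n::finite"
  assumes "integrable M U" shows "(LINT z|M. U z) $ i = (LINT z|M. U z $ i)"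
  using integral_inner_left[of "axis i 1", OF assms] by (simp add: cart_eq_inner_axis)

lemma (in prob_space) vec_variance_eq:
  fixes U :: "'a => 'b::euclidean_space"
  assumes "L2 M U"
  shows "vec_variance M U = (LINT z|M. (norm (U z))\<^sup>2) - (norm (LINT z|M. U z))\<^sup>2"
proof -
  let ?m = "LINT z|M. U z"
  have i: "integrable M U" by (rule sqint_integrable[OF finite_measure_axioms assms])
  have "vec_variance M U = (LINT z|M. (norm (U z))\<^sup>2 - 2 * (U z \<bullet> ?m) + (norm ?m)\<^sup>2)"
    unfolding vec_variance_def power2_norm_eq_inner
    by (intro Lintegral_cong) (auto simp: inner_diff inner_commute)
  also have "\<dots> = (LINT z|M. (norm (U z))\<^sup>2) - 2 * (?m \<bullet> ?m) + (norm ?m)\<^sup>2"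
    using i sqint_norm2[OF assms] prob_space by simp
  finally show ?thesis by (simp add: power2_norm_eq_inner)
qed

lemma (in prob_space) vec_variance_vec:
  fixes U :: "'a => real^'n::finite"
  assumes "L2 M U"
  shows "vec_variance M U = (\<Sum>i\<in>UNIV. (LINT z|M. (U z $ i)\<^sup>2) - (LINT z|M. U z $ i)\<^sup>2)"
proof -
  have i: "integrable M U" by (rule sqint_integrable[OF finite_measure_axioms assms])
  have "(LINT z|M. U z) $ i = (LINT z|M. U z $ i)" for i
    by (rule integral_vec_component[OF i])
  moreover have "integrable M (\<lambda>z. (U z $ i)\<^sup>2)" for i
    using sqint_norm2[OF sqint_component[OF assms, of i]] by simp
  ultimately show ?thesis
    unfolding vec_variance_eq[OF assms] power2_norm_vec by (simp add: sum_subtractf)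
qed

lemma (in prob_space) vec_variance_le:
  fixes U :: "'a => 'b::euclidean_space"
  assumes "L2 M U"
  shows "vec_variance M U \<le> (LINT z|M. (norm (U z))\<^sup>2)"
  unfolding vec_variance_eq[OF assms] by simp

lemma vec_variance_nonneg: "0 \<le> vec_variance M U"
  unfolding vec_variance_def by simp

lemma bsmooth_square_integrable:
  fixes f :: "real^'n::finite => real"
  assumes "bsmooth f" shows "L2 gauss (\<lambda>z. f (x + c *\<^sub>R z))"
proof -
  obtain C where C: "\<And>z. \<bar>f z\<bar> \<le> C" using bsmooth_bounded[OF assms] by blast
  show ?thesis
    by (rule sqint_bounded[OF gauss.finite_measure_axioms, where C=C])
      (use C heat_terminal_shift_measurable[OF bsmoothD[OF assms]] in auto)
qed

lemma sqint_vec_lambda: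
  fixes f :: "'n::finite => 'a => 'b::euclidean_space"
  assumes "\<And>i. L2 N (f i)"
  shows "L2 N (\<lambda>z. \<chi> i. f i z)"
proof (rule sqint_bound)
  have "(norm (\<chi> i. f i z))\<^sup>2 = (\<Sum>i\<in>UNIV. (norm (f i z))\<^sup>2)" for z
    by (simp add: norm_vec_def L2_set_def sum_nonneg)
  then show "AE z in N. (norm (\<chi> i. f i z))\<^sup>2 \<le> (\<Sum>i\<in>UNIV. (norm (f i z))\<^sup>2)" by simp
  show "integrable N (\<lambda>z. \<Sum>i\<in>UNIV. (norm (f i z))\<^sup>2)"
    using assms by (auto simp: square_integrable_def)
  have [measurable]: "f i \<in> borel_measurable N" for i using assms by (rule sqintD)
  have "(\<lambda>z. \<chi> i. f i z) = (\<lambda>z. \<Sum>i\<in>UNIV. (\<chi> j. if j = i then f i z else 0))"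
    by (auto simp: vec_eq_iff fun_eq_iff sum.delta)
  moreover have "(\<lambda>z. \<chi> j. if j = i then f i z else 0) \<in> borel_measurable N" for i
  proof -
    have "continuous_on UNIV (\<lambda>v::'b. \<chi> j. if j = i then v else (0::'b))"
      by (intro continuous_on_vec_lambda) (case_tac "j = i"; simp)
    from borel_measurable_continuous_onI[OF this] show ?thesis by measurable
  qed
  ultimately show "(\<lambda>z. \<chi> i. f i z) \<in> borel_measurable N" by simp
qed

section \<open>Jets of mild solutions and the Gaussian Bochner and Poincare inequalities\<close>

definition mild_grad where
  "mild_grad T F \<eta> t x = (\<chi> i. mild T (dx i F) (partial i \<eta>) t x)"

definition mild_hess where
  "mild_hess T F \<eta> t x = (\<chi> i j. mild T (dx i (dx j F)) (partial i (partial j \<eta>)) t x)"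

definition mild_mean where
  "mild_mean T F \<eta> x0 t = (LINT z|gauss. mild_grad T F \<eta> t (x0 + sqrt t *\<^sub>R z))"

text \<open>The drift form of \<open>gen\<close> applied to the solution minus its affine
  projection. Second derivatives do not see the affine part, and in the drift only its slope
  \<open>mild_mean\<close> survives.\<close>

definition mild_AQ where
  "mild_AQ T F \<eta> x0 t x = (\<Sum>i\<in>UNIV. mild_hess T F \<eta> t x $ i $ i)
     - ((x - x0) \<bullet> (mild_grad T F \<eta> t x - mild_mean T F \<eta> x0 t)) / t"

abbreviation (input) "Grad T F \<eta> \<equiv> \<lambda>q. mild_grad T F \<eta> (fst q) (snd q)"
abbreviation (input) "Hess T F \<eta> \<equiv> \<lambda>q. mild_hess T F \<eta> (fst q) (snd q)"
abbreviation (input) "AQ T F \<eta> x0 \<equiv> \<lambda>q. mild_AQ T F \<eta> x0 (fst q) (snd q)"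

definition mild_var where
  "mild_var T F \<eta> x0 t = vec_variance gauss (\<lambda>z. mild_grad T F \<eta> t (x0 + sqrt t *\<^sub>R z))"

lemma power2_norm_matrix: "(norm (A::real^'n::finite^'m::finite))\<^sup>2 = (\<Sum>i\<in>UNIV. \<Sum>j\<in>UNIV. (A $ i $ j)\<^sup>2)"
proof -
  have "(norm A)\<^sup>2 = (\<Sum>i\<in>UNIV. (norm (A $ i))\<^sup>2)"
    by (simp add: norm_vec_def[of A] L2_set_def sum_nonneg)
  then show ?thesis by (simp add: power2_norm_vec)
qed

text \<open>The left side is the squared norm of the Gaussian divergence of the field
  \<open>a\<close>. Stein's identity moves both factors \<open>z $ i\<close> and
  \<open>z $ j\<close> onto the field; the derivative of \<open>z $ j\<close> along axis
  \<open>i\<close> produces the term of order zero.\<close>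

lemma bochner_gauss:
  fixes a :: "'n::finite => real^'n => real"
  assumes a: "\<And>i. bsmooth (a i)"
  shows "(LINT z|gauss. (\<Sum>i\<in>UNIV. partial i (a i) z - z $ i * a i z)\<^sup>2)
     = (\<Sum>i\<in>UNIV. \<Sum>j\<in>UNIV. LINT z|gauss. partial j (a i) z * partial i (a j) z)
        + (\<Sum>i\<in>UNIV. LINT z|gauss. (a i z)\<^sup>2)"
    and "integrable gauss (\<lambda>z. (\<Sum>i\<in>UNIV. partial i (a i) z - z $ i * a i z)\<^sup>2)"
proof -
  note a1 = bsmooth_partial[OF a] and mult = bsmooth_mult
  have int: "integrable gauss f" if "bsmooth f" for f :: "real^'n => real"
    using integrable_heat_terminal[OF that, of 0 1] by simp
  have st: "(LINT z|gauss. z $ i * f z) = (LINT z|gauss. partial i f z)" "integrable gauss (\<lambda>z. z $ i * f z)"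
    if "bsmooth f" for f :: "real^'n => real" and i
    using stein_bsmooth[OF that, where i=i and x=0 and s=1] by simp_all
  have pm: "partial i (\<lambda>z. f z * g z) = (\<lambda>z. f z * partial i g z + partial i f z * g z)"
    if "bsmooth f" "bsmooth g" for f g :: "real^'n => real" and i
    unfolding partial_eq by (intro ext dir_deriv_mult smooth_differentiable bsmoothD that)
  \<comment> \<open>Stein twice. The Kronecker delta, written \<open>axis i 1 $ j\<close>, is the
    derivative of the coordinate \<open>j\<close> along axis \<open>i\<close>.\<close>
  have st2: "(LINT z|gauss. z $ i * (z $ j * f z)) = axis i 1 $ j * (LINT z|gauss. f z) + (LINT z|gauss. partial j (partial i f) z)"
    "integrable gauss (\<lambda>z. z $ i * (z $ j * f z))" if f: "bsmooth f" for f :: "real^'n => real" and i j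
  proof -
    obtain A B where AB: "\<And>y. \<bar>f y\<bar> \<le> A" "\<And>y. \<bar>partial i f y\<bar> \<le> B"
      using bsmooth_bounded[OF f] bsmooth_bounded[OF bsmooth_partial[OF f]] by blast
    have "((\<lambda>r. (z + r *\<^sub>R axis i 1) $ j) has_real_derivative axis i 1 $ j) (at 0)" for z :: "real^'n"
      by (auto intro!: derivative_eq_intros)
    from DERIV_mult[OF this DERIV_partial[OF bsmoothD[OF f]]]
    have 1: "((\<lambda>r. (z + r *\<^sub>R axis i 1) $ j * f (z + r *\<^sub>R axis i 1)) has_real_derivative axis i 1 $ j * f z + z $ j * partial i f z) (at 0)" for z
      by (simp add: algebra_simps)
    have 2: "continuous_on UNIV (\<lambda>z. z $ j * f z)" "continuous_on UNIV (\<lambda>z. axis i 1 $ j * f z + z $ j * partial i f z)"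
      by (intro continuous_intros smooth_continuous_on bsmoothD bsmooth_partial f)+
    have z: "\<bar>z $ j * c\<bar> \<le> norm z * C" if "\<bar>c\<bar> \<le> C" for z :: "real^'n" and c C
      unfolding abs_mult using that component_le_norm_cart[of z j] by (intro mult_mono) auto
    have A0: "0 \<le> A" "0 \<le> B" using order_trans[OF abs_ge_zero AB(1)] order_trans[OF abs_ge_zero AB(2)] by auto
    have 3: "\<bar>z $ j * f z\<bar> \<le> (A + B) * (1 + norm z)" for z
    proof -
      have "norm z * A \<le> (1 + norm z) * (A + B)" using A0 by (intro mult_mono) auto
      with z[OF AB(1), of z z] show ?thesis by (simp add: mult.commute)
    qed
    have 4: "\<bar>axis i 1 $ j * f z + z $ j * partial i f z\<bar> \<le> (A + B) * (1 + norm z)" for z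
    proof -
      have "\<bar>axis i 1 $ j * f z\<bar> \<le> A" using AB(1) A0 by (simp add: axis_def)
      then have "\<bar>axis i 1 $ j * f z + z $ j * partial i f z\<bar> \<le> A + norm z * B"
        using z[OF AB(2), of z z] by linarith
      also have "\<dots> \<le> (A + B) * (1 + norm z)" using A0 by (simp add: algebra_simps)
      finally show ?thesis .
    qed
    show "(LINT z|gauss. z $ i * (z $ j * f z)) = axis i 1 $ j * (LINT z|gauss. f z) + (LINT z|gauss. partial j (partial i f) z)"
      using stein_identity(1)[OF 1 2 3 4] int[OF f] st[OF bsmooth_partial[OF f], of j i] by simp
    show "integrable gauss (\<lambda>z. z $ i * (z $ j * f z))" by (rule stein_identity(2)[OF 1 2 3 4])
  qed
  define D where "D i z = partial i (a i) z - z $ i * a i z" for i z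
  have DD: "integrable gauss (\<lambda>z. D i z * D j z)" and
    DD2: "(LINT z|gauss. D i z * D j z) = (LINT z|gauss. partial j (a i) z * partial i (a j) z) + axis i 1 $ j * (LINT z|gauss. a i z * a j z)" for i j
  proof -
    let ?P = "\<lambda>z. partial i (a i) z * partial j (a j) z"
    note b = mult[OF a1 a1, of i i j j] mult[OF a a1, of j i i] mult[OF a a1, of i j j] mult[OF a a, of i j]
    have e: "D i z * D j z = ?P z - z $ j * (a j z * partial i (a i) z) - z $ i * (a i z * partial j (a j) z) + z $ i * (z $ j * (a i z * a j z))" for z
      by (simp add: D_def algebra_simps)
    show "integrable gauss (\<lambda>z. D i z * D j z)"
      unfolding e by (intro Lintegrable_add Lintegrable_diff int b st(2) st2(2))
    let ?X = "partial j (\<lambda>z. a j z * partial i (a i) z)" and ?Y = "partial i (\<lambda>z. a i z * partial j (a j) z)"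
      and ?Z = "partial j (partial i (\<lambda>z. a i z * a j z))"
    note ib = int[OF b(1)] int[OF bsmooth_partial[OF b(2)], of j] int[OF bsmooth_partial[OF b(3)], of i] int[OF bsmooth_partial[OF bsmooth_partial[OF b(4)]], of j i]
    have "(LINT z|gauss. D i z * D j z) = (LINT z|gauss. ?P z) - (LINT z|gauss. ?X z) - (LINT z|gauss. ?Y z)
        + (axis i 1 $ j * (LINT z|gauss. a i z * a j z) + (LINT z|gauss. ?Z z))"
      unfolding e st(1)[OF b(2), symmetric] st(1)[OF b(3), symmetric] st2(1)[OF b(4), symmetric]
      using int[OF b(1)] st(2)[OF b(2), of j] st(2)[OF b(3), of i] st2(2)[OF b(4), of i j] by simp
    also have "\<dots> = (LINT z|gauss. ?P z - ?X z - ?Y z + ?Z z) + axis i 1 $ j * (LINT z|gauss. a i z * a j z)"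
      using ib by simp
    \<comment> \<open>Expanding all products, every term with a second derivative cancels because
      mixed derivatives commute, and the products of diagonal derivatives cancel as 1 - 1 - 1 +
      1.\<close>
    also have "(\<lambda>z. ?P z - ?X z - ?Y z + ?Z z) = (\<lambda>z. partial j (a i) z * partial i (a j) z)"
    proof -
      have "?Z z = partial j (\<lambda>z. a i z * partial i (a j) z) z + partial j (\<lambda>z. partial i (a i) z * a j z) z" for z
        unfolding pm[OF a a] partial_eq[of j]
        by (intro dir_deriv_add smooth_differentiable bsmoothD mult a a1)
      moreover have "partial i (partial j (a j)) = partial j (partial i (a j))"
        unfolding partial_eq by (rule ext) (rule dir_deriv_commute[OF bsmoothD[OF a]])
      ultimately show ?thesis unfolding fun_eq_iff by (simp add: pm a a1 algebra_simps)
    qed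
    finally show "(LINT z|gauss. D i z * D j z) = (LINT z|gauss. partial j (a i) z * partial i (a j) z) + axis i 1 $ j * (LINT z|gauss. a i z * a j z)" .
  qed
  have sq: "(\<Sum>i\<in>UNIV. partial i (a i) z - z $ i * a i z)\<^sup>2 = (\<Sum>i\<in>UNIV. \<Sum>j\<in>UNIV. D i z * D j z)" for z
    unfolding D_def[symmetric] by (simp add: power2_eq_square sum_product)
  show "integrable gauss (\<lambda>z. (\<Sum>i\<in>UNIV. partial i (a i) z - z $ i * a i z)\<^sup>2)"
    unfolding sq by (intro Bochner_Integration.integrable_sum DD)
  have "(LINT z|gauss. (\<Sum>i\<in>UNIV. partial i (a i) z - z $ i * a i z)\<^sup>2) = (\<Sum>i\<in>UNIV. \<Sum>j\<in>UNIV. LINT z|gauss. D i z * D j z)"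
    unfolding sq using DD by simp
  also have "\<dots> = (\<Sum>i\<in>UNIV. \<Sum>j\<in>UNIV. LINT z|gauss. partial j (a i) z * partial i (a j) z)
        + (\<Sum>i\<in>UNIV. \<Sum>j\<in>UNIV. axis i 1 $ j * (LINT z|gauss. a i z * a j z))"
    by (simp add: DD2 sum.distrib)
  also have "(\<Sum>i\<in>UNIV. \<Sum>j\<in>UNIV. axis i 1 $ j * (LINT z|gauss. a i z * a j z)) = (\<Sum>i\<in>UNIV. LINT z|gauss. (a i z)\<^sup>2)"
  proof -
    have "(\<Sum>j\<in>UNIV. axis i (1::real) $ j * c j) = c i" for c and i :: 'n
    proof -
      have "(\<Sum>j\<in>UNIV. axis i (1::real) $ j * c j) = (\<Sum>j\<in>UNIV. if j = i then c j else 0)"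
        by (rule sum.cong) (auto simp: axis_def)
      then show ?thesis by simp
    qed
    then show ?thesis by (simp only: power2_eq_square)
  qed
  finally show "(LINT z|gauss. (\<Sum>i\<in>UNIV. partial i (a i) z - z $ i * a i z)\<^sup>2)
     = (\<Sum>i\<in>UNIV. \<Sum>j\<in>UNIV. LINT z|gauss. partial j (a i) z * partial i (a j) z)
        + (\<Sum>i\<in>UNIV. LINT z|gauss. (a i z)\<^sup>2)" .
qed

lemma mild_at_terminal:
  assumes "T > 0" "test_function (cylinder T) F"
  shows "mild T F \<eta> T x = \<eta> x"
proof -
  have "heat_source T F T x = (LINT p|(time_gauss T :: (real \<times> (real^'a)) measure). 0)"
    unfolding heat_source_def
  proof (rule Lintegral_cong[OF refl])
    fix p :: "real \<times> (real^'a)" assume "p \<in> space (time_gauss T)"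
    then have "fst p \<ge> 0" by (auto simp: time_gauss_def space_pair_measure space_restrict_space)
    then show "F ((T, x) + (fst p, sqrt (fst p) *\<^sub>R snd p)) = 0"
      by (intro testfun_zero_outside[OF assms(2)]) (auto simp: cylinder_def)
  qed
  then show ?thesis by (simp add: mild_def heat_terminal_def)
qed

text \<open>Continuity reaches the endpoints of the time interval, where the evolution formula gives
  no derivative; the mean value theorem and the fundamental theorem rely on it there.\<close>

lemma continuous_on_mild_moment:
  assumes T: "T \<ge> 0" and F: "bsmooth F" and \<eta>: "bsmooth \<eta>"
  shows "continuous_on S (\<lambda>s. LINT z|gauss. mild T F \<eta> s (x0 + sqrt s *\<^sub>R z))"
    and "continuous_on S (\<lambda>s. LINT z|gauss. (mild T F \<eta> s (x0 + sqrt s *\<^sub>R z))\<^sup>2)"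
proof -
  obtain C where C: "\<And>s y. \<bar>mild T F \<eta> s y\<bar> \<le> C"
    using mild_bounded[OF T F \<eta>] by (metis fst_conv snd_conv)
  have m: "(\<lambda>z. mild T F \<eta> s (x0 + sqrt s *\<^sub>R z)) \<in> borel_measurable gauss" for s
    by (intro gauss_measurableI borel_measurable_continuous_onI continuous_on_mild_compose F \<eta> continuous_intros)
  show "continuous_on S (\<lambda>s. LINT z|gauss. mild T F \<eta> s (x0 + sqrt s *\<^sub>R z))"
    by (rule continuous_on_integral_bounded[OF gauss.finite_measure_axioms _ m C])
      (intro continuous_on_mild_compose F \<eta> continuous_intros)
  have C2: "\<bar>(mild T F \<eta> s (x0 + sqrt s *\<^sub>R z))\<^sup>2\<bar> \<le> C\<^sup>2" for s z
    using power_mono[OF C abs_ge_zero, of s _ 2] by simp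
  show "continuous_on S (\<lambda>s. LINT z|gauss. (mild T F \<eta> s (x0 + sqrt s *\<^sub>R z))\<^sup>2)"
    by (rule continuous_on_integral_bounded[OF gauss.finite_measure_axioms _ borel_measurable_power[OF m] C2])
      (intro continuous_on_mild_compose F \<eta> continuous_intros)
qed

text \<open>Interpolate with the heat semigroup and use that the Dirichlet form
  of \<open>P (t - s) g\<close> under \<open>mu s\<close> increases in \<open>s\<close>.\<close>

lemma gaussian_poincare:
  fixes g :: "real^'n::finite => real"
  assumes g: "bsmooth g" and t: "t > 0"
  shows "(LINT z|gauss. (g (x0 + sqrt t *\<^sub>R z))\<^sup>2) - (LINT z|gauss. g (x0 + sqrt t *\<^sub>R z))\<^sup>2
     \<le> t * (\<Sum>i\<in>UNIV. LINT z|gauss. (partial i g (x0 + sqrt t *\<^sub>R z))\<^sup>2)"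
proof -
  \<comment> \<open>With zero source and horizon \<open>t\<close> the mild solution at time
    \<open>s\<close> is the heat semigroup over \<open>t - s\<close> applied to the terminal
    function.\<close>
  let ?Z = "\<lambda>z::real \<times> (real^'n). 0::real"
  have Z: "test_function (cylinder t) ?Z" by (rule testfun_zero)
  note bZ = testfun_bsmooth[OF Z]
  have sZ: "dx i ?Z = ?Z" for i
    by (simp add: dx_eq dir_deriv_const)
  define E where "E h s = (LINT z|gauss. (mild t ?Z h s (x0 + sqrt s *\<^sub>R z))\<^sup>2)" for h s
  define A where "A s = (LINT z|gauss. mild t ?Z g s (x0 + sqrt s *\<^sub>R z))" for s
  have cE: "continuous_on {0..t} (E h)" if "bsmooth h" for h
    unfolding E_def using continuous_on_mild_moment(2)[OF _ bZ that] t by simp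
  have cA: "continuous_on {0..t} A"
    unfolding A_def using continuous_on_mild_moment(1)[OF _ bZ g] t by simp
  have dE: "(E h has_real_derivative (\<Sum>i\<in>UNIV. E (partial i h) s)) (at s)" if h: "bsmooth h" and s: "0 < s" "s < t" for h s
  proof -
    have "(LINT z|gauss. (\<Sum>i\<in>UNIV. (mild t ?Z (partial i h) s (x0 + sqrt s *\<^sub>R z))\<^sup>2)) = (\<Sum>i\<in>UNIV. E (partial i h) s)"
      unfolding E_def
      using sqint_norm2[OF bsmooth_square_integrable[OF bsmooth_mild[OF _ bZ bsmooth_partial[OF h]]]] t
      by simp
    then show ?thesis
      using mild_quadratic_evolution[OF Z h s, where ?x0.0=x0 and a=1 and b=0] by (simp add: E_def[abs_def] sZ)
  qed
  have dA: "(A has_real_derivative 0) (at s)" if s: "0 < s" "s < t" for s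
    using mild_quadratic_evolution[OF Z g s, where ?x0.0=x0 and a=0 and b=1] by (simp add: A_def[abs_def])
  have Enn: "0 \<le> E h s" for h s unfolding E_def by simp
  have mono: "E h s \<le> E h t" if h: "bsmooth h" and s: "0 < s" "s < t" for h s
  proof (rule DERIV_nonneg_imp_increasing_open[where f="E h" and a=s and b=t])
    show "\<exists>y. (E h has_real_derivative y) (at x) \<and> 0 \<le> y" if "s < x" "x < t" for x
      using dE[OF h, of x] that s Enn by (intro exI conjI) (auto intro: sum_nonneg)
  qed (use s continuous_on_subset[OF cE[OF h], of "{s..t}"] in auto)
  \<comment> \<open>The mean is conserved along the interpolation. At time 0 the law is a point
    mass, so there the second moment is the square of the mean, and the difference of second moments
    over the interval is the variance.\<close>
  have "A t = A 0"
    using DERIV_isconst_end[OF t cA] dA by simp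
  moreover have "A 0 = mild t ?Z g 0 x0" "E g 0 = (mild t ?Z g 0 x0)\<^sup>2"
    by (simp_all add: A_def E_def)
  \<comment> \<open>The mean value theorem takes the place of integrating the Dirichlet form over
    time: its value at one intermediate time is already at most the terminal one.\<close>
  moreover obtain s where s: "0 < s" "s < t" "E g t - E g 0 = (t - 0) * (\<Sum>i\<in>UNIV. E (partial i g) s)"
    using MVT[OF t cE[OF g]] dE[OF g] by (metis DERIV_unique real_differentiable_def)
  moreover have "(t - 0) * (\<Sum>i\<in>UNIV. E (partial i g) s) \<le> t * (\<Sum>i\<in>UNIV. E (partial i g) t)"
    using t mono[OF bsmooth_partial[OF g] s(1,2)] by (auto intro!: mult_left_mono sum_mono)
  ultimately have "E g t - (A t)\<^sup>2 \<le> t * (\<Sum>i\<in>UNIV. E (partial i g) t)" by simp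
  then show ?thesis
    unfolding E_def A_def mild_at_terminal[OF t Z] .
qed

section \<open>Variance of the gradient for smooth data\<close>

context
  fixes F :: "real \<times> (real^'n::finite) => real" and \<eta> :: "real^'n => real" and T :: real and x0 :: "real^'n"
  assumes T: "T > 0" and F: "test_function (cylinder T) F" and \<eta>: "bsmooth \<eta>"
begin

lemma bsmooth_data:
  "bsmooth F" "bsmooth (dx i F)" "bsmooth (dx j (dx i F))"
  "bsmooth \<eta>" "bsmooth (partial i \<eta>)" "bsmooth (partial j (partial i \<eta>))"
  by (intro testfun_bsmooth[OF F] bsmooth_spatial_partial \<eta> bsmooth_partial)+

lemma bsmooth_mild_data:
  "bsmooth (mild T F \<eta> t)" "bsmooth (mild T (dx i F) (partial i \<eta>) t)"
  "bsmooth (mild T (dx j (dx i F)) (partial j (partial i \<eta>)) t)"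
  using T by (intro bsmooth_mild bsmooth_data; simp)+

lemma sqint_mild_grad:
  "L2 gauss (\<lambda>z. mild_grad T F \<eta> t (x0 + sqrt t *\<^sub>R z))"
  unfolding mild_grad_def
  by (intro sqint_vec_lambda bsmooth_square_integrable bsmooth_mild_data)

lemma mild_mean_component:
  "mild_mean T F \<eta> x0 t $ i = (LINT z|gauss. mild T (dx i F) (partial i \<eta>) t (x0 + sqrt t *\<^sub>R z))"
  unfolding mild_mean_def
    integral_vec_component[OF sqint_integrable[OF gauss.finite_measure_axioms sqint_mild_grad]]
  by (simp add: mild_grad_def)

lemma mild_hess_symmetric: "mild_hess T F \<eta> t x $ i $ j = mild_hess T F \<eta> t x $ j $ i"
proof -
  have "dx i (dx j F) = dx j (dx i F)"
    "partial i (partial j \<eta>) = partial j (partial i \<eta>)"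
    using dir_deriv_commute[OF bsmoothD[OF bsmooth_data(1)]] dir_deriv_commute[OF bsmoothD[OF \<eta>]]
    by (auto simp: partial_eq dx_eq fun_eq_iff)
  then show ?thesis by (simp add: mild_hess_def)
qed

lemma integral_norm2_mild_hess:
  "(LINT z|gauss. (norm (mild_hess T F \<eta> t (x0 + sqrt t *\<^sub>R z)))\<^sup>2)
   = (\<Sum>i\<in>UNIV. \<Sum>j\<in>UNIV. LINT z|gauss. (mild T (dx i (dx j F)) (partial i (partial j \<eta>)) t (x0 + sqrt t *\<^sub>R z))\<^sup>2)"
  unfolding power2_norm_matrix mild_hess_def
  using sqint_norm2[OF bsmooth_square_integrable[OF bsmooth_mild_data(3)]] by simp

lemma mild_var_eq:
  "mild_var T F \<eta> x0 t = (\<Sum>i\<in>UNIV. (LINT z|gauss. (mild T (dx i F) (partial i \<eta>) t (x0 + sqrt t *\<^sub>R z))\<^sup>2)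
     - (LINT z|gauss. mild T (dx i F) (partial i \<eta>) t (x0 + sqrt t *\<^sub>R z))\<^sup>2)"
  unfolding mild_var_def gauss.vec_variance_vec[OF sqint_mild_grad]
  by (simp add: mild_grad_def)

text \<open>Poincare applied to each component of the gradient, summed over components. The factor
  \<open>t\<close> is what later absorbs the singular \<open>1 / t\<close> in the norm of the
  operator.\<close>

lemma mild_var_le:
  assumes t: "t > 0"
  shows "mild_var T F \<eta> x0 t \<le> t * (LINT z|gauss. (norm (mild_hess T F \<eta> t (x0 + sqrt t *\<^sub>R z)))\<^sup>2)"
proof -
  have "mild_var T F \<eta> x0 t \<le> (\<Sum>i\<in>UNIV. t * (\<Sum>j\<in>UNIV. LINT z|gauss.
      (mild T (dx j (dx i F)) (partial j (partial i \<eta>)) t (x0 + sqrt t *\<^sub>R z))\<^sup>2))"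
    unfolding mild_var_eq
  proof (rule sum_mono)
    fix i
    show "(LINT z|gauss. (mild T (dx i F) (partial i \<eta>) t (x0 + sqrt t *\<^sub>R z))\<^sup>2)
     - (LINT z|gauss. mild T (dx i F) (partial i \<eta>) t (x0 + sqrt t *\<^sub>R z))\<^sup>2
     \<le> t * (\<Sum>j\<in>UNIV. LINT z|gauss.
      (mild T (dx j (dx i F)) (partial j (partial i \<eta>)) t (x0 + sqrt t *\<^sub>R z))\<^sup>2)"
      using gaussian_poincare[OF bsmooth_mild_data(2)[of i t] t, of x0]
      unfolding partial_mild[OF bsmooth_data(2,5)] .
  qed
  also have "\<dots> = t * (LINT z|gauss. (norm (mild_hess T F \<eta> t (x0 + sqrt t *\<^sub>R z)))\<^sup>2)"
    unfolding integral_norm2_mild_hess sum_distrib_left[symmetric]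
    by (subst sum.swap) (rule refl)
  finally show ?thesis .
qed

text \<open>In the coordinate \<open>z\<close> the operator, multiplied by \<open>sqrt t\<close>, is
  the Gaussian divergence of the centred gradient. Bochner then gives \<open>t\<close> times the
  squared Hessian, from the two inner factors \<open>sqrt t\<close>, plus the variance as the term
  of order zero.\<close>

lemma mild_AQ_norm2:
  assumes t: "t > 0"
  shows "(LINT z|gauss. (mild_AQ T F \<eta> x0 t (x0 + sqrt t *\<^sub>R z))\<^sup>2)
     = (LINT z|gauss. (norm (mild_hess T F \<eta> t (x0 + sqrt t *\<^sub>R z)))\<^sup>2) + mild_var T F \<eta> x0 t / t"
    and "integrable gauss (\<lambda>z. (mild_AQ T F \<eta> x0 t (x0 + sqrt t *\<^sub>R z))\<^sup>2)"
proof -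
  let ?u = "\<lambda>i. mild T (dx i F) (partial i \<eta>) t"
  let ?uu = "\<lambda>j i. mild T (dx j (dx i F)) (partial j (partial i \<eta>)) t"
  let ?s = "sqrt t"
  \<comment> \<open>Centring by the mean gradient is the effect of the affine projection; it makes
    the term of order zero in Bochner's formula a variance instead of a second moment.\<close>
  define a where "a i z = ?u i (x0 + ?s *\<^sub>R z) - mild_mean T F \<eta> x0 t $ i" for i and z :: "real^'n"
  have b0: "bsmooth (\<lambda>z. ?u i (x0 + ?s *\<^sub>R z))" for i
    by (rule bsmooth_affine[OF bounded_linear_scaleR_right bsmooth_mild_data(2)])
  have pu: "partial j (\<lambda>z. ?u i (x0 + ?s *\<^sub>R z)) z = ?s * ?uu j i (x0 + ?s *\<^sub>R z)" for i j z
  proof -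
    have "dir_deriv (axis j 1) (\<lambda>z. ?u i (x0 + ?s *\<^sub>R z)) z = dir_deriv (?s *\<^sub>R axis j 1) (?u i) (x0 + ?s *\<^sub>R z)"
      by (rule dir_deriv_affine[OF bounded_linear_scaleR_right smooth_differentiable[OF bsmoothD[OF bsmooth_mild_data(2)]]])
    also have "\<dots> = ?s * partial j (?u i) (x0 + ?s *\<^sub>R z)"
      using linear_cmul[OF dir_deriv_linear[OF bsmoothD[OF bsmooth_mild_data(2)]]]
      by (simp add: partial_eq)
    finally show ?thesis unfolding partial_mild[OF bsmooth_data(2,5)] by (simp add: partial_eq)
  qed
  have ba: "bsmooth (a i)" for i
  proof (rule bsmoothI_derivative)
    have d: "(a i has_derivative (\<lambda>v. dir_deriv v (\<lambda>z. ?u i (x0 + ?s *\<^sub>R z)) z)) (at z)" for z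
      using has_derivative_diff[OF smooth_has_derivative[OF bsmoothD[OF b0[of i]]] has_derivative_const]
      by (simp add: a_def[abs_def])
    then show "a i differentiable (at z)" for z by (rule differentiableI)
    show "bsmooth (dir_deriv v (a i))" for v
      unfolding dir_deriv_cong_has_derivative[OF d] by (rule bsmooth_dir_deriv[OF b0])
    obtain C where "\<And>z. \<bar>?u i (x0 + ?s *\<^sub>R z)\<bar> \<le> C" using bsmooth_bounded[OF b0[of i]] by blast
    then have "\<bar>a i z\<bar> \<le> C + \<bar>mild_mean T F \<eta> x0 t $ i\<bar>" for z
      unfolding a_def by (meson abs_triangle_ineq4 add_mono order.trans order_refl)
    then show "\<exists>C. \<forall>x. \<bar>a i x\<bar> \<le> C" by blast
  qed
  have pa: "partial j (a i) z = ?s * ?uu j i (x0 + ?s *\<^sub>R z)" for i j z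
  proof -
    have "(a i has_derivative (\<lambda>v. dir_deriv v (\<lambda>z. ?u i (x0 + ?s *\<^sub>R z)) z)) (at z)"
      using has_derivative_diff[OF smooth_has_derivative[OF bsmoothD[OF b0[of i]]] has_derivative_const]
      by (simp add: a_def[abs_def])
    from dir_derivI[OF this] show ?thesis unfolding pu[symmetric] by (simp add: partial_eq)
  qed
  have eq: "?s * mild_AQ T F \<eta> x0 t (x0 + ?s *\<^sub>R z) = (\<Sum>i\<in>UNIV. partial i (a i) z - z $ i * a i z)" for z
  proof -
    have "((x0 + ?s *\<^sub>R z - x0) \<bullet> (mild_grad T F \<eta> t (x0 + ?s *\<^sub>R z) - mild_mean T F \<eta> x0 t)) / t
       = (\<Sum>i\<in>UNIV. z $ i * a i z) / ?s"
    proof -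
      have "((x0 + ?s *\<^sub>R z - x0) \<bullet> (mild_grad T F \<eta> t (x0 + ?s *\<^sub>R z) - mild_mean T F \<eta> x0 t)) / t
         = (?s / t) * (z \<bullet> (mild_grad T F \<eta> t (x0 + ?s *\<^sub>R z) - mild_mean T F \<eta> x0 t))"
        by simp
      also have "?s / t = 1 / ?s" using t real_div_sqrt[of t] by (simp add: field_simps)
      finally show ?thesis by (simp add: inner_vec_def mild_grad_def a_def)
    qed
    then show ?thesis
      using t by (simp add: mild_AQ_def mild_hess_def pa sum_subtractf sum_distrib_left[symmetric] algebra_simps)
  qed
  have eq2: "(mild_AQ T F \<eta> x0 t (x0 + ?s *\<^sub>R z))\<^sup>2 = (\<Sum>i\<in>UNIV. partial i (a i) z - z $ i * a i z)\<^sup>2 / t" for z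
    unfolding eq[symmetric] using t by (simp add: power_mult_distrib)
  show "integrable gauss (\<lambda>z. (mild_AQ T F \<eta> x0 t (x0 + ?s *\<^sub>R z))\<^sup>2)"
    unfolding eq2 by (intro integrable_divide bochner_gauss(2) ba)
  have v: "(\<Sum>i\<in>UNIV. LINT z|gauss. (a i z)\<^sup>2) = mild_var T F \<eta> x0 t"
  proof -
    have "mild_var T F \<eta> x0 t = (LINT z|gauss. (\<Sum>i\<in>UNIV. (a i z)\<^sup>2))"
      unfolding mild_var_def vec_variance_def mild_mean_def[symmetric] power2_norm_vec
      by (simp add: mild_grad_def a_def)
    also have "\<dots> = (\<Sum>i\<in>UNIV. LINT z|gauss. (a i z)\<^sup>2)"
      using sqint_norm2[OF bsmooth_square_integrable[OF ba, where x=0 and c=1]] by simp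
    finally show ?thesis ..
  qed
  have h: "(\<Sum>i\<in>UNIV. \<Sum>j\<in>UNIV. LINT z|gauss. partial j (a i) z * partial i (a j) z)
     = t * (LINT z|gauss. (norm (mild_hess T F \<eta> t (x0 + ?s *\<^sub>R z)))\<^sup>2)"
  proof -
    have "?uu j i x * ?uu i j x = (?uu i j x)\<^sup>2" for i j x
      using mild_hess_symmetric[of t x i j] by (simp add: mild_hess_def power2_eq_square)
    note sym = this
    have "partial j (a i) z * partial i (a j) z = t * (?uu i j (x0 + ?s *\<^sub>R z))\<^sup>2" for i j z
    proof -
      have "partial j (a i) z * partial i (a j) z = (?s * ?s) * (?uu j i (x0 + ?s *\<^sub>R z) * ?uu i j (x0 + ?s *\<^sub>R z))"
        unfolding pa by (simp only: ac_simps)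
      then show ?thesis unfolding sym using t by simp
    qed
    then show ?thesis unfolding integral_norm2_mild_hess by (simp add: sum_distrib_left)
  qed
  show "(LINT z|gauss. (mild_AQ T F \<eta> x0 t (x0 + ?s *\<^sub>R z))\<^sup>2)
     = (LINT z|gauss. (norm (mild_hess T F \<eta> t (x0 + ?s *\<^sub>R z)))\<^sup>2) + mild_var T F \<eta> x0 t / t"
    unfolding eq2 using bochner_gauss(1)[of a, OF ba] t unfolding h v by (simp add: add_divide_distrib)
qed

lemma mild_AQ_norm2_le:
  assumes t: "t > 0"
  shows "(LINT z|gauss. (mild_AQ T F \<eta> x0 t (x0 + sqrt t *\<^sub>R z))\<^sup>2)
     \<le> 2 * (LINT z|gauss. (norm (mild_hess T F \<eta> t (x0 + sqrt t *\<^sub>R z)))\<^sup>2)"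
  using mild_AQ_norm2(1)[OF t] mild_var_le[OF t] t by (simp add: divide_le_eq mult.commute)

lemma continuous_on_mild_var: "continuous_on S (mild_var T F \<eta> x0)"
  unfolding mild_var_eq[abs_def]
  using T by (intro continuous_intros continuous_on_mild_moment bsmooth_data) auto

text \<open>At time 0 the scaling \<open>sqrt 0\<close> collapses the law to a point, so the energy
  identity has no contribution from the lower endpoint.\<close>

lemma mild_var_0: "mild_var T F \<eta> x0 0 = 0"
  unfolding mild_var_eq by simp

lemma mild_var_T: "mild_var T F \<eta> x0 T = vec_variance gauss (\<lambda>z. grad \<eta> (x0 + sqrt T *\<^sub>R z))"
  unfolding mild_var_def mild_grad_def grad_def
  by (simp add: mild_at_terminal[OF T testfun_spatial_partial[OF F]])

text \<open>The gradient components are mild solutions with differentiated data, so their means and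
  second moments evolve by \<open>mild_quadratic_evolution\<close> with source
  \<open>dx i F\<close>. Gaussian integration by parts then takes the derivative off
  \<open>F\<close> and reproduces the operator.\<close>

lemma mild_var_derivative:
  assumes t: "0 < t" "t < T"
  shows "(mild_var T F \<eta> x0 has_real_derivative
     (LINT z|gauss. (norm (mild_hess T F \<eta> t (x0 + sqrt t *\<^sub>R z)))\<^sup>2)
     + 2 * (LINT z|gauss. F (t, x0 + sqrt t *\<^sub>R z) * mild_AQ T F \<eta> x0 t (x0 + sqrt t *\<^sub>R z))) (at t)"
proof -
  let ?u = "\<lambda>i t. mild T (dx i F) (partial i \<eta>) t"
  let ?uu = "\<lambda>j i. mild T (dx j (dx i F)) (partial j (partial i \<eta>)) t"
  let ?s = "sqrt t"
  let ?y = "\<lambda>z. x0 + ?s *\<^sub>R z"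
  define m where "m = mild_mean T F \<eta> x0 t"
  have s: "?s > 0" using t by simp
  \<comment> \<open>Freezing time makes the source a smooth bounded function of space, to which
    Stein's identity applies.\<close>
  define Ft where "Ft y = F (t, y)" for y
  have bl: "bounded_linear (\<lambda>y. (0::real, y::real^'n))"
    by (rule bounded_linear_Pair[OF bounded_linear_zero bounded_linear_ident])
  have Ft: "Ft = (\<lambda>y. F ((t, 0) + (0, y)))" by (simp add: Ft_def fun_eq_iff)
  have bF: "bsmooth Ft" unfolding Ft by (rule bsmooth_affine[OF bl bsmooth_data(1)])
  have pF: "partial i Ft y = dx i F (t, y)" for i y
  proof -
    have "dir_deriv (axis i 1) (\<lambda>y. F ((t, 0) + (0, y))) y = dir_deriv (0, axis i 1) F ((t, 0) + (0, y))"
      by (rule dir_deriv_affine[OF bl smooth_differentiable[OF bsmoothD[OF bsmooth_data(1)]]])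
    then show ?thesis by (simp add: Ft partial_eq dx_eq)
  qed
  have bu: "bsmooth (\<lambda>y. ?u i t y)" for i by (rule bsmooth_mild_data(2))
  have pu: "partial i (\<lambda>y. ?u i t y) y = ?uu i i y" for i y
    by (simp add: partial_mild[OF bsmooth_data(2,5)])
  have pFu: "partial i (\<lambda>y. Ft y * ?u i t y) y = F (t, y) * ?uu i i y + ?u i t y * dx i F (t, y)" for i y
    using dir_deriv_mult[OF smooth_differentiable[OF bsmoothD[OF bF]] smooth_differentiable[OF bsmoothD[OF bu]]]
    by (simp add: pF[unfolded partial_eq] pu[unfolded partial_eq] partial_eq Ft_def)
  have i1: "integrable gauss (\<lambda>z. ?u i t (?y z) * dx i F (t, ?y z))" for i
    using integrable_heat_terminal[OF bsmooth_mult[OF bu[of i] bsmooth_partial[OF bF, of i]], where x=x0 and c="?s"] by (simp add: pF)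
  have i2: "integrable gauss (\<lambda>z. dx i F (t, ?y z))" for i
    using integrable_heat_terminal[OF bsmooth_partial[OF bF, of i], where x=x0 and c="?s"] by (simp add: pF)
  have i3: "integrable gauss (\<lambda>z. F (t, ?y z) * ?uu i i (?y z))" for i
    using integrable_heat_terminal[OF bsmooth_mult[OF bF bsmooth_mild_data(3)[of i i t]], where x=x0 and c="?s"] by (simp add: Ft_def)
  have i4: "integrable gauss (\<lambda>z. (?u i t (?y z) - m $ i) * dx i F (t, ?y z))" for i
    using i1[of i] i2[of i] by (simp add: left_diff_distrib)
  have e1: "(LINT z|gauss. (?u i t (?y z) - m $ i) * dx i F (t, ?y z))
     = (LINT z|gauss. ?u i t (?y z) * dx i F (t, ?y z)) - m $ i * (LINT z|gauss. dx i F (t, ?y z))" for i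
    using i1[of i] i2[of i] by (simp add: left_diff_distrib)
  have st: "(LINT z|gauss. z $ i * (F (t, ?y z) * (?u i t (?y z) - m $ i)))
      = ?s * ((LINT z|gauss. (?u i t (?y z) - m $ i) * dx i F (t, ?y z)) + (LINT z|gauss. F (t, ?y z) * ?uu i i (?y z)))"
    "integrable gauss (\<lambda>z. z $ i * (F (t, ?y z) * (?u i t (?y z) - m $ i)))" for i
  proof -
    note A = stein_bsmooth[OF bsmooth_mult[OF bF bu], where i=i and x=x0 and s="?s"]
      and B = stein_bsmooth[OF bF, where i=i and x=x0 and s="?s"]
    have e: "(\<lambda>z. z $ i * (F (t, ?y z) * (?u i t (?y z) - m $ i))) = (\<lambda>z. z $ i * (Ft (?y z) * ?u i t (?y z)) - m $ i * (z $ i * Ft (?y z)))"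
      by (simp add: fun_eq_iff Ft_def algebra_simps)
    show "integrable gauss (\<lambda>z. z $ i * (F (t, ?y z) * (?u i t (?y z) - m $ i)))"
      unfolding e by (intro Lintegrable_diff integrable_mult_right A(2) B(2))
    have "(LINT z|gauss. z $ i * (F (t, ?y z) * (?u i t (?y z) - m $ i)))
       = (LINT z|gauss. z $ i * (Ft (?y z) * ?u i t (?y z))) - m $ i * (LINT z|gauss. z $ i * Ft (?y z))"
      unfolding e using A(2) B(2) by simp
    then show "(LINT z|gauss. z $ i * (F (t, ?y z) * (?u i t (?y z) - m $ i)))
      = ?s * ((LINT z|gauss. (?u i t (?y z) - m $ i) * dx i F (t, ?y z)) + (LINT z|gauss. F (t, ?y z) * ?uu i i (?y z)))"
      unfolding A(1) B(1) pFu pF e1 using i1[of i] i3[of i] by (simp add: algebra_simps)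
  qed
  have AQ: "F (t, ?y z) * mild_AQ T F \<eta> x0 t (?y z)
     = (\<Sum>i\<in>UNIV. F (t, ?y z) * ?uu i i (?y z) - z $ i * (F (t, ?y z) * (?u i t (?y z) - m $ i)) / ?s)" for z
  proof -
    have "((?y z - x0) \<bullet> (mild_grad T F \<eta> t (?y z) - m)) / t = (\<Sum>i\<in>UNIV. z $ i * (?u i t (?y z) - m $ i) / ?s)"
    proof -
      have "((?y z - x0) \<bullet> (mild_grad T F \<eta> t (?y z) - m)) / t = (?s / t) * (z \<bullet> (mild_grad T F \<eta> t (?y z) - m))"
        by simp
      also have "?s / t = 1 / ?s" using t real_div_sqrt[of t] by (simp add: field_simps)
      finally show ?thesis by (simp add: inner_vec_def mild_grad_def sum_divide_distrib)
    qed
    then show ?thesis unfolding mild_AQ_def m_def[symmetric]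
      by (simp add: mild_hess_def sum_subtractf sum_distrib_left right_diff_distrib mult.left_commute)
  qed
  \<comment> \<open>The trace of the Hessian in the operator cancels against the Hessian term of the
    product rule in \<open>st\<close>; what is left is minus the source term of the evolution of the
    variance.\<close>
  have FAQ: "(LINT z|gauss. F (t, ?y z) * mild_AQ T F \<eta> x0 t (?y z))
      = - (\<Sum>i\<in>UNIV. LINT z|gauss. (?u i t (?y z) - m $ i) * dx i F (t, ?y z))"
  proof -
    have "(LINT z|gauss. F (t, ?y z) * mild_AQ T F \<eta> x0 t (?y z))
      = (\<Sum>i\<in>UNIV. (LINT z|gauss. F (t, ?y z) * ?uu i i (?y z)) - (LINT z|gauss. z $ i * (F (t, ?y z) * (?u i t (?y z) - m $ i))) / ?s)"
      unfolding AQ using i3 st(2) by simp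
    also have "\<dots> = (\<Sum>i\<in>UNIV. - (LINT z|gauss. (?u i t (?y z) - m $ i) * dx i F (t, ?y z)))"
      unfolding st(1) using i3 i4 s by simp
    finally show ?thesis by (simp add: sum_negf)
  qed
  have q2: "((\<lambda>s. LINT z|gauss. (?u i s (x0 + sqrt s *\<^sub>R z))\<^sup>2) has_real_derivative
     (\<Sum>j\<in>UNIV. LINT z|gauss. (?uu j i (?y z))\<^sup>2) - 2 * (LINT z|gauss. ?u i t (?y z) * dx i F (t, ?y z))) (at t)" for i
    using mild_quadratic_evolution[OF testfun_spatial_partial[OF F] bsmooth_data(5) t, where ?x0.0=x0 and a=1 and b=0, of i i]
      i1[of i] sqint_norm2[OF bsmooth_square_integrable[OF bsmooth_mild_data(3)]]
    by (simp add: mult.assoc)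
  have q1: "((\<lambda>s. LINT z|gauss. ?u i s (x0 + sqrt s *\<^sub>R z)) has_real_derivative
     - (LINT z|gauss. dx i F (t, ?y z))) (at t)" for i
    using mild_quadratic_evolution[OF testfun_spatial_partial[OF F] bsmooth_data(5) t, where ?x0.0=x0 and a=0 and b=1, of i i] by simp
  have "(mild_var T F \<eta> x0 has_real_derivative (\<Sum>i\<in>UNIV.
      ((\<Sum>j\<in>UNIV. LINT z|gauss. (?uu j i (?y z))\<^sup>2) - 2 * (LINT z|gauss. ?u i t (?y z) * dx i F (t, ?y z)))
      - 2 * (- (LINT z|gauss. dx i F (t, ?y z))) * m $ i)) (at t)"
  proof -
    have "((\<lambda>s. (LINT z|gauss. ?u i s (x0 + sqrt s *\<^sub>R z))\<^sup>2) has_real_derivative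
       2 * (- (LINT z|gauss. dx i F (t, ?y z))) * m $ i) (at t)" for i
      using DERIV_power[OF q1[of i], of 2] by (simp add: m_def mild_mean_component mult.assoc)
    then show ?thesis
      unfolding mild_var_eq[abs_def] by (intro DERIV_sum DERIV_diff q2)
  qed
  moreover have "(\<Sum>i\<in>UNIV.
      ((\<Sum>j\<in>UNIV. LINT z|gauss. (?uu j i (?y z))\<^sup>2) - 2 * (LINT z|gauss. ?u i t (?y z) * dx i F (t, ?y z)))
      - 2 * (- (LINT z|gauss. dx i F (t, ?y z))) * m $ i)
     = (LINT z|gauss. (norm (mild_hess T F \<eta> t (?y z)))\<^sup>2) + 2 * (LINT z|gauss. F (t, ?y z) * mild_AQ T F \<eta> x0 t (?y z))"
  proof -
    have e2: "(LINT z|gauss. (norm (mild_hess T F \<eta> t (?y z)))\<^sup>2) = (\<Sum>i\<in>UNIV. \<Sum>j\<in>UNIV. LINT z|gauss. (?uu j i (?y z))\<^sup>2)"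
      unfolding integral_norm2_mild_hess by (rule sum.swap)
    show ?thesis unfolding FAQ e1 e2
      by (simp add: sum_subtractf sum.distrib sum_distrib_left algebra_simps)
  qed
  ultimately show ?thesis by simp
qed

end

subsection \<open>The occupation measure as an image of a product measure\<close>

text \<open>The time factor of the occupation measure: \<open>nu\<close> is the image of
  \<open>wt\<close> times \<open>gauss\<close> under \<open>occ_map\<close>.\<close>

definition wt :: "real => real => real measure" where
  "wt T \<beta> = density (restrict_space lborel {0<..<T}) (\<lambda>t. ennreal (rfac T \<beta> t))"

definition occ_map :: "real^'n::finite => real \<times> (real^'n) => real \<times> (real^'n)" where
  "occ_map x0 p = (fst p, x0 + sqrt (fst p) *\<^sub>R snd p)"

lemma rfac_measurable [measurable]: "rfac T \<beta> \<in> borel_measurable borel"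
  unfolding rfac_def[abs_def] by measurable

lemma rfac_pos: "0 < rfac T \<beta> t" by (simp add: rfac_def)

lemma rfac_nonneg [simp]: "0 \<le> rfac T \<beta> t" by (simp add: rfac_def)

lemma rfac_le_1: "\<beta> > 0 ==> t \<le> T ==> rfac T \<beta> t \<le> 1" by (simp add: rfac_def)

lemma space_wt [simp]: "space (wt T \<beta>) = {0<..<T}"
  by (simp add: wt_def space_restrict_space)

lemma sets_wt [measurable_cong]: "sets (wt T \<beta>) = sets (restrict_space borel {0<..<T})"
  by (simp add: wt_def sets_restrict_space)

lemma nn_integral_wt:
  assumes [measurable]: "f \<in> borel_measurable borel"
  shows "(\<integral>\<^sup>+t. f t \<partial>wt T \<beta>) = (\<integral>\<^sup>+t. ennreal (rfac T \<beta> t) * f t * indicator {0<..<T} t \<partial>lborel)"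
  unfolding wt_def
  by (subst nn_integral_density) (auto simp: nn_integral_restrict_space intro!: measurable_restrict_space1)

lemma finite_measure_wt:
  assumes "T > 0" "\<beta> > 0" shows "finite_measure (wt T \<beta>)"
proof (rule finite_measureI)
  have "emeasure (wt T \<beta>) (space (wt T \<beta>)) = (\<integral>\<^sup>+t. 1 \<partial>wt T \<beta>)" by simp
  also have "\<dots> \<le> (\<integral>\<^sup>+t. indicator {0<..<T} t \<partial>lborel)"
    unfolding nn_integral_wt[OF borel_measurable_const]
    using assms by (intro nn_integral_mono) (auto split: split_indicator simp: rfac_le_1)
  also have "\<dots> < \<infinity>" using assms by simp
  finally show "emeasure (wt T \<beta>) (space (wt T \<beta>)) \<noteq> \<infinity>" by simp
qed

lemma cylinder_borel [measurable]: "cylinder T \<in> sets borel"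
  unfolding cylinder_def by (intro borel_open open_Times) auto

lemma space_nu [simp]: "space (nu T x0 \<beta>) = cylinder T"
  by (simp add: nu_def space_restrict_space)

lemma sets_nu [measurable_cong]: "sets (nu T x0 \<beta>) = sets (restrict_space borel (cylinder T))"
  by (simp add: nu_def sets_restrict_space)

lemma nu_measurableI: "f \<in> borel_measurable borel ==> f \<in> borel_measurable (nu T x0 \<beta>)"
  unfolding measurable_cong_sets[OF sets_nu refl] by (rule measurable_restrict_space1)

lemma occ_map_measurable:
  "occ_map x0 \<in> (wt T \<beta> \<Otimes>\<^sub>M gauss) \<rightarrow>\<^sub>M restrict_space borel (cylinder T)"
proof (rule measurable_restrict_space2)
  show "occ_map x0 \<in> space (wt T \<beta> \<Otimes>\<^sub>M gauss) \<rightarrow> cylinder T"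
    by (auto simp: occ_map_def cylinder_def space_pair_measure)
  have [measurable]: "(\<lambda>t. t) \<in> wt T \<beta> \<rightarrow>\<^sub>M borel"
    unfolding measurable_cong_sets[OF sets_wt refl] by (rule measurable_restrict_space1) simp
  have [measurable]: "fst \<in> (wt T \<beta> \<Otimes>\<^sub>M gauss) \<rightarrow>\<^sub>M borel"
    using measurable_compose[OF measurable_fst \<open>(\<lambda>t. t) \<in> wt T \<beta> \<rightarrow>\<^sub>M borel\<close>] by simp
  have [measurable]: "snd \<in> (wt T \<beta> \<Otimes>\<^sub>M gauss) \<rightarrow>\<^sub>M borel"
    by (rule measurable_snd'') simp
  show "occ_map x0 \<in> borel_measurable (wt T \<beta> \<Otimes>\<^sub>M gauss)"
    unfolding occ_map_def[abs_def] borel_prod[symmetric] by measurable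
qed

text \<open>This turns integrals over \<open>nu\<close> into iterated integrals with a
  time-independent inner measure, the form in which the identities at fixed time are
  available.\<close>

lemma nu_eq_distr:
  fixes x0 :: "real^'n::finite"
  shows "nu T x0 \<beta> = distr (wt T \<beta> \<Otimes>\<^sub>M gauss) (restrict_space borel (cylinder T)) (occ_map x0)"
proof (rule measure_eqI)
  show "sets (nu T x0 \<beta>) = sets (distr (wt T \<beta> \<Otimes>\<^sub>M gauss) (restrict_space borel (cylinder T)) (occ_map x0))"
    by (simp add: sets_nu)
  fix A assume "A \<in> sets (nu T x0 \<beta>)"
  then have A: "A \<in> sets (restrict_space borel (cylinder T))" by (simp add: sets_nu)
  then have A'[measurable]: "A \<in> sets borel" and Ac: "A \<subseteq> cylinder T"
    by (auto simp: sets_restrict_space_iff)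
  have [measurable]: "(\<lambda>q. ennreal (gauss_density x0 (fst q) (snd q))) \<in> borel_measurable (borel :: (real \<times> (real^'n)) measure)"
    unfolding gauss_density_def borel_prod[symmetric] by measurable
  have [measurable]: "A \<in> sets (borel \<Otimes>\<^sub>M borel)"
    unfolding borel_prod by (rule A')
  have [measurable]: "A \<in> sets (lborel \<Otimes>\<^sub>M lborel)"
    unfolding lborel_prod sets_lborel by (rule A')
  have [measurable]: "(\<lambda>q. ennreal (gauss_density x0 (fst q) (snd q))) \<in> borel_measurable ((borel :: real measure) \<Otimes>\<^sub>M (borel :: (real^'n) measure))"
    unfolding gauss_density_def by measurable
  have [measurable]: "(\<lambda>q. ennreal (rfac T \<beta> (fst q))) \<in> borel_measurable (borel :: (real \<times> (real^'n)) measure)"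
    unfolding borel_prod[symmetric] by measurable
  let ?I = "\<lambda>t x. indicator A (t, x) :: ennreal"
  have IA: "?I t x = ?I t x * indicator {0<..<T} t" for t x
    using Ac by (auto split: split_indicator simp: cylinder_def)
  have inner: "(\<integral>\<^sup>+x. ennreal (gauss_density x0 t x) * ?I t x \<partial>lborel) = (\<integral>\<^sup>+z. ?I t (x0 + sqrt t *\<^sub>R z) \<partial>gauss)" if "t > 0" for t
  proof -
    have "(\<integral>\<^sup>+x. ennreal (gauss_density x0 t x) * ?I t x \<partial>lborel) = (\<integral>\<^sup>+x. ?I t x \<partial>density lborel (\<lambda>x. ennreal (gauss_density x0 t x)))"
      by (subst nn_integral_density) auto
    also have "\<dots> = (\<integral>\<^sup>+z. ?I t (x0 + sqrt t *\<^sub>R z) \<partial>gauss)"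
      unfolding distr_gauss_affine[OF that, symmetric] by (subst nn_integral_distr) auto
    finally show ?thesis .
  qed
  have "emeasure (nu T x0 \<beta>) A = (\<integral>\<^sup>+q. ennreal (rfac T \<beta> (fst q) * gauss_density x0 (fst q) (snd q)) * indicator A q \<partial>restrict_space lborel (cylinder T))"
    unfolding nu_def using A
    by (subst emeasure_density)
      (auto simp: case_prod_beta' sets_restrict_space_iff ennreal_mult intro!: measurable_restrict_space1)
  also have "\<dots> = (\<integral>\<^sup>+q. ennreal (rfac T \<beta> (fst q)) * ennreal (gauss_density x0 (fst q) (snd q)) * indicator A q \<partial>lborel)"
    using Ac by (subst nn_integral_restrict_space)
      (auto simp: ennreal_mult intro!: nn_integral_cong split: split_indicator)
  also have "\<dots> = (\<integral>\<^sup>+q. ennreal (rfac T \<beta> (fst q)) * ennreal (gauss_density x0 (fst q) (snd q)) * indicator A q \<partial>(lborel \<Otimes>\<^sub>M lborel))"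
    by (simp add: lborel_prod)
  also have "\<dots> = (\<integral>\<^sup>+t. \<integral>\<^sup>+x. ennreal (rfac T \<beta> t) * (ennreal (gauss_density x0 t x) * ?I t x) \<partial>lborel \<partial>lborel)"
    by (subst lborel.nn_integral_fst[symmetric]) (auto simp: mult.assoc)
  also have "\<dots> = (\<integral>\<^sup>+t. ennreal (rfac T \<beta> t) * (\<integral>\<^sup>+x. ennreal (gauss_density x0 t x) * ?I t x \<partial>lborel) \<partial>lborel)"
    by (intro nn_integral_cong nn_integral_cmult) auto
  also have "\<dots> = (\<integral>\<^sup>+t. ennreal (rfac T \<beta> t) * (\<integral>\<^sup>+z. ?I t (x0 + sqrt t *\<^sub>R z) \<partial>gauss) * indicator {0<..<T} t \<partial>lborel)"
  proof (rule nn_integral_cong)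
    fix t :: real
    show "ennreal (rfac T \<beta> t) * (\<integral>\<^sup>+x. ennreal (gauss_density x0 t x) * ?I t x \<partial>lborel)
      = ennreal (rfac T \<beta> t) * (\<integral>\<^sup>+z. ?I t (x0 + sqrt t *\<^sub>R z) \<partial>gauss) * indicator {0<..<T} t"
    proof (cases "t \<in> {0<..<T}")
      case True then show ?thesis using inner[of t] by simp
    next
      case False
      then have "?I t x = 0" for x using IA[of t x] by simp
      with False show ?thesis by simp
    qed
  qed
  also have "\<dots> = (\<integral>\<^sup>+t. (\<integral>\<^sup>+z. ?I t (x0 + sqrt t *\<^sub>R z) \<partial>gauss) \<partial>wt T \<beta>)"
  proof (rule nn_integral_wt[symmetric])
    show "(\<lambda>t. \<integral>\<^sup>+z. ?I t (x0 + sqrt t *\<^sub>R z) \<partial>gauss) \<in> borel_measurable borel"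
      by (intro gauss.borel_measurable_nn_integral) measurable
  qed
  also have "\<dots> = (\<integral>\<^sup>+p. indicator A (occ_map x0 p) \<partial>(wt T \<beta> \<Otimes>\<^sub>M gauss))"
  proof -
    have "(\<lambda>p. indicator A (occ_map x0 p) :: ennreal) \<in> borel_measurable (wt T \<beta> \<Otimes>\<^sub>M gauss)"
      by (rule measurable_compose[OF occ_map_measurable borel_measurable_indicator[OF A]])
    from gauss.nn_integral_fst[OF this] show ?thesis by (simp add: occ_map_def)
  qed
  also have "\<dots> = emeasure (distr (wt T \<beta> \<Otimes>\<^sub>M gauss) (restrict_space borel (cylinder T)) (occ_map x0)) A"
    using A by (subst nn_integral_indicator[symmetric], simp, subst nn_integral_distr[OF occ_map_measurable]) auto
  finally show "emeasure (nu T x0 \<beta>) A = emeasure (distr (wt T \<beta> \<Otimes>\<^sub>M gauss) (restrict_space borel (cylinder T)) (occ_map x0)) A" .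
qed

lemma nu_measurable_occ:
  "f \<in> borel_measurable (nu T x0 \<beta>) ==> (\<lambda>p. f (occ_map x0 p)) \<in> borel_measurable (wt T \<beta> \<Otimes>\<^sub>M gauss)"
  by (rule measurable_compose[OF occ_map_measurable]) (simp add: measurable_cong_sets[OF sets_nu refl])

lemma nn_integral_nu:
  assumes "f \<in> borel_measurable (nu T x0 \<beta>)"
  shows "(\<integral>\<^sup>+q. f q \<partial>nu T x0 \<beta>) = (\<integral>\<^sup>+t. \<integral>\<^sup>+z. f (t, x0 + sqrt t *\<^sub>R z) \<partial>gauss \<partial>wt T \<beta>)"
proof -
  have "(\<integral>\<^sup>+q. f q \<partial>nu T x0 \<beta>) = (\<integral>\<^sup>+p. f (occ_map x0 p) \<partial>(wt T \<beta> \<Otimes>\<^sub>M gauss))"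
    unfolding nu_eq_distr[of T x0] using assms
    by (subst nn_integral_distr[OF occ_map_measurable]) (auto simp: measurable_cong_sets[OF sets_nu refl])
  also have "\<dots> = (\<integral>\<^sup>+t. \<integral>\<^sup>+z. f (t, x0 + sqrt t *\<^sub>R z) \<partial>gauss \<partial>wt T \<beta>)"
    by (subst gauss.nn_integral_fst[symmetric, OF nu_measurable_occ[OF assms]]) (simp add: occ_map_def)
  finally show ?thesis .
qed

context
  fixes T \<beta> :: real and x0 :: "real^'n::finite"
  assumes T: "T > 0" and \<beta>: "\<beta> > 0"
begin

lemma finite_measure_nu: "finite_measure (nu T x0 \<beta>)"
proof -
  interpret finite_measure "wt T \<beta> \<Otimes>\<^sub>M (gauss :: (real^'n) measure)"
    by (rule finite_measure_pair_measure[OF gauss.finite_measure_axioms finite_measure_wt[OF T \<beta>]])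
  show ?thesis unfolding nu_eq_distr by (rule finite_measure_distr[OF occ_map_measurable])
qed

lemma integral_nu:
  fixes f :: "real \<times> (real^'n) => 'b::{banach, second_countable_topology}"
  assumes f: "integrable (nu T x0 \<beta>) f"
  shows "(LINT q|nu T x0 \<beta>. f q) = (LINT t|wt T \<beta>. LINT z|gauss. f (t, x0 + sqrt t *\<^sub>R z))"
    and "integrable (wt T \<beta>) (\<lambda>t. LINT z|gauss. f (t, x0 + sqrt t *\<^sub>R z))"
    and "AE t in wt T \<beta>. integrable gauss (\<lambda>z. f (t, x0 + sqrt t *\<^sub>R z))"
proof -
  interpret R: finite_measure "wt T \<beta>" by (rule finite_measure_wt[OF T \<beta>])
  interpret pair_sigma_finite "wt T \<beta>" "gauss :: (real^'n) measure" ..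
  have m: "f \<in> borel_measurable (restrict_space borel (cylinder T))"
    using borel_measurable_integrable[OF f] by (simp add: measurable_cong_sets[OF sets_nu refl])
  have i: "integrable (wt T \<beta> \<Otimes>\<^sub>M gauss) (\<lambda>p. f (occ_map x0 p))"
    using f unfolding nu_eq_distr integrable_distr_eq[OF occ_map_measurable m] .
  show "(LINT q|nu T x0 \<beta>. f q) = (LINT t|wt T \<beta>. LINT z|gauss. f (t, x0 + sqrt t *\<^sub>R z))"
    unfolding nu_eq_distr integral_distr[OF occ_map_measurable m] integral_fst'[OF i, symmetric]
    by (simp add: occ_map_def)
  show "integrable (wt T \<beta>) (\<lambda>t. LINT z|gauss. f (t, x0 + sqrt t *\<^sub>R z))"
    using integrable_fst'[OF i] by (simp add: occ_map_def)
  show "AE t in wt T \<beta>. integrable gauss (\<lambda>z. f (t, x0 + sqrt t *\<^sub>R z))"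
    using AE_integrable_fst'[OF i] by (simp add: occ_map_def)
qed

lemma integral_wt:
  fixes f :: "real => real"
  assumes f: "f \<in> borel_measurable (wt T \<beta>)"
  shows "(LINT t|wt T \<beta>. f t) = (LINT t:{0<..<T}|lborel. rfac T \<beta> t * f t)"
    and "integrable (wt T \<beta>) f \<longleftrightarrow> set_integrable lborel {0<..<T} (\<lambda>t. rfac T \<beta> t * f t)"
proof -
  have m: "f \<in> borel_measurable (restrict_space lborel {0<..<T})"
    using f by (simp add: wt_def)
  have r: "rfac T \<beta> \<in> borel_measurable (restrict_space lborel {0<..<T})"
    by (intro measurable_restrict_space1) simp
  show "(LINT t|wt T \<beta>. f t) = (LINT t:{0<..<T}|lborel. rfac T \<beta> t * f t)"
    unfolding wt_def using m r
    by (subst integral_density) (auto simp: integral_restrict_space set_lebesgue_integral_def)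
  show "integrable (wt T \<beta>) f \<longleftrightarrow> set_integrable lborel {0<..<T} (\<lambda>t. rfac T \<beta> t * f t)"
    unfolding wt_def using m r
    by (subst integrable_density) (auto simp: integrable_restrict_space set_integrable_def)
qed

text \<open>The weight satisfies \<open>rfac' = 2 * \<beta> * rfac\<close> and equals 1 at
  \<open>T\<close>, so the weighted integrand \<open>2 * \<beta> * Q + K\<close> is the derivative
  of the weight times \<open>Q\<close>. This is the origin of the term with
  \<open>2 * \<beta>\<close>.\<close>

lemma weighted_FTC:
  fixes Q K :: "real => real"
  assumes Q: "continuous_on {0..T} Q"
    and der: "\<And>t. 0 < t ==> t < T ==> (Q has_real_derivative K t) (at t)"
    and K: "integrable (wt T \<beta>) K"
  shows "2 * \<beta> * (LINT t|wt T \<beta>. Q t) + (LINT t|wt T \<beta>. K t) = Q T - rfac T \<beta> 0 * Q 0"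
    and "integrable (wt T \<beta>) Q"
proof -
  interpret R: finite_measure "wt T \<beta>" by (rule finite_measure_wt[OF T \<beta>])
  obtain C where "\<forall>y\<in>Q ` {0..T}. norm y \<le> C"
    using compact_imp_bounded[OF compact_continuous_image[OF Q compact_Icc]] unfolding bounded_iff by blast
  then have C: "\<bar>Q t\<bar> \<le> C" if "t \<in> {0..T}" for t using that by auto
  have Qm: "Q \<in> borel_measurable (wt T \<beta>)"
    unfolding measurable_cong_sets[OF sets_wt refl]
    by (intro borel_measurable_continuous_on_restrict continuous_on_subset[OF Q]) auto
  show Qi: "integrable (wt T \<beta>) Q"
    by (rule R.integrable_const_bound[where B=C]) (use C Qm in auto)
  have i: "integrable (wt T \<beta>) (\<lambda>t. 2 * \<beta> * Q t + K t)"
    using Qi K by auto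
  have drf: "(rfac T \<beta> has_real_derivative 2 * \<beta> * rfac T \<beta> t) (at t)" for t
    unfolding rfac_def[abs_def] by (auto intro!: derivative_eq_intros)
  have cr: "continuous_on {0..T} (rfac T \<beta>)" unfolding rfac_def[abs_def] by (intro continuous_intros)
  have "((\<lambda>t. rfac T \<beta> t * (2 * \<beta> * Q t + K t)) has_integral (rfac T \<beta> T * Q T - rfac T \<beta> 0 * Q 0)) {0..T}"
  proof (rule fundamental_theorem_of_calculus_interior)
    show "continuous_on {0..T} (\<lambda>t. rfac T \<beta> t * Q t)" by (intro continuous_intros cr Q)
    show "((\<lambda>t. rfac T \<beta> t * Q t) has_vector_derivative rfac T \<beta> t * (2 * \<beta> * Q t + K t)) (at t)" if "t \<in> {0<..<T}" for t
      unfolding has_real_derivative_iff_has_vector_derivative[symmetric]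
      using DERIV_mult[OF drf der[of t]] that by (simp add: algebra_simps)
  qed (use T in auto)
  then have h: "((\<lambda>t. rfac T \<beta> t * (2 * \<beta> * Q t + K t)) has_integral (rfac T \<beta> T * Q T - rfac T \<beta> 0 * Q 0)) {0<..<T}"
    by (simp add: has_integral_Icc_iff_Ioo)
  have "2 * \<beta> * (LINT t|wt T \<beta>. Q t) + (LINT t|wt T \<beta>. K t) = (LINT t|wt T \<beta>. 2 * \<beta> * Q t + K t)"
    using Qi K by simp
  also have "\<dots> = (LINT t:{0<..<T}|lborel. rfac T \<beta> t * (2 * \<beta> * Q t + K t))"
    by (rule integral_wt(1)[OF borel_measurable_integrable[OF i]])
  also have "\<dots> = rfac T \<beta> T * Q T - rfac T \<beta> 0 * Q 0"
    using i h unfolding integral_wt(2)[OF borel_measurable_integrable[OF i]]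
    by (simp add: set_borel_integral_eq_integral(2) integral_unique)
  also have "rfac T \<beta> T = 1" by (simp add: rfac_def)
  finally show "2 * \<beta> * (LINT t|wt T \<beta>. Q t) + (LINT t|wt T \<beta>. K t) = Q T - rfac T \<beta> 0 * Q 0"
    by simp
qed

subsection \<open>Integrated identities for smooth data\<close>

context
  fixes F :: "real \<times> (real^'n) => real" and \<eta> :: "real^'n => real"
  assumes F: "test_function (cylinder T) F" and \<eta>: "bsmooth \<eta>"
begin

lemmas bs = bsmooth_data[OF T F \<eta>]

lemma sqint_nu_mild:
  assumes "bsmooth G" "bsmooth \<zeta>" shows "L2 (nu T x0 \<beta>) (\<lambda>q. mild T G \<zeta> (fst q) (snd q))"
proof -
  obtain C where "\<And>q. \<bar>mild T G \<zeta> (fst q) (snd q)\<bar> \<le> C" using mild_bounded[OF less_imp_le[OF T] assms] by blast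
  then show ?thesis
    by (intro sqint_bounded[OF finite_measure_nu, where C=C] nu_measurableI
        borel_measurable_continuous_onI continuous_on_mild assms) auto
qed

lemma sqint_nu_grad: "L2 (nu T x0 \<beta>) (Grad T F \<eta>)"
  unfolding mild_grad_def by (intro sqint_vec_lambda sqint_nu_mild bs)

lemma sqint_nu_hess: "L2 (nu T x0 \<beta>) (Hess T F \<eta>)"
  unfolding mild_hess_def by (intro sqint_vec_lambda sqint_nu_mild bs)

lemma sqint_nu_test: "L2 (nu T x0 \<beta>) F"
proof -
  obtain C where "\<And>q. \<bar>F q\<bar> \<le> C" using bsmooth_bounded[OF bs(1)] by blast
  then show ?thesis
    by (intro sqint_bounded[OF finite_measure_nu, where C=C] nu_measurableI
        borel_measurable_continuous_onI smooth_continuous_on bsmoothD bs(1)) auto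
qed

lemma mild_AQ_measurable: "(AQ T F \<eta> x0) \<in> borel_measurable (borel :: (real \<times> (real^'n)) measure)"
proof -
  have [measurable]: "(\<lambda>q. mild T G \<zeta> (fst q) (snd q)) \<in> borel_measurable (borel :: (real \<times> (real^'n)) measure)" if "bsmooth G" "bsmooth \<zeta>" for G \<zeta>
    by (intro borel_measurable_continuous_onI continuous_on_mild that)
  have cm: "(\<lambda>q. mild_mean T F \<eta> x0 (fst q) $ i) \<in> borel_measurable (borel :: (real \<times> (real^'n)) measure)" for i
  proof -
    have c: "continuous_on UNIV (\<lambda>s. LINT z|gauss. mild T (dx i F) (partial i \<eta>) s (x0 + sqrt s *\<^sub>R z))"
      by (rule continuous_on_mild_moment(1)[OF less_imp_le[OF T] bs(2,5)])
    show ?thesis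
      unfolding mild_mean_component[OF T F \<eta>]
      by (intro borel_measurable_continuous_onI continuous_on_compose2[OF c]) (auto intro!: continuous_intros)
  qed
  have fs: "(\<lambda>q. fst q) \<in> borel_measurable (borel :: (real \<times> (real^'n)) measure)" "(\<lambda>q. snd q $ i) \<in> borel_measurable (borel :: (real \<times> (real^'n)) measure)" for i
    by (intro borel_measurable_continuous_onI continuous_intros)+
  have m1: "(\<lambda>q. mild T (dx i F) (partial i \<eta>) (fst q) (snd q)) \<in> borel_measurable (borel :: (real \<times> (real^'n)) measure)"
    "(\<lambda>q. mild T (dx i (dx i F)) (partial i (partial i \<eta>)) (fst q) (snd q)) \<in> borel_measurable (borel :: (real \<times> (real^'n)) measure)" for i
    by (intro borel_measurable_continuous_onI continuous_on_mild bs)+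
  show ?thesis
    unfolding mild_AQ_def mild_hess_def mild_grad_def inner_vec_def
    using cm fs m1 by simp
qed

lemma mild_AQ_nn_integral:
  "(\<integral>\<^sup>+q. ennreal ((mild_AQ T F \<eta> x0 (fst q) (snd q))\<^sup>2) \<partial>nu T x0 \<beta>)
     \<le> ennreal (2 * (L2_norm (nu T x0 \<beta>) (Hess T F \<eta>))\<^sup>2)"
proof -
  note ih = integral_nu(1,2)[OF sqint_norm2[OF sqint_nu_hess]]
  have "(\<integral>\<^sup>+q. ennreal ((mild_AQ T F \<eta> x0 (fst q) (snd q))\<^sup>2) \<partial>nu T x0 \<beta>)
    = (\<integral>\<^sup>+t. \<integral>\<^sup>+z. ennreal ((mild_AQ T F \<eta> x0 t (x0 + sqrt t *\<^sub>R z))\<^sup>2) \<partial>gauss \<partial>wt T \<beta>)"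
    using nu_measurableI[OF mild_AQ_measurable] by (subst nn_integral_nu) auto
  also have "\<dots> \<le> (\<integral>\<^sup>+t. ennreal (2 * (LINT z|gauss. (norm (mild_hess T F \<eta> t (x0 + sqrt t *\<^sub>R z)))\<^sup>2)) \<partial>wt T \<beta>)"
  proof (rule nn_integral_mono)
    fix t assume "t \<in> space (wt T \<beta>)"
    then have t: "t > 0" by simp
    show "(\<integral>\<^sup>+z. ennreal ((mild_AQ T F \<eta> x0 t (x0 + sqrt t *\<^sub>R z))\<^sup>2) \<partial>gauss)
       \<le> ennreal (2 * (LINT z|gauss. (norm (mild_hess T F \<eta> t (x0 + sqrt t *\<^sub>R z)))\<^sup>2))"
      using mild_AQ_norm2_le[OF T F \<eta> t, of x0] mild_AQ_norm2(2)[OF T F \<eta> t, of x0]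
      by (subst nn_integral_eq_integral) (auto intro: ennreal_leI)
  qed
  also have "\<dots> = ennreal (2 * (L2_norm (nu T x0 \<beta>) (Hess T F \<eta>))\<^sup>2)"
    unfolding L2_norm_power2 ih(1) using ih(2) by (subst nn_integral_eq_integral) auto
  finally show ?thesis .
qed

lemma sqint_nu_AQ: "L2 (nu T x0 \<beta>) (AQ T F \<eta> x0)"
  unfolding square_integrable_def
  using nu_measurableI[OF mild_AQ_measurable] mild_AQ_nn_integral
  by (auto intro!: integrableI_bounded intro: le_less_trans)

lemma L2_norm_AQ_le:
  "L2_norm (nu T x0 \<beta>) (AQ T F \<eta> x0)
     \<le> sqrt 2 * L2_norm (nu T x0 \<beta>) (Hess T F \<eta>)"
proof (rule power2_le_imp_le)
  show "(L2_norm (nu T x0 \<beta>) (AQ T F \<eta> x0))\<^sup>2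
     \<le> (sqrt 2 * L2_norm (nu T x0 \<beta>) (Hess T F \<eta>))\<^sup>2"
    using mild_AQ_nn_integral sqint_norm2[OF sqint_nu_AQ]
    unfolding L2_norm_power2[of _ "\<lambda>q. mild_AQ T F \<eta> x0 (fst q) (snd q)"]
    by (subst (asm) nn_integral_eq_integral) (auto simp: power_mult_distrib)
qed simp

lemma mild_variance_identity:
  "(L2_norm (nu T x0 \<beta>) (Hess T F \<eta>))\<^sup>2 + 2 * \<beta> * (LINT t|wt T \<beta>. mild_var T F \<eta> x0 t)
    = vec_variance gauss (\<lambda>z. grad \<eta> (x0 + sqrt T *\<^sub>R z))
      - 2 * (LINT q|nu T x0 \<beta>. F q * mild_AQ T F \<eta> x0 (fst q) (snd q))"
proof -
  let ?A = "\<lambda>q. (norm (mild_hess T F \<eta> (fst q) (snd q)))\<^sup>2" and ?B = "\<lambda>q. F q * mild_AQ T F \<eta> x0 (fst q) (snd q)"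
  let ?K = "\<lambda>t. (LINT z|gauss. (norm (mild_hess T F \<eta> t (x0 + sqrt t *\<^sub>R z)))\<^sup>2)
     + 2 * (LINT z|gauss. F (t, x0 + sqrt t *\<^sub>R z) * mild_AQ T F \<eta> x0 t (x0 + sqrt t *\<^sub>R z))"
  have iA: "integrable (nu T x0 \<beta>) ?A" by (rule sqint_norm2[OF sqint_nu_hess])
  have iB: "integrable (nu T x0 \<beta>) ?B" by (rule sqint_mult[OF sqint_nu_test sqint_nu_AQ])
  note A = integral_nu[OF iA, simplified] and B = integral_nu[OF iB, simplified]
  have iK: "integrable (wt T \<beta>) ?K" using A(2) B(2) by auto
  have "2 * \<beta> * (LINT t|wt T \<beta>. mild_var T F \<eta> x0 t) + (LINT t|wt T \<beta>. ?K t)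
     = mild_var T F \<eta> x0 T - rfac T \<beta> 0 * mild_var T F \<eta> x0 0"
    by (rule weighted_FTC(1)[OF continuous_on_mild_var[OF T F \<eta>] mild_var_derivative[OF T F \<eta>] iK])
  moreover have "(LINT t|wt T \<beta>. ?K t) = (LINT q|nu T x0 \<beta>. ?A q) + 2 * (LINT q|nu T x0 \<beta>. ?B q)"
    using A(1,2) B(1,2) by simp
  ultimately show ?thesis
    unfolding L2_norm_power2 mild_var_0[OF T F \<eta>] mild_var_T[OF T F \<eta>] by simp
qed

lemma L2_norm_hess_le:
  "L2_norm (nu T x0 \<beta>) (Hess T F \<eta>)
    \<le> 2 * sqrt 2 * L2_norm (nu T x0 \<beta>) F + sqrt (vec_variance gauss (\<lambda>z. grad \<eta> (x0 + sqrt T *\<^sub>R z)))"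
proof -
  define h where "h = L2_norm (nu T x0 \<beta>) (Hess T F \<eta>)"
  define f where "f = L2_norm (nu T x0 \<beta>) F"
  define v where "v = vec_variance gauss (\<lambda>z. grad \<eta> (x0 + sqrt T *\<^sub>R z))"
  have nn: "0 \<le> h" "0 \<le> f" "0 \<le> v" by (simp_all add: h_def f_def v_def vec_variance_nonneg)
  have "0 \<le> (LINT t|wt T \<beta>. mild_var T F \<eta> x0 t)"
    by (rule Lintegral_nonneg) (simp add: mild_var_def vec_variance_nonneg)
  then have "0 \<le> 2 * \<beta> * (LINT t|wt T \<beta>. mild_var T F \<eta> x0 t)" using \<beta> by simp
  then have "h\<^sup>2 \<le> v - 2 * (LINT q|nu T x0 \<beta>. F q * mild_AQ T F \<eta> x0 (fst q) (snd q))"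
    using mild_variance_identity unfolding h_def v_def by linarith
  also have "\<bar>LINT q|nu T x0 \<beta>. F q * mild_AQ T F \<eta> x0 (fst q) (snd q)\<bar> \<le> f * (sqrt 2 * h)"
    using L2_Cauchy_Schwarz_mult[OF sqint_nu_test sqint_nu_AQ]
      mult_left_mono[OF L2_norm_AQ_le nn(2)] unfolding f_def h_def by linarith
  then have "v - 2 * (LINT q|nu T x0 \<beta>. F q * mild_AQ T F \<eta> x0 (fst q) (snd q)) \<le> v + 2 * (f * (sqrt 2 * h))"
    by linarith
  finally have "h\<^sup>2 \<le> v + 2 * (f * (sqrt 2 * h))" .
  \<comment> \<open>Completing the square: one \<open>sqrt 2 * f\<close> comes from the centre of
    the square and a second from its radius, together the constant \<open>2 * sqrt 2\<close> of the
    estimate.\<close>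
  then have "(h - sqrt 2 * f)\<^sup>2 \<le> v + (sqrt 2 * f)\<^sup>2" by (simp add: power2_diff algebra_simps)
  also have "\<dots> \<le> (sqrt v + sqrt 2 * f)\<^sup>2" using nn by (simp add: power2_sum)
  finally have "h - sqrt 2 * f \<le> sqrt v + sqrt 2 * f" by (rule power2_le_imp_le) (use nn in simp)
  then show ?thesis unfolding h_def f_def v_def by simp
qed

text \<open>The energy identity for the solution itself. It is a separate estimate because the
  variance identity controls the gradient only up to its mean, while convergence of the jets needs
  the full gradient.\<close>

lemma L2_norm_grad_le:
  "(L2_norm (nu T x0 \<beta>) (Grad T F \<eta>))\<^sup>2
    \<le> (L2_norm gauss (\<lambda>z. \<eta> (x0 + sqrt T *\<^sub>R z)))\<^sup>2
      + 2 * (L2_norm (nu T x0 \<beta>) (Mild T F \<eta>) * L2_norm (nu T x0 \<beta>) F)"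
proof -
  let ?A = "\<lambda>q. (norm (mild_grad T F \<eta> (fst q) (snd q)))\<^sup>2" and ?B = "\<lambda>q. mild T F \<eta> (fst q) (snd q) * F q"
  let ?Q = "\<lambda>t. LINT z|gauss. (mild T F \<eta> t (x0 + sqrt t *\<^sub>R z))\<^sup>2"
  let ?K = "\<lambda>t. (LINT z|gauss. (norm (mild_grad T F \<eta> t (x0 + sqrt t *\<^sub>R z)))\<^sup>2
     - 2 * (mild T F \<eta> t (x0 + sqrt t *\<^sub>R z) * F (t, x0 + sqrt t *\<^sub>R z)))"
  have iA: "integrable (nu T x0 \<beta>) ?A" by (rule sqint_norm2[OF sqint_nu_grad])
  have iB: "integrable (nu T x0 \<beta>) ?B" by (rule sqint_mult[OF sqint_nu_mild[OF bs(1,4)] sqint_nu_test])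
  have iAB: "integrable (nu T x0 \<beta>) (\<lambda>q. ?A q - 2 * ?B q)" using iA iB by auto
  note AB = integral_nu[OF iAB, simplified]
  have der: "(?Q has_real_derivative ?K t) (at t)" if "0 < t" "t < T" for t
    using mild_quadratic_evolution[OF F \<eta> that, where ?x0.0=x0 and a=1 and b=0]
    by (simp add: mild_grad_def power2_norm_vec mult.assoc)
  have "2 * \<beta> * (LINT t|wt T \<beta>. ?Q t) + (LINT t|wt T \<beta>. ?K t) = ?Q T - rfac T \<beta> 0 * ?Q 0"
    by (rule weighted_FTC(1)[OF continuous_on_mild_moment(2)[OF less_imp_le[OF T] bs(1,4)] der AB(2)])
  moreover have "0 \<le> 2 * \<beta> * (LINT t|wt T \<beta>. ?Q t)" "0 \<le> rfac T \<beta> 0 * ?Q 0"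
    using \<beta> by (auto intro!: Lintegral_nonneg)
  moreover have "(LINT t|wt T \<beta>. ?K t) = (LINT q|nu T x0 \<beta>. ?A q) - 2 * (LINT q|nu T x0 \<beta>. ?B q)"
    using AB(1) iA iB by simp
  moreover have "?Q T = (L2_norm gauss (\<lambda>z. \<eta> (x0 + sqrt T *\<^sub>R z)))\<^sup>2"
    by (simp add: L2_norm_power2 mild_at_terminal[OF T F])
  moreover have "(LINT q|nu T x0 \<beta>. ?B q) \<le> L2_norm (nu T x0 \<beta>) (Mild T F \<eta>) * L2_norm (nu T x0 \<beta>) F"
    using L2_Cauchy_Schwarz_mult[OF sqint_nu_mild[OF bs(1,4)] sqint_nu_test] by linarith
  ultimately show ?thesis unfolding L2_norm_power2[of "nu T x0 \<beta>"] by linarith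
qed

lemma mild_map_eq_mild:
  fixes W :: "real => 'w => real^'n"
  assumes bm: "brownian_motion M W" and t: "0 < t" "t < T"
  shows "mild_map M W T F \<eta> (t, x) = mild T F \<eta> t x"
proof -
  define E where "E s = (LINT z|gauss. F (t + s, x + sqrt s *\<^sub>R z))" for s
  have "heat M W (T - t) \<eta> x = heat_terminal T \<eta> t x"
    unfolding heat_terminal_def using t
    by (intro heat_eq_gauss[OF bm]) (auto intro: borel_measurable_continuous_onI smooth_continuous_on bsmoothD \<eta>)
  moreover have "(LINT r:{t<..<T}|lborel. heat M W (r - t) (\<lambda>y. F (r, y)) x) = heat_source T F t x"
  proof -
    have h: "heat M W (r - t) (\<lambda>y. F (r, y)) x = E (r - t)" if "t < r" for r
    proof -
      have "(\<lambda>y. F (r, y)) \<in> borel_measurable borel"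
        by (intro borel_measurable_continuous_onI smooth_compose_cont[OF bsmoothD[OF bs(1)]] continuous_intros)
      with that show ?thesis unfolding E_def by (subst heat_eq_gauss[OF bm]) auto
    qed
    obtain C where C: "\<And>z. \<bar>F z\<bar> \<le> C" using bsmooth_bounded[OF bs(1)] by blast
    have "continuous_on UNIV E"
      unfolding E_def
      by (rule continuous_on_integral_bounded[OF gauss.finite_measure_axioms _ _ C])
        (auto intro!: smooth_compose_cont[OF bsmoothD[OF bs(1)]] continuous_intros
            gauss_measurableI borel_measurable_continuous_onI)
    then have [measurable]: "E \<in> borel_measurable borel" by (rule borel_measurable_continuous_onI)
    have "(LINT r:{t<..<T}|lborel. heat M W (r - t) (\<lambda>y. F (r, y)) x) = (LINT r|lborel. indicator {t<..<T} r * E (r - t))"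
      unfolding set_lebesgue_integral_def
      by (rule Lintegral_cong) (auto simp: h split: split_indicator)
    also have "\<dots> = (LINT s|lborel. indicator {t<..<T} (s + t) * E (s + t - t))"
      by (rule lborel_translate(2)[symmetric]) simp
    \<comment> \<open>After the shift the range is the open interval from 0 to \<open>T - t\<close>.
      Enlarging it adds the null set at 0 and times with \<open>s + t \<ge> T\<close>, at which
      \<open>E\<close> vanishes by the support of \<open>F\<close>.\<close>
    also have "\<dots> = (LINT s|lborel. indicator {0..T} s * E s)"
    proof (rule integral_cong_AE)
      have "AE s in lborel. s \<noteq> (0::real)" by (rule AE_lborel_singleton)
      then show "AE s in lborel. indicator {t<..<T} (s + t) * E (s + t - t) = indicator {0..T} s * E s"
      proof eventually_elim
        case (elim s)
        have "E s = 0" if "s + t \<ge> T"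
          unfolding E_def using that by (simp add: testfun_zero_outside[OF F] cylinder_def)
        then show ?case using elim t by (auto split: split_indicator)
      qed
    qed auto
    also have "\<dots> = heat_source T F t x"
      unfolding heat_source_iterated[OF bs(1)] E_def[symmetric] set_lebesgue_integral_def by simp
    finally show ?thesis .
  qed
  ultimately show ?thesis by (simp add: mild_map_def mild_def)
qed

lemma AQ_classical_eq:
  fixes W :: "real => 'w => real^'n"
  assumes bm: "brownian_motion M W" and q: "q \<in> cylinder T"
  shows "AQ_classical M W x0 (mild_map M W T F \<eta>) q = mild_AQ T F \<eta> x0 (fst q) (snd q)"
proof -
  obtain t x where qq: "q = (t, x)" and t: "0 < t" "t < T" using q by (auto simp: cylinder_def)
  let ?v = "mild T F \<eta> t" and ?m = "mild_mean T F \<eta> x0 t"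
  have v: "(\<lambda>y. mild_map M W T F \<eta> (t, y)) = ?v" by (rule ext) (rule mild_map_eq_mild[OF bm t])
  have bv: "smooth ?v" "smooth (partial i ?v)" for i
    using bsmooth_mild_data[OF T F \<eta>] by (auto intro!: bsmoothD simp: partial_mild[OF bs(1,4)])
  have gv: "grad ?v = mild_grad T F \<eta> t"
    by (auto simp: grad_def mild_grad_def partial_mild[OF bs(1,4)])
  have gm: "grad ?v \<in> borel_measurable borel"
    unfolding grad_def by (intro borel_measurable_continuous_onI continuous_on_vec_lambda smooth_continuous_on bv)
  have m: "(LINT y|mu M W x0 t. grad ?v y) = ?m"
    using integral_mu(1)[OF bm t(1) gm, of x0] by (simp add: mild_mean_def gv)
  define c where "c = (LINT y|mu M W x0 t. ?v y)"
  let ?\<phi> = "\<lambda>y. ?v y - (c + ?m \<bullet> (y - x0))"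
  have d1: "(?\<phi> has_derivative (\<lambda>h. dir_deriv h ?v y - (0 + ?m \<bullet> h))) (at y)" for y
    by (intro has_derivative_diff smooth_has_derivative bv has_derivative_add has_derivative_const)
      (auto intro!: derivative_eq_intros)
  have p1: "partial i ?\<phi> = (\<lambda>y. partial i ?v y - ?m $ i)" for i
    unfolding partial_eq using dir_deriv_cong_has_derivative[OF d1, of "axis i 1"]
    by (simp add: inner_axis)
  have d2: "(partial i ?\<phi> has_derivative (\<lambda>h. dir_deriv h (partial i ?v) y - 0)) (at y)" for i y
    unfolding p1 by (intro has_derivative_diff smooth_has_derivative bv has_derivative_const)
  have p2: "partial i (partial i ?\<phi>) x = partial i (partial i ?v) x" for i
    unfolding partial_eq[of i, THEN fun_cong, of "partial i ?\<phi>"] using dir_derivI[OF d2, of "axis i 1" i x]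
    by (simp add: partial_eq)
  have "AQ_classical M W x0 (mild_map M W T F \<eta>) q = gen x0 t ?\<phi> x"
    unfolding AQ_classical_def qq aff_proj_def by (simp add: v m c_def mild_map_eq_mild[OF bm t])
  also have "\<dots> = (\<Sum>i\<in>UNIV. partial i (partial i ?\<phi>) x) - ((x - x0) \<bullet> grad ?\<phi> x) / t"
    by (rule gen_eq_drift_form[OF t(1)]) (use d2 in \<open>auto simp: differentiable_def\<close>)
  also have "grad ?\<phi> x = mild_grad T F \<eta> t x - ?m"
    unfolding grad_def p1 by (auto simp: vec_eq_iff mild_grad_def partial_mild[OF bs(1,4)])
  also have "(\<Sum>i\<in>UNIV. partial i (partial i ?\<phi>) x) = (\<Sum>i\<in>UNIV. mild_hess T F \<eta> t x $ i $ i)"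
    unfolding p2 by (simp add: mild_hess_def partial_mild[OF bs(1,4)] partial_mild[OF bs(2,5)])
  finally show ?thesis by (simp add: mild_AQ_def qq)
qed

end

end

subsection \<open>The mild solution map on square-integrable data\<close>

lemma sqint_cong:
  assumes "\<And>z. z \<in> space N ==> f z = g z"
  shows "L2 N f \<longleftrightarrow> L2 N g"
proof -
  have "f \<in> borel_measurable N \<longleftrightarrow> g \<in> borel_measurable N" by (rule measurable_cong) (rule assms)
  moreover have "integrable N (\<lambda>z. (norm (f z))\<^sup>2) \<longleftrightarrow> integrable N (\<lambda>z. (norm (g z))\<^sup>2)"
    by (rule Bochner_Integration.integrable_cong) (simp_all add: assms)
  ultimately show ?thesis by (simp add: square_integrable_def)
qed

text \<open>Measurability with respect to \<open>nu\<close> says nothing about values off the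
  cylinder. The extension by zero is Borel on the whole space and can be composed with maps that
  leave the cylinder.\<close>

definition cyl_ext :: "real => (real \<times> (real^'n::finite) => real) => real \<times> (real^'n) => real" where
  "cyl_ext T F q = indicator (cylinder T) q * F q"

text \<open>The kernel keeps the absolute time \<open>fst p\<close> instead of the time-to-go. With
  that time held fixed, integration over the starting point is a Gaussian convolution, so its square
  can be estimated without any regularity of \<open>F\<close>.\<close>

definition src_kernel :: "real => (real \<times> (real^'n::finite) => real) => real \<times> (real^'n) => real \<times> (real^'n) => real" where
  "src_kernel T F q p =
     (if fst q < fst p then cyl_ext T F (fst p, snd q + sqrt (fst p - fst q) *\<^sub>R snd p) else 0)"

definition src_int :: "real => (real \<times> (real^'n::finite) => real) => real \<times> (real^'n) => real" where
  "src_int T F q = (LINT r|Leb T. LINT z|gauss. src_kernel T F q (r, z))"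

definition term_int :: "real => (real^'n::finite => real) => real \<times> (real^'n) => real" where
  "term_int T \<eta> q = (LINT z|gauss. \<eta> (snd q + sqrt (T - fst q) *\<^sub>R z))"

lemma cyl_ext_measurable:
  "F \<in> borel_measurable (nu T x0 \<beta>) ==> cyl_ext T F \<in> borel_measurable borel"
  using borel_measurable_restrict_space_iff[of "cylinder T" borel F]
  by (simp add: measurable_cong_sets[OF sets_nu refl] cyl_ext_def[abs_def])

lemma time_gauss_id_measurable: "(\<lambda>p. p) \<in> time_gauss T \<rightarrow>\<^sub>M (borel :: (real \<times> (real^'n::finite)) measure)"
proof (rule borel_measurableI)
  fix S :: "(real \<times> (real^'n)) set" assume "open S"
  then have "indicator S \<in> borel_measurable (borel :: (real \<times> (real^'n)) measure)" by simp
  from time_gauss_measurable[where f="indicator S :: _ => real", of T] \<open>open S\<close>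
  have "(indicator S :: _ => real) \<in> borel_measurable (time_gauss T)" by simp
  then have "(indicator S :: _ => real) -` {1} \<inter> space (time_gauss T) \<in> sets (time_gauss T)"
    by (rule measurable_sets) simp
  also have "(indicator S :: _ => real) -` {1} = (\<lambda>p. p) -` S" by (auto simp: indicator_def)
  finally show "(\<lambda>p. p) -` S \<inter> space (time_gauss T) \<in> sets (time_gauss T)" .
qed

lemma src_kernel_measurable:
  fixes F :: "real \<times> (real^'n::finite) => real"
  assumes F: "F \<in> borel_measurable (nu T x0 \<beta>)"
  shows "(\<lambda>(q, p). src_kernel T F q p) \<in> borel_measurable (borel \<Otimes>\<^sub>M borel)"
proof -
  have c: "(\<lambda>w. (fst (snd w), snd (fst w) + sqrt (fst (snd w) - fst (fst w)) *\<^sub>R snd (snd w)))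
     \<in> borel_measurable (borel :: ((real \<times> (real^'n)) \<times> (real \<times> (real^'n))) measure)"
    by (intro borel_measurable_continuous_onI continuous_intros)
  have s: "{w :: (real \<times> (real^'n)) \<times> (real \<times> (real^'n)). fst (fst w) < fst (snd w)} \<in> sets borel"
    by (intro borel_open open_Collect_less continuous_intros)
  have "(\<lambda>w. if fst (fst w) < fst (snd w) then cyl_ext T F (fst (snd w), snd (fst w) + sqrt (fst (snd w) - fst (fst w)) *\<^sub>R snd (snd w)) else 0)
     \<in> borel_measurable (borel :: ((real \<times> (real^'n)) \<times> (real \<times> (real^'n))) measure)"
    using measurable_compose[OF c cyl_ext_measurable[OF F]] s by (intro measurable_If) auto
  then show ?thesis by (simp add: src_kernel_def case_prod_beta' borel_prod)
qed

lemma src_kernel_section: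
  fixes F :: "real \<times> (real^'n::finite) => real"
  assumes F: "F \<in> borel_measurable (nu T x0 \<beta>)"
  shows "src_kernel T F q \<in> borel_measurable (time_gauss T)"
    and "(\<lambda>w. src_kernel T F (fst w) (snd w)) \<in> borel_measurable (nu T x0 \<beta> \<Otimes>\<^sub>M time_gauss T)"
    and "(\<lambda>z. src_kernel T F q (r, z)) \<in> borel_measurable borel"
proof -
  have p: "(\<lambda>p. (q, p)) \<in> borel \<rightarrow>\<^sub>M (borel \<Otimes>\<^sub>M borel)" by simp
  have sec: "src_kernel T F q \<in> borel_measurable borel"
    using measurable_compose[OF p src_kernel_measurable[OF F]] by simp
  then show "src_kernel T F q \<in> borel_measurable (time_gauss T)" by (rule time_gauss_measurable)
  have "(\<lambda>z::real^'n. (r, z)) \<in> borel_measurable borel" by (intro borel_measurable_continuous_onI continuous_intros)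
  from measurable_compose[OF this sec] show "(\<lambda>z. src_kernel T F q (r, z)) \<in> borel_measurable borel" .
  have "(\<lambda>q. q) \<in> nu T x0 \<beta> \<rightarrow>\<^sub>M (borel :: (real \<times> (real^'n)) measure)"
    by (rule nu_measurableI) simp
  then have "(\<lambda>w. (fst w, snd w)) \<in> (nu T x0 \<beta> \<Otimes>\<^sub>M time_gauss T) \<rightarrow>\<^sub>M (borel \<Otimes>\<^sub>M (borel :: (real \<times> (real^'n)) measure))"
    by (intro measurable_Pair measurable_compose[OF measurable_fst] measurable_compose[OF measurable_snd time_gauss_id_measurable])
  from measurable_compose[OF this src_kernel_measurable[OF F]]
  show "(\<lambda>w. src_kernel T F (fst w) (snd w)) \<in> borel_measurable (nu T x0 \<beta> \<Otimes>\<^sub>M time_gauss T)"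
    by simp
qed

lemma src_kernel_diff: "src_kernel T (\<lambda>q. F q - G q) q p = src_kernel T F q p - src_kernel T G q p"
  by (simp add: src_kernel_def cyl_ext_def right_diff_distrib)

text \<open>After Fubini the later time \<open>r\<close> is fixed. Averaging over the position at
  time \<open>t\<close> and over the increment up to \<open>r\<close> gives the law at time
  \<open>r\<close>, so the bound no longer depends on \<open>t\<close>; what remains is to restore
  the weight at time \<open>r\<close>.\<close>

lemma src_kernel_nn:
  fixes F :: "real \<times> (real^'n::finite) => real" and W :: "real => 'w => real^'n"
  assumes T: "T > 0" and \<beta>: "\<beta> > 0" and bm: "brownian_motion M W"
    and F: "F \<in> borel_measurable (nu T x0 \<beta>)"
  shows "(\<integral>\<^sup>+q. \<integral>\<^sup>+p. ennreal ((src_kernel T F q p)\<^sup>2) \<partial>time_gauss T \<partial>nu T x0 \<beta>)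
    \<le> emeasure (wt T \<beta>) {0<..<T} * (ennreal (exp (2 * \<beta> * T)) * (\<integral>\<^sup>+q. ennreal ((F q)\<^sup>2) \<partial>nu T x0 \<beta>))"
proof -
  interpret I: finite_measure "Leb T" by (rule finite_measure_Icc)
  interpret TG: finite_measure "time_gauss T :: (real \<times> (real^'n)) measure" by (rule finite_measure_time_gauss)
  interpret IG: pair_sigma_finite "Leb T" "gauss :: (real^'n) measure" ..
  let ?k = "\<lambda>q p. ennreal ((src_kernel T F q p)\<^sup>2)"
  let ?E = "\<lambda>q. ennreal ((cyl_ext T F q)\<^sup>2)"
  define D where "D r = (\<integral>\<^sup>+z. ?E (r, x0 + sqrt r *\<^sub>R z) \<partial>(gauss :: (real^'n) measure))" for r
  have Em: "?E \<in> borel_measurable borel" using cyl_ext_measurable[OF F] by simp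
  have Esec: "(\<lambda>y. ?E (r, y)) \<in> borel_measurable borel" for r
    by (rule measurable_compose[OF _ Em]) (intro borel_measurable_continuous_onI continuous_intros)
  have Dm: "D \<in> borel_measurable borel"
  proof -
    have c0: "(\<lambda>p. (fst p, x0 + sqrt (fst p) *\<^sub>R snd p)) \<in> borel_measurable (borel :: (real \<times> (real^'n)) measure)"
      by (intro borel_measurable_continuous_onI continuous_intros)
    have "(\<lambda>p. ?E (fst p, x0 + sqrt (fst p) *\<^sub>R snd p)) \<in> borel_measurable ((borel :: real measure) \<Otimes>\<^sub>M (gauss :: (real^'n) measure))"
    proof -
      have S: "sets ((borel :: real measure) \<Otimes>\<^sub>M (gauss :: (real^'n) measure)) = sets borel"
        unfolding sets_pair_measure_cong[OF refl sets_gauss] borel_prod ..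
      show ?thesis unfolding measurable_cong_sets[OF S refl] using measurable_compose[OF c0 Em] by simp
    qed
    from gauss.borel_measurable_nn_integral_fst[OF this] show ?thesis by (simp add: D_def[abs_def])
  qed
  have inner: "(\<integral>\<^sup>+z'. \<integral>\<^sup>+p. ?k (t, x0 + sqrt t *\<^sub>R z') p \<partial>time_gauss T \<partial>gauss)
     \<le> (\<integral>\<^sup>+r. D r \<partial>Leb T)" if t: "0 < t" for t
  proof -
    have e: "(\<integral>\<^sup>+p. ?k q p \<partial>time_gauss T) = (\<integral>\<^sup>+r. \<integral>\<^sup>+z. ?k q (r, z) \<partial>gauss \<partial>Leb T)" for q
      unfolding time_gauss_def
      by (rule gauss.nn_integral_fst[symmetric]) (use src_kernel_section(1)[OF F, of q] in \<open>simp add: time_gauss_def\<close>)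
    have m: "(\<lambda>(r, z'). \<integral>\<^sup>+z. ?k (t, x0 + sqrt t *\<^sub>R z') (r, z) \<partial>gauss) \<in> borel_measurable (Leb T \<Otimes>\<^sub>M (gauss :: (real^'n) measure))"
    proof -
      have c: "(\<lambda>w. ((t, x0 + sqrt t *\<^sub>R snd (fst w)), (fst (fst w), snd w))) \<in> borel_measurable (borel :: ((real \<times> (real^'n)) \<times> (real^'n)) measure)"
        by (intro borel_measurable_continuous_onI continuous_intros)
      have "(\<lambda>w. src_kernel T F (t, x0 + sqrt t *\<^sub>R snd (fst w)) (fst (fst w), snd w)) \<in> borel_measurable (borel :: ((real \<times> (real^'n)) \<times> (real^'n)) measure)"
        using measurable_compose[OF c, of "\<lambda>(q, p). src_kernel T F q p" borel] src_kernel_measurable[OF F]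
        by (simp add: borel_prod)
      then have m1: "(\<lambda>w. ?k (t, x0 + sqrt t *\<^sub>R snd (fst w)) (fst (fst w), snd w)) \<in> borel_measurable (borel \<Otimes>\<^sub>M borel :: ((real \<times> (real^'n)) \<times> (real^'n)) measure)"
        by (simp add: borel_prod)
      have id1: "(\<lambda>w. w) \<in> Leb T \<Otimes>\<^sub>M (gauss :: (real^'n) measure) \<rightarrow>\<^sub>M borel"
        using time_gauss_id_measurable[of T, where 'n='n] by (simp add: time_gauss_def)
      have "(\<lambda>w. (fst w, snd w)) \<in> ((Leb T \<Otimes>\<^sub>M (gauss :: (real^'n) measure)) \<Otimes>\<^sub>M (gauss :: (real^'n) measure)) \<rightarrow>\<^sub>M (borel \<Otimes>\<^sub>M borel)"
        by (intro measurable_Pair measurable_compose[OF measurable_fst id1] measurable_snd'') simp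
      from measurable_compose[OF this m1]
      have "(\<lambda>w. ?k (t, x0 + sqrt t *\<^sub>R snd (fst w)) (fst (fst w), snd w)) \<in> borel_measurable ((Leb T \<Otimes>\<^sub>M (gauss :: (real^'n) measure)) \<Otimes>\<^sub>M (gauss :: (real^'n) measure))"
        by simp
      from gauss.borel_measurable_nn_integral_fst[OF this] show ?thesis by (simp add: case_prod_beta')
    qed
    have "(\<integral>\<^sup>+z'. \<integral>\<^sup>+p. ?k (t, x0 + sqrt t *\<^sub>R z') p \<partial>time_gauss T \<partial>gauss)
       = (\<integral>\<^sup>+r. \<integral>\<^sup>+z'. \<integral>\<^sup>+z. ?k (t, x0 + sqrt t *\<^sub>R z') (r, z) \<partial>gauss \<partial>gauss \<partial>Leb T)"
      unfolding e by (rule IG.Fubini'[OF m])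
    also have "\<dots> \<le> (\<integral>\<^sup>+r. D r \<partial>Leb T)"
    proof (rule nn_integral_mono)
      fix r :: real
      show "(\<integral>\<^sup>+z'. \<integral>\<^sup>+z. ?k (t, x0 + sqrt t *\<^sub>R z') (r, z) \<partial>gauss \<partial>gauss) \<le> D r"
      \<comment> \<open>Chapman-Kolmogorov for \<open>t < r\<close>; otherwise the kernel is zero by
        definition.\<close>
      proof (cases "t < r")
        case True
        then show ?thesis
          unfolding D_def using gauss_convolution[OF bm t True Esec[of r], of x0] by (simp add: src_kernel_def)
      qed (simp add: src_kernel_def)
    qed
    finally show ?thesis .
  qed
  have "(\<integral>\<^sup>+q. \<integral>\<^sup>+p. ?k q p \<partial>time_gauss T \<partial>nu T x0 \<beta>)
     = (\<integral>\<^sup>+t. \<integral>\<^sup>+z'. \<integral>\<^sup>+p. ?k (t, x0 + sqrt t *\<^sub>R z') p \<partial>time_gauss T \<partial>gauss \<partial>wt T \<beta>)"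
  proof (rule nn_integral_nu)
    have "(\<lambda>w. ?k (fst w) (snd w)) \<in> borel_measurable (nu T x0 \<beta> \<Otimes>\<^sub>M time_gauss T)"
      using src_kernel_section(2)[OF F] by simp
    from TG.borel_measurable_nn_integral_fst[OF this]
    show "(\<lambda>q. \<integral>\<^sup>+p. ?k q p \<partial>time_gauss T) \<in> borel_measurable (nu T x0 \<beta>)" by simp
  qed
  also have "\<dots> \<le> (\<integral>\<^sup>+t. (\<integral>\<^sup>+r. D r \<partial>Leb T) \<partial>wt T \<beta>)"
    by (intro nn_integral_mono inner) simp
  also have "\<dots> = emeasure (wt T \<beta>) {0<..<T} * (\<integral>\<^sup>+r. D r \<partial>Leb T)"
    by (simp add: mult.commute)
  also have "(\<integral>\<^sup>+r. D r \<partial>Leb T) \<le> ennreal (exp (2 * \<beta> * T)) * (\<integral>\<^sup>+q. ennreal ((F q)\<^sup>2) \<partial>nu T x0 \<beta>)"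
  proof -
    have "(\<integral>\<^sup>+r. D r \<partial>Leb T) = (\<integral>\<^sup>+r. D r * indicator {0..T} r \<partial>lborel)"
      by (simp add: nn_integral_restrict_space)
    \<comment> \<open>On the open interval the factor \<open>exp (2 * \<beta> * T)\<close> times the
      weight is \<open>exp (2 * \<beta> * r)\<close>, hence at least 1; outside it the extended
      source is zero.\<close>
    also have "\<dots> \<le> (\<integral>\<^sup>+r. ennreal (exp (2 * \<beta> * T)) * (ennreal (rfac T \<beta> r) * D r * indicator {0<..<T} r) \<partial>lborel)"
    proof (rule nn_integral_mono)
      fix r :: real
      show "D r * indicator {0..T} r \<le> ennreal (exp (2 * \<beta> * T)) * (ennreal (rfac T \<beta> r) * D r * indicator {0<..<T} r)"
      proof (cases "r \<in> {0<..<T}")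
        case True
        have "1 \<le> exp (2 * \<beta> * T) * rfac T \<beta> r"
          using True \<beta> by (simp add: rfac_def exp_add[symmetric] algebra_simps)
        then have "1 \<le> ennreal (exp (2 * \<beta> * T)) * ennreal (rfac T \<beta> r)"
          by (metis ennreal_1 ennreal_leI ennreal_mult exp_ge_zero rfac_nonneg)
        from mult_right_mono[OF this, of "D r"] True show ?thesis by (simp add: mult.assoc)
      next
        case False
        then have "?E (r, y) = 0" for y by (simp add: cyl_ext_def cylinder_def)
        then show ?thesis by (simp add: D_def)
      qed
    qed
    also have "\<dots> = ennreal (exp (2 * \<beta> * T)) * (\<integral>\<^sup>+t. D t \<partial>wt T \<beta>)"
      using Dm by (simp add: nn_integral_cmult nn_integral_wt)
    also have "(\<integral>\<^sup>+t. D t \<partial>wt T \<beta>) = (\<integral>\<^sup>+q. ?E q \<partial>nu T x0 \<beta>)"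
      unfolding D_def using nu_measurableI[OF Em] by (rule nn_integral_nu[symmetric])
    also have "\<dots> = (\<integral>\<^sup>+q. ennreal ((F q)\<^sup>2) \<partial>nu T x0 \<beta>)"
      by (rule nn_integral_cong) (simp add: cyl_ext_def)
    finally show ?thesis .
  qed
  finally show ?thesis by (simp add: mult_left_mono)
qed

section \<open>Continuity of the mild map in the square-integrable norm\<close>

context
  fixes T \<beta> :: real and x0 :: "real^'n::finite" and M :: "'w measure" and W :: "real => 'w => real^'n"
  assumes T: "T > 0" and \<beta>: "\<beta> > 0" and bm: "brownian_motion M W"
begin

text \<open>The factor \<open>T\<close> is the total mass of \<open>time_gauss\<close>, paid in
  Cauchy-Schwarz; the mass of \<open>wt\<close> comes from integrating over the starting time, and
  the exponential undoes the weight.\<close>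

definition src_const :: real where
  "src_const = sqrt (T * (measure (wt T \<beta>) {0<..<T} * exp (2 * \<beta> * T)))"

lemma src_int_measurable:
  assumes F: "F \<in> borel_measurable (nu T x0 \<beta>)"
  shows "src_int T F \<in> borel_measurable (nu T x0 \<beta>)"
proof -
  interpret I: finite_measure "Leb T" by (rule finite_measure_Icc)
  have a: "(\<lambda>w. (fst (fst w), (snd (fst w), snd w))) \<in> ((nu T x0 \<beta> \<Otimes>\<^sub>M Leb T) \<Otimes>\<^sub>M (gauss :: (real^'n) measure)) \<rightarrow>\<^sub>M (nu T x0 \<beta> \<Otimes>\<^sub>M time_gauss T)"
    unfolding time_gauss_def by measurable
  from measurable_compose[OF a src_kernel_section(2)[OF F]]
  have "(\<lambda>w. src_kernel T F (fst (fst w)) (snd (fst w), snd w)) \<in> borel_measurable ((nu T x0 \<beta> \<Otimes>\<^sub>M Leb T) \<Otimes>\<^sub>M (gauss :: (real^'n) measure))"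
    by simp
  then have "(\<lambda>v. LINT z|gauss. src_kernel T F (fst v) (snd v, z)) \<in> borel_measurable (nu T x0 \<beta> \<Otimes>\<^sub>M Leb T)"
    by (intro gauss.borel_measurable_lebesgue_integral) (simp add: case_prod_beta')
  then show ?thesis
    unfolding src_int_def[abs_def] by (intro I.borel_measurable_lebesgue_integral) (simp add: case_prod_beta')
qed

lemma src_int_bound:
  assumes F: "L2 (nu T x0 \<beta>) F"
  shows "L2 (nu T x0 \<beta>) (src_int T F)"
    and "L2_norm (nu T x0 \<beta>) (src_int T F) \<le> src_const * L2_norm (nu T x0 \<beta>) F"
    and "AE q in nu T x0 \<beta>. integrable (time_gauss T) (src_kernel T F q)"
proof -
  let ?N = "nu T x0 \<beta>" and ?G = "time_gauss T :: (real \<times> (real^'n)) measure"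
  interpret I: finite_measure "Leb T" by (rule finite_measure_Icc)
  interpret TG: finite_measure "time_gauss T :: (real \<times> (real^'n)) measure" by (rule finite_measure_time_gauss)
  interpret TW: finite_measure "wt T \<beta>" by (rule finite_measure_wt[OF T \<beta>])
  interpret IG: pair_sigma_finite "Leb T" "gauss :: (real^'n) measure" ..
  have Fm: "F \<in> borel_measurable ?N" using F by (rule sqintD)
  let ?J = "\<lambda>q. \<integral>\<^sup>+p. ennreal ((src_kernel T F q p)\<^sup>2) \<partial>?G"
  have Jm: "?J \<in> borel_measurable ?N"
  proof -
    have "(\<lambda>w. ennreal ((src_kernel T F (fst w) (snd w))\<^sup>2)) \<in> borel_measurable (?N \<Otimes>\<^sub>M ?G)"
      using src_kernel_section(2)[OF Fm] by simp
    from TG.borel_measurable_nn_integral_fst[OF this] show ?thesis by simp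
  qed
  have J: "(\<integral>\<^sup>+q. ?J q \<partial>?N) \<le> ennreal (measure (wt T \<beta>) {0<..<T} * exp (2 * \<beta> * T) * (L2_norm ?N F)\<^sup>2)"
  proof -
    have "(\<integral>\<^sup>+q. ennreal ((F q)\<^sup>2) \<partial>?N) = ennreal ((L2_norm ?N F)\<^sup>2)"
      unfolding L2_norm_power2 using sqint_norm2[OF F] by (subst nn_integral_eq_integral) auto
    then show ?thesis
      using src_kernel_nn[OF T \<beta> bm Fm] by (simp add: TW.emeasure_eq_measure ennreal_mult[symmetric] mult.assoc)
  qed
  then have "(\<integral>\<^sup>+q. ?J q \<partial>?N) \<noteq> \<infinity>" by (auto simp: top_unique)
  then have AJ: "AE q in ?N. ?J q \<noteq> \<infinity>" by (rule nn_integral_PInf_AE[OF Jm])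
  have sk: "L2 ?G (src_kernel T F q)" if "?J q \<noteq> \<infinity>" for q
    unfolding square_integrable_def using that src_kernel_section(1)[OF Fm, of q]
    by (auto intro!: integrableI_bounded simp: top.not_eq_extremum)
  show AEi: "AE q in ?N. integrable ?G (src_kernel T F q)"
    using AJ by eventually_elim (intro sqint_integrable[OF TG.finite_measure_axioms] sk)
  have one: "L2 ?G (\<lambda>_. 1::real)"
    by (rule sqint_bounded[OF TG.finite_measure_axioms, where C=1]) auto
  have L1: "L2_norm ?G (\<lambda>_. 1::real) = sqrt T"
    using measure_time_gauss[OF less_imp_le[OF T], where 'n='n] by (simp add: L2_norm_def)
  \<comment> \<open>Cauchy-Schwarz against the constant one. It is restricted to points where the
    kernel is square integrable, since elsewhere the iterated integral need not be the integral over
    the product.\<close>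
  have sq: "ennreal ((src_int T F q)\<^sup>2) \<le> ennreal T * ?J q" if q: "?J q \<noteq> \<infinity>" for q
  proof -
    have i: "integrable ?G (src_kernel T F q)" by (intro sqint_integrable[OF TG.finite_measure_axioms] sk q)
    have "src_int T F q = (LINT p|?G. src_kernel T F q p)"
      unfolding src_int_def time_gauss_def by (rule IG.integral_fst'[OF i[unfolded time_gauss_def]])
    then have "\<bar>src_int T F q\<bar> \<le> L2_norm ?G (src_kernel T F q) * sqrt T"
      using L2_Cauchy_Schwarz_mult[OF sk[OF q] one] by (simp add: L1)
    then have "(src_int T F q)\<^sup>2 \<le> (L2_norm ?G (src_kernel T F q) * sqrt T)\<^sup>2"
      using power_mono[of "\<bar>src_int T F q\<bar>" _ 2] by simp
    also have "\<dots> = T * (LINT p|?G. (src_kernel T F q p)\<^sup>2)"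
      using T by (simp add: power_mult_distrib L2_norm_power2)
    finally have "ennreal ((src_int T F q)\<^sup>2) \<le> ennreal (T * (LINT p|?G. (src_kernel T F q p)\<^sup>2))"
      by (rule ennreal_leI)
    also have "\<dots> = ennreal T * ?J q"
      using T sqint_norm2[OF sk[OF q]] by (subst nn_integral_eq_integral) (auto simp: ennreal_mult)
    finally show ?thesis .
  qed
  have tot: "(\<integral>\<^sup>+q. ennreal ((src_int T F q)\<^sup>2) \<partial>?N) \<le> ennreal ((src_const * L2_norm ?N F)\<^sup>2)"
  proof -
    have "(\<integral>\<^sup>+q. ennreal ((src_int T F q)\<^sup>2) \<partial>?N) \<le> (\<integral>\<^sup>+q. ennreal T * ?J q \<partial>?N)"
    proof (rule nn_integral_mono_AE)
      show "AE q in ?N. ennreal ((src_int T F q)\<^sup>2) \<le> ennreal T * ?J q"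
        using AJ by eventually_elim (rule sq)
    qed
    also have "\<dots> = ennreal T * (\<integral>\<^sup>+q. ?J q \<partial>?N)" by (rule nn_integral_cmult[OF Jm])
    also have "\<dots> \<le> ennreal T * ennreal (measure (wt T \<beta>) {0<..<T} * exp (2 * \<beta> * T) * (L2_norm ?N F)\<^sup>2)"
      by (rule mult_left_mono[OF J]) simp
    also have "\<dots> = ennreal ((src_const * L2_norm ?N F)\<^sup>2)"
      using T by (simp add: ennreal_mult[symmetric] src_const_def power_mult_distrib mult.assoc)
    finally show ?thesis .
  qed
  show s: "L2 ?N (src_int T F)"
    unfolding square_integrable_def using src_int_measurable[OF Fm] tot
    by (auto intro!: integrableI_bounded intro: le_less_trans)
  show "L2_norm ?N (src_int T F) \<le> src_const * L2_norm ?N F"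
  proof (rule power2_le_imp_le)
    show "(L2_norm ?N (src_int T F))\<^sup>2 \<le> (src_const * L2_norm ?N F)\<^sup>2"
      unfolding L2_norm_power2[of ?N "src_int T F"] using tot sqint_norm2[OF s]
      by (subst (asm) nn_integral_eq_integral) auto
    show "0 \<le> src_const * L2_norm ?N F" using T by (simp add: src_const_def)
  qed
qed

text \<open>Additivity holds only almost everywhere: where a kernel fails to be integrable, its
  integral takes the default value zero.\<close>

lemma src_int_diff:
  assumes F: "L2 (nu T x0 \<beta>) F" and G: "L2 (nu T x0 \<beta>) G"
  shows "AE q in nu T x0 \<beta>. src_int T F q - src_int T G q = src_int T (\<lambda>q. F q - G q) q"
proof -
  interpret I: finite_measure "Leb T" by (rule finite_measure_Icc)
  interpret IG: pair_sigma_finite "Leb T" "gauss :: (real^'n) measure" ..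
  have e: "src_int T H q = (LINT p|time_gauss T. src_kernel T H q p)" if "integrable (time_gauss T) (src_kernel T H q)"
    for H :: "real \<times> (real^'n) => real" and q
    unfolding src_int_def time_gauss_def by (rule IG.integral_fst'[OF that[unfolded time_gauss_def]])
  show ?thesis
    using src_int_bound(3)[OF F] src_int_bound(3)[OF G] src_int_bound(3)[OF sqint_diff[OF F G]]
    by eventually_elim (simp add: e src_kernel_diff)
qed

text \<open>By Chapman-Kolmogorov from \<open>t\<close> to \<open>T\<close> the second moment of the
  integrand, averaged over the law at time \<open>t\<close>, is the terminal second moment for every
  \<open>t\<close>, so integration over time only contributes the mass of \<open>wt\<close>.\<close>

lemma term_int_bound:
  assumes \<eta>: "\<eta> \<in> borel_measurable borel" and sq: "L2 gauss (\<lambda>z. \<eta> (x0 + sqrt T *\<^sub>R z))"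
  shows "L2 (nu T x0 \<beta>) (term_int T \<eta>)"
    and "L2_norm (nu T x0 \<beta>) (term_int T \<eta>) \<le> sqrt (measure (wt T \<beta>) {0<..<T}) * L2_norm gauss (\<lambda>z. \<eta> (x0 + sqrt T *\<^sub>R z))"
    and "AE q in nu T x0 \<beta>. integrable gauss (\<lambda>z. \<eta> (snd q + sqrt (T - fst q) *\<^sub>R z))"
proof -
  let ?N = "nu T x0 \<beta>"
  interpret TW: finite_measure "wt T \<beta>" by (rule finite_measure_wt[OF T \<beta>])
  let ?k = "\<lambda>q z. \<eta> (snd q + sqrt (T - fst q) *\<^sub>R z)"
  have c: "(\<lambda>w. snd (fst w) + sqrt (T - fst (fst w)) *\<^sub>R snd w) \<in> borel_measurable (borel :: ((real \<times> (real^'n)) \<times> (real^'n)) measure)"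
    by (intro borel_measurable_continuous_onI continuous_intros)
  have km0: "(\<lambda>w. ?k (fst w) (snd w)) \<in> borel_measurable (borel \<Otimes>\<^sub>M borel)"
    using measurable_compose[OF c \<eta>] by (simp add: borel_prod)
  have "(\<lambda>w. (fst w, snd w)) \<in> (?N \<Otimes>\<^sub>M (gauss :: (real^'n) measure)) \<rightarrow>\<^sub>M (borel \<Otimes>\<^sub>M borel)"
    by (intro measurable_Pair measurable_compose[OF measurable_fst nu_measurableI] measurable_snd'') simp_all
  from measurable_compose[OF this km0]
  have km: "(\<lambda>w. ?k (fst w) (snd w)) \<in> borel_measurable (?N \<Otimes>\<^sub>M gauss)" by simp
  have ks: "?k q \<in> borel_measurable gauss" for q
    by (intro gauss_measurableI measurable_compose[OF _ \<eta>] borel_measurable_continuous_onI continuous_intros)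
  have tm: "term_int T \<eta> \<in> borel_measurable ?N"
    unfolding term_int_def[abs_def]
    by (intro gauss.borel_measurable_lebesgue_integral) (use km in \<open>simp add: case_prod_beta'\<close>)
  let ?J = "\<lambda>q. \<integral>\<^sup>+z. ennreal ((?k q z)\<^sup>2) \<partial>gauss"
  have "(\<lambda>w. ennreal ((?k (fst w) (snd w))\<^sup>2)) \<in> borel_measurable (?N \<Otimes>\<^sub>M gauss)" using km by simp
  from gauss.borel_measurable_nn_integral_fst[OF this] have Jm: "?J \<in> borel_measurable ?N" by simp
  have J: "(\<integral>\<^sup>+q. ?J q \<partial>?N) = ennreal (measure (wt T \<beta>) {0<..<T} * (L2_norm gauss (\<lambda>z. \<eta> (x0 + sqrt T *\<^sub>R z)))\<^sup>2)"
  proof -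
    have "(\<integral>\<^sup>+q. ?J q \<partial>?N) = (\<integral>\<^sup>+t. \<integral>\<^sup>+z'. \<integral>\<^sup>+z. ennreal ((\<eta> (x0 + sqrt t *\<^sub>R z' + sqrt (T - t) *\<^sub>R z))\<^sup>2) \<partial>gauss \<partial>gauss \<partial>wt T \<beta>)"
      by (subst nn_integral_nu[OF Jm]) simp
    also have "\<dots> = (\<integral>\<^sup>+t. (\<integral>\<^sup>+z. ennreal ((\<eta> (x0 + sqrt T *\<^sub>R z))\<^sup>2) \<partial>gauss) \<partial>wt T \<beta>)"
      by (intro nn_integral_cong gauss_convolution[OF bm]) (use \<eta> in auto)
    also have "(\<integral>\<^sup>+z. ennreal ((\<eta> (x0 + sqrt T *\<^sub>R z))\<^sup>2) \<partial>gauss) = ennreal ((L2_norm gauss (\<lambda>z. \<eta> (x0 + sqrt T *\<^sub>R z)))\<^sup>2)"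
      unfolding L2_norm_power2 using sqint_norm2[OF sq] by (subst nn_integral_eq_integral) auto
    finally show ?thesis
      by (simp add: TW.emeasure_eq_measure ennreal_mult[symmetric] mult.commute)
  qed
  then have "(\<integral>\<^sup>+q. ?J q \<partial>?N) \<noteq> \<infinity>" by simp
  then have AJ: "AE q in ?N. ?J q \<noteq> \<infinity>" by (rule nn_integral_PInf_AE[OF Jm])
  have sk: "L2 gauss (?k q)" if "?J q \<noteq> \<infinity>" for q
    unfolding square_integrable_def using that ks[of q]
    by (auto intro!: integrableI_bounded simp: top.not_eq_extremum)
  show "AE q in ?N. integrable gauss (?k q)"
    using AJ by eventually_elim (intro sqint_integrable[OF gauss.finite_measure_axioms] sk)
  have one: "L2 gauss (\<lambda>_::real^'n. 1::real)"
    by (rule sqint_bounded[OF gauss.finite_measure_axioms, where C=1]) auto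
  have sq: "ennreal ((term_int T \<eta> q)\<^sup>2) \<le> ?J q" if q: "?J q \<noteq> \<infinity>" for q
  proof -
    have "\<bar>term_int T \<eta> q\<bar> \<le> L2_norm gauss (?k q)"
      using L2_Cauchy_Schwarz_mult[OF sk[OF q] one] by (simp add: term_int_def L2_norm_def[of _ "\<lambda>_. 1"])
    then have "(term_int T \<eta> q)\<^sup>2 \<le> (L2_norm gauss (?k q))\<^sup>2"
      using power_mono[of "\<bar>term_int T \<eta> q\<bar>" _ 2] by simp
    then have "ennreal ((term_int T \<eta> q)\<^sup>2) \<le> ennreal (LINT z|gauss. (?k q z)\<^sup>2)"
      by (simp add: L2_norm_power2 ennreal_leI)
    also have "\<dots> = ?J q"
      using sqint_norm2[OF sk[OF q]] by (subst nn_integral_eq_integral) auto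
    finally show ?thesis .
  qed
  have tot: "(\<integral>\<^sup>+q. ennreal ((term_int T \<eta> q)\<^sup>2) \<partial>?N) \<le> ennreal (measure (wt T \<beta>) {0<..<T} * (L2_norm gauss (\<lambda>z. \<eta> (x0 + sqrt T *\<^sub>R z)))\<^sup>2)"
    unfolding J[symmetric]
  proof (rule nn_integral_mono_AE)
    show "AE q in ?N. ennreal ((term_int T \<eta> q)\<^sup>2) \<le> ?J q"
      using AJ by eventually_elim (rule sq)
  qed
  show s: "L2 ?N (term_int T \<eta>)"
    unfolding square_integrable_def using tm tot
    by (auto intro!: integrableI_bounded intro: le_less_trans)
  show "L2_norm ?N (term_int T \<eta>) \<le> sqrt (measure (wt T \<beta>) {0<..<T}) * L2_norm gauss (\<lambda>z. \<eta> (x0 + sqrt T *\<^sub>R z))"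
  proof (rule power2_le_imp_le)
    show "(L2_norm ?N (term_int T \<eta>))\<^sup>2 \<le> (sqrt (measure (wt T \<beta>) {0<..<T}) * L2_norm gauss (\<lambda>z. \<eta> (x0 + sqrt T *\<^sub>R z)))\<^sup>2"
      unfolding L2_norm_power2[of ?N "term_int T \<eta>"] using tot sqint_norm2[OF s]
      by (subst (asm) nn_integral_eq_integral) (auto simp: power_mult_distrib)
  qed simp
qed

lemma term_int_diff:
  assumes "\<eta> \<in> borel_measurable borel" "L2 gauss (\<lambda>z. \<eta> (x0 + sqrt T *\<^sub>R z))"
    "\<zeta> \<in> borel_measurable borel" "L2 gauss (\<lambda>z. \<zeta> (x0 + sqrt T *\<^sub>R z))"
  shows "AE q in nu T x0 \<beta>. term_int T \<eta> q - term_int T \<zeta> q = term_int T (\<lambda>x. \<eta> x - \<zeta> x) q"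
  using term_int_bound(3)[OF assms(1,2)] term_int_bound(3)[OF assms(3,4)]
  by eventually_elim (simp add: term_int_def)

lemma mild_map_eq:
  assumes F: "F \<in> borel_measurable (nu T x0 \<beta>)" and \<eta>: "\<eta> \<in> borel_measurable borel" and q: "q \<in> cylinder T"
  shows "mild_map M W T F \<eta> q = term_int T \<eta> q + src_int T F q"
proof -
  obtain t x where qq: "q = (t, x)" and t: "0 < t" "t < T" using q by (auto simp: cylinder_def)
  have "heat M W (T - t) \<eta> x = term_int T \<eta> q"
    using heat_eq_gauss[OF bm _ \<eta>, of "T - t" x] t by (simp add: term_int_def qq)
  moreover have "(LINT r:{t<..<T}|lborel. heat M W (r - t) (\<lambda>y. F (r, y)) x) = src_int T F q"
  proof -
    \<comment> \<open>The two ranges may differ because the kernel vanishes for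
      \<open>r \<le> t\<close> by its case distinction and at \<open>r = T\<close> because the
      extended source is zero there.\<close>
    have "indicator {t<..<T} r *\<^sub>R heat M W (r - t) (\<lambda>y. F (r, y)) x
      = indicator {0..T} r *\<^sub>R (LINT z|gauss. src_kernel T F q (r, z))" for r
    proof (cases "r \<in> {t<..<T}")
      case True
      have r: "(r, y) \<in> cylinder T" for y :: "real^'n" using True t by (simp add: cylinder_def)
      have "(\<lambda>y. cyl_ext T F (r, y)) \<in> borel_measurable borel"
        by (rule measurable_compose[OF _ cyl_ext_measurable[OF F]]) (intro borel_measurable_continuous_onI continuous_intros)
      then have "(\<lambda>y. F (r, y)) \<in> borel_measurable borel" using r by (simp add: cyl_ext_def)
      from heat_eq_gauss[OF bm _ this, of "r - t" x] True t r
      show ?thesis by (simp add: src_kernel_def cyl_ext_def qq)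
    next
      case False
      then have "src_kernel T F q (r, z) = 0" for z
        using t by (auto simp: src_kernel_def cyl_ext_def cylinder_def qq)
      with False show ?thesis by simp
    qed
    then show ?thesis
      unfolding set_lebesgue_integral_def src_int_def by (simp add: integral_restrict_space set_lebesgue_integral_def)
  qed
  ultimately show ?thesis by (simp add: mild_map_def qq)
qed

lemma sqint_mild_map:
  assumes F: "L2 (nu T x0 \<beta>) F"
    and \<eta>: "\<eta> \<in> borel_measurable borel" "L2 gauss (\<lambda>z. \<eta> (x0 + sqrt T *\<^sub>R z))"
  shows "L2 (nu T x0 \<beta>) (mild_map M W T F \<eta>)"
proof -
  have s: "L2 (nu T x0 \<beta>) (\<lambda>q. term_int T \<eta> q + src_int T F q)"
    by (intro sqint_add term_int_bound src_int_bound F \<eta>)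
  have "mild_map M W T F \<eta> q = term_int T \<eta> q + src_int T F q" if "q \<in> space (nu T x0 \<beta>)" for q
    using that mild_map_eq[OF sqintD[OF F] \<eta>(1)] by simp
  from sqint_cong[of "nu T x0 \<beta>", OF this] s show ?thesis by simp
qed

definition map_const :: real where
  "map_const = sqrt (measure (wt T \<beta>) {0<..<T}) + src_const"

lemma mild_map_diff_bound:
  assumes F: "L2 (nu T x0 \<beta>) F" and G: "L2 (nu T x0 \<beta>) G"
    and \<eta>: "\<eta> \<in> borel_measurable borel" "L2 gauss (\<lambda>z. \<eta> (x0 + sqrt T *\<^sub>R z))"
    and \<zeta>: "\<zeta> \<in> borel_measurable borel" "L2 gauss (\<lambda>z. \<zeta> (x0 + sqrt T *\<^sub>R z))"
  shows "L2_norm (nu T x0 \<beta>) (\<lambda>q. mild_map M W T F \<eta> q - mild_map M W T G \<zeta> q)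
    \<le> map_const * (L2_norm (nu T x0 \<beta>) (\<lambda>q. F q - G q) + L2_norm gauss (\<lambda>z. \<eta> (x0 + sqrt T *\<^sub>R z) - \<zeta> (x0 + sqrt T *\<^sub>R z)))"
proof -
  let ?N = "nu T x0 \<beta>"
  note FG = sqint_diff[OF F G]
  have \<eta>\<zeta>: "(\<lambda>x. \<eta> x - \<zeta> x) \<in> borel_measurable borel" "L2 gauss (\<lambda>z. \<eta> (x0 + sqrt T *\<^sub>R z) - \<zeta> (x0 + sqrt T *\<^sub>R z))"
    using \<eta> \<zeta> by (auto intro: sqint_diff)
  have "L2_norm ?N (\<lambda>q. mild_map M W T F \<eta> q - mild_map M W T G \<zeta> q)
     = L2_norm ?N (\<lambda>q. term_int T (\<lambda>x. \<eta> x - \<zeta> x) q + src_int T (\<lambda>q. F q - G q) q)"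
  proof (rule L2_norm_AE_cong)
    show "(\<lambda>q. mild_map M W T F \<eta> q - mild_map M W T G \<zeta> q) \<in> borel_measurable ?N"
      using sqintD[OF sqint_mild_map[OF F \<eta>]] sqintD[OF sqint_mild_map[OF G \<zeta>]] by simp
    show "(\<lambda>q. term_int T (\<lambda>x. \<eta> x - \<zeta> x) q + src_int T (\<lambda>q. F q - G q) q) \<in> borel_measurable ?N"
      using sqintD[OF term_int_bound(1)[OF \<eta>\<zeta>]] sqintD[OF src_int_bound(1)[OF FG]] by simp
    show "AE q in ?N. mild_map M W T F \<eta> q - mild_map M W T G \<zeta> q = term_int T (\<lambda>x. \<eta> x - \<zeta> x) q + src_int T (\<lambda>q. F q - G q) q"
      using src_int_diff[OF F G] term_int_diff[OF \<eta> \<zeta>] AE_space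
    proof eventually_elim
      case (elim q)
      then show ?case
        using mild_map_eq[OF sqintD[OF F] \<eta>(1), of q] mild_map_eq[OF sqintD[OF G] \<zeta>(1), of q]
        by simp
    qed
  qed
  also have "\<dots> \<le> L2_norm ?N (term_int T (\<lambda>x. \<eta> x - \<zeta> x)) + L2_norm ?N (src_int T (\<lambda>q. F q - G q))"
    by (rule L2_norm_triangle[OF term_int_bound(1)[OF \<eta>\<zeta>] src_int_bound(1)[OF FG]])
  also have "\<dots> \<le> sqrt (measure (wt T \<beta>) {0<..<T}) * L2_norm gauss (\<lambda>z. \<eta> (x0 + sqrt T *\<^sub>R z) - \<zeta> (x0 + sqrt T *\<^sub>R z))
     + src_const * L2_norm ?N (\<lambda>q. F q - G q)"
    by (intro add_mono term_int_bound(2)[OF \<eta>\<zeta>] src_int_bound(2)[OF FG])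
  also have "\<dots> \<le> map_const * (L2_norm ?N (\<lambda>q. F q - G q) + L2_norm gauss (\<lambda>z. \<eta> (x0 + sqrt T *\<^sub>R z) - \<zeta> (x0 + sqrt T *\<^sub>R z)))"
  proof -
    have "0 \<le> src_const" using T by (simp add: src_const_def)
    then show ?thesis by (simp add: map_const_def algebra_simps)
  qed
  finally show ?thesis .
qed

end

subsection \<open>Density of test functions\<close>

text \<open>Kept general in the measure and the open set: it is used for \<open>nu\<close> on the
  cylinder, and for Lebesgue measure on bounded boxes in the mollification and separation
  arguments.\<close>

definition approximable :: "'a::euclidean_space measure => 'a set => ('a => real) => bool" where
  "approximable N D f \<longleftrightarrow> L2 N f \<and>
     (\<forall>e>0. \<exists>\<phi>. test_function D \<phi> \<and> L2_norm N (\<lambda>z. f z - \<phi> z) < e)"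

context
  fixes N :: "'a::euclidean_space measure" and D :: "'a set" and a b :: "nat => 'a"
  assumes fin: "finite_measure N" and spN: "space N = D" and stN: "sets N = sets (restrict_space borel D)"
    and D: "D = (\<Union>k. box (a k) (b k))" and inc: "incseq (\<lambda>k. box (a k) (b k))"
begin

lemma measurable_N: "f \<in> borel_measurable borel ==> f \<in> borel_measurable N"
  unfolding measurable_cong_sets[OF stN refl] by (rule measurable_restrict_space1)

lemma test_square_integrable: "test_function D \<phi> ==> L2 N \<phi>"
proof -
  assume t: "test_function D \<phi>"
  obtain C where "\<And>x. \<bar>\<phi> x\<bar> \<le> C" using testfun_bounded[OF t] by blast
  then show ?thesis
    by (intro sqint_bounded[OF fin, where C=C] measurable_N borel_measurable_continuous_onI
        smooth_continuous_on testfun_smooth[OF t]) auto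
qed

lemma approximable_add:
  assumes f: "approximable N D f" and g: "approximable N D g"
  shows "approximable N D (\<lambda>x. f x + g x)"
  unfolding approximable_def
proof (intro conjI allI impI)
  have s: "L2 N f" "L2 N g" using f g by (auto simp: approximable_def)
  then show "L2 N (\<lambda>x. f x + g x)" by (rule sqint_add)
  fix e :: real assume "e > 0"
  then have "e / 2 > 0" by simp
  with f g obtain \<phi> \<psi> where p: "test_function D \<phi>" "L2_norm N (\<lambda>z. f z - \<phi> z) < e / 2"
      "test_function D \<psi>" "L2_norm N (\<lambda>z. g z - \<psi> z) < e / 2"
    unfolding approximable_def by blast
  have "L2_norm N (\<lambda>z. (f z + g z) - (\<phi> z + \<psi> z)) = L2_norm N (\<lambda>z. (f z - \<phi> z) + (g z - \<psi> z))"
    by (simp add: algebra_simps)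
  also have "\<dots> \<le> L2_norm N (\<lambda>z. f z - \<phi> z) + L2_norm N (\<lambda>z. g z - \<psi> z)"
    by (intro L2_norm_triangle sqint_diff s test_square_integrable p)
  also have "\<dots> < e" using p by simp
  finally show "\<exists>\<phi>. test_function D \<phi> \<and> L2_norm N (\<lambda>z. f z + g z - \<phi> z) < e"
    using testfun_add[OF p(1,3)] by blast
qed

lemma approximable_cmult:
  assumes f: "approximable N D f" shows "approximable N D (\<lambda>x. c * f x)"
  unfolding approximable_def
proof (intro conjI allI impI)
  have s: "L2 N f" using f by (auto simp: approximable_def)
  then show "L2 N (\<lambda>x. c * f x)" using sqint_scaleR[OF s, of c] by simp
  fix e :: real assume e: "e > 0"
  have "e / (\<bar>c\<bar> + 1) > 0" using e by simp
  with f obtain \<phi> where p: "test_function D \<phi>" "L2_norm N (\<lambda>z. f z - \<phi> z) < e / (\<bar>c\<bar> + 1)"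
    unfolding approximable_def by blast
  have "L2_norm N (\<lambda>z. c * f z - c * \<phi> z) = \<bar>c\<bar> * L2_norm N (\<lambda>z. f z - \<phi> z)"
    using L2_norm_scaleR[of N c "\<lambda>z. f z - \<phi> z"] by (simp add: right_diff_distrib)
  also have "\<dots> \<le> (\<bar>c\<bar> + 1) * L2_norm N (\<lambda>z. f z - \<phi> z)" by (intro mult_right_mono) auto
  also have "\<dots> < e" using p(2) by (simp add: pos_less_divide_eq mult.commute)
  finally show "\<exists>\<phi>. test_function D \<phi> \<and> L2_norm N (\<lambda>z. c * f z - \<phi> z) < e"
    using testfun_cmult[OF p(1)] by blast
qed

lemma approximable_limit:
  assumes f: "L2 N f" and g: "\<And>k. approximable N D (g k)"
    and lim: "(\<lambda>k. L2_norm N (\<lambda>z. f z - g k z)) \<longlonglongrightarrow> 0"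
  shows "approximable N D f"
  unfolding approximable_def
proof (intro conjI allI impI f)
  fix e :: real assume "e > 0"
  then have e2: "e / 2 > 0" by simp
  from order_tendstoD(2)[OF lim e2] obtain k where k: "L2_norm N (\<lambda>z. f z - g k z) < e / 2"
    by (auto simp: eventually_sequentially)
  from g[of k] e2 obtain \<phi> where p: "test_function D \<phi>" "L2_norm N (\<lambda>z. g k z - \<phi> z) < e / 2"
    unfolding approximable_def by blast
  have "L2_norm N (\<lambda>z. f z - \<phi> z) \<le> L2_norm N (\<lambda>z. f z - g k z) + L2_norm N (\<lambda>z. g k z - \<phi> z)"
    using g[of k] by (intro L2_norm_triangle3[OF f _ test_square_integrable[OF p(1)]]) (simp add: approximable_def)
  then show "\<exists>\<phi>. test_function D \<phi> \<and> L2_norm N (\<lambda>z. f z - \<phi> z) < e" using k p by (intro exI[of _ \<phi>]) auto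
qed

lemma approximable_test: "test_function D \<phi> ==> approximable N D \<phi>"
  unfolding approximable_def using test_square_integrable by (auto intro!: exI[of _ \<phi>])

lemma sqint_dominated_limit:
  fixes f h :: "'a => real" and g :: "nat => 'a => real"
  assumes "\<And>k. g k \<in> borel_measurable N" "L2 N f" "L2 N h"
    "\<And>z. z \<in> D ==> (\<lambda>k. g k z) \<longlonglongrightarrow> f z" "\<And>k z. z \<in> D ==> \<bar>f z - g k z\<bar> \<le> h z"
  shows "(\<lambda>k. L2_norm N (\<lambda>z. f z - g k z)) \<longlonglongrightarrow> 0"
proof (rule L2_norm_tendsto_0_dominated[OF assms(3)])
  show "(\<lambda>z. f z - g k z) \<in> borel_measurable N" for k using assms(1)[of k] sqintD[OF assms(2)] by simp
  show "AE z in N. (\<lambda>k. f z - g k z) \<longlonglongrightarrow> 0"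
    using assms(4) by (intro AE_I2) (auto simp: spN intro!: tendsto_eq_intros)
  show "AE z in N. norm (f z - g k z) \<le> norm (h z)" for k
  proof (rule AE_I2)
    fix z assume "z \<in> space N"
    then have "\<bar>f z - g k z\<bar> \<le> h z" using assms(5) by (simp add: spN)
    then show "norm (f z - g k z) \<le> norm (h z)" using abs_ge_self[of "h z"] by simp
  qed
qed

lemma indicator_square_integrable: "A \<in> sets borel ==> L2 N (indicator A :: 'a => real)"
  by (intro sqint_bounded[OF fin, where C=1] measurable_N) auto

lemma approximable_box:
  assumes "box c d \<subseteq> D" shows "approximable N D (indicator (box c d))"
proof (rule approximable_limit)
  show "approximable N D (box_bump c d k)" for k
    by (intro approximable_test testfun_mono[OF testfun_box_bump assms])
  show "L2 N (indicator (box c d) :: 'a => real)" by (intro indicator_square_integrable) simp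
  show "(\<lambda>k. L2_norm N (\<lambda>z. indicator (box c d) z - box_bump c d k z)) \<longlonglongrightarrow> 0"
  proof (rule sqint_dominated_limit[where h="\<lambda>_. 1"])
    show "box_bump c d k \<in> borel_measurable N" for k
      by (intro measurable_N borel_measurable_continuous_onI smooth_continuous_on testfun_smooth[OF testfun_box_bump])
    show "L2 N (indicator (box c d) :: 'a => real)" by (intro indicator_square_integrable) simp
    show "L2 N (\<lambda>_. 1 :: real)" by (rule sqint_bounded[OF fin, where C=1]) auto
    show "(\<lambda>k. box_bump c d k z) \<longlonglongrightarrow> indicator (box c d) z" for z by (rule box_bump_tendsto)
    show "\<bar>indicator (box c d) z - box_bump c d k z\<bar> \<le> 1" for k z
      using box_bump_bounds[of c d k z] by (auto split: split_indicator)
  qed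
qed

text \<open>Dynkin's argument: boxes are stable under intersection and generate the Borel sets, and
  approximability passes to complements and to countable disjoint unions.\<close>

lemma approximable_indicator:
  assumes "A \<in> sets borel" shows "approximable N D (indicator A)"
proof -
  have one: "L2 N (\<lambda>_. 1 :: real)" by (rule sqint_bounded[OF fin, where C=1]) auto
  have ind_lim: "approximable N D (indicator A)"
    if "A \<in> sets borel" "\<And>k. approximable N D (indicator (B k))" "\<And>k. B k \<in> sets borel"
      "\<And>z. z \<in> D ==> (\<lambda>k. indicator (B k) z :: real) \<longlonglongrightarrow> indicator A z" for A B
  proof (rule approximable_limit[OF indicator_square_integrable[OF that(1)] that(2)])
    show "(\<lambda>k. L2_norm N (\<lambda>z. indicator A z - indicator (B k) z :: real)) \<longlonglongrightarrow> 0"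
      by (rule sqint_dominated_limit[where h="\<lambda>_. 1"])
        (use that one in \<open>auto intro!: indicator_square_integrable measurable_N split: split_indicator\<close>)
  qed
  have mem: "\<forall>\<^sub>F k in sequentially. z \<in> box (a k) (b k)" if "z \<in> D" for z
  proof -
    obtain k where "z \<in> box (a k) (b k)" using \<open>z \<in> D\<close> D by auto
    then show ?thesis
      unfolding eventually_sequentially using inc by (intro exI[of _ k]) (auto simp: incseq_def)
  qed
  \<comment> \<open>A box that sticks out of \<open>D\<close> is first intersected with the
    exhausting boxes; each intersection is a box inside \<open>D\<close>, and the intersections
    converge to the given box pointwise on \<open>D\<close>.\<close>
  have boxes: "approximable N D (indicator (box c d))" for c d
  proof (rule ind_lim[where B="\<lambda>k. box c d \<inter> box (a k) (b k)"])
    show "approximable N D (indicator (box c d \<inter> box (a k) (b k)))" for k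
      unfolding box_Int_box by (rule approximable_box) (use D in \<open>auto simp flip: box_Int_box\<close>)
    show "(\<lambda>k. indicator (box c d \<inter> box (a k) (b k)) z :: real) \<longlonglongrightarrow> indicator (box c d) z" if "z \<in> D" for z
      by (rule tendsto_eventually) (use mem[OF that] in \<open>eventually_elim, simp add: indicator_def\<close>)
  qed auto
  have univ: "approximable N D (indicator UNIV)"
  proof (rule ind_lim[where B="\<lambda>k. box (a k) (b k)"])
    show "(\<lambda>k. indicator (box (a k) (b k)) z :: real) \<longlonglongrightarrow> indicator UNIV z" if "z \<in> D" for z
      by (rule tendsto_eventually) (use mem[OF that] in \<open>eventually_elim, simp\<close>)
  qed (use boxes in auto)
  have sets: "A \<in> sigma_sets UNIV (range (\<lambda>(a, b). box a b :: 'a set))" 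
    using assms unfolding borel_eq_box by simp
  have st: "Int_stable (range (\<lambda>(a, b). box a b :: 'a set))"
    by (auto simp: Int_stable_def box_Int_box)
  show ?thesis
  proof (rule sigma_sets_induct_disjoint[OF st _ sets])
    show "approximable N D (indicator A)" if "A \<in> range (\<lambda>(a, b). box a b)" for A
      using that boxes by auto
    have "(indicator {} :: 'a => real) = (\<lambda>x. 0)" by auto
    then show "approximable N D (indicator {})"
      using approximable_test[OF testfun_zero] by simp
    fix A :: "'a set" assume "approximable N D (indicator A)"
    from approximable_add[OF univ approximable_cmult[OF this, of "-1"]]
    have "approximable N D (\<lambda>x. 1 - indicator A x)" by simp
    also have "(\<lambda>x. 1 - indicator A x :: real) = indicator (UNIV - A)" by (auto simp: fun_eq_iff split: split_indicator)
    finally show "approximable N D (indicator (UNIV - A))" .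
  next
    fix A :: "nat => 'a set"
    assume A: "disjoint_family A" "range A \<subseteq> sigma_sets UNIV (range (\<lambda>(a, b). box a b))"
      "\<And>i. approximable N D (indicator (A i))"
    have Ab: "A i \<in> sets borel" for i using A(2) unfolding borel_eq_box by auto
    have fin: "approximable N D (indicator (\<Union>i<k. A i))" for k
    proof (induction k)
      case 0
      have "(indicator (\<Union>i<0. A i) :: 'a => real) = (\<lambda>x. 0)" by auto
      then show ?case using approximable_test[OF testfun_zero] by simp
    next
      case (Suc k)
      have "indicator (\<Union>i<Suc k. A i) x = (indicator (\<Union>i<k. A i) x + indicator (A k) x :: real)" for x
      proof -
        have "x \<notin> A i" if "x \<in> A k" "i < k" for i
          using disjoint_family_onD[OF A(1), of i k] that by auto
        then show ?thesis unfolding lessThan_Suc UN_insert indicator_def by auto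
      qed
      then have "(indicator (\<Union>i<Suc k. A i) :: 'a => real) = (\<lambda>x. indicator (\<Union>i<k. A i) x + indicator (A k) x)"
        by (rule ext)
      then show ?case using approximable_add[OF Suc A(3)[of k]] by (simp only:)
    qed
    show "approximable N D (indicator (\<Union>i. A i))"
    proof (rule ind_lim[where B="\<lambda>k. \<Union>i<k. A i"])
      show "(\<lambda>k. indicator (\<Union>i<k. A i) z :: real) \<longlonglongrightarrow> indicator (\<Union>i. A i) z" for z
        by (rule LIMSEQ_indicator_UN)
    qed (use Ab fin in auto)
  qed simp
qed

theorem test_functions_dense:
  fixes f :: "'a => real"
  assumes f: "L2 N f"
  shows "approximable N D f"
proof -
  \<comment> \<open>Square integrability is carried through the induction as an implication: it
    descends from the final function to each ingredient, since all ingredients are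
    nonnegative.\<close>
  have nonneg: "L2 N u \<longrightarrow> approximable N D u"
    if "u \<in> borel_measurable N" "\<And>x. 0 \<le> u x" for u :: "'a => real"
    using that
  proof (induction u rule: borel_measurable_induct_real)
    case (set A)
    then have "A \<in> sets (restrict_space borel D)" by (simp add: stN)
    then obtain B where B: "B \<in> sets borel" "A = D \<inter> B" by (auto simp: sets_restrict_space)
    have "approximable N D (indicator B)" by (rule approximable_indicator[OF B(1)])
    moreover have "L2_norm N (\<lambda>z. indicator A z - \<phi> z) = L2_norm N (\<lambda>z. indicator B z - \<phi> z)" for \<phi> :: "'a => real"
      by (rule L2_norm_cong) (auto simp: spN B indicator_def)
    ultimately show ?case unfolding approximable_def by simp
  next
    case (mult u c)
    show ?case
    \<comment> \<open>For \<open>c = 0\<close> square integrability of the product says nothing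
      about \<open>u\<close>, so the induction hypothesis cannot be invoked; the product is then
      zero itself.\<close>
    proof (cases "c = 0")
      case True then show ?thesis using approximable_test[OF testfun_zero] by simp
    next
      case False
      show ?thesis
      proof
        assume "L2 N (\<lambda>x. c * u x)"
        from sqint_scaleR[OF this, of "1 / c"] False have "L2 N u" by simp
        with mult.IH show "approximable N D (\<lambda>x. c * u x)" by (intro approximable_cmult) simp
      qed
    qed
  next
    case (add u v)
    show ?case
    proof
      assume s: "L2 N (\<lambda>x. v x + u x)"
      have "L2 N u" "L2 N v"
        by (rule sqint_bound[OF sqint_norm2[OF s]];
            use add.hyps in \<open>auto intro!: AE_I2 power_mono\<close>)+
      with add.IH show "approximable N D (\<lambda>x. v x + u x)" by (intro approximable_add) auto
    qed
  next
    case (seq U)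
    show ?case
    proof
      assume s: "L2 N u"
      have U: "0 \<le> U i x" "U i x \<le> u x" if "x \<in> space N" for i x
      proof -
        show "0 \<le> U i x" by (rule seq.hyps)
        show "U i x \<le> u x"
          using seq.hyps(3,4) that by (intro incseq_le[of "\<lambda>i. U i x"]) (auto simp: incseq_def le_fun_def)
      qed
      have "L2 N (U i)" for i
        by (rule sqint_bound[OF sqint_norm2[OF s]])
          (use seq.hyps(1) U in \<open>auto intro!: AE_I2 power_mono\<close>)
      with seq.IH have a: "approximable N D (U i)" for i by blast
      show "approximable N D u"
      proof (rule approximable_limit[OF s a])
        show "(\<lambda>k. L2_norm N (\<lambda>z. u z - U k z)) \<longlonglongrightarrow> 0"
        proof (rule sqint_dominated_limit[where h=u])
          show "\<bar>u z - U k z\<bar> \<le> u z" if "z \<in> D" for k z using U[of z k] that by (simp add: spN)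
        qed (use seq.hyps s in \<open>auto simp: spN\<close>)
      qed
    qed
  qed
  have fm: "f \<in> borel_measurable N" using f by (rule sqintD)
  have "L2 N (\<lambda>x. max (f x) 0)" "L2 N (\<lambda>x. max (- f x) 0)"
    by (rule sqint_bound[OF sqint_norm2[OF f]];
        use fm in \<open>auto intro!: AE_I2 simp: max_def\<close>)+
  with nonneg[of "\<lambda>x. max (f x) 0"] nonneg[of "\<lambda>x. max (- f x) 0"] fm
  have "approximable N D (\<lambda>x. max (f x) 0 + (-1) * max (- f x) 0)"
    by (intro approximable_add approximable_cmult) auto
  also have "(\<lambda>x. max (f x) 0 + (-1) * max (- f x) 0) = f" by (auto simp: fun_eq_iff max_def)
  finally show ?thesis .
qed

corollary test_functions_dense_sequence:
  assumes f: "L2 N f"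
  shows "\<exists>\<phi>. (\<forall>k. test_function D (\<phi> k)) \<and> L2_converges N \<phi> f"
proof -
  have "\<exists>\<phi>. test_function D \<phi> \<and> L2_norm N (\<lambda>z. f z - \<phi> z) < inverse (real (Suc k))" for k
    using test_functions_dense[OF f] unfolding approximable_def by simp
  then obtain \<phi> where p: "\<And>k. test_function D (\<phi> k)" "\<And>k. L2_norm N (\<lambda>z. f z - \<phi> k z) < inverse (real (Suc k))"
    by metis
  have "(\<lambda>k. L2_norm N (\<lambda>z. \<phi> k z - f z)) \<longlonglongrightarrow> 0"
  proof (rule tendsto_sandwich[OF _ _ tendsto_const LIMSEQ_inverse_real_of_nat])
    show "\<forall>\<^sub>F k in sequentially. L2_norm N (\<lambda>z. \<phi> k z - f z) \<le> inverse (real (Suc k))"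
      using p(2) by (auto intro!: always_eventually less_imp_le simp: L2_norm_minus_commute[of N "\<phi> _"])
  qed simp
  then show ?thesis using p(1) f test_square_integrable unfolding L2_converges_def by blast
qed

text \<open>Testing against approximations of \<open>g\<close> itself gives zero for the integral of
  the square of \<open>g\<close>.\<close>

lemma test_functions_separate:
  fixes g :: "'a => real"
  assumes g: "L2 N g" and z: "\<And>\<phi>. test_function D \<phi> ==> (LINT x|N. g x * \<phi> x) = 0"
  shows "AE x in N. g x = 0"
proof -
  obtain \<phi> where p: "\<And>k. test_function D (\<phi> k)" "L2_converges N \<phi> g"
    using test_functions_dense_sequence[OF g] by blast
  have "(\<lambda>k. LINT x|N. g x * \<phi> k x) \<longlonglongrightarrow> (LINT x|N. g x * g x)"
    by (rule L2_converges_mult[OF L2_converges_const[OF g] p(2)])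
  then have "(\<lambda>k. 0::real) \<longlonglongrightarrow> (LINT x|N. g x * g x)" using z p(1) by simp
  then have "(LINT x|N. g x * g x) = 0" by (simp add: LIMSEQ_const_iff)
  then have "L2_norm N g = 0" by (simp add: L2_norm_def power2_eq_square)
  from L2_norm_eq_0_AE[OF g this] show ?thesis .
qed

end

subsection \<open>Density of test functions in the Gaussian Sobolev space\<close>

text \<open>Convolution with the reflected kernel. In this form the value at \<open>x\<close> is the
  pairing of \<open>h\<close> with a translated test function, so the definition of a weak
  derivative applies to it verbatim.\<close>

definition mollify :: "('a::euclidean_space => real) => ('a => real) => 'a => real" where
  "mollify \<rho> h x = (LINT y|lborel. h y * \<rho> (y - x))"

lemma testfun_integrable:
  fixes \<rho> :: "'a::euclidean_space => real"
  assumes "test_function UNIV \<rho>" shows "integrable lborel \<rho>"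
proof -
  let ?K = "closure {x. \<rho> x \<noteq> 0}"
  have "integrable lborel (\<lambda>x. indicator ?K x *\<^sub>R \<rho> x)"
    by (intro borel_integrable_compact smooth_continuous_on testfun_smooth[OF assms])
      (use assms in \<open>simp add: test_function_def\<close>)
  also have "(\<lambda>x. indicator ?K x *\<^sub>R \<rho> x) = \<rho>"
  proof
    show "indicator ?K x *\<^sub>R \<rho> x = \<rho> x" for x
      using testfun_support(1)[OF assms, of x] by (cases "x \<in> ?K") auto
  qed
  finally show ?thesis .
qed

lemma testfun_shift:
  fixes \<rho> :: "'a::euclidean_space => real"
  assumes "test_function UNIV \<rho>" shows "test_function UNIV (\<lambda>y. \<rho> (y - x))"
proof (rule test_functionI[where K="(+) x ` closure {x. \<rho> x \<noteq> 0}"])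
  show "smooth (\<lambda>y. \<rho> (y - x))"
    using smooth_affine[OF bounded_linear_ident testfun_smooth[OF assms], of "- x"] by simp
  have c: "compact (closure {x. \<rho> x \<noteq> 0})" using assms by (simp add: test_function_def)
  then have "compact ((+) x ` closure {x. \<rho> x \<noteq> 0})" by (rule compact_translation)
  then show "closed ((+) x ` closure {x. \<rho> x \<noteq> 0})" "bounded ((+) x ` closure {x. \<rho> x \<noteq> 0})"
    by (auto simp: compact_eq_bounded_closed)
  show "y \<in> (+) x ` closure {x. \<rho> x \<noteq> 0}" if "\<rho> (y - x) \<noteq> 0" for y
    using that closure_subset[of "{x. \<rho> x \<noteq> 0}"] by (intro image_eqI[of _ _ "y - x"]) auto
qed simp

lemma dir_deriv_shift:
  fixes \<rho> :: "'a::euclidean_space => real"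
  assumes "smooth \<rho>" shows "dir_deriv v (\<lambda>y. \<rho> (y - x)) y = dir_deriv v \<rho> (y - x)"
  using dir_deriv_affine[OF bounded_linear_ident smooth_differentiable[OF assms], where a="- x" and x=y and v=v] by simp

lemma integrable_mult_test_shift:
  fixes g \<rho> :: "'a::euclidean_space => real"
  assumes g: "integrable lborel g" and \<rho>: "test_function UNIV \<rho>"
  shows "integrable lborel (\<lambda>y. g y * \<rho> (y - x))"
proof -
  obtain B where B: "\<And>x. \<bar>\<rho> x\<bar> \<le> B" using testfun_bounded[OF \<rho>] by blast
  have [measurable]: "\<rho> \<in> borel_measurable borel" by (rule smooth_borel[OF testfun_smooth[OF \<rho>]])
  show ?thesis
  proof (rule Lintegrable_bound[where f="\<lambda>y. \<bar>g y\<bar> * B"])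
    have "\<bar>g y\<bar> * \<bar>\<rho> (y - x)\<bar> \<le> \<bar>g y\<bar> * \<bar>B\<bar>" for y
      using B[of "y - x"] by (intro mult_left_mono) auto
    then show "AE y in lborel. norm (g y * \<rho> (y - x)) \<le> norm (\<bar>g y\<bar> * B)" by (simp add: abs_mult)
  qed (use g borel_measurable_integrable[OF g] in auto)
qed

lemma mollify_has_derivative:
  fixes h \<rho> :: "'a::euclidean_space => real"
  assumes h: "integrable lborel h" and \<rho>: "test_function UNIV \<rho>"
  shows "(mollify \<rho> h has_derivative (\<lambda>v. mollify (\<lambda>y. - dir_deriv v \<rho> y) h x)) (at x)"
proof -
  note s = testfun_smooth[OF \<rho>]
  obtain C where C: "\<And>v x. \<bar>dir_deriv v \<rho> x\<bar> \<le> C * norm v"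
    using bsmooth_derivative_bound[OF testfun_bsmooth[OF \<rho>]] by blast
  have hm[measurable]: "h \<in> borel_measurable borel" using borel_measurable_integrable[OF h] by simp
  have m: "(\<lambda>y. g (y - x)) \<in> borel_measurable borel" if "smooth g" for g :: "'a => real" and x
    by (intro borel_measurable_continuous_onI smooth_compose_cont[OF that] continuous_intros)
  show ?thesis
    unfolding mollify_def
  proof (rule has_derivative_integral_dominated[where e=1 and g="\<lambda>y. \<bar>h y\<bar> * C" and f'="\<lambda>x y v. h y * - dir_deriv v \<rho> (y - x)"])
    show "(\<lambda>y. h y * \<rho> (y - x)) \<in> borel_measurable lborel" for x using m[OF s] by simp
    show "(\<lambda>z. h z * - dir_deriv v \<rho> (z - x)) \<in> borel_measurable lborel" for v
      using m[OF smooth_dir_deriv[OF s]] by simp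
    show "integrable lborel (\<lambda>y. h y * \<rho> (y - x))"
      by (rule integrable_mult_test_shift[OF h \<rho>])
    show "integrable lborel (\<lambda>y. \<bar>h y\<bar> * C)" using h by auto
    show "((\<lambda>x. h y * \<rho> (y - x)) has_derivative (\<lambda>v. h y * - dir_deriv v \<rho> (y - x))) (at x)" for x y
    proof -
      have "((\<lambda>x. y - x) has_derivative (\<lambda>v. - v)) (at x)" by (auto intro!: derivative_eq_intros)
      from has_derivative_mult_right[OF has_derivative_compose[OF this smooth_has_derivative[OF s]], of "h y"]
      show ?thesis by (simp add: linear_neg[OF dir_deriv_linear[OF s]])
    qed
    show "norm (h z * - dir_deriv v \<rho> (z - x)) \<le> \<bar>h z\<bar> * C * norm v" for x z v
      using mult_left_mono[OF C[of v "z - x"], of "\<bar>h z\<bar>"] by (simp add: abs_mult mult.assoc)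
  qed auto
qed

lemma testfun_mollify:
  fixes h \<rho> :: "'a::euclidean_space => real"
  assumes h: "integrable lborel h" "bounded {x. h x \<noteq> 0}" and \<rho>: "test_function UNIV \<rho>"
  shows "test_function UNIV (mollify \<rho> h)"
proof -
  have "smooth (mollify \<rho> h)"
  proof (rule smooth_coinduct[of "{mollify \<rho> h |\<rho>. test_function UNIV \<rho>}"])
    fix g assume "g \<in> {mollify \<rho> h |\<rho>. test_function UNIV \<rho>}"
    then obtain \<rho> where g: "g = mollify \<rho> h" "test_function UNIV \<rho>" by blast
    note d = mollify_has_derivative[OF h(1) g(2)]
    show "g differentiable (at x)" for x using d g(1) by (auto intro: differentiableI)
    have "test_function UNIV (\<lambda>y. - dir_deriv v \<rho> y)" for v
      using testfun_cmult[OF testfun_dir_deriv[OF g(2)], of "-1"] by simp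
    then show "dir_deriv v g \<in> fun_sums {mollify \<rho> h |\<rho>. test_function UNIV \<rho>}" for v
      unfolding g(1) dir_deriv_cong_has_derivative[OF d] by (intro fun_sums.base) blast
  qed (use \<rho> in blast)
  moreover obtain R where R: "\<And>x. h x \<noteq> 0 ==> norm x \<le> R" using h(2) by (auto simp: bounded_iff)
  moreover obtain S where S: "\<And>x. \<rho> x \<noteq> 0 ==> norm x \<le> S"
  proof -
    have "bounded (closure {x. \<rho> x \<noteq> 0})" using \<rho> by (simp add: test_function_def compact_imp_bounded)
    then have "bounded {x. \<rho> x \<noteq> 0}" using closure_subset bounded_subset by blast
    then show ?thesis using that by (auto simp: bounded_iff)
  qed
  moreover have "x \<in> cball 0 (R + S)" if "mollify \<rho> h x \<noteq> 0" for x
  proof (rule ccontr)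
    assume x: "x \<notin> cball 0 (R + S)"
    have "h y * \<rho> (y - x) = 0" for y
    proof (rule ccontr)
      assume "h y * \<rho> (y - x) \<noteq> 0"
      then have "norm y \<le> R" "norm (y - x) \<le> S" using R S by auto
      then have "norm x \<le> R + S" using norm_triangle_ineq4[of y "y - x"] by simp
      with x show False by simp
    qed
    then have "mollify \<rho> h x = (LINT y::'a|lborel. 0)"
      unfolding mollify_def by (intro Lintegral_cong) auto
    then have "mollify \<rho> h x = 0" by simp
    with that show False by simp
  qed
  ultimately show ?thesis by (intro test_functionI[where K="cball 0 (R + S)"]) auto
qed

text \<open>Differentiating in \<open>x\<close> gives minus the derivative of the kernel in
  \<open>y\<close>; the sign in the definition of the weak derivative compensates it.\<close>

lemma mollify_weak_derivative:
  fixes h g \<rho> :: "'a::euclidean_space => real"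
  assumes h: "integrable lborel h" and \<rho>: "test_function UNIV \<rho>"
    and w: "\<And>\<phi>. test_function UNIV \<phi> ==> (LINT x|lborel. h x * dir_deriv v \<phi> x) = - (LINT x|lborel. g x * \<phi> x)"
  shows "dir_deriv v (mollify \<rho> h) x = mollify \<rho> g x"
proof -
  have "dir_deriv v (mollify \<rho> h) x = mollify (\<lambda>y. - dir_deriv v \<rho> y) h x"
    by (rule dir_derivI[OF mollify_has_derivative[OF h \<rho>]])
  also have "\<dots> = - (LINT y|lborel. h y * dir_deriv v (\<lambda>y. \<rho> (y - x)) y)"
    unfolding mollify_def dir_deriv_shift[OF testfun_smooth[OF \<rho>]] by simp
  also have "\<dots> = mollify \<rho> g x"
    unfolding w[OF testfun_shift[OF \<rho>]] mollify_def by simp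
  finally show ?thesis .
qed

lemma mollifier_exists:
  assumes "e > 0"
  shows "\<exists>\<rho>::'a::euclidean_space => real. test_function UNIV \<rho> \<and> (\<forall>x. 0 \<le> \<rho> x) \<and> (\<forall>x. \<rho> x \<noteq> 0 \<longrightarrow> norm x \<le> e) \<and> (LINT x|lborel. \<rho> x) = 1"
proof -
  define \<psi> where "\<psi> x = ball_bump ((1 / e) *\<^sub>R x)" for x :: 'a
  have supp: "norm x < e" if "\<psi> x \<noteq> 0" for x
  proof -
    have "((1 / e) *\<^sub>R x) \<bullet> ((1 / e) *\<^sub>R x) < 1"
      using that by (auto simp: \<psi>_def ball_bump_def exp_cutoff_def split: if_splits)
    then have "(norm ((1 / e) *\<^sub>R x))\<^sup>2 < 1" by (simp only: power2_norm_eq_inner)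
    then have "norm ((1 / e) *\<^sub>R x) < 1" by (simp only: abs_square_less_1 abs_norm_cancel)
    then show ?thesis using assms by (simp add: field_simps)
  qed
  have t: "test_function UNIV \<psi>"
  proof (rule test_functionI[where K="cball 0 e"])
    show "smooth \<psi>"
      unfolding \<psi>_def
      using smooth_affine[OF bounded_linear_scaleR_right testfun_smooth[OF testfun_ball_bump], of 0] by simp
  qed (use supp in \<open>auto intro: less_imp_le\<close>)
  have nn: "0 \<le> \<psi> x" for x by (simp add: \<psi>_def ball_bump_def exp_cutoff_bounds)
  have pos: "0 < \<psi> x" if "norm x < e" for x
  proof -
    have "norm ((1 / e) *\<^sub>R x) < 1" using that assms by (simp add: field_simps)
    then have "(norm ((1 / e) *\<^sub>R x))\<^sup>2 < 1" by (simp only: abs_square_less_1 abs_norm_cancel)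
    then show ?thesis
      unfolding power2_norm_eq_inner by (simp add: \<psi>_def ball_bump_def exp_cutoff_pos_iff)
  qed
  note i = testfun_integrable[OF t]
  \<comment> \<open>A vanishing integral would force the bump to be zero almost everywhere, but it
    is positive on a ball, which has positive volume.\<close>
  have "(LINT x|lborel. \<psi> x) \<noteq> 0"
  proof
    assume "(LINT x|lborel. \<psi> x) = 0"
    then have "AE x in lborel. \<psi> x = 0"
      using integral_nonneg_eq_0_iff_AE[OF i] nn by simp
    then have "AE x in lborel. x \<notin> ball (0::'a) e"
      by eventually_elim (use pos in force)
    then have "emeasure lborel (ball (0::'a) e) = 0"
      by (subst (asm) AE_iff_measurable[where N="ball 0 e"]) auto
    moreover have "measure lborel (ball (0::'a) e) > 0" using content_ball_pos[OF assms] by simp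
    ultimately show False by (simp add: measure_def)
  qed
  moreover have "0 \<le> (LINT x|lborel. \<psi> x)" using nn by simp
  ultimately have I: "0 < (LINT x|lborel. \<psi> x)" by linarith
  show ?thesis
  proof (intro exI conjI allI impI)
    show "test_function UNIV (\<lambda>x. (1 / (LINT x|lborel. \<psi> x)) * \<psi> x)" by (rule testfun_cmult[OF t])
    show "0 \<le> (1 / (LINT x|lborel. \<psi> x)) * \<psi> x" for x using nn[of x] I by simp
    show "norm x \<le> e" if "(1 / (LINT x|lborel. \<psi> x)) * \<psi> x \<noteq> 0" for x using supp[of x] that by auto
    show "(LINT x|lborel. (1 / (LINT x|lborel. \<psi> x)) * \<psi> x) = 1" using I by simp
  qed
qed

lemma nn_integral_lborel_reflect:
  fixes f :: "'a::euclidean_space => ennreal"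
  assumes [measurable]: "f \<in> borel_measurable borel"
  shows "(\<integral>\<^sup>+x. f (y - x) \<partial>lborel) = (\<integral>\<^sup>+x. f x \<partial>lborel)"
proof -
  have "(\<integral>\<^sup>+x. f x \<partial>lborel) = (\<integral>\<^sup>+x. f x \<partial>density (distr lborel borel (\<lambda>x. y + (-1) *\<^sub>R x)) (\<lambda>_. ennreal (\<bar>-1\<bar> ^ DIM('a))))"
    using lborel_affine[of "-1" y] by simp
  also have "\<dots> = (\<integral>\<^sup>+x. f (y - x) \<partial>lborel)"
    by (subst nn_integral_density; (subst nn_integral_distr)?; simp)
  finally show ?thesis ..
qed

lemma L2_norm_vec_le_sum:
  fixes U :: "'a => real^'n::finite"
  assumes "L2 N U"
  shows "L2_norm N U \<le> (\<Sum>i\<in>UNIV. L2_norm N (\<lambda>z. U z $ i))"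
proof (rule power2_le_imp_le)
  have i: "integrable N (\<lambda>z. (U z $ i)\<^sup>2)" for i
    using sqint_norm2[OF sqint_component[OF assms, of i]] by simp
  have "(L2_norm N U)\<^sup>2 = (\<Sum>i\<in>UNIV. (L2_norm N (\<lambda>z. U z $ i))\<^sup>2)"
    unfolding L2_norm_power2 power2_norm_vec using i by simp
  also have "\<dots> \<le> (\<Sum>i\<in>UNIV. L2_norm N (\<lambda>z. U z $ i))\<^sup>2"
  proof -
    have "L2_set (\<lambda>i. L2_norm N (\<lambda>z. U z $ i)) UNIV \<le> (\<Sum>i\<in>UNIV. L2_norm N (\<lambda>z. U z $ i))"
      by (rule L2_set_le_sum) simp
    from power_mono[OF this L2_set_nonneg, of 2] show ?thesis by (simp add: L2_set_def sum_nonneg)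
  qed
  finally show "(L2_norm N U)\<^sup>2 \<le> (\<Sum>i\<in>UNIV. L2_norm N (\<lambda>z. U z $ i))\<^sup>2" .
qed (simp add: sum_nonneg)

lemma cutoff_exists:
  "\<exists>\<kappa>::nat => 'a::euclidean_space => real. \<exists>C. (\<forall>k. test_function UNIV (\<kappa> k)) \<and> (\<forall>k x. \<bar>\<kappa> k x\<bar> \<le> 1) \<and>
     (\<forall>x. (\<lambda>k. \<kappa> k x) \<longlonglongrightarrow> 1) \<and> (\<forall>k v x. \<bar>dir_deriv v (\<kappa> k) x\<bar> \<le> C * norm v * inverse (real (Suc k)))"
proof -
  \<comment> \<open>The factor \<open>exp 1\<close> normalises the bump to 1 at the origin, so the
    cutoffs increase to 1 pointwise only through the dilation; the dilation by \<open>Suc k\<close>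
    makes their derivatives decay like its inverse.\<close>
  define \<kappa> where "\<kappa> k x = exp 1 * ball_bump (inverse (real (Suc k)) *\<^sub>R x)" for k and x :: 'a
  note tb = testfun_ball_bump[where 'a='a]
  obtain C where C: "\<And>v x. \<bar>dir_deriv v ball_bump (x::'a)\<bar> \<le> C * norm v"
    using bsmooth_derivative_bound[OF testfun_bsmooth[OF tb]] by blast
  have sb: "smooth (\<lambda>x. ball_bump (0 + inverse (real (Suc k)) *\<^sub>R (x::'a)))" for k
    by (rule smooth_affine[OF bounded_linear_scaleR_right testfun_smooth[OF tb]])
  have t: "test_function UNIV (\<kappa> k)" for k
    unfolding \<kappa>_def
  proof (intro testfun_cmult test_functionI[where K="cball 0 (real (Suc k))"])
    show "smooth (\<lambda>x. ball_bump (inverse (real (Suc k)) *\<^sub>R (x::'a)))" using sb[of k] by simp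
    fix x :: 'a assume "ball_bump (inverse (real (Suc k)) *\<^sub>R x) \<noteq> 0"
    then have "(inverse (real (Suc k)) *\<^sub>R x) \<bullet> (inverse (real (Suc k)) *\<^sub>R x) < 1"
      by (auto simp: ball_bump_def exp_cutoff_def split: if_splits)
    then have "(norm (inverse (real (Suc k)) *\<^sub>R x))\<^sup>2 < 1" by (simp only: power2_norm_eq_inner)
    then have "norm (inverse (real (Suc k)) *\<^sub>R x) < 1" by (simp only: abs_square_less_1 abs_norm_cancel)
    then show "x \<in> cball 0 (real (Suc k))" by (simp add: field_simps)
  qed auto
  have b: "\<bar>\<kappa> k x\<bar> \<le> 1" for k x
  proof -
    have "exp 1 * exp_cutoff (1 - r) \<le> 1" if "0 \<le> r" for r
    proof (cases "r < 1")
      case True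
      have "1 - 1 / (1 - r) \<le> 0" using that True by (simp add: field_simps)
      then have "exp (1 - 1 / (1 - r)) \<le> 1" by simp
      then show ?thesis using True by (simp add: exp_cutoff_def exp_diff exp_minus divide_inverse)
    qed (simp add: exp_cutoff_def)
    note * = this
    show ?thesis
      unfolding \<kappa>_def ball_bump_def
      by (subst abs_of_nonneg, intro mult_nonneg_nonneg exp_cutoff_bounds, simp, rule *[OF inner_ge_zero])
  qed
  have l: "(\<lambda>k. \<kappa> k x) \<longlonglongrightarrow> 1" for x
  proof -
    have "isCont (ball_bump :: 'a => real) 0"
      using smooth_continuous_on[OF testfun_smooth[OF tb], of UNIV] by (simp add: continuous_on_eq_continuous_at)
    moreover have "(\<lambda>k. inverse (real (Suc k)) *\<^sub>R x) \<longlonglongrightarrow> 0 *\<^sub>R x"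
      by (intro tendsto_intros LIMSEQ_inverse_real_of_nat)
    ultimately have "(\<lambda>k. ball_bump (inverse (real (Suc k)) *\<^sub>R x)) \<longlonglongrightarrow> ball_bump (0::'a)"
      using isCont_tendsto_compose[of "0::'a" ball_bump] by simp
    then have "(\<lambda>k. \<kappa> k x) \<longlonglongrightarrow> exp 1 * ball_bump (0::'a)" unfolding \<kappa>_def by (intro tendsto_intros)
    also have "exp 1 * ball_bump (0::'a) = 1" by (simp add: ball_bump_def exp_cutoff_def exp_minus)
    finally show ?thesis .
  qed
  have d: "\<bar>dir_deriv v (\<kappa> k) x\<bar> \<le> (exp 1 * C) * norm v * inverse (real (Suc k))" for k v x
  proof -
    let ?c = "inverse (real (Suc k))"
    have "dir_deriv v (\<kappa> k) x = exp 1 * dir_deriv (?c *\<^sub>R v) ball_bump (?c *\<^sub>R x)"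
    proof (rule dir_derivI)
      have "((\<lambda>x. ?c *\<^sub>R x) has_derivative (\<lambda>v. ?c *\<^sub>R v)) (at x)"
        by (auto intro!: derivative_eq_intros)
      from has_derivative_mult_right[OF has_derivative_compose[OF this smooth_has_derivative[OF testfun_smooth[OF tb]]], of "exp 1"]
      show "(\<kappa> k has_derivative (\<lambda>v. exp 1 * dir_deriv (?c *\<^sub>R v) ball_bump (?c *\<^sub>R x))) (at x)"
        by (simp add: \<kappa>_def[abs_def])
    qed
    then have "\<bar>dir_deriv v (\<kappa> k) x\<bar> \<le> exp 1 * (C * norm (?c *\<^sub>R v))"
      using C[of "?c *\<^sub>R v" "?c *\<^sub>R x"] by (simp add: abs_mult)
    also have "\<dots> = (exp 1 * C) * norm v * ?c" by simp
    finally show ?thesis .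
  qed
  from t b l d show ?thesis by blast
qed

section \<open>Comparison of Gaussian and Lebesgue norms, and mollification\<close>

context
  fixes T :: real and x0 :: "real^'n::finite" and \<mu> :: "(real^'n) measure"
  assumes T: "T > 0" and \<mu>: "\<mu> = density lborel (\<lambda>x. ennreal (gauss_density x0 T x))"
begin

lemma sets_mu' [measurable_cong]: "sets \<mu> = sets borel" and space_mu': "space \<mu> = UNIV"
  by (simp_all add: \<mu>)

lemma finite_measure_mu': "finite_measure \<mu>"
  unfolding \<mu> distr_gauss_affine[OF T, symmetric] by (rule gauss.finite_measure_distr) simp

text \<open>The peak of the Gaussian density, attained at \<open>x0\<close>; its square root is the
  constant with which Lebesgue norms dominate Gaussian ones.\<close>

definition gmax :: real where "gmax = (2 * pi * T) powr (- real CARD('n) / 2)"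

lemma gmax: "0 < gmax" "gauss_density x0 T x \<le> gmax"
  using T by (simp_all add: gmax_def gauss_density_def mult_left_le)

lemma mu'_measurable: "f \<in> borel_measurable \<mu> \<longleftrightarrow> f \<in> borel_measurable borel"
  by (simp add: measurable_cong_sets[OF sets_mu' refl])

lemma L2_mu'_le:
  fixes f :: "real^'n => real"
  assumes f: "L2 lborel f"
  shows "L2 \<mu> f" and "L2_norm \<mu> f \<le> sqrt gmax * L2_norm lborel f"
proof -
  have [measurable]: "f \<in> borel_measurable borel" using sqintD[OF f] by simp
  have "(\<integral>\<^sup>+x. ennreal ((f x)\<^sup>2) \<partial>\<mu>) = (\<integral>\<^sup>+x. ennreal (gauss_density x0 T x) * ennreal ((f x)\<^sup>2) \<partial>lborel)"
    unfolding \<mu> by (subst nn_integral_density) auto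
  also have "\<dots> \<le> (\<integral>\<^sup>+x. ennreal gmax * ennreal ((f x)\<^sup>2) \<partial>lborel)"
    by (intro nn_integral_mono mult_right_mono ennreal_leI gmax) simp
  also have "\<dots> = ennreal gmax * ennreal ((L2_norm lborel f)\<^sup>2)"
    unfolding L2_norm_power2 using sqint_norm2[OF f]
    by (simp add: nn_integral_cmult nn_integral_eq_integral)
  also have "\<dots> = ennreal ((sqrt gmax * L2_norm lborel f)\<^sup>2)"
    using gmax(1) by (simp add: ennreal_mult[symmetric] power_mult_distrib)
  finally have le: "(\<integral>\<^sup>+x. ennreal ((f x)\<^sup>2) \<partial>\<mu>) \<le> ennreal ((sqrt gmax * L2_norm lborel f)\<^sup>2)" .
  show s: "L2 \<mu> f"
    unfolding square_integrable_def mu'_measurable using le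
    by (auto intro!: integrableI_bounded simp: mu'_measurable intro: le_less_trans)
  show "L2_norm \<mu> f \<le> sqrt gmax * L2_norm lborel f"
  proof (rule power2_le_imp_le)
    show "(L2_norm \<mu> f)\<^sup>2 \<le> (sqrt gmax * L2_norm lborel f)\<^sup>2"
      unfolding L2_norm_power2[of \<mu> f] using le sqint_norm2[OF s]
      by (subst (asm) nn_integral_eq_integral) auto
  qed (use gmax(1) in simp)
qed

text \<open>On the compact support of the cutoff the Gaussian density is bounded below, so Gaussian
  square integrability implies Lebesgue square integrability there.\<close>

lemma cutoff_L2:
  fixes f :: "real^'n => real"
  assumes f: "L2 \<mu> f" and c: "test_function UNIV \<kappa>"
  shows "L2 lborel (\<lambda>x. \<kappa> x * f x)"
proof -
  have [measurable]: "f \<in> borel_measurable borel" using sqintD[OF f] by (simp add: mu'_measurable)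
  have [measurable]: "\<kappa> \<in> borel_measurable borel" using smooth_borel[OF testfun_smooth[OF c]] .
  obtain B where B: "\<And>x. \<bar>\<kappa> x\<bar> \<le> B" using testfun_bounded[OF c] by blast
  have "bounded (closure {x. \<kappa> x \<noteq> 0})" using c by (simp add: test_function_def compact_imp_bounded)
  then have "bounded {x. \<kappa> x \<noteq> 0}" using closure_subset bounded_subset by blast
  then obtain R where R: "\<And>x. \<kappa> x \<noteq> 0 ==> dist x0 x \<le> R" using bounded_any_center[of _ x0] by auto
  \<comment> \<open>The value of the density at distance \<open>R\<close> from \<open>x0\<close>,
    hence a lower bound on the ball that contains the support.\<close>
  define m where "m = gmax * exp (- R\<^sup>2 / (2 * T))"
  have m: "m > 0" using gmax by (simp add: m_def)
  have low: "m \<le> gauss_density x0 T x" if "\<kappa> x \<noteq> 0" for x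
  proof -
    have "(norm (x - x0))\<^sup>2 \<le> R\<^sup>2" using R[OF that] by (intro power_mono) (auto simp: dist_norm norm_minus_commute)
    then show ?thesis
      unfolding m_def gmax_def gauss_density_def using T by (intro mult_left_mono) (auto simp: divide_right_mono)
  qed
  show ?thesis
  proof (rule sqint_bound[where g="\<lambda>x. B\<^sup>2 / m * (gauss_density x0 T x * (f x)\<^sup>2)"])
    have "integrable \<mu> (\<lambda>x. (f x)\<^sup>2)" using sqint_norm2[OF f] by simp
    then have "integrable lborel (\<lambda>x. gauss_density x0 T x * (f x)\<^sup>2)"
      unfolding \<mu> by (subst (asm) integrable_density) auto
    then show "integrable lborel (\<lambda>x. B\<^sup>2 / m * (gauss_density x0 T x * (f x)\<^sup>2))" by auto
    show "AE x in lborel. (norm (\<kappa> x * f x))\<^sup>2 \<le> B\<^sup>2 / m * (gauss_density x0 T x * (f x)\<^sup>2)"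
    proof (rule AE_I2)
      fix x
      show "(norm (\<kappa> x * f x))\<^sup>2 \<le> B\<^sup>2 / m * (gauss_density x0 T x * (f x)\<^sup>2)"
      proof (cases "\<kappa> x = 0")
        case True then show ?thesis using m by simp
      next
        case False
        have "(\<kappa> x)\<^sup>2 \<le> B\<^sup>2" using power_mono[OF B[of x] abs_ge_zero, of 2] by simp
        moreover have "1 \<le> gauss_density x0 T x / m" using low[OF False] m by (simp add: le_divide_eq)
        ultimately have "(\<kappa> x)\<^sup>2 * 1 \<le> B\<^sup>2 * (gauss_density x0 T x / m)" by (intro mult_mono) auto
        from mult_right_mono[OF this, of "(f x)\<^sup>2"] show ?thesis by (simp add: power_mult_distrib mult.assoc)
      qed
    qed
  qed simp
qed

lemma testfun_L2: "test_function UNIV \<phi> ==> L2 lborel (\<phi> :: real^'n => real)"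
proof -
  assume c: "test_function UNIV \<phi>"
  obtain B where B: "\<And>x. \<bar>\<phi> x\<bar> \<le> B" using testfun_bounded[OF c] by blast
  have "integrable lborel (\<lambda>x. \<phi> x * \<phi> x)"
    by (intro testfun_integrable testfun_mult_smooth c testfun_smooth[OF c])
  then show ?thesis
    unfolding square_integrable_def using smooth_borel[OF testfun_smooth[OF c]]
    by (simp add: power2_eq_square)
qed

lemma L2_bounded_support_integrable:
  fixes h :: "real^'n => real"
  assumes h: "L2 lborel h" and b: "\<And>x. x \<notin> box a b ==> h x = 0"
  shows "integrable lborel h"
proof -
  have "L2 lborel (indicator (box a b) :: real^'n => real)"
  proof -
    have "(\<lambda>z. (norm (indicator (box a b) z :: real))\<^sup>2) = indicator (box a b)"
      by (auto simp: indicator_def fun_eq_iff)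
    then show ?thesis
      unfolding square_integrable_def
      using integrable_real_indicator[of "box a b" lborel] emeasure_lborel_box_finite[of a b] by simp
  qed
  from sqint_mult[OF this h]
  have "integrable lborel (\<lambda>x. indicator (box a b) x * h x)" .
  also have "(\<lambda>x. indicator (box a b) x * h x) = h" using b by (auto simp: fun_eq_iff indicator_def)
  finally show ?thesis .
qed

text \<open>Translations preserve Lebesgue measure but not the Gaussian, so the contraction property
  of averaging is proved in the Lebesgue norm and only then compared with the Gaussian norm through
  the peak of the density.\<close>

lemma mollify_L2_bound:
  fixes h :: "real^'n => real"
  assumes h: "L2 lborel h" "integrable lborel h"
    and \<rho>: "test_function UNIV \<rho>" "\<And>x. 0 \<le> \<rho> x" "(LINT x|lborel. \<rho> x) = 1"
  shows "L2 \<mu> (mollify \<rho> h)" and "L2_norm \<mu> (mollify \<rho> h) \<le> sqrt gmax * L2_norm lborel h"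
proof -
  have hm[measurable]: "h \<in> borel_measurable borel" using sqintD[OF h(1)] by simp
  have rm[measurable]: "\<rho> \<in> borel_measurable borel" using smooth_borel[OF testfun_smooth[OF \<rho>(1)]] .
  have r1: "(\<integral>\<^sup>+x. ennreal (\<rho> x) \<partial>lborel) = 1"
    using \<rho>(2,3) testfun_integrable[OF \<rho>(1)] by (simp add: nn_integral_eq_integral)
  \<comment> \<open>Jensen's inequality for the probability density given by the kernel, obtained
    from Cauchy-Schwarz by splitting the kernel into two square roots.\<close>
  have pt: "ennreal ((mollify \<rho> h x)\<^sup>2) \<le> (\<integral>\<^sup>+y. ennreal ((h y)\<^sup>2) * ennreal (\<rho> (y - x)) \<partial>lborel)" for x
  proof -
    have i: "integrable lborel (\<lambda>y. (h y)\<^sup>2 * \<rho> (y - x))"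
      using sqint_norm2[OF h(1)] by (intro integrable_mult_test_shift \<rho>(1)) simp
    have s1: "L2 lborel (\<lambda>y. h y * sqrt (\<rho> (y - x)))"
      unfolding square_integrable_def using i \<rho>(2) by (simp add: power_mult_distrib)
    have s2: "L2 lborel (\<lambda>y. sqrt (\<rho> (y - x)))"
      unfolding square_integrable_def
      using \<rho>(2) testfun_integrable[OF testfun_shift[OF \<rho>(1), of x]] by simp
    have "\<bar>mollify \<rho> h x\<bar> \<le> L2_norm lborel (\<lambda>y. h y * sqrt (\<rho> (y - x))) * L2_norm lborel (\<lambda>y. sqrt (\<rho> (y - x)))"
      using L2_Cauchy_Schwarz_mult[OF s1 s2] \<rho>(2) by (simp add: mollify_def mult.assoc)
    also have "L2_norm lborel (\<lambda>y. sqrt (\<rho> (y - x))) = 1"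
      using \<rho>(2,3) lborel_translate(2)[OF rm, of "- x"] by (simp add: L2_norm_def)
    finally have "(mollify \<rho> h x)\<^sup>2 \<le> (L2_norm lborel (\<lambda>y. h y * sqrt (\<rho> (y - x))))\<^sup>2"
      using power_mono[of "\<bar>mollify \<rho> h x\<bar>" _ 2] by simp
    also have "\<dots> = (LINT y|lborel. (h y)\<^sup>2 * \<rho> (y - x))"
      unfolding L2_norm_power2 using \<rho>(2) by (simp add: power_mult_distrib)
    finally show ?thesis
      using i \<rho>(2) by (simp add: nn_integral_eq_integral ennreal_mult[symmetric] ennreal_leI)
  qed
  have mm[measurable]: "mollify \<rho> h \<in> borel_measurable borel"
    unfolding mollify_def[abs_def] by (intro lborel.borel_measurable_lebesgue_integral) measurable
  have "(\<integral>\<^sup>+x. ennreal ((mollify \<rho> h x)\<^sup>2) \<partial>\<mu>) = (\<integral>\<^sup>+x. ennreal (gauss_density x0 T x) * ennreal ((mollify \<rho> h x)\<^sup>2) \<partial>lborel)"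
    unfolding \<mu> by (subst nn_integral_density) auto
  also have "\<dots> \<le> (\<integral>\<^sup>+x. ennreal gmax * (\<integral>\<^sup>+y. ennreal ((h y)\<^sup>2) * ennreal (\<rho> (y - x)) \<partial>lborel) \<partial>lborel)"
    by (intro nn_integral_mono mult_mono ennreal_leI gmax pt) auto
  also have "\<dots> = ennreal gmax * (\<integral>\<^sup>+x. \<integral>\<^sup>+y. ennreal ((h y)\<^sup>2) * ennreal (\<rho> (y - x)) \<partial>lborel \<partial>lborel)"
    by (rule nn_integral_cmult) measurable
  also have "(\<integral>\<^sup>+x. \<integral>\<^sup>+y. ennreal ((h y)\<^sup>2) * ennreal (\<rho> (y - x)) \<partial>lborel \<partial>lborel)
     = (\<integral>\<^sup>+y. \<integral>\<^sup>+x. ennreal ((h y)\<^sup>2) * ennreal (\<rho> (y - x)) \<partial>lborel \<partial>lborel)"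
    by (rule lborel_pair.Fubini'[symmetric]) measurable
  also have "\<dots> = (\<integral>\<^sup>+y. ennreal ((h y)\<^sup>2) \<partial>lborel)"
  proof (rule nn_integral_cong)
    fix y
    have "(\<integral>\<^sup>+x. ennreal ((h y)\<^sup>2) * ennreal (\<rho> (y - x)) \<partial>lborel) = ennreal ((h y)\<^sup>2) * (\<integral>\<^sup>+x. ennreal (\<rho> (y - x)) \<partial>lborel)"
      by (rule nn_integral_cmult) measurable
    also have "(\<integral>\<^sup>+x. ennreal (\<rho> (y - x)) \<partial>lborel) = 1"
      using nn_integral_lborel_reflect[of "\<lambda>x. ennreal (\<rho> x)" y] r1 by simp
    finally show "(\<integral>\<^sup>+x. ennreal ((h y)\<^sup>2) * ennreal (\<rho> (y - x)) \<partial>lborel) = ennreal ((h y)\<^sup>2)" by simp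
  qed
  also have "\<dots> = ennreal ((L2_norm lborel h)\<^sup>2)"
    unfolding L2_norm_power2 using sqint_norm2[OF h(1)] by (simp add: nn_integral_eq_integral)
  also have "ennreal gmax * ennreal ((L2_norm lborel h)\<^sup>2) = ennreal ((sqrt gmax * L2_norm lborel h)\<^sup>2)"
    using gmax(1) by (simp add: ennreal_mult[symmetric] power_mult_distrib)
  finally have le: "(\<integral>\<^sup>+x. ennreal ((mollify \<rho> h x)\<^sup>2) \<partial>\<mu>) \<le> ennreal ((sqrt gmax * L2_norm lborel h)\<^sup>2)" .
  show s: "L2 \<mu> (mollify \<rho> h)"
    unfolding square_integrable_def mu'_measurable using le
    by (auto intro!: integrableI_bounded simp: mu'_measurable intro: le_less_trans)
  show "L2_norm \<mu> (mollify \<rho> h) \<le> sqrt gmax * L2_norm lborel h"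
  proof (rule power2_le_imp_le)
    show "(L2_norm \<mu> (mollify \<rho> h))\<^sup>2 \<le> (sqrt gmax * L2_norm lborel h)\<^sup>2"
      unfolding L2_norm_power2[of \<mu> "mollify \<rho> h"] using le sqint_norm2[OF s]
      by (subst (asm) nn_integral_eq_integral) auto
  qed (use gmax(1) in simp)
qed

text \<open>The function is split into a test function and a remainder small in the Lebesgue norm.
  On the test function the mollification converges uniformly, by its Lipschitz bound; on the
  remainder averaging does not enlarge the norm.\<close>

lemma mollify_tendsto:
  fixes h :: "real^'n => real"
  assumes h: "L2 lborel h" and supp: "\<And>x. x \<notin> box a b ==> h x = 0"
    and \<rho>: "\<And>m. test_function UNIV (\<rho> m)" "\<And>m x. 0 \<le> \<rho> m x" "\<And>m. (LINT x|lborel. \<rho> m x) = 1"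
      "\<And>m x. \<rho> m x \<noteq> 0 ==> norm x \<le> inverse (real (Suc m))"
  shows "(\<lambda>m. L2_norm \<mu> (\<lambda>x. mollify (\<rho> m) h x - h x)) \<longlonglongrightarrow> 0"
proof (rule LIMSEQ_I)
  let ?r = "\<lambda>k. inverse (real (Suc k))"
  fix e :: real assume e: "e > 0"
  note ih = L2_bounded_support_integrable[OF h supp]
  let ?N = "restrict_space lborel (box a b)"
  have hN: "L2 ?N h"
    unfolding square_integrable_def using h supp
    by (auto simp: square_integrable_def integrable_restrict_space indicator_def intro!: measurable_restrict_space1
        intro: Bochner_Integration.integrable_cong[THEN iffD1, rotated 2])
  have finN: "finite_measure ?N"
    by (intro finite_measureI) (simp add: emeasure_restrict_space space_restrict_space emeasure_lborel_box_eq)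
  \<comment> \<open>The remainder and its mollification each contribute at most
    \<open>sqrt gmax * \<delta>\<close>, so together at most \<open>e / 2\<close>.\<close>
  define \<delta> where "\<delta> = e / (4 * (sqrt gmax + 1))"
  have \<delta>: "\<delta> > 0" using e gmax(1) by (simp add: \<delta>_def add_pos_pos)
  have "approximable ?N (box a b) h"
    by (rule test_functions_dense[OF finN _ _ _ _ hN, where a="\<lambda>_. a" and b="\<lambda>_. b"])
      (auto simp: space_restrict_space sets_restrict_space incseq_def)
  then obtain \<phi> where \<phi>: "test_function (box a b) \<phi>" "L2_norm ?N (\<lambda>z. h z - \<phi> z) < \<delta>"
    unfolding approximable_def using \<delta> by blast
  have \<phi>U: "test_function UNIV \<phi>" by (rule testfun_mono[OF \<phi>(1)]) simp
  define d where "d x = h x - \<phi> x" for x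
  have ds: "L2 lborel d"
    unfolding d_def by (intro sqint_diff h testfun_L2 \<phi>U)
  have dsupp: "d x = 0" if "x \<notin> box a b" for x
    using supp[OF that] testfun_zero_outside[OF \<phi>(1) that] by (simp add: d_def)
  note di = L2_bounded_support_integrable[OF ds dsupp]
  have dn: "L2_norm lborel d < \<delta>"
  proof -
    have "(LINT x|?N. (norm (d x))\<^sup>2) = (LINT x|lborel. (norm (d x))\<^sup>2)"
      by (subst integral_restrict_space)
        (auto simp: set_lebesgue_integral_def indicator_def dsupp intro!: Lintegral_cong)
    then show ?thesis using \<phi>(2) by (simp add: L2_norm_def d_def)
  qed
  obtain C where C0: "0 \<le> C" and C: "\<And>v x. \<bar>dir_deriv v \<phi> x\<bar> \<le> C * norm v"
    using bsmooth_derivative_bound[OF testfun_bsmooth[OF \<phi>U]] by blast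
  have lip: "\<bar>\<phi> y - \<phi> x\<bar> \<le> C * norm (y - x)" for x y
  proof -
    have "norm (\<phi> y - \<phi> x) \<le> C * norm (y - x)"
      by (rule differentiable_bound[of UNIV \<phi> "\<lambda>x h. dir_deriv h \<phi> x"])
        (auto intro!: smooth_has_derivative testfun_smooth[OF \<phi>U] onorm_le C simp del: real_norm_def simp: real_norm_def[of "dir_deriv _ _ _"])
    then show ?thesis by simp
  qed
  note mi = integrable_mult_test_shift[OF _ \<rho>(1)]
  have i\<phi>: "integrable lborel \<phi>" by (rule testfun_integrable[OF \<phi>U])
  have one: "(LINT y|lborel. \<rho> m (y - x)) = 1" for m x
    using lborel_translate(2)[of "\<rho> m" "- x"] smooth_borel[OF testfun_smooth[OF \<rho>(1)]] \<rho>(3) by simp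
  have ir: "integrable lborel (\<lambda>y. \<rho> m (y - x))" for m x
    by (rule testfun_integrable[OF testfun_shift[OF \<rho>(1)]])
  have close: "\<bar>mollify (\<rho> m) \<phi> x - \<phi> x\<bar> \<le> C * ?r m" for m x
  proof -
    have "mollify (\<rho> m) \<phi> x - \<phi> x = (LINT y|lborel. \<phi> y * \<rho> m (y - x)) - (LINT y|lborel. \<phi> x * \<rho> m (y - x))"
      using one by (simp add: mollify_def)
    also have "\<dots> = (LINT y|lborel. (\<phi> y - \<phi> x) * \<rho> m (y - x))"
      using mi[OF i\<phi>, of m x] ir[of m x] by (simp add: left_diff_distrib)
    also have "\<bar>\<dots>\<bar> \<le> (LINT y|lborel. \<bar>(\<phi> y - \<phi> x) * \<rho> m (y - x)\<bar>)" by (rule integral_abs_bound)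
    also have "\<dots> \<le> (LINT y|lborel. (C * ?r m) * \<rho> m (y - x))"
    proof (rule integral_mono)
      show "integrable lborel (\<lambda>y. \<bar>(\<phi> y - \<phi> x) * \<rho> m (y - x)\<bar>)"
        using mi[OF i\<phi>, of m x] ir[of m x] by (simp add: left_diff_distrib)
      show "integrable lborel (\<lambda>y. C * ?r m * \<rho> m (y - x))" using ir by simp
      fix y
      show "\<bar>(\<phi> y - \<phi> x) * \<rho> m (y - x)\<bar> \<le> C * ?r m * \<rho> m (y - x)"
      proof (cases "\<rho> m (y - x) = 0")
        case False
        have "\<bar>\<phi> y - \<phi> x\<bar> \<le> C * ?r m"
          by (rule order_trans[OF lip mult_left_mono[OF \<rho>(4)[OF False] C0]])
        then show ?thesis unfolding abs_mult using \<rho>(2)[of m "y - x"] by (intro mult_mono) auto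
      qed simp
    qed
    also have "\<dots> = C * ?r m" using one by simp
    finally show ?thesis .
  qed
  interpret finite_measure \<mu> by (rule finite_measure_mu')
  have "(\<lambda>m. (C * L2_norm \<mu> (\<lambda>_. 1::real)) * ?r m) \<longlonglongrightarrow> (C * L2_norm \<mu> (\<lambda>_. 1::real)) * 0"
    by (intro tendsto_intros LIMSEQ_inverse_real_of_nat)
  then have "\<forall>\<^sub>F m in sequentially. (C * L2_norm \<mu> (\<lambda>_. 1::real)) * ?r m < e / 2"
    using e by (intro order_tendstoD(2)) auto
  then obtain m0 where m0: "\<And>m. m \<ge> m0 ==> (C * L2_norm \<mu> (\<lambda>_. 1::real)) * ?r m < e / 2"
    unfolding eventually_sequentially by blast
  have "L2_norm \<mu> (\<lambda>x. mollify (\<rho> m) h x - h x) < e" if m: "m \<ge> m0" for m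
  proof -
    note md = mollify_L2_bound[OF ds di \<rho>(1)[of m] \<rho>(2)[of m] \<rho>(3)[of m]]
    note dmu = L2_mu'_le[OF ds]
    have mph: "L2 \<mu> (\<lambda>x. mollify (\<rho> m) \<phi> x - \<phi> x)"
    proof (rule sqint_diff)
      show "L2 \<mu> (mollify (\<rho> m) \<phi>)"
        by (rule mollify_L2_bound(1)[OF testfun_L2[OF \<phi>U] i\<phi> \<rho>(1)[of m] \<rho>(2)[of m] \<rho>(3)[of m]])
      show "L2 \<mu> \<phi>" by (rule L2_mu'_le(1)[OF testfun_L2[OF \<phi>U]])
    qed
    have "mollify (\<rho> m) h x - h x = (mollify (\<rho> m) d x - d x) + (mollify (\<rho> m) \<phi> x - \<phi> x)" for x
    proof -
      have "mollify (\<rho> m) h x = mollify (\<rho> m) d x + mollify (\<rho> m) \<phi> x"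
      proof -
        have "mollify (\<rho> m) h x = (LINT y|lborel. d y * \<rho> m (y - x) + \<phi> y * \<rho> m (y - x))"
          unfolding mollify_def d_def by (simp add: algebra_simps)
        then show ?thesis
          using Lintegral_add[OF mi[OF di] mi[OF i\<phi>]] by (simp add: mollify_def)
      qed
      then show ?thesis by (simp add: d_def)
    qed
    then have "L2_norm \<mu> (\<lambda>x. mollify (\<rho> m) h x - h x) = L2_norm \<mu> (\<lambda>x. (mollify (\<rho> m) d x - d x) + (mollify (\<rho> m) \<phi> x - \<phi> x))"
      by simp
    also have "\<dots> \<le> L2_norm \<mu> (\<lambda>x. mollify (\<rho> m) d x - d x) + L2_norm \<mu> (\<lambda>x. mollify (\<rho> m) \<phi> x - \<phi> x)"
      by (intro L2_norm_triangle sqint_diff md dmu mph)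
    also have "L2_norm \<mu> (\<lambda>x. mollify (\<rho> m) d x - d x) \<le> L2_norm \<mu> (mollify (\<rho> m) d) + L2_norm \<mu> d"
      by (rule L2_norm_triangle_diff[OF md(1) dmu(1)])
    also have "\<dots> \<le> sqrt gmax * L2_norm lborel d + sqrt gmax * L2_norm lborel d"
      by (intro add_mono md dmu)
    also have "\<dots> \<le> 2 * (sqrt gmax * \<delta>)" using dn gmax(1) by (simp add: mult_left_mono less_imp_le)
    also have "\<dots> \<le> 2 * ((sqrt gmax + 1) * \<delta>)" using \<delta> by (intro mult_left_mono mult_right_mono) auto
    also have "\<dots> = e / 2"
    proof -
      have "sqrt gmax + 1 > 0" using gmax(1) by (simp add: add_pos_pos)
      moreover have "2 * (c * (e / (4 * c))) = e / 2" if "c > 0" for c :: real using that by simp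
      ultimately show ?thesis unfolding \<delta>_def by blast
    qed
    also have "L2_norm \<mu> (\<lambda>x. mollify (\<rho> m) \<phi> x - \<phi> x) \<le> L2_norm \<mu> (\<lambda>_. C * ?r m)"
    proof (rule L2_norm_mono)
      show "L2 \<mu> (\<lambda>_. C * ?r m)"
        by (rule sqint_bounded[OF finite_measure_mu' _ order_refl]) simp
      show "AE x in \<mu>. norm (mollify (\<rho> m) \<phi> x - \<phi> x) \<le> norm (C * ?r m)"
        using close C0 by (intro AE_I2) (simp add: abs_mult)
    qed
    also have "L2_norm \<mu> (\<lambda>_. C * ?r m) = (C * L2_norm \<mu> (\<lambda>_. 1::real)) * ?r m"
      using L2_norm_scaleR[of \<mu> "C * ?r m" "\<lambda>_. 1::real"] C0 by (simp add: abs_mult)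
    also have "\<dots> < e / 2" by (rule m0[OF m])
    finally show ?thesis by simp
  qed
  then show "\<exists>no. \<forall>m\<ge>no. norm (L2_norm \<mu> (\<lambda>x. mollify (\<rho> m) h x - h x) - 0) < e" by auto
qed

text \<open>Cutting off comes before mollifying: it gives compact support, hence Lebesgue
  integrability, which mollification requires. The extra term in the gradient carries a derivative
  of the cutoff and vanishes in the limit.\<close>

theorem gaussian_H1_dense:
  fixes \<eta> :: "real^'n => real" and D\<eta> :: "real^'n => real^'n"
  assumes H: "gaussian_H1 \<mu> \<eta> D\<eta>"
  shows "\<exists>\<eta>s. (\<forall>k. test_function UNIV (\<eta>s k)) \<and> L2_converges \<mu> \<eta>s \<eta> \<and> L2_converges \<mu> (\<lambda>k. grad (\<eta>s k)) D\<eta>"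
proof -
  let ?r = "\<lambda>k. inverse (real (Suc k))"
  have \<eta>: "L2 \<mu> \<eta>" and D\<eta>: "L2 \<mu> D\<eta>"
    and weak: "\<And>\<phi> i. test_function UNIV \<phi> ==> (LINT x|lborel. \<eta> x * partial i \<phi> x) = - (LINT x|lborel. D\<eta> x $ i * \<phi> x)"
    using H unfolding gaussian_H1_def by auto
  obtain \<kappa> :: "nat => real^'n => real" and C where \<kappa>: "\<And>k. test_function UNIV (\<kappa> k)" "\<And>k x. \<bar>\<kappa> k x\<bar> \<le> 1"
    "\<And>x. (\<lambda>k. \<kappa> k x) \<longlonglongrightarrow> 1" "\<And>k v x. \<bar>dir_deriv v (\<kappa> k) x\<bar> \<le> C * norm v * ?r k"
    using cutoff_exists by metis
  have "\<exists>\<rho>::real^'n => real. test_function UNIV \<rho> \<and> (\<forall>x. 0 \<le> \<rho> x) \<and> (\<forall>x. \<rho> x \<noteq> 0 \<longrightarrow> norm x \<le> ?r m) \<and> (LINT x|lborel. \<rho> x) = 1" for m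
    by (rule mollifier_exists) simp
  then obtain \<rho> :: "nat => real^'n => real" where \<rho>: "\<And>m. test_function UNIV (\<rho> m)" "\<And>m x. 0 \<le> \<rho> m x"
    "\<And>m x. \<rho> m x \<noteq> 0 ==> norm x \<le> ?r m" "\<And>m. (LINT x|lborel. \<rho> m x) = 1" by metis
  define f where "f k x = \<kappa> k x * \<eta> x" for k x
  \<comment> \<open>The product rule for the weak gradient of the function after cutting off;
    \<open>fg_weak\<close> confirms that it is one.\<close>
  define g where "g k i x = \<kappa> k x * D\<eta> x $ i + partial i (\<kappa> k) x * \<eta> x" for k i x
  note pt = testfun_partial[OF \<kappa>(1)]
  have fs: "L2 lborel (f k)" for k unfolding f_def by (rule cutoff_L2[OF \<eta> \<kappa>(1)])
  have gs: "L2 lborel (g k i)" for k i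
    unfolding g_def by (intro sqint_add cutoff_L2 \<eta> \<kappa>(1) pt sqint_component D\<eta>)
  have fg_weak: "(LINT x|lborel. f k x * dir_deriv (axis i 1) \<phi> x) = - (LINT x|lborel. g k i x * \<phi> x)"
    if \<phi>: "test_function UNIV \<phi>" for k i \<phi>
  proof -
    have i1: "integrable lborel (\<lambda>x. (\<kappa> k x * \<eta> x) * partial i \<phi> x)"
      by (intro sqint_mult cutoff_L2 \<eta> \<kappa>(1) testfun_L2 testfun_partial \<phi>)
    have i2: "integrable lborel (\<lambda>x. (partial i (\<kappa> k) x * \<eta> x) * \<phi> x)"
      by (intro sqint_mult cutoff_L2 \<eta> pt testfun_L2 \<phi>)
    have i3: "integrable lborel (\<lambda>x. (\<kappa> k x * D\<eta> x $ i) * \<phi> x)"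
      by (intro sqint_mult cutoff_L2 sqint_component D\<eta> \<kappa>(1) testfun_L2 \<phi>)
    have p: "partial i (\<lambda>x. \<kappa> k x * \<phi> x) x = \<kappa> k x * partial i \<phi> x + partial i (\<kappa> k) x * \<phi> x" for x
      unfolding partial_eq
      by (rule dir_deriv_mult) (intro smooth_differentiable testfun_smooth[OF \<kappa>(1)] testfun_smooth[OF \<phi>])+
    have "(LINT x|lborel. (\<kappa> k x * \<eta> x) * partial i \<phi> x) + (LINT x|lborel. (partial i (\<kappa> k) x * \<eta> x) * \<phi> x)
       = (LINT x|lborel. \<eta> x * partial i (\<lambda>x. \<kappa> k x * \<phi> x) x)"
      unfolding p using i1 i2 by (subst Lintegral_add[symmetric]) (auto simp: algebra_simps)
    also have "\<dots> = - (LINT x|lborel. D\<eta> x $ i * (\<kappa> k x * \<phi> x))"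
      by (rule weak) (intro testfun_mult_smooth \<phi> testfun_smooth[OF \<kappa>(1)])
    also have "\<dots> = - (LINT x|lborel. (\<kappa> k x * D\<eta> x $ i) * \<phi> x)" by (simp add: ac_simps)
    finally show ?thesis
      unfolding f_def g_def partial_eq[symmetric] using i1 i2 i3 by (simp add: distrib_right)
  qed
  have supp: "\<exists>a b. \<forall>x. x \<notin> box a b \<longrightarrow> f k x = 0 \<and> (\<forall>i. g k i x = 0)" for k
  proof -
    have "bounded (closure {x. \<kappa> k x \<noteq> 0})" using \<kappa>(1)[of k] by (simp add: test_function_def compact_imp_bounded)
    then obtain a b where ab: "closure {x. \<kappa> k x \<noteq> 0} \<subseteq> box a b" using bounded_subset_box_symmetric by metis
    have "f k x = 0 \<and> (\<forall>i. g k i x = 0)" if "x \<notin> box a b" for x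
    proof -
      have x: "x \<notin> closure {x. \<kappa> k x \<noteq> 0}" using that ab by blast
      from testfun_support(1)[OF \<kappa>(1) x] testfun_support(2)[OF \<kappa>(1) x]
      show ?thesis by (simp add: f_def g_def partial_eq)
    qed
    then show ?thesis by blast
  qed
  \<comment> \<open>At a fixed cutoff the mollifications converge for the function and for its
    finitely many gradient components together, so a single index \<open>m k\<close> achieves the
    error \<open>inverse (real (Suc k))\<close> for all of them.\<close>
  have "\<exists>m. L2_norm \<mu> (\<lambda>x. mollify (\<rho> m) (f k) x - f k x) < ?r k \<and>
     (\<forall>i. L2_norm \<mu> (\<lambda>x. mollify (\<rho> m) (g k i) x - g k i x) < ?r k)" for k
  proof -
    obtain a b where ab: "\<And>x. x \<notin> box a b ==> f k x = 0" "\<And>i x. x \<notin> box a b ==> g k i x = 0" using supp[of k] by blast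
    have p: "0 < ?r k" by simp
    have "\<forall>\<^sub>F m in sequentially. L2_norm \<mu> (\<lambda>x. mollify (\<rho> m) (f k) x - f k x) < ?r k"
      by (rule order_tendstoD(2)[OF mollify_tendsto[OF fs ab(1) \<rho>(1,2,4,3)] p])
    moreover have "\<forall>\<^sub>F m in sequentially. L2_norm \<mu> (\<lambda>x. mollify (\<rho> m) (g k i) x - g k i x) < ?r k" for i
      by (rule order_tendstoD(2)[OF mollify_tendsto[OF gs ab(2) \<rho>(1,2,4,3)] p])
    then have "\<forall>\<^sub>F m in sequentially. \<forall>i. L2_norm \<mu> (\<lambda>x. mollify (\<rho> m) (g k i) x - g k i x) < ?r k"
      by (rule eventually_all_finite)
    ultimately have "\<forall>\<^sub>F m in sequentially. L2_norm \<mu> (\<lambda>x. mollify (\<rho> m) (f k) x - f k x) < ?r k \<and>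
       (\<forall>i. L2_norm \<mu> (\<lambda>x. mollify (\<rho> m) (g k i) x - g k i x) < ?r k)"
      by (rule eventually_conj)
    then show ?thesis unfolding eventually_sequentially by blast
  qed
  then obtain m where m: "\<And>k. L2_norm \<mu> (\<lambda>x. mollify (\<rho> (m k)) (f k) x - f k x) < ?r k"
    "\<And>k i. L2_norm \<mu> (\<lambda>x. mollify (\<rho> (m k)) (g k i) x - g k i x) < ?r k" by metis
  define \<eta>s where "\<eta>s k = mollify (\<rho> (m k)) (f k)" for k
  have fi: "integrable lborel (f k)" for k
    using supp[of k] L2_bounded_support_integrable[OF fs] by blast
  have gi: "integrable lborel (g k i)" for k i
    using supp[of k] L2_bounded_support_integrable[OF gs] by blast
  have t: "test_function UNIV (\<eta>s k)" for k
  proof -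
    obtain a b where ab: "\<And>x. x \<notin> box a b ==> f k x = 0" using supp[of k] by blast
    have "{x. f k x \<noteq> 0} \<subseteq> box a b" using ab by auto
    then have "bounded {x. f k x \<noteq> 0}" by (rule bounded_subset[OF bounded_box])
    then show ?thesis unfolding \<eta>s_def by (rule testfun_mollify[OF fi _ \<rho>(1)])
  qed
  have gr: "grad (\<eta>s k) x $ i = mollify (\<rho> (m k)) (g k i) x" for k x i
    unfolding grad_def \<eta>s_def partial_eq
    using mollify_weak_derivative[OF fi \<rho>(1) fg_weak] by simp
  have \<eta>ss: "L2 \<mu> (\<eta>s k)" for k by (rule L2_mu'_le(1)[OF testfun_L2[OF t]])
  have grs: "L2 \<mu> (\<lambda>x. grad (\<eta>s k) x $ i)" for k i
    unfolding grad_def using L2_mu'_le(1)[OF testfun_L2[OF testfun_partial[OF t]]] by simp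
  have grv: "L2 \<mu> (grad (\<eta>s k))" for k
    using sqint_vec_lambda[of \<mu> "\<lambda>i x. grad (\<eta>s k) x $ i", OF grs] by (simp only: vec_lambda_eta)
  note fm = L2_mu'_le(1)[OF fs] and gm = L2_mu'_le(1)[OF gs]
  have inv0: "(\<lambda>k. ?r k) \<longlonglongrightarrow> 0" by (rule LIMSEQ_inverse_real_of_nat)
  have cut: "L2_converges \<mu> (\<lambda>k x. \<kappa> k x * u x) u" if u: "L2 \<mu> u" for u
    unfolding L2_converges_def
  proof (intro conjI allI u L2_mu'_le(1)[OF cutoff_L2[OF u \<kappa>(1)]])
    show "(\<lambda>k. L2_norm \<mu> (\<lambda>x. \<kappa> k x * u x - u x)) \<longlonglongrightarrow> 0"
  proof (rule L2_norm_tendsto_0_dominated[where g="\<lambda>x. 2 * u x"])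
    show "L2 \<mu> (\<lambda>x. 2 * u x)" using sqint_scaleR[OF u, of 2] by simp
    show "(\<lambda>x. \<kappa> k x * u x - u x) \<in> borel_measurable \<mu>" for k
      using sqintD[OF u] smooth_borel[OF testfun_smooth[OF \<kappa>(1)]] by (simp add: mu'_measurable)
    show "AE x in \<mu>. (\<lambda>k. \<kappa> k x * u x - u x) \<longlonglongrightarrow> 0"
    proof (rule AE_I2)
      fix x
      have "(\<lambda>k. \<kappa> k x * u x - u x) \<longlonglongrightarrow> 1 * u x - u x" by (intro tendsto_intros \<kappa>(3))
      then show "(\<lambda>k. \<kappa> k x * u x - u x) \<longlonglongrightarrow> 0" by simp
    qed
    show "AE x in \<mu>. norm (\<kappa> k x * u x - u x) \<le> norm (2 * u x)" for k
    proof (rule AE_I2)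
      fix x
      have "\<bar>\<kappa> k x * u x\<bar> \<le> 1 * \<bar>u x\<bar>" unfolding abs_mult by (intro mult_right_mono \<kappa>) simp
      then have "\<bar>\<kappa> k x * u x - u x\<bar> \<le> 2 * \<bar>u x\<bar>"
        using abs_triangle_ineq4[of "\<kappa> k x * u x" "u x"] by linarith
      then show "norm (\<kappa> k x * u x - u x) \<le> norm (2 * u x)" by simp
    qed
  qed
  qed
  have c1: "L2_converges \<mu> \<eta>s \<eta>"
  proof (rule L2_converges_trans[OF cut[OF \<eta>] \<eta>ss _ inv0])
    show "L2_norm \<mu> (\<lambda>x. \<eta>s k x - \<kappa> k x * \<eta> x) \<le> ?r k" for k
      using less_imp_le[OF m(1)[of k]] by (simp add: \<eta>s_def f_def)
  qed
  have comp: "L2_converges \<mu> (\<lambda>k x. grad (\<eta>s k) x $ i) (\<lambda>x. D\<eta> x $ i)" for i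
  proof (rule L2_converges_trans[OF _ grs _ inv0])
    show "L2_norm \<mu> (\<lambda>x. grad (\<eta>s k) x $ i - g k i x) \<le> ?r k" for k
      unfolding gr by (rule less_imp_le[OF m(2)])
    let ?c = "\<lambda>k. \<bar>C\<bar> * ?r k"
    show "L2_converges \<mu> (\<lambda>k. g k i) (\<lambda>x. D\<eta> x $ i)"
    proof (rule L2_converges_trans[OF cut[OF sqint_component[OF D\<eta>]] gm])
      fix k
      have "L2_norm \<mu> (\<lambda>x. g k i x - \<kappa> k x * D\<eta> x $ i) = L2_norm \<mu> (\<lambda>x. partial i (\<kappa> k) x * \<eta> x)"
        by (simp add: g_def)
      also have "\<dots> \<le> L2_norm \<mu> (\<lambda>x. ?c k *\<^sub>R \<eta> x)"
      proof (rule L2_norm_mono[OF sqint_scaleR[OF \<eta>]], rule AE_I2)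
        fix x
        have "\<bar>partial i (\<kappa> k) x\<bar> \<le> C * ?r k"
          using \<kappa>(4)[of "axis i 1" k x] by (simp add: partial_eq norm_axis_1)
        also have "\<dots> \<le> ?c k" by (intro mult_right_mono) auto
        finally have "\<bar>partial i (\<kappa> k) x\<bar> * \<bar>\<eta> x\<bar> \<le> ?c k * \<bar>\<eta> x\<bar>" by (intro mult_right_mono) auto
        then show "norm (partial i (\<kappa> k) x * \<eta> x) \<le> norm (?c k *\<^sub>R \<eta> x)" by (simp add: abs_mult)
      qed
      also have "\<dots> = ?c k * L2_norm \<mu> \<eta>" by (simp only: L2_norm_scaleR) (simp add: abs_mult)
      finally show "L2_norm \<mu> (\<lambda>x. g k i x - \<kappa> k x * D\<eta> x $ i) \<le> ?c k * L2_norm \<mu> \<eta>" .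
    next
      show "(\<lambda>k. ?c k * L2_norm \<mu> \<eta>) \<longlonglongrightarrow> 0"
        using tendsto_mult[OF tendsto_mult[OF tendsto_const[of "\<bar>C\<bar>"] inv0] tendsto_const[of "L2_norm \<mu> \<eta>"]] by simp
    qed
  qed
  have "(\<lambda>k. L2_norm \<mu> (\<lambda>x. grad (\<eta>s k) x - D\<eta> x)) \<longlonglongrightarrow> 0"
  proof (rule tendsto_sandwich[OF _ _ tendsto_const])
    show "\<forall>\<^sub>F k in sequentially. L2_norm \<mu> (\<lambda>x. grad (\<eta>s k) x - D\<eta> x) \<le> (\<Sum>i\<in>UNIV. L2_norm \<mu> (\<lambda>x. grad (\<eta>s k) x $ i - D\<eta> x $ i))"
      using L2_norm_vec_le_sum[OF sqint_diff[OF grv D\<eta>]] by simp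
    show "(\<lambda>k. \<Sum>i\<in>UNIV. L2_norm \<mu> (\<lambda>x. grad (\<eta>s k) x $ i - D\<eta> x $ i)) \<longlonglongrightarrow> 0"
      using tendsto_sum[of UNIV "\<lambda>i k. L2_norm \<mu> (\<lambda>x. grad (\<eta>s k) x $ i - D\<eta> x $ i)" "\<lambda>_. 0", OF L2_convergesD(3)[OF comp]] by simp
  qed simp
  then have c2: "L2_converges \<mu> (\<lambda>k. grad (\<eta>s k)) D\<eta>" using D\<eta> grv by (simp add: L2_converges_def)
  from t c1 c2 show ?thesis by blast
qed

end

subsection \<open>Passage to the limit\<close>

lemma (in prob_space) norm_integral_le_L2_norm:
  fixes U :: "'a => 'b::euclidean_space"
  assumes "L2 M U" shows "norm (LINT z|M. U z) \<le> L2_norm M U"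
proof (rule power2_le_imp_le)
  show "(norm (LINT z|M. U z))\<^sup>2 \<le> (L2_norm M U)\<^sup>2"
    using vec_variance_eq[OF assms] vec_variance_nonneg[of M U] unfolding L2_norm_power2 by linarith
qed (rule L2_norm_nonneg)

lemma (in prob_space) vec_variance_converges:
  fixes U :: "nat => 'a => 'b::euclidean_space"
  assumes c: "L2_converges M U u"
  shows "(\<lambda>k. vec_variance M (U k)) \<longlonglongrightarrow> vec_variance M u"
proof -
  note s = L2_convergesD[OF c]
  note si = sqint_integrable[OF finite_measure_axioms]
  have "(\<lambda>k. (LINT z|M. U k z)) \<longlonglongrightarrow> (LINT z|M. u z)"
  proof (rule LIM_zero_cancel, rule Lim_null_comparison[OF _ s(3)])
    show "\<forall>\<^sub>F k in sequentially. norm ((LINT z|M. U k z) - (LINT z|M. u z)) \<le> L2_norm M (\<lambda>z. U k z - u z)"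
    proof (rule always_eventually, rule allI)
      fix k
      have "(LINT z|M. U k z) - (LINT z|M. u z) = (LINT z|M. U k z - u z)"
        using si[OF s(2)] si[OF s(1)] by simp
      then show "norm ((LINT z|M. U k z) - (LINT z|M. u z)) \<le> L2_norm M (\<lambda>z. U k z - u z)"
        using norm_integral_le_L2_norm[OF sqint_diff[OF s(2) s(1)]] by simp
    qed
  qed
  then have "(\<lambda>k. (L2_norm M (U k))\<^sup>2 - (norm (LINT z|M. U k z))\<^sup>2) \<longlonglongrightarrow> (L2_norm M u)\<^sup>2 - (norm (LINT z|M. u z))\<^sup>2"
    by (intro tendsto_intros L2_converges_norm[OF c])
  then show ?thesis unfolding vec_variance_eq[OF s(1)] vec_variance_eq[OF s(2)] L2_norm_power2 .
qed

lemma sqint_component2: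
  fixes D :: "'a => real^'n::finite^'m::finite"
  assumes "L2 N D"
  shows "L2 N (\<lambda>q. D q $ i $ j)"
proof (rule sqint_component, rule sqint_bound[OF sqint_norm2[OF assms]])
  have "continuous_on UNIV (\<lambda>A::real^'n^'m. A $ i)" by (intro continuous_intros)
  from measurable_compose[OF sqintD[OF assms] borel_measurable_continuous_onI[OF this]]
  show "(\<lambda>q. D q $ i) \<in> borel_measurable N" .
  show "AE z in N. (norm (D z $ i))\<^sup>2 \<le> (norm (D z))\<^sup>2"
    by (intro AE_I2 power_mono Finite_Cartesian_Product.norm_nth_le norm_ge_zero)
qed

lemma L2_Cauchy_converges:
  fixes X :: "nat => 'a => 'b::euclidean_space"
  assumes fin: "finite_measure N" and sq: "\<And>k. L2 N (X k)"
    and le: "\<And>k l. L2_norm N (\<lambda>z. X k z - X l z) \<le> C * (s k + s l)" and s: "s \<longlonglongrightarrow> (0::real)" and C: "0 \<le> C"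
  shows "\<exists>x. L2_converges N X x"
proof (rule L2_complete[OF fin sq])
  fix e :: real assume e: "e > 0"
  have "e / (C + 1) / 2 > 0" using e C by simp
  from order_tendstoD(2)[OF s this] obtain n where n: "\<And>k. k \<ge> n ==> s k < e / (C + 1) / 2"
    unfolding eventually_sequentially by blast
  have "L2_norm N (\<lambda>z. X k z - X l z) < e" if kl: "k \<ge> n" "l \<ge> n" for k l
  proof -
    have "s k + s l \<le> e / (C + 1)"
      using n[OF kl(1)] n[OF kl(2)] by linarith
    then have "C * (s k + s l) \<le> C * (e / (C + 1))" by (rule mult_left_mono[OF _ C])
    also have "\<dots> < e" using e C by (simp add: field_simps)
    finally show ?thesis using le[of k l] by linarith
  qed
  then show "\<exists>n. \<forall>k\<ge>n. \<forall>l\<ge>n. L2_norm N (\<lambda>z. X k z - X l z) < e" by blast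
qed

lemma nu_section_measurable:
  assumes f: "f \<in> borel_measurable (nu T x0 \<beta>)" and t: "t \<in> {0<..<T}"
  shows "(\<lambda>x. f (t, x)) \<in> borel_measurable borel"
proof (rule measurable_compose[where N="restrict_space borel (cylinder T)"])
  show "Pair t \<in> borel \<rightarrow>\<^sub>M restrict_space borel (cylinder T)"
    using t by (intro measurable_restrict_space2 borel_measurable_continuous_onI continuous_intros) (auto simp: cylinder_def)
  show "f \<in> borel_measurable (restrict_space borel (cylinder T))"
    using f by (simp add: measurable_cong_sets[OF sets_nu refl])
qed

lemma dir_deriv_diff:
  fixes f g :: "'a::euclidean_space => real"
  assumes "smooth f" "smooth g"
  shows "dir_deriv v (\<lambda>x. f x - g x) = (\<lambda>x. dir_deriv v f x - dir_deriv v g x)"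
  by (rule dir_deriv_cong_has_derivative) (intro has_derivative_diff smooth_has_derivative assms)

lemma partial_diff:
  "smooth f ==> smooth g ==> partial i (\<lambda>x. f x - g x) = (\<lambda>x. partial i f x - partial i g x)"
  by (simp add: partial_eq dir_deriv_diff)

lemma spatial_partial_diff:
  "smooth f ==> smooth g ==> dx i (\<lambda>x. f x - g x) = (\<lambda>x. dx i f x - dx i g x)"
  by (simp add: dx_eq dir_deriv_diff)

section \<open>Occupation variance, pairings with test functions and uniqueness of jets\<close>

context
  fixes T \<beta> :: real and x0 :: "real^'n::finite"
  assumes T: "T > 0" and \<beta>: "\<beta> > 0"
begin

interpretation TW: finite_measure "wt T \<beta>" by (rule finite_measure_wt[OF T \<beta>])

text \<open>Written as a difference of two squared norms, the time-integrated variance is seen to be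
  continuous on the square-integrable functions. Sections are square integrable only for almost
  every time, so the pointwise variance formula is used almost everywhere.\<close>

lemma occ_variance:
  fixes U :: "real \<times> (real^'n) => 'b::euclidean_space"
  assumes U: "L2 (nu T x0 \<beta>) U"
  shows "(\<lambda>t. vec_variance gauss (\<lambda>z. U (t, x0 + sqrt t *\<^sub>R z))) \<in> borel_measurable (wt T \<beta>)"
    and "(LINT t|wt T \<beta>. vec_variance gauss (\<lambda>z. U (t, x0 + sqrt t *\<^sub>R z)))
      = (L2_norm (nu T x0 \<beta>) U)\<^sup>2 - (L2_norm (wt T \<beta>) (\<lambda>t. LINT z|gauss. U (t, x0 + sqrt t *\<^sub>R z)))\<^sup>2"
    and "L2 (wt T \<beta>) (\<lambda>t. LINT z|gauss. U (t, x0 + sqrt t *\<^sub>R z))"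
proof -
  let ?y = "\<lambda>t z. (t, x0 + sqrt t *\<^sub>R z)"
  define m where "m t = (LINT z|gauss. U (?y t z))" for t
  have Um: "U \<in> borel_measurable (nu T x0 \<beta>)" using U by (rule sqintD)
  note iU = integral_nu[OF T \<beta> sqint_integrable[OF finite_measure_nu[OF T \<beta>] U]]
  note i2 = integral_nu[OF T \<beta> sqint_norm2[OF U]]
  have mm[measurable]: "m \<in> borel_measurable (wt T \<beta>)"
    unfolding m_def using borel_measurable_integrable[OF iU(2)] .
  have [measurable]: "(\<lambda>p. U (occ_map x0 p)) \<in> borel_measurable (wt T \<beta> \<Otimes>\<^sub>M gauss)"
    by (rule nu_measurable_occ[OF Um])
  have "(\<lambda>p. (norm (U (occ_map x0 p) - m (fst p)))\<^sup>2) \<in> borel_measurable (wt T \<beta> \<Otimes>\<^sub>M gauss)"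
    by measurable
  then have "(\<lambda>t. LINT z|gauss. (norm (U (?y t z) - m t))\<^sup>2) \<in> borel_measurable (wt T \<beta>)"
    by (intro gauss.borel_measurable_lebesgue_integral) (simp add: case_prod_beta' occ_map_def)
  then show vm: "(\<lambda>t. vec_variance gauss (\<lambda>z. U (?y t z))) \<in> borel_measurable (wt T \<beta>)"
    by (simp add: vec_variance_def m_def)
  have sq: "AE t in wt T \<beta>. L2 gauss (\<lambda>z. U (?y t z))"
    using i2(3) AE_space
  proof eventually_elim
    case (elim t)
    have "(\<lambda>x. U (t, x)) \<in> borel_measurable borel" using nu_section_measurable[OF Um] elim(2) by simp
    then have "(\<lambda>z. U (?y t z)) \<in> borel_measurable borel"
      by (rule measurable_compose[rotated]) (intro borel_measurable_continuous_onI continuous_intros)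
    with elim(1) show ?case unfolding square_integrable_def by (simp add: measurable_cong_sets[OF sets_gauss refl])
  qed
  have ve: "AE t in wt T \<beta>. vec_variance gauss (\<lambda>z. U (?y t z)) = (LINT z|gauss. (norm (U (?y t z)))\<^sup>2) - (norm (m t))\<^sup>2"
    using sq by eventually_elim (simp add: gauss.vec_variance_eq m_def)
  have sm: "L2 (wt T \<beta>) m"
  proof (rule sqint_bound[OF i2(2) mm])
    show "AE t in wt T \<beta>. (norm (m t))\<^sup>2 \<le> (LINT z|gauss. (norm (U (?y t z)))\<^sup>2)"
      using ve by eventually_elim (use vec_variance_nonneg in \<open>smt (verit)\<close>)
  qed
  then show "L2 (wt T \<beta>) (\<lambda>t. LINT z|gauss. U (?y t z))" by (simp add: m_def[abs_def])
  have "(LINT t|wt T \<beta>. vec_variance gauss (\<lambda>z. U (?y t z)))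
     = (LINT t|wt T \<beta>. (LINT z|gauss. (norm (U (?y t z)))\<^sup>2) - (norm (m t))\<^sup>2)"
    using vm ve i2(2) by (intro integral_cong_AE) auto
  also have "\<dots> = (L2_norm (nu T x0 \<beta>) U)\<^sup>2 - (L2_norm (wt T \<beta>) m)\<^sup>2"
    unfolding L2_norm_power2 i2(1) using i2(2) sqint_norm2[OF sm] by simp
  finally show "(LINT t|wt T \<beta>. vec_variance gauss (\<lambda>z. U (?y t z)))
      = (L2_norm (nu T x0 \<beta>) U)\<^sup>2 - (L2_norm (wt T \<beta>) (\<lambda>t. LINT z|gauss. U (?y t z)))\<^sup>2"
    by (simp add: m_def[abs_def])
qed

lemma occ_variance_converges:
  fixes U :: "nat => real \<times> (real^'n) => 'b::euclidean_space"
  assumes c: "L2_converges (nu T x0 \<beta>) U u"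
  shows "(\<lambda>k. LINT t|wt T \<beta>. vec_variance gauss (\<lambda>z. U k (t, x0 + sqrt t *\<^sub>R z)))
     \<longlonglongrightarrow> (LINT t|wt T \<beta>. vec_variance gauss (\<lambda>z. u (t, x0 + sqrt t *\<^sub>R z)))"
proof -
  note s = L2_convergesD[OF c]
  define m where "m V t = (LINT z|gauss. V (t, x0 + sqrt t *\<^sub>R z))" for V :: "real \<times> (real^'n) => 'b" and t
  have sm: "L2 (wt T \<beta>) (m V)" if "L2 (nu T x0 \<beta>) V" for V
    using occ_variance(3)[OF that] by (simp add: m_def[abs_def])
  \<comment> \<open>The mean at fixed time is a contraction into the square-integrable functions of
    time, because the variance it leaves out is nonnegative.\<close>
  have le: "L2_norm (wt T \<beta>) (m V) \<le> L2_norm (nu T x0 \<beta>) V" if V: "L2 (nu T x0 \<beta>) V" for V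
  proof (rule power2_le_imp_le)
    have "0 \<le> (LINT t|wt T \<beta>. vec_variance gauss (\<lambda>z. V (t, x0 + sqrt t *\<^sub>R z)))"
      by (rule Lintegral_nonneg) (rule vec_variance_nonneg)
    then show "(L2_norm (wt T \<beta>) (m V))\<^sup>2 \<le> (L2_norm (nu T x0 \<beta>) V)\<^sup>2"
      using occ_variance(2)[OF V] by (simp add: m_def[abs_def])
  qed simp
  note si = sqint_integrable[OF finite_measure_nu[OF T \<beta>]]
  have d: "L2_norm (wt T \<beta>) (\<lambda>t. m (U k) t - m u t) \<le> L2_norm (nu T x0 \<beta>) (\<lambda>q. U k q - u q)" for k
  proof -
    have "L2_norm (wt T \<beta>) (\<lambda>t. m (U k) t - m u t) = L2_norm (wt T \<beta>) (m (\<lambda>q. U k q - u q))"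
    proof (rule L2_norm_AE_cong)
      show "(\<lambda>t. m (U k) t - m u t) \<in> borel_measurable (wt T \<beta>)"
        using sqintD[OF sm[OF s(2)]] sqintD[OF sm[OF s(1)]] by simp
      show "m (\<lambda>q. U k q - u q) \<in> borel_measurable (wt T \<beta>)"
        by (rule sqintD[OF sm[OF sqint_diff[OF s(2) s(1)]]])
      show "AE t in wt T \<beta>. m (U k) t - m u t = m (\<lambda>q. U k q - u q) t"
        using integral_nu(3)[OF T \<beta> si[OF s(2)[of k]]] integral_nu(3)[OF T \<beta> si[OF s(1)]]
        by eventually_elim (simp add: m_def)
    qed
    with le[OF sqint_diff[OF s(2) s(1)]] show ?thesis by simp
  qed
  have "L2_converges (wt T \<beta>) (\<lambda>k. m (U k)) (m u)"
    unfolding L2_converges_def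
  proof (intro conjI allI sm s)
    show "(\<lambda>k. L2_norm (wt T \<beta>) (\<lambda>z. m (U k) z - m u z)) \<longlonglongrightarrow> 0"
      by (rule tendsto_sandwich[OF _ always_eventually[OF allI[OF d]] tendsto_const s(3)]) simp
  qed
  then have "(\<lambda>k. (L2_norm (nu T x0 \<beta>) (U k))\<^sup>2 - (L2_norm (wt T \<beta>) (m (U k)))\<^sup>2)
     \<longlonglongrightarrow> (L2_norm (nu T x0 \<beta>) u)\<^sup>2 - (L2_norm (wt T \<beta>) (m u))\<^sup>2"
    by (intro tendsto_intros L2_converges_norm c)
  then show ?thesis unfolding occ_variance(2)[OF s(1)] occ_variance(2)[OF s(2)] m_def .
qed

definition occ_density :: "real \<times> (real^'n) => real" where
  "occ_density q = rfac T \<beta> (fst q) * gauss_density x0 (fst q) (snd q)"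

lemma occ_density_pos: "q \<in> cylinder T ==> 0 < occ_density q"
  by (auto simp: occ_density_def cylinder_def rfac_pos gauss_density_pos)

lemma continuous_on_occ_density: "S \<subseteq> cylinder T ==> continuous_on S occ_density"
  unfolding occ_density_def[abs_def] rfac_def gauss_density_def
  by (intro continuous_intros) (auto simp: cylinder_def)

lemma occ_density_measurable [measurable]: "occ_density \<in> borel_measurable borel"
  unfolding occ_density_def[abs_def] rfac_def gauss_density_def borel_prod[symmetric] by measurable

lemma occ_density_lower:
  assumes "compact K" "K \<subseteq> cylinder T"
  shows "\<exists>c>0. \<forall>q\<in>K. c \<le> occ_density q"
proof (cases "K = {}")
  case False
  from continuous_attains_inf[OF assms(1) False continuous_on_occ_density[OF assms(2)]]
  obtain q where "q \<in> K" "\<forall>y\<in>K. occ_density q \<le> occ_density y" by blast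
  then show ?thesis using occ_density_pos assms(2) by blast
qed (auto intro: exI[of _ 1])

lemma nu_eq_density: "nu T x0 \<beta> = density (restrict_space lborel (cylinder T)) (\<lambda>q. ennreal (occ_density q))"
  unfolding nu_def occ_density_def by (simp add: case_prod_beta')

lemma integral_nu_density:
  fixes f :: "real \<times> (real^'n) => real"
  assumes "f \<in> borel_measurable (nu T x0 \<beta>)"
  shows "(LINT q|nu T x0 \<beta>. f q) = (LINT q:cylinder T|lborel. occ_density q * f q)"
    and "integrable (nu T x0 \<beta>) f \<longleftrightarrow> set_integrable lborel (cylinder T) (\<lambda>q. occ_density q * f q)"
proof -
  have f: "f \<in> borel_measurable (restrict_space lborel (cylinder T))"
    using assms by (simp add: nu_eq_density)
  have d: "occ_density \<in> borel_measurable (restrict_space lborel (cylinder T))"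
    by (intro measurable_restrict_space1) simp
  have AE: "AE q in restrict_space lborel (cylinder T). 0 \<le> occ_density q"
    by (intro AE_I2) (auto simp: space_restrict_space intro: less_imp_le occ_density_pos)
  show "(LINT q|nu T x0 \<beta>. f q) = (LINT q:cylinder T|lborel. occ_density q * f q)"
    unfolding nu_eq_density using f d AE
    by (subst integral_density) (auto simp: integral_restrict_space set_lebesgue_integral_def)
  show "integrable (nu T x0 \<beta>) f \<longleftrightarrow> set_integrable lborel (cylinder T) (\<lambda>q. occ_density q * f q)"
    unfolding nu_eq_density using f d AE
    by (subst integrable_density) (auto simp: integrable_restrict_space set_integrable_def)
qed

text \<open>Pairing with a test function under Lebesgue measure is an inner product in the weighted space.\<close>

lemma test_pairing:
  fixes f :: "real \<times> (real^'n) => real"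
  assumes \<psi>: "test_function (cylinder T) \<psi>"
  shows "L2 (nu T x0 \<beta>) (\<lambda>q. \<psi> q / occ_density q)"
    and "f \<in> borel_measurable (nu T x0 \<beta>) ==> (LINT q:cylinder T|lborel. f q * \<psi> q) = (LINT q|nu T x0 \<beta>. f q * (\<psi> q / occ_density q))"
proof -
  let ?K = "closure {q. \<psi> q \<noteq> 0}"
  have K: "compact ?K" "?K \<subseteq> cylinder T" using \<psi> by (auto simp: test_function_def)
  obtain c where c: "c > 0" "\<And>q. q \<in> ?K ==> c \<le> occ_density q" using occ_density_lower[OF K] by blast
  obtain B where B: "\<And>q. \<bar>\<psi> q\<bar> \<le> B" using testfun_bounded[OF \<psi>] by blast
  have B0: "0 \<le> B" using order_trans[OF abs_ge_zero B] .
  have m: "(\<lambda>q. \<psi> q / occ_density q) \<in> borel_measurable (nu T x0 \<beta>)"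
    using smooth_borel[OF testfun_smooth[OF \<psi>]] by (intro nu_measurableI) simp
  show "L2 (nu T x0 \<beta>) (\<lambda>q. \<psi> q / occ_density q)"
  proof (rule sqint_bounded[OF finite_measure_nu[OF T \<beta>] m])
    fix q
    show "norm (\<psi> q / occ_density q) \<le> B / c"
    proof (cases "q \<in> ?K")
      case True
      have "\<bar>\<psi> q\<bar> / occ_density q \<le> B / c" by (rule frac_le[OF B0 B c(1) c(2)[OF True]])
      moreover have "0 < occ_density q" using c(1) c(2)[OF True] by linarith
      ultimately show ?thesis by simp
    next
      case False
      then show ?thesis using testfun_support(1)[OF \<psi> False] B0 c by simp
    qed
  qed
  show "(LINT q:cylinder T|lborel. f q * \<psi> q) = (LINT q|nu T x0 \<beta>. f q * (\<psi> q / occ_density q))"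
    if f: "f \<in> borel_measurable (nu T x0 \<beta>)"
  proof -
    have "(\<lambda>q. f q * (\<psi> q / occ_density q)) \<in> borel_measurable (nu T x0 \<beta>)" by (rule borel_measurable_times[OF f m])
    from integral_nu_density(1)[OF this]
    have "(LINT q|nu T x0 \<beta>. f q * (\<psi> q / occ_density q)) = (LINT q:cylinder T|lborel. occ_density q * (f q * (\<psi> q / occ_density q)))" .
    also have "\<dots> = (LINT q:cylinder T|lborel. f q * \<psi> q)"
    proof (rule set_lebesgue_integral_cong)
      have "occ_density q * (f q * (\<psi> q / occ_density q)) = f q * \<psi> q" if "q \<in> cylinder T" for q
        using occ_density_pos[OF that] by simp
      then show "\<forall>q. q \<in> cylinder T \<longrightarrow> occ_density q * (f q * (\<psi> q / occ_density q)) = f q * \<psi> q" by blast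
    qed simp
    finally show ?thesis ..
  qed
qed

lemma test_pairing_converges:
  fixes f :: "nat => real \<times> (real^'n) => real"
  assumes c: "L2_converges (nu T x0 \<beta>) f g" and \<psi>: "test_function (cylinder T) \<psi>"
  shows "(\<lambda>k. LINT q:cylinder T|lborel. f k q * \<psi> q) \<longlonglongrightarrow> (LINT q:cylinder T|lborel. g q * \<psi> q)"
  using L2_converges_mult[OF c L2_converges_const[OF test_pairing(1)[OF \<psi>]]]
  by (simp add: test_pairing(2)[OF \<psi>] sqintD[OF L2_convergesD(1)[OF c]] sqintD[OF L2_convergesD(2)[OF c]])

lemma cylinder_boxes:
  obtains a b :: "nat => real \<times> (real^'n)" where "\<And>k. cbox (a k) (b k) \<subseteq> cylinder T"
    "cylinder T = (\<Union>k. box (a k) (b k))" "incseq (\<lambda>k. box (a k) (b k))"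
proof -
  \<comment> \<open>The offset 2 keeps the lower end in time at most the upper end for every
    \<open>k\<close>. The closed boxes still lie in the open cylinder, so the density is bounded
    below on each of them.\<close>
  define a where "a k = (T / real (k + 2), (\<chi> i. - real k) :: real^'n)" for k :: nat
  define b where "b k = (T - T / real (k + 2), (\<chi> i. real k) :: real^'n)" for k :: nat
  have bp: "x \<in> box (c1, c2) (d1, d2) \<longleftrightarrow> c1 < fst x \<and> fst x < d1 \<and> snd x \<in> box c2 d2" for x :: "real \<times> (real^'n)" and c1 c2 d1 d2
    by (cases x) (auto simp: mem_box Basis_prod_def)
  have cbp: "x \<in> cbox (c1, c2) (d1, d2) \<longleftrightarrow> c1 \<le> fst x \<and> fst x \<le> d1 \<and> snd x \<in> cbox c2 d2" for x :: "real \<times> (real^'n)" and c1 c2 d1 d2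
    by (cases x) (auto simp: mem_box Basis_prod_def)
  have pos: "0 < T / (2 + real k)" for k :: nat using T by simp
  have sub: "cbox (a k) (b k) \<subseteq> cylinder T" for k
    unfolding a_def b_def by (auto simp: cbp cylinder_def) (use pos[of k] in linarith)+
  have cover: "\<exists>k. q \<in> box (a k) (b k)" if q: "q \<in> cylinder T" for q
  proof -
    obtain t x where qq: "q = (t, x)" and t: "0 < t" "t < T" using q by (auto simp: cylinder_def)
    have "(\<lambda>k. T * inverse (real (Suc (Suc k)))) \<longlonglongrightarrow> T * 0"
      by (intro tendsto_intros LIMSEQ_Suc[OF LIMSEQ_inverse_real_of_nat])
    then have "\<forall>\<^sub>F k in sequentially. T * inverse (real (Suc (Suc k))) < min t (T - t)"
      using t by (intro order_tendstoD(2)) auto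
    moreover obtain n where "norm x < real n" using reals_Archimedean2 by blast
    then have "\<forall>\<^sub>F k in sequentially. norm x < real k"
      unfolding eventually_sequentially by (intro exI[of _ n]) auto
    ultimately have "\<forall>\<^sub>F k in sequentially. q \<in> box (a k) (b k)"
    proof eventually_elim
      case (elim k)
      have "\<bar>x $ i\<bar> < real k" for i using component_le_norm_cart[of x i] elim(2) by linarith
      then have "x \<in> box (\<chi> i. - real k) (\<chi> i. real k)" by (auto simp: mem_box_cart abs_less_iff minus_less_iff)
      moreover have "T / real (k + 2) < t" "t < T - T / real (k + 2)" using elim(1) by (simp_all add: divide_inverse)
      ultimately show ?case unfolding qq a_def b_def bp by simp
    qed
    then show ?thesis unfolding eventually_sequentially by blast
  qed
  have inc: "incseq (\<lambda>k. box (a k) (b k))"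
  proof (rule incseq_SucI, rule subsetI)
    fix k q assume "q \<in> box (a k) (b k)"
    then have q: "T / (2 + real k) < fst q" "fst q < T - T / (2 + real k)" "\<And>i. - real k < snd q $ i" "\<And>i. snd q $ i < real k"
      unfolding a_def b_def bp by (auto simp: mem_box_cart)
    have "T / (2 + real (Suc k)) \<le> T / (2 + real k)" using T by (intro divide_left_mono) auto
    moreover have "- real (Suc k) < snd q $ i" "snd q $ i < real (Suc k)" for i using q(3,4)[of i] by simp_all
    ultimately show "q \<in> box (a (Suc k)) (b (Suc k))"
      unfolding a_def b_def bp using q(1,2) by (simp add: mem_box_cart)
  qed
  have "box (a k) (b k) \<subseteq> cylinder T" for k using sub[of k] box_subset_cbox by blast
  then have "cylinder T = (\<Union>k. box (a k) (b k))" using cover by blast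
  from that[OF sub this inc] show ?thesis .
qed

text \<open>The pairings use Lebesgue measure, which need not make \<open>g\<close> square
  integrable on the whole cylinder. On each box the occupation density is bounded below, so
  \<open>g\<close> is Lebesgue square integrable there and separation applies box by box.\<close>

lemma cylinder_separate:
  fixes g :: "real \<times> (real^'n) => real"
  assumes g: "L2 (nu T x0 \<beta>) g"
    and z: "\<And>\<psi>. test_function (cylinder T) \<psi> ==> (LINT q:cylinder T|lborel. g q * \<psi> q) = 0"
  shows "AE q in nu T x0 \<beta>. g q = 0"
proof -
  obtain a b :: "nat => real \<times> (real^'n)" where sub: "\<And>k. cbox (a k) (b k) \<subseteq> cylinder T"
    and cover: "cylinder T = (\<Union>k. box (a k) (b k))" and "incseq (\<lambda>k. box (a k) (b k))" by (rule cylinder_boxes) blast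
  have bsub: "box (a k) (b k) \<subseteq> cylinder T" for k using sub[of k] box_subset_cbox by blast
  have each: "AE q in lborel. q \<in> box (a k) (b k) \<longrightarrow> g q = 0" for k
  proof -
    let ?N = "restrict_space lborel (box (a k) (b k))"
    obtain c where c: "c > 0" "\<And>q. q \<in> cbox (a k) (b k) ==> c \<le> occ_density q"
      using occ_density_lower[OF compact_cbox sub] by blast
    have gm: "(\<lambda>q. indicator (cylinder T) q * g q) \<in> borel_measurable borel"
      using cyl_ext_measurable[OF sqintD[OF g]] by (simp add: cyl_ext_def[abs_def])
    have gN: "g \<in> borel_measurable ?N"
    proof -
      have "(\<lambda>q. indicator (cylinder T) q * g q) \<in> borel_measurable ?N" by (intro measurable_restrict_space1) (use gm in simp)
      moreover have "indicator (cylinder T) q * g q = g q" if "q \<in> space ?N" for q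
        using that bsub[of k] by (auto simp: space_restrict_space indicator_def)
      ultimately show ?thesis by (subst measurable_cong[where g="\<lambda>q. indicator (cylinder T) q * g q"]) auto
    qed
    have i: "set_integrable lborel (cylinder T) (\<lambda>q. occ_density q * (g q)\<^sup>2)"
      using sqint_norm2[OF g] sqintD[OF g] by (subst (asm) integral_nu_density(2)) auto
    have "integrable lborel (\<lambda>q. indicator (box (a k) (b k)) q * (g q)\<^sup>2)"
    proof (rule Lintegrable_bound)
      show "integrable lborel (\<lambda>q. (1 / c) * (indicator (cylinder T) q * (occ_density q * (g q)\<^sup>2)))"
        using i by (simp add: set_integrable_def)
      have "(\<lambda>q. indicator (box (a k) (b k)) q * (indicator (cylinder T) q * g q)\<^sup>2) \<in> borel_measurable borel" using gm by simp
      moreover have "indicator (box (a k) (b k)) q * (indicator (cylinder T) q * g q)\<^sup>2 = indicator (box (a k) (b k)) q * (g q)\<^sup>2" for q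
        using bsub[of k] by (auto simp: indicator_def)
      ultimately show "(\<lambda>q. indicator (box (a k) (b k)) q * (g q)\<^sup>2) \<in> borel_measurable lborel" by simp
      show "AE q in lborel. norm (indicator (box (a k) (b k)) q * (g q)\<^sup>2) \<le> norm ((1 / c) * (indicator (cylinder T) q * (occ_density q * (g q)\<^sup>2)))"
      proof (rule AE_I2)
        fix q
        show "norm (indicator (box (a k) (b k)) q * (g q)\<^sup>2) \<le> norm ((1 / c) * (indicator (cylinder T) q * (occ_density q * (g q)\<^sup>2)))"
        proof (cases "q \<in> box (a k) (b k)")
          case True
          then have "q \<in> cylinder T" "q \<in> cbox (a k) (b k)" using bsub box_subset_cbox by blast+
          then have "1 \<le> occ_density q / c" using c by (simp add: le_divide_eq)
          from mult_right_mono[OF this, of "(g q)\<^sup>2"] \<open>q \<in> cylinder T\<close> True c(1) occ_density_pos[OF \<open>q \<in> cylinder T\<close>]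
          show ?thesis by (simp add: abs_mult)
        qed simp
      qed
    qed
    then have gsq: "L2 ?N g"
      unfolding square_integrable_def using gN by (simp add: integrable_restrict_space)
    have fin: "finite_measure ?N"
      by (intro finite_measureI) (simp add: emeasure_restrict_space space_restrict_space emeasure_lborel_box_eq)
    have "AE q in ?N. g q = 0"
    proof (rule test_functions_separate[OF fin _ _ _ _ gsq, where a="\<lambda>_. a k" and b="\<lambda>_. b k"])
      fix \<psi> assume \<psi>: "test_function (box (a k) (b k)) \<psi>"
      have "(LINT x|?N. g x * \<psi> x) = (LINT q:cylinder T|lborel. g q * \<psi> q)"
        unfolding set_lebesgue_integral_def
        by (subst integral_restrict_space)
          (use testfun_zero_outside[OF \<psi>] bsub[of k] in \<open>auto simp: set_lebesgue_integral_def indicator_def intro!: Lintegral_cong\<close>)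
      then show "(LINT x|?N. g x * \<psi> x) = 0" using z[OF testfun_mono[OF \<psi> bsub]] by simp
    qed (auto simp: space_restrict_space sets_restrict_space incseq_def)
    then show ?thesis by (simp add: AE_restrict_space_iff)
  qed
  have "AE q in lborel. \<forall>k. q \<in> box (a k) (b k) \<longrightarrow> g q = 0"
    using each by (subst AE_all_countable) blast
  then have "AE q in lborel. q \<in> cylinder T \<longrightarrow> g q = 0"
    by eventually_elim (use cover in blast)
  then have "AE q in restrict_space lborel (cylinder T). g q = 0" by (simp add: AE_restrict_space_iff)
  then show ?thesis unfolding nu_eq_density
    by (subst AE_density) (auto intro: measurable_restrict_space1 elim: eventually_mono)
qed

text \<open>The theorem concerns an arbitrary jet of the solution; uniqueness up to null sets
  transfers to it what is proved for the jet built by approximation.\<close>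

lemma jet_unique:
  assumes "occupation_mild_jet T x0 \<beta> v Dv D2v" "occupation_mild_jet T x0 \<beta> v Dv' D2v'"
  shows "AE q in nu T x0 \<beta>. Dv q = Dv' q \<and> D2v q = D2v' q"
proof -
  note a = assms[unfolded occupation_mild_jet_def]
  note a1 = a(1)[THEN conjunct2, THEN conjunct2, THEN conjunct2, THEN conjunct2]
    and a2 = a(2)[THEN conjunct2, THEN conjunct2, THEN conjunct2, THEN conjunct2]
  note w1 = a1[THEN conjunct1, rule_format] and w1' = a2[THEN conjunct1, rule_format]
    and w2 = a1[THEN conjunct2, rule_format] and w2' = a2[THEN conjunct2, rule_format]
  have sep: "AE q in nu T x0 \<beta>. f q = h q" if f: "L2 (nu T x0 \<beta>) f" and h: "L2 (nu T x0 \<beta>) h"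
    and e: "\<And>\<psi>. test_function (cylinder T) \<psi> ==> (LINT q:cylinder T|lborel. f q * \<psi> q) = (LINT q:cylinder T|lborel. h q * \<psi> q)"
    for f h :: "real \<times> (real^'n) => real"
  proof -
    have "AE q in nu T x0 \<beta>. f q - h q = 0"
    proof (rule cylinder_separate[OF sqint_diff[OF f h]])
      fix \<psi> :: "real \<times> (real^'n) => real" assume \<psi>: "test_function (cylinder T) \<psi>"
      note p = test_pairing[OF \<psi>]
      have "(LINT q|nu T x0 \<beta>. (f q - h q) * (\<psi> q / occ_density q))
         = (LINT q|nu T x0 \<beta>. f q * (\<psi> q / occ_density q)) - (LINT q|nu T x0 \<beta>. h q * (\<psi> q / occ_density q))"
        using sqint_mult[OF f p(1)] sqint_mult[OF h p(1)]
        unfolding left_diff_distrib by (rule Lintegral_diff)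
      also have "\<dots> = 0"
        using e[OF \<psi>] p(2)[OF sqintD[OF f]] p(2)[OF sqintD[OF h]] by simp
      finally show "(LINT q:cylinder T|lborel. (f q - h q) * \<psi> q) = 0"
        using p(2)[OF sqintD[OF sqint_diff[OF f h]]] by simp
    qed
    then show ?thesis by simp
  qed
  have 1: "AE q in nu T x0 \<beta>. Dv q $ i = Dv' q $ i" for i
  proof (rule sep)
    show "(LINT q:cylinder T|lborel. Dv q $ i * \<psi> q) = (LINT q:cylinder T|lborel. Dv' q $ i * \<psi> q)"
      if "test_function (cylinder T) \<psi>" for \<psi> using w1[OF that, of i] w1'[OF that, of i] by linarith
  qed (use a in \<open>auto intro: sqint_component\<close>)
  have 2: "AE q in nu T x0 \<beta>. D2v q $ i $ j = D2v' q $ i $ j" for i j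
  proof (rule sep)
    show "(LINT q:cylinder T|lborel. D2v q $ i $ j * \<psi> q) = (LINT q:cylinder T|lborel. D2v' q $ i $ j * \<psi> q)"
      if "test_function (cylinder T) \<psi>" for \<psi> using w2[OF that, of i j] w2'[OF that, of i j] by linarith
  qed (use a in \<open>auto intro: sqint_component2\<close>)
  have "AE q in nu T x0 \<beta>. \<forall>i. Dv q $ i = Dv' q $ i" using 1 by (intro eventually_all_finite)
  moreover have "AE q in nu T x0 \<beta>. \<forall>i. \<forall>j. D2v q $ i $ j = D2v' q $ i $ j" using 2 by (intro eventually_all_finite)
  ultimately show ?thesis by eventually_elim (simp add: vec_eq_iff)
qed

lemma mild_weak_derivative:
  fixes F :: "real \<times> (real^'n) => real" and \<eta> :: "real^'n => real"
  assumes F: "bsmooth F" and \<eta>: "bsmooth \<eta>" and \<psi>: "test_function (cylinder T) \<psi>"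
  shows "(LINT q:cylinder T|lborel. mild T F \<eta> (fst q) (snd q) * dx i \<psi> q)
    = - (LINT q:cylinder T|lborel. mild T (dx i F) (partial i \<eta>) (fst q) (snd q) * \<psi> q)"
proof -
  have whole: "(LINT q:cylinder T|lborel. f q * \<phi> q) = (LINT q|lborel. f q * \<phi> q)"
    if "test_function (cylinder T) \<phi>" for f \<phi> :: "real \<times> (real^'n) => real"
    unfolding set_lebesgue_integral_def
    by (rule Lintegral_cong) (use testfun_zero_outside[OF that] in \<open>auto simp: indicator_def\<close>)
  have "(LINT q|lborel. mild T F \<eta> (fst q) (snd q) * dir_deriv (0, axis i 1) \<psi> q)
    = - (LINT q|lborel. mild T (dx i F) (partial i \<eta>) (fst q) (snd q) * \<psi> q)"
  proof (rule integration_by_parts_smooth[OF \<psi>])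
    show "((\<lambda>s. mild T F \<eta> (fst (q + s *\<^sub>R (0, axis i 1))) (snd (q + s *\<^sub>R (0, axis i 1)))) has_real_derivative
       mild T (dx i F) (partial i \<eta>) (fst q) (snd q)) (at 0)" for q
      using DERIV_mild[OF less_imp_le[OF T] F \<eta>] by simp
  qed (intro continuous_on_mild F \<eta> bsmooth_spatial_partial bsmooth_partial)+
  then show ?thesis
    using whole[OF \<psi>] whole[OF testfun_spatial_partial[OF \<psi>]] by (simp add: dx_eq)
qed

end

section \<open>Components, symmetrisation and changes of representative\<close>

lemma L2_converges_component:
  fixes U :: "nat => 'a => real^'n::finite"
  assumes "L2_converges N U u"
  shows "L2_converges N (\<lambda>k z. U k z $ i) (\<lambda>z. u z $ i)"
  unfolding L2_converges_def
proof (intro conjI allI sqint_component L2_convergesD(1,2)[OF assms])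
  note s = L2_convergesD[OF assms]
  have "L2_norm N (\<lambda>z. U k z $ i - u z $ i) \<le> L2_norm N (\<lambda>z. U k z - u z)" for k
  proof (rule L2_norm_mono[OF sqint_diff[OF s(2) s(1)]], rule AE_I2)
    fix z
    show "norm (U k z $ i - u z $ i) \<le> norm (U k z - u z)"
      using Finite_Cartesian_Product.norm_nth_le[of "U k z - u z" i] by simp
  qed
  then show "(\<lambda>k. L2_norm N (\<lambda>z. U k z $ i - u z $ i)) \<longlonglongrightarrow> 0"
    by (intro tendsto_sandwich[OF _ always_eventually tendsto_const s(3)]) simp_all
qed

lemma L2_converges_component2:
  fixes U :: "nat => 'a => real^'n::finite^'m::finite"
  assumes "L2_converges N U u"
  shows "L2_converges N (\<lambda>k z. U k z $ i $ j) (\<lambda>z. u z $ i $ j)"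
  unfolding L2_converges_def
proof (intro conjI allI sqint_component2 L2_convergesD(1,2)[OF assms])
  note s = L2_convergesD[OF assms]
  have "L2_norm N (\<lambda>z. U k z $ i $ j - u z $ i $ j) \<le> L2_norm N (\<lambda>z. U k z - u z)" for k
  proof (rule L2_norm_mono[OF sqint_diff[OF s(2) s(1)]], rule AE_I2)
    fix z
    show "norm (U k z $ i $ j - u z $ i $ j) \<le> norm (U k z - u z)"
      using order_trans[OF Finite_Cartesian_Product.norm_nth_le[of "(U k z - u z) $ i" j] Finite_Cartesian_Product.norm_nth_le] by simp
  qed
  then show "(\<lambda>k. L2_norm N (\<lambda>z. U k z $ i $ j - u z $ i $ j)) \<longlonglongrightarrow> 0"
    by (intro tendsto_sandwich[OF _ always_eventually tendsto_const s(3)]) simp_all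
qed

text \<open>A limit of symmetric matrices is symmetric only almost everywhere, while a jet must be
  symmetric at every point of the cylinder. Averaging with the transpose is a projection that fixes
  the approximants, so it does not increase their distance to the limit.\<close>

lemma L2_converges_symmetrize:
  fixes U :: "nat => 'a => real^'n^'n::finite"
  assumes c: "L2_converges N U u" and sym: "\<And>k z i j. U k z $ i $ j = U k z $ j $ i"
  shows "L2_converges N U (\<lambda>z. \<chi> i j. (1/2) *\<^sub>R (u z $ i $ j + u z $ j $ i))"
  unfolding L2_converges_def
proof (intro conjI allI L2_convergesD(2)[OF c])
  let ?v = "\<lambda>z. \<chi> i j. (1/2) *\<^sub>R (u z $ i $ j + u z $ j $ i)"
  note s = L2_convergesD[OF c]
  show "L2 N ?v"
    by (intro sqint_vec_lambda sqint_scaleR sqint_add sqint_component2 s)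
  have "L2_norm N (\<lambda>z. U k z - ?v z) \<le> L2_norm N (\<lambda>z. U k z - u z)" for k
  proof (rule L2_norm_mono[OF sqint_diff[OF s(2) s(1)]], rule AE_I2, rule power2_le_imp_le)
    fix z
    define D where "D i j = U k z $ i $ j - u z $ i $ j" for i j
    have e: "U k z $ i $ j - (u z $ i $ j + u z $ j $ i) / 2 = (D i j + D j i) / 2" for i j
      using sym[of k z j i] by (simp add: D_def field_simps)
    have le: "((D i j + D j i) / 2)\<^sup>2 \<le> ((D i j)\<^sup>2 + (D j i)\<^sup>2) / 2" for i j
      using zero_le_power2[of "D i j - D j i"] by (simp add: power2_eq_square field_simps)
    have "(norm (U k z - ?v z))\<^sup>2 = (\<Sum>i\<in>UNIV. \<Sum>j\<in>UNIV. ((D i j + D j i) / 2)\<^sup>2)"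
      unfolding power2_norm_matrix by (intro sum.cong refl) (simp add: e)
    also have "\<dots> \<le> (\<Sum>i\<in>UNIV. \<Sum>j\<in>UNIV. ((D i j)\<^sup>2 + (D j i)\<^sup>2) / 2)"
      by (intro sum_mono le)
    also have "\<dots> = (\<Sum>i\<in>UNIV. \<Sum>j\<in>UNIV. (D i j)\<^sup>2) / 2 + (\<Sum>i\<in>UNIV. \<Sum>j\<in>UNIV. (D j i)\<^sup>2) / 2"
      by (simp add: sum.distrib add_divide_distrib sum_divide_distrib)
    also have "(\<Sum>i\<in>UNIV. \<Sum>j\<in>UNIV. (D j i)\<^sup>2) = (\<Sum>i\<in>UNIV. \<Sum>j\<in>UNIV. (D i j)\<^sup>2)" by (rule sum.swap)
    also have "(\<Sum>i\<in>UNIV. \<Sum>j\<in>UNIV. (D i j)\<^sup>2) / 2 + (\<Sum>i\<in>UNIV. \<Sum>j\<in>UNIV. (D i j)\<^sup>2) / 2 = (norm (U k z - u z))\<^sup>2"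
      unfolding power2_norm_matrix by (simp add: D_def)
    finally show "(norm (U k z - ?v z))\<^sup>2 \<le> (norm (U k z - u z))\<^sup>2" .
  qed simp
  then show "(\<lambda>k. L2_norm N (\<lambda>z. U k z - ?v z)) \<longlonglongrightarrow> 0"
    by (intro tendsto_sandwich[OF _ always_eventually tendsto_const s(3)]) simp_all
qed

lemma L2_converges_AE_cong:
  assumes c: "L2_converges N f g" and h: "L2 N h" and e: "AE z in N. g z = h z"
  shows "L2_converges N f h"
proof -
  note s = L2_convergesD[OF c]
  have "L2_norm N (\<lambda>z. f k z - h z) = L2_norm N (\<lambda>z. f k z - g z)" for k
    using e by (intro L2_norm_AE_cong sqintD sqint_diff s h) auto
  then show ?thesis unfolding L2_converges_def using s h by simp
qed

lemma L2_converges_space_cong: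
  assumes "\<And>k z. z \<in> space N ==> f k z = f' k z" and "L2_converges N f g"
  shows "L2_converges N f' g"
proof -
  have "L2_norm N (\<lambda>z. f' k z - g z) = L2_norm N (\<lambda>z. f k z - g z)" for k
    by (rule L2_norm_cong) (simp add: assms(1))
  moreover have "L2 N (f' k)" for k
    using sqint_cong[of N "f k" "f' k"] assms(1) L2_convergesD(2)[OF assms(2)] by blast
  ultimately show ?thesis using L2_convergesD[OF assms(2)] unfolding L2_converges_def by simp
qed

section \<open>A priori bounds for smooth data\<close>

context
  fixes T \<beta> :: real and x0 :: "real^'n::finite" and M :: "'w measure" and W :: "real => 'w => real^'n"
  assumes T: "T > 0" and \<beta>: "\<beta> > 0" and bm: "brownian_motion M W"
begin

abbreviation (input) "\<nu> \<equiv> nu T x0 \<beta>"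
abbreviation (input) "\<mu>\<^sub>T \<equiv> mu M W x0 T"

lemma sqint_muD:
  fixes f :: "real^'n => 'b::euclidean_space"
  assumes f: "L2 \<mu>\<^sub>T f"
  shows "f \<in> borel_measurable borel" "L2 gauss (\<lambda>z. f (x0 + sqrt T *\<^sub>R z))"
    "L2_norm \<mu>\<^sub>T f = L2_norm gauss (\<lambda>z. f (x0 + sqrt T *\<^sub>R z))"
proof -
  show m: "f \<in> borel_measurable borel" using sqintD[OF f] by (simp add: mu_def)
  then have n: "(\<lambda>x. (norm (f x))\<^sup>2) \<in> borel_measurable borel" by simp
  have "(\<lambda>z. f (x0 + sqrt T *\<^sub>R z)) \<in> borel_measurable borel"
    by (rule measurable_compose[OF _ m]) (intro borel_measurable_continuous_onI continuous_intros)
  then show "L2 gauss (\<lambda>z. f (x0 + sqrt T *\<^sub>R z))"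
    using sqint_norm2[OF f] integral_mu(2)[OF bm T n, of x0]
    unfolding square_integrable_def by (simp add: measurable_cong_sets[OF sets_gauss refl])
  show "L2_norm \<mu>\<^sub>T f = L2_norm gauss (\<lambda>z. f (x0 + sqrt T *\<^sub>R z))"
    unfolding L2_norm_def integral_mu(1)[OF bm T n] ..
qed

lemma testfun_square_integrable_mu:
  assumes "test_function UNIV \<zeta>"
  shows "L2 \<mu>\<^sub>T \<zeta>" "L2 \<mu>\<^sub>T (grad \<zeta>)"
proof -
  have b: "L2 \<mu>\<^sub>T f" if f: "bsmooth f" for f :: "real^'n => real"
  proof -
    have m: "(\<lambda>x. (norm (f x))\<^sup>2) \<in> borel_measurable borel" using smooth_borel[OF bsmoothD[OF f]] by simp
    show ?thesis
      using sqint_norm2[OF bsmooth_square_integrable[OF f]] smooth_borel[OF bsmoothD[OF f]] integral_mu(2)[OF bm T m]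
      unfolding square_integrable_def by (simp add: mu_def)
  qed
  show "L2 \<mu>\<^sub>T \<zeta>" by (intro b testfun_bsmooth[OF assms])
  show "L2 \<mu>\<^sub>T (grad \<zeta>)"
    unfolding grad_def[abs_def] by (intro sqint_vec_lambda b bsmooth_partial testfun_bsmooth[OF assms])
qed

definition test_data :: "(real \<times> (real^'n) => real) => (real^'n => real) => bool" where
  "test_data F \<eta> \<longleftrightarrow> test_function (cylinder T) F \<and> test_function UNIV \<eta>"

lemma test_dataD:
  assumes "test_data F \<eta>"
  shows "test_function (cylinder T) F" "test_function UNIV \<eta>" "bsmooth F" "bsmooth \<eta>"
  using assms by (auto simp: test_data_def intro: testfun_bsmooth)

lemma test_data_diff:
  assumes a: "test_data F \<eta>" and b: "test_data G \<zeta>"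
  shows "test_data (\<lambda>q. F q - G q) (\<lambda>x. \<eta> x - \<zeta> x)"
    and "mild_grad T (\<lambda>q. F q - G q) (\<lambda>x. \<eta> x - \<zeta> x) t x = mild_grad T F \<eta> t x - mild_grad T G \<zeta> t x"
    and "mild_hess T (\<lambda>q. F q - G q) (\<lambda>x. \<eta> x - \<zeta> x) t x = mild_hess T F \<eta> t x - mild_hess T G \<zeta> t x"
    and "mild_AQ T (\<lambda>q. F q - G q) (\<lambda>x. \<eta> x - \<zeta> x) x0 t x = mild_AQ T F \<eta> x0 t x - mild_AQ T G \<zeta> x0 t x"
    and "grad (\<lambda>x. \<eta> x - \<zeta> x) x = grad \<eta> x - grad \<zeta> x"
proof -
  note da = test_dataD[OF a] and db = test_dataD[OF b]
  note bs = bsmooth_partial bsmooth_spatial_partial da(3,4) db(3,4)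
  note sm = bsmoothD[OF da(3)] bsmoothD[OF da(4)] bsmoothD[OF db(3)] bsmoothD[OF db(4)]
  show td: "test_data (\<lambda>q. F q - G q) (\<lambda>x. \<eta> x - \<zeta> x)"
    using da db by (simp add: test_data_def testfun_diff)
  note sp = spatial_partial_diff[OF sm(1,3)] and p = partial_diff[OF sm(2,4)]
  have sp2: "dx i (dx j (\<lambda>q. F q - G q)) = (\<lambda>q. dx i (dx j F) q - dx i (dx j G) q)" for i j
    unfolding sp by (intro spatial_partial_diff bsmoothD bs)
  have p2: "partial i (partial j (\<lambda>q. \<eta> q - \<zeta> q)) = (\<lambda>q. partial i (partial j \<eta>) q - partial i (partial j \<zeta>) q)" for i j
    unfolding p by (intro partial_diff bsmoothD bs)
  show g: "mild_grad T (\<lambda>q. F q - G q) (\<lambda>x. \<eta> x - \<zeta> x) t x = mild_grad T F \<eta> t x - mild_grad T G \<zeta> t x" for t x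
    by (simp add: mild_grad_def vec_eq_iff sp p mild_diff bs)
  show h: "mild_hess T (\<lambda>q. F q - G q) (\<lambda>x. \<eta> x - \<zeta> x) t x = mild_hess T F \<eta> t x - mild_hess T G \<zeta> t x"
    by (simp add: mild_hess_def vec_eq_iff sp2 p2 mild_diff bs)
  note si = sqint_integrable[OF gauss.finite_measure_axioms]
  have m: "mild_mean T (\<lambda>q. F q - G q) (\<lambda>x. \<eta> x - \<zeta> x) x0 t = mild_mean T F \<eta> x0 t - mild_mean T G \<zeta> x0 t"
    unfolding mild_mean_def g
    by (intro Lintegral_diff si sqint_mild_grad T da db)
  show "mild_AQ T (\<lambda>q. F q - G q) (\<lambda>x. \<eta> x - \<zeta> x) x0 t x = mild_AQ T F \<eta> x0 t x - mild_AQ T G \<zeta> x0 t x"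
    unfolding mild_AQ_def g h m
    by (simp add: sum_subtractf inner_diff_right diff_divide_distrib)
  show "grad (\<lambda>x. \<eta> x - \<zeta> x) x = grad \<eta> x - grad \<zeta> x"
    by (simp add: grad_def vec_eq_iff p)
qed

text \<open>Generous rounding: the Hessian needs 3, the operator \<open>3/2 * 3\<close>, which is
  below 5, and the gradient the square root of \<open>1 + 2 * map_const T \<beta>\<close>.\<close>

definition jet_const :: real where "jet_const = 5 + 2 * map_const T \<beta>"

lemma map_const_nonneg: "0 \<le> map_const T \<beta>"
  using T by (simp add: map_const_def[OF T \<beta> bm] src_const_def[OF T \<beta> bm])

lemma test_data_mild_map:
  assumes "test_data F \<eta>" and q: "q \<in> cylinder T"
  shows "mild_map M W T F \<eta> q = mild T F \<eta> (fst q) (snd q)"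
  using mild_map_eq_mild[OF T \<beta> test_dataD(1,4)[OF assms(1)] bm, of "fst q" "snd q"] q by (auto simp: cylinder_def)

text \<open>Bounds by the norm of the data space. Since jets and operator are linear in smooth data,
  applying them to differences of data gives the Cauchy property.\<close>

lemma test_data_bounds:
  assumes a: "test_data F \<eta>"
  defines "e \<equiv> L2_norm \<nu> F + L2_norm \<mu>\<^sub>T \<eta> + L2_norm \<mu>\<^sub>T (grad \<eta>)"
  shows "L2_norm \<nu> (Hess T F \<eta>) \<le> jet_const * e"
    and "L2_norm \<nu> (AQ T F \<eta> x0) \<le> jet_const * e"
    and "L2_norm \<nu> (Grad T F \<eta>) \<le> jet_const * e"
proof -
  note d = test_dataD[OF a]
  note mu1 = sqint_muD[OF testfun_square_integrable_mu(1)[OF d(2)]]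
    and mu2 = sqint_muD[OF testfun_square_integrable_mu(2)[OF d(2)]]
  let ?H = "L2_norm \<nu> (Hess T F \<eta>)"
  define f g h K where "f = L2_norm \<nu> F" and "g = L2_norm \<mu>\<^sub>T \<eta>" and "h = L2_norm \<mu>\<^sub>T (grad \<eta>)" and "K = map_const T \<beta>"
  have nn: "0 \<le> f" "0 \<le> g" "0 \<le> h" "0 \<le> K" using map_const_nonneg by (simp_all add: f_def g_def h_def K_def)
  have e: "e = f + g + h" "0 \<le> e" using nn by (simp_all add: e_def f_def g_def h_def)
  have "sqrt (vec_variance gauss (\<lambda>z. grad \<eta> (x0 + sqrt T *\<^sub>R z))) \<le> h"
  proof -
    have "h = sqrt (LINT z|gauss. (norm (grad \<eta> (x0 + sqrt T *\<^sub>R z)))\<^sup>2)"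
      unfolding h_def mu2(3) by (simp add: L2_norm_def)
    then show ?thesis by (simp add: gauss.vec_variance_le[OF mu2(2)])
  qed
  then have H0: "?H \<le> 2 * sqrt 2 * f + h"
    using L2_norm_hess_le[OF T \<beta> d(1,4), of x0] by (simp add: f_def)
  have s2: "sqrt 2 \<le> 3/2" by (rule real_le_lsqrt) (simp_all add: power2_eq_square)
  have "2 * sqrt 2 * f \<le> 3 * f" using s2 nn(1) by (intro mult_right_mono) auto
  then have H: "?H \<le> 3 * e" using H0 nn e by linarith
  have Ke: "0 \<le> 2 * K * e" using nn(4) e(2) by simp
  have jc: "jet_const * e = 5 * e + 2 * K * e" by (simp add: jet_const_def K_def distrib_right)
  show "?H \<le> jet_const * e" using H Ke e(2) unfolding jc by linarith
  have "L2_norm \<nu> (AQ T F \<eta> x0) \<le> sqrt 2 * ?H"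
    by (rule L2_norm_AQ_le[OF T \<beta> d(1,4)])
  also have "\<dots> \<le> 3/2 * (3 * e)" using s2 H by (intro mult_mono) auto
  finally show "L2_norm \<nu> (AQ T F \<eta> x0) \<le> jet_const * e"
    using Ke e(2) unfolding jc by linarith
  show "L2_norm \<nu> (Grad T F \<eta>) \<le> jet_const * e"
  proof (rule power2_le_imp_le)
    \<comment> \<open>Zero data have the mild solution zero, so the difference bound for the mild
      map, taken against them, bounds the norm of the solution that enters the energy
      estimate.\<close>
    have z: "test_function (cylinder T) (\<lambda>q. 0)" "test_function UNIV (\<lambda>x::real^'n. 0)" by (rule testfun_zero)+
    have z0: "L2 \<nu> (\<lambda>q. 0::real)" by (rule sqint_nu_test[OF T \<beta> z(1) testfun_bsmooth[OF z(2)]])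
    note mz = sqint_muD[OF testfun_square_integrable_mu(1)[OF z(2)]]
    have m0: "mild_map M W T (\<lambda>q. 0) (\<lambda>x. 0) q = 0" for q
      by (simp add: mild_map_def heat_def set_lebesgue_integral_def case_prod_beta')
    have "L2_norm \<nu> (\<lambda>q. mild_map M W T F \<eta> q - mild_map M W T (\<lambda>q. 0) (\<lambda>x. 0) q) \<le> K * (L2_norm \<nu> (\<lambda>q. F q - 0) + L2_norm gauss (\<lambda>z. \<eta> (x0 + sqrt T *\<^sub>R z) - 0))"
      unfolding K_def by (rule mild_map_diff_bound[OF T \<beta> bm sqint_nu_test[OF T \<beta> d(1,4)] z0 mu1(1,2) mz(1,2)])
    then have "L2_norm \<nu> (mild_map M W T F \<eta>) \<le> K * (f + g)"
      unfolding m0 by (simp add: f_def g_def mu1(3))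
    moreover have "L2_norm \<nu> (mild_map M W T F \<eta>) = L2_norm \<nu> (Mild T F \<eta>)"
      by (rule L2_norm_cong) (simp add: test_data_mild_map[OF a])
    ultimately have w: "L2_norm \<nu> (Mild T F \<eta>) \<le> K * (f + g)" by simp
    have "(L2_norm \<nu> (Grad T F \<eta>))\<^sup>2 \<le> g\<^sup>2 + 2 * (L2_norm \<nu> (Mild T F \<eta>) * f)"
      using L2_norm_grad_le[OF T \<beta> d(1,4), of x0] by (simp add: f_def g_def mu1(3))
    also have "\<dots> \<le> g\<^sup>2 + 2 * (K * (f + g) * f)" using w nn by (simp add: mult_right_mono)
    also have "\<dots> \<le> e\<^sup>2 + 2 * (K * e * e)"
      using nn e by (intro add_mono power_mono mult_left_mono mult_mono) auto
    also have "\<dots> = (1 + 2 * K) * e\<^sup>2" by (simp add: power2_eq_square algebra_simps)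
    also have "\<dots> \<le> (5 + 2 * K)\<^sup>2 * e\<^sup>2"
    proof (rule mult_right_mono)
      have "1 + 2 * K \<le> (5 + 2 * K) * 1" by simp
      also have "\<dots> \<le> (5 + 2 * K) * (5 + 2 * K)" using nn by (intro mult_left_mono) auto
      finally show "1 + 2 * K \<le> (5 + 2 * K)\<^sup>2" by (simp add: power2_eq_square)
    qed simp
    finally show "(L2_norm \<nu> (Grad T F \<eta>))\<^sup>2 \<le> (jet_const * e)\<^sup>2"
      by (simp add: jet_const_def K_def power_mult_distrib)
  qed (use e(2) map_const_nonneg in \<open>simp add: jet_const_def\<close>)
qed

section \<open>Limits along approximating smooth data\<close>

context
  fixes F :: "real \<times> (real^'n) => real" and \<eta> :: "real^'n => real" and D\<eta> :: "real^'n => real^'n"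
  assumes F: "L2 \<nu> F" and \<eta>: "gaussian_H1 \<mu>\<^sub>T \<eta> D\<eta>"
begin

lemma terminal_square_integrable: "L2 \<mu>\<^sub>T \<eta>" "L2 \<mu>\<^sub>T D\<eta>"
  using \<eta> by (simp_all add: gaussian_H1_def)

definition approximates :: "(nat => real \<times> (real^'n) => real) => (nat => real^'n => real) => bool" where
  "approximates Fs \<eta>s \<longleftrightarrow> (\<forall>k. test_data (Fs k) (\<eta>s k)) \<and> L2_converges \<nu> Fs F \<and>
     L2_converges \<mu>\<^sub>T \<eta>s \<eta> \<and> L2_converges \<mu>\<^sub>T (\<lambda>k. grad (\<eta>s k)) D\<eta>"

lemma approximatesD:
  assumes "approximates Fs \<eta>s"
  shows "test_data (Fs k) (\<eta>s k)" "L2_converges \<nu> Fs F" "L2_converges \<mu>\<^sub>T \<eta>s \<eta>" "L2_converges \<mu>\<^sub>T (\<lambda>k. grad (\<eta>s k)) D\<eta>"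
  using assms by (auto simp: approximates_def)

definition gap :: "(real \<times> (real^'n) => real) => (real^'n => real) => real" where
  "gap G \<zeta> = L2_norm \<nu> (\<lambda>q. G q - F q) + L2_norm \<mu>\<^sub>T (\<lambda>x. \<zeta> x - \<eta> x) + L2_norm \<mu>\<^sub>T (\<lambda>x. grad \<zeta> x - D\<eta> x)"

lemma gap_tendsto: "approximates Fs \<eta>s ==> (\<lambda>k. gap (Fs k) (\<eta>s k)) \<longlonglongrightarrow> 0"
  unfolding gap_def
  using tendsto_add[OF tendsto_add[OF L2_convergesD(3)[OF approximatesD(2)] L2_convergesD(3)[OF approximatesD(3)]] L2_convergesD(3)[OF approximatesD(4)]]
  by simp

text \<open>The bound is by distances to the limit data rather than between the two smooth data. The
  same statement then compares members of one sequence, for the Cauchy property, and members of two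
  sequences, for independence of the limit.\<close>

lemma jet_difference_bounds:
  assumes a: "test_data G \<zeta>" and b: "test_data G' \<zeta>'"
  shows "L2_norm \<nu> (\<lambda>q. mild_hess T G \<zeta> (fst q) (snd q) - mild_hess T G' \<zeta>' (fst q) (snd q)) \<le> jet_const * (gap G \<zeta> + gap G' \<zeta>')"
    and "L2_norm \<nu> (\<lambda>q. mild_AQ T G \<zeta> x0 (fst q) (snd q) - mild_AQ T G' \<zeta>' x0 (fst q) (snd q)) \<le> jet_const * (gap G \<zeta> + gap G' \<zeta>')"
    and "L2_norm \<nu> (\<lambda>q. mild_grad T G \<zeta> (fst q) (snd q) - mild_grad T G' \<zeta>' (fst q) (snd q)) \<le> jet_const * (gap G \<zeta> + gap G' \<zeta>')"
proof -
  have tri: "L2_norm N (\<lambda>z. f z - g z) \<le> L2_norm N (\<lambda>z. f z - h z) + L2_norm N (\<lambda>z. g z - h z)"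
    if "L2 N f" "L2 N g" "L2 N h"
    for N :: "'x measure" and f g h :: "'x => 'y::euclidean_space"
    using L2_norm_triangle3[OF that(1,3,2)] by (simp add: L2_norm_minus_commute[of N h g])
  note da = test_dataD[OF a] and db = test_dataD[OF b]
  note sq = sqint_nu_test[OF T \<beta> da(1,4)] sqint_nu_test[OF T \<beta> db(1,4)]
    and sm = testfun_square_integrable_mu[OF da(2)] testfun_square_integrable_mu[OF db(2)]
  define e where "e = L2_norm \<nu> (\<lambda>q. G q - G' q) + L2_norm \<mu>\<^sub>T (\<lambda>x. \<zeta> x - \<zeta>' x) + L2_norm \<mu>\<^sub>T (\<lambda>x. grad \<zeta> x - grad \<zeta>' x)"
  have "e \<le> gap G \<zeta> + gap G' \<zeta>'"
    unfolding e_def gap_def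
    using tri[OF sq F] tri[OF sm(1,3) terminal_square_integrable(1)] tri[OF sm(2,4) terminal_square_integrable(2)] by linarith
  then have le: "jet_const * e \<le> jet_const * (gap G \<zeta> + gap G' \<zeta>')"
    by (rule mult_left_mono) (use map_const_nonneg in \<open>simp add: jet_const_def\<close>)
  have g: "grad (\<lambda>x. \<zeta> x - \<zeta>' x) = (\<lambda>x. grad \<zeta> x - grad \<zeta>' x)" by (rule ext) (rule test_data_diff(5)[OF a b])
  note bd = test_data_bounds[OF test_data_diff(1)[OF a b], unfolded test_data_diff(2-4)[OF a b] g, folded e_def]
  show "L2_norm \<nu> (\<lambda>q. mild_hess T G \<zeta> (fst q) (snd q) - mild_hess T G' \<zeta>' (fst q) (snd q)) \<le> jet_const * (gap G \<zeta> + gap G' \<zeta>')"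
    by (rule order_trans[OF bd(1) le])
  show "L2_norm \<nu> (\<lambda>q. mild_AQ T G \<zeta> x0 (fst q) (snd q) - mild_AQ T G' \<zeta>' x0 (fst q) (snd q)) \<le> jet_const * (gap G \<zeta> + gap G' \<zeta>')"
    by (rule order_trans[OF bd(2) le])
  show "L2_norm \<nu> (\<lambda>q. mild_grad T G \<zeta> (fst q) (snd q) - mild_grad T G' \<zeta>' (fst q) (snd q)) \<le> jet_const * (gap G \<zeta> + gap G' \<zeta>')"
    by (rule order_trans[OF bd(3) le])
qed

lemma approximates_exists: "\<exists>Fs \<eta>s. approximates Fs \<eta>s"
proof -
  obtain a b :: "nat => real \<times> (real^'n)" where "\<And>k. cbox (a k) (b k) \<subseteq> cylinder T"
    and cyl: "cylinder T = (\<Union>k. box (a k) (b k))" and inc: "incseq (\<lambda>k. box (a k) (b k))"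
    by (rule cylinder_boxes[OF T \<beta>]) blast
  from test_functions_dense_sequence[OF finite_measure_nu[OF T \<beta>] space_nu sets_nu cyl inc F]
  obtain Fs where Fs: "\<And>k. test_function (cylinder T) (Fs k)" "L2_converges \<nu> Fs F" by blast
  from gaussian_H1_dense[OF T mu_eq_density[OF bm T] \<eta>]
  obtain \<eta>s where \<eta>s: "\<And>k. test_function UNIV (\<eta>s k)" "L2_converges \<mu>\<^sub>T \<eta>s \<eta>" "L2_converges \<mu>\<^sub>T (\<lambda>k. grad (\<eta>s k)) D\<eta>" by blast
  have "approximates Fs \<eta>s" using Fs \<eta>s by (simp add: approximates_def test_data_def)
  then show ?thesis by blast
qed

context
  fixes Fs :: "nat => real \<times> (real^'n) => real" and \<eta>s :: "nat => real^'n => real"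
  assumes ap: "approximates Fs \<eta>s"
begin

lemma approximating_data: "test_function (cylinder T) (Fs k)" "bsmooth (Fs k)" "bsmooth (\<eta>s k)" "test_function UNIV (\<eta>s k)"
  using test_dataD[OF approximatesD(1)[OF ap]] by auto

lemma jet_limits:
  shows "\<exists>G. L2_converges \<nu> (\<lambda>k. Grad T (Fs k) (\<eta>s k)) G"
    and "\<exists>H. L2_converges \<nu> (\<lambda>k. Hess T (Fs k) (\<eta>s k)) H"
    and "\<exists>A. L2_converges \<nu> (\<lambda>k. AQ T (Fs k) (\<eta>s k) x0) A"
proof -
  note d = approximating_data(1,3)
  have c: "0 \<le> jet_const" using map_const_nonneg by (simp add: jet_const_def)
  note tail = gap_tendsto[OF ap] c
  note bd = jet_difference_bounds[OF approximatesD(1)[OF ap] approximatesD(1)[OF ap]]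
  show "\<exists>G. L2_converges \<nu> (\<lambda>k. Grad T (Fs k) (\<eta>s k)) G"
    by (rule L2_Cauchy_converges[OF finite_measure_nu[OF T \<beta>] sqint_nu_grad[OF T \<beta> d] bd(3) tail])
  show "\<exists>H. L2_converges \<nu> (\<lambda>k. Hess T (Fs k) (\<eta>s k)) H"
    by (rule L2_Cauchy_converges[OF finite_measure_nu[OF T \<beta>] sqint_nu_hess[OF T \<beta> d] bd(1) tail])
  show "\<exists>A. L2_converges \<nu> (\<lambda>k. AQ T (Fs k) (\<eta>s k) x0) A"
    by (rule L2_Cauchy_converges[OF finite_measure_nu[OF T \<beta>] sqint_nu_AQ[OF T \<beta> d] bd(2) tail])
qed

lemma mild_converges:
  "L2_converges \<nu> (\<lambda>k. Mild T (Fs k) (\<eta>s k)) (mild_map M W T F \<eta>)"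
proof (rule L2_converges_space_cong)
  show "mild_map M W T (Fs k) (\<eta>s k) q = mild T (Fs k) (\<eta>s k) (fst q) (snd q)" if "q \<in> space \<nu>" for k q
    using test_data_mild_map[OF approximatesD(1)[OF ap]] that by simp
  note m = sqint_muD[OF terminal_square_integrable(1)]
  note mk = sqint_muD[OF testfun_square_integrable_mu(1)[OF approximating_data(4)]]
  note Fk = sqint_nu_test[OF T \<beta> approximating_data(1,3)]
  note c1 = L2_convergesD(3)[OF approximatesD(2)[OF ap]] and c2 = L2_convergesD(3)[OF approximatesD(3)[OF ap]]
  have lim: "(\<lambda>k. map_const T \<beta> * (L2_norm \<nu> (\<lambda>q. Fs k q - F q) + L2_norm \<mu>\<^sub>T (\<lambda>x. \<eta>s k x - \<eta> x))) \<longlonglongrightarrow> 0"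
    using tendsto_mult_left[OF tendsto_add[OF c1 c2], of "map_const T \<beta>"] by simp
  have le: "L2_norm \<nu> (\<lambda>q. mild_map M W T (Fs k) (\<eta>s k) q - mild_map M W T F \<eta> q)
      \<le> map_const T \<beta> * (L2_norm \<nu> (\<lambda>q. Fs k q - F q) + L2_norm \<mu>\<^sub>T (\<lambda>x. \<eta>s k x - \<eta> x))" for k
    using mild_map_diff_bound[OF T \<beta> bm Fk F mk(1,2) m(1,2), of k k]
      sqint_muD(3)[OF sqint_diff[OF testfun_square_integrable_mu(1)[OF approximating_data(4)] terminal_square_integrable(1)], of k]
    by simp
  show "L2_converges \<nu> (\<lambda>k. mild_map M W T (Fs k) (\<eta>s k)) (mild_map M W T F \<eta>)"
    by (rule L2_converges_trans[OF L2_converges_const[OF sqint_mild_map[OF T \<beta> bm F m(1,2)]]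
        sqint_mild_map[OF T \<beta> bm Fk mk(1,2)] le lim])
qed

lemma AQ_converges_iff:
  "L2_converges \<nu> (\<lambda>k. AQ_classical M W x0 (mild_map M W T (Fs k) (\<eta>s k))) A
    \<longleftrightarrow> L2_converges \<nu> (\<lambda>k. AQ T (Fs k) (\<eta>s k) x0) A"
proof -
  have e: "AQ_classical M W x0 (mild_map M W T (Fs k) (\<eta>s k)) q = mild_AQ T (Fs k) (\<eta>s k) x0 (fst q) (snd q)" if "q \<in> space \<nu>" for k q
    using AQ_classical_eq[OF T \<beta> approximating_data(1,3) bm] that by simp
  show ?thesis
    by (rule iffI; erule L2_converges_space_cong[rotated]) (simp_all only: e)
qed

lemma AQ_limitD:
  "AQ_limit M W T x0 \<beta> F \<eta> D\<eta> A ==> L2_converges \<nu> (\<lambda>k. AQ T (Fs k) (\<eta>s k) x0) A"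
  using ap unfolding AQ_limit_def AQ_converges_iff[symmetric] approximates_def test_data_def by blast

lemma limit_jet:
  assumes G: "L2_converges \<nu> (\<lambda>k. Grad T (Fs k) (\<eta>s k)) G"
    and H: "L2_converges \<nu> (\<lambda>k. Hess T (Fs k) (\<eta>s k)) H"
  shows "occupation_mild_jet T x0 \<beta> (mild_map M W T F \<eta>) G (\<lambda>q. \<chi> i j. (1/2) *\<^sub>R (H q $ i $ j + H q $ j $ i))"
proof -
  let ?S = "\<lambda>q. \<chi> i j. (1/2) *\<^sub>R (H q $ i $ j + H q $ j $ i)"
  have S: "L2_converges \<nu> (\<lambda>k. Hess T (Fs k) (\<eta>s k)) ?S"
    by (rule L2_converges_symmetrize[OF H mild_hess_symmetric[OF T approximating_data(1,3)]])
  note w = mild_converges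
  have 1: "(LINT z:cylinder T|lborel. mild_map M W T F \<eta> z * dx i \<psi> z) = - (LINT z:cylinder T|lborel. G z $ i * \<psi> z)"
    if \<psi>: "test_function (cylinder T) \<psi>" for \<psi> i
  proof (rule LIMSEQ_unique)
    show "(\<lambda>k. LINT q:cylinder T|lborel. mild T (Fs k) (\<eta>s k) (fst q) (snd q) * dx i \<psi> q)
        \<longlonglongrightarrow> (LINT z:cylinder T|lborel. mild_map M W T F \<eta> z * dx i \<psi> z)"
      by (rule test_pairing_converges[OF T \<beta> w testfun_spatial_partial[OF \<psi>]])
    show "(\<lambda>k. LINT q:cylinder T|lborel. mild T (Fs k) (\<eta>s k) (fst q) (snd q) * dx i \<psi> q)
        \<longlonglongrightarrow> - (LINT z:cylinder T|lborel. G z $ i * \<psi> z)"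
      using tendsto_minus[OF test_pairing_converges[OF T \<beta> L2_converges_component[OF G, of i] \<psi>]]
      by (simp add: mild_weak_derivative[OF T \<beta> approximating_data(2,3) \<psi>] mild_grad_def)
  qed
  have 2: "(LINT z:cylinder T|lborel. mild_map M W T F \<eta> z * dx i (dx j \<psi>) z) = (LINT z:cylinder T|lborel. ?S z $ i $ j * \<psi> z)"
    if \<psi>: "test_function (cylinder T) \<psi>" for \<psi> i j
  proof (rule LIMSEQ_unique)
    note \<psi>1 = testfun_spatial_partial[OF \<psi>]
    show "(\<lambda>k. LINT q:cylinder T|lborel. mild T (Fs k) (\<eta>s k) (fst q) (snd q) * dx i (dx j \<psi>) q)
        \<longlonglongrightarrow> (LINT z:cylinder T|lborel. mild_map M W T F \<eta> z * dx i (dx j \<psi>) z)"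
      by (rule test_pairing_converges[OF T \<beta> w testfun_spatial_partial[OF \<psi>1]])
    \<comment> \<open>Integration by parts removes the outer derivative \<open>i\<close> first, so
      the Hessian entry comes out with indices swapped; symmetry of the limit restores their
      order.\<close>
    have e: "(LINT q:cylinder T|lborel. mild T (Fs k) (\<eta>s k) (fst q) (snd q) * dx i (dx j \<psi>) q)
       = (LINT q:cylinder T|lborel. mild_hess T (Fs k) (\<eta>s k) (fst q) (snd q) $ j $ i * \<psi> q)" for k
      by (simp add: mild_weak_derivative[OF T \<beta> approximating_data(2,3) \<psi>1] mild_hess_def
          mild_weak_derivative[OF T \<beta> bsmooth_spatial_partial[OF approximating_data(2)] bsmooth_partial[OF approximating_data(3)] \<psi>])
    show "(\<lambda>k. LINT q:cylinder T|lborel. mild T (Fs k) (\<eta>s k) (fst q) (snd q) * dx i (dx j \<psi>) q)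
        \<longlonglongrightarrow> (LINT z:cylinder T|lborel. ?S z $ i $ j * \<psi> z)"
    proof -
      from test_pairing_converges[OF T \<beta> L2_converges_component2[OF S, of j i] \<psi>]
      show ?thesis unfolding e by (simp add: add.commute)
    qed
  qed
  show ?thesis
    unfolding occupation_mild_jet_def
    using 1 2 by (intro conjI allI ballI impI L2_convergesD(1)[OF w] L2_convergesD(1)[OF G] L2_convergesD(1)[OF S])
      (simp_all add: transpose_def vec_eq_iff add.commute)
qed

text \<open>Each term is continuous under the three given convergences: norms, the occupation
  variance, the terminal variance and the pairing of source with operator. The remaining work
  translates Gaussian averages back to the process and its laws.\<close>

lemma limit_identity:
  assumes G: "L2_converges \<nu> (\<lambda>k. Grad T (Fs k) (\<eta>s k)) G"
    and H: "L2_converges \<nu> (\<lambda>k. Hess T (Fs k) (\<eta>s k)) H"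
    and A: "L2_converges \<nu> (\<lambda>k. AQ T (Fs k) (\<eta>s k) x0) A"
  shows "(L2_norm \<nu> H)\<^sup>2 + 2 * \<beta> * (LINT t:{0<..<T}|lborel. rfac T \<beta> t * vec_variance M (\<lambda>\<omega>. G (t, x0 + W t \<omega>)))
      = vec_variance M (\<lambda>\<omega>. D\<eta> (x0 + W T \<omega>))
        - 2 * (LINT t:{0<..<T}|lborel. rfac T \<beta> t * (LINT x|mu M W x0 t. F (t, x) * A (t, x)))"
    and "L2_norm \<nu> H \<le> 2 * sqrt 2 * L2_norm \<nu> F + sqrt (vec_variance M (\<lambda>\<omega>. D\<eta> (x0 + W T \<omega>)))"
proof -
  note FC = approximatesD(2)[OF ap] and d = approximating_data(1,3)
  let ?V = "vec_variance gauss (\<lambda>z. D\<eta> (x0 + sqrt T *\<^sub>R z))"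
  have "L2_converges gauss (\<lambda>k z. grad (\<eta>s k) (x0 + sqrt T *\<^sub>R z)) (\<lambda>z. D\<eta> (x0 + sqrt T *\<^sub>R z))"
  proof -
    note c = L2_convergesD[OF approximatesD(4)[OF ap]]
    show ?thesis
      using c(3) unfolding L2_converges_def sqint_muD(3)[OF sqint_diff[OF c(2) c(1)]]
      using sqint_muD(2)[OF c(1)] sqint_muD(2)[OF c(2)] by blast
  qed
  then have V: "(\<lambda>k. vec_variance gauss (\<lambda>z. grad (\<eta>s k) (x0 + sqrt T *\<^sub>R z))) \<longlonglongrightarrow> ?V"
    by (rule gauss.vec_variance_converges)
  have VM: "vec_variance M (\<lambda>\<omega>. D\<eta> (x0 + W T \<omega>)) = ?V"
    by (rule vec_variance_brownian[OF bm T sqint_muD(1)[OF terminal_square_integrable(2)]])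
  have "(L2_norm \<nu> H)\<^sup>2 + 2 * \<beta> * (LINT t|wt T \<beta>. vec_variance gauss (\<lambda>z. G (t, x0 + sqrt t *\<^sub>R z)))
     = ?V - 2 * (LINT q|\<nu>. F q * A q)"
  proof (rule LIMSEQ_unique)
    let ?L = "\<lambda>k. (L2_norm \<nu> (\<lambda>q. mild_hess T (Fs k) (\<eta>s k) (fst q) (snd q)))\<^sup>2 + 2 * \<beta> * (LINT t|wt T \<beta>. mild_var T (Fs k) (\<eta>s k) x0 t)"
    show "?L \<longlonglongrightarrow> (L2_norm \<nu> H)\<^sup>2 + 2 * \<beta> * (LINT t|wt T \<beta>. vec_variance gauss (\<lambda>z. G (t, x0 + sqrt t *\<^sub>R z)))"
      unfolding mild_var_def
      by (intro tendsto_intros L2_converges_norm[OF H] occ_variance_converges[OF T \<beta> G, simplified])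
    show "?L \<longlonglongrightarrow> ?V - 2 * (LINT q|\<nu>. F q * A q)"
      unfolding mild_variance_identity[OF T \<beta> d]
      by (intro tendsto_intros V L2_converges_mult FC A)
  qed
  moreover have "(LINT t|wt T \<beta>. vec_variance gauss (\<lambda>z. G (t, x0 + sqrt t *\<^sub>R z)))
     = (LINT t:{0<..<T}|lborel. rfac T \<beta> t * vec_variance M (\<lambda>\<omega>. G (t, x0 + W t \<omega>)))"
    unfolding integral_wt(1)[OF T \<beta> occ_variance(1)[OF T \<beta> L2_convergesD(1)[OF G]]]
  proof (rule set_lebesgue_integral_cong, simp, intro allI impI)
    fix t assume t: "t \<in> {0<..<T}"
    then show "rfac T \<beta> t * vec_variance gauss (\<lambda>z. G (t, x0 + sqrt t *\<^sub>R z)) = rfac T \<beta> t * vec_variance M (\<lambda>\<omega>. G (t, x0 + W t \<omega>))"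
      using vec_variance_brownian[OF bm _ nu_section_measurable[OF sqintD[OF L2_convergesD(1)[OF G]] t], of t x0] by simp
  qed
  moreover have "(LINT q|\<nu>. F q * A q) = (LINT t:{0<..<T}|lborel. rfac T \<beta> t * (LINT x|mu M W x0 t. F (t, x) * A (t, x)))"
  proof -
    note i = integral_nu[OF T \<beta> sqint_mult[OF F L2_convergesD(1)[OF A]]]
    note m = nu_section_measurable[OF sqintD[OF F]] nu_section_measurable[OF sqintD[OF L2_convergesD(1)[OF A]]]
    show ?thesis
      unfolding i(1) integral_wt(1)[OF T \<beta> borel_measurable_integrable[OF i(2)]]
    proof (rule set_lebesgue_integral_cong, simp, intro allI impI)
      fix t assume t: "t \<in> {0<..<T}"
      then show "rfac T \<beta> t * (LINT z|gauss. F (t, x0 + sqrt t *\<^sub>R z) * A (t, x0 + sqrt t *\<^sub>R z))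
          = rfac T \<beta> t * (LINT x|mu M W x0 t. F (t, x) * A (t, x))"
        using integral_mu(1)[OF bm _ borel_measurable_times[OF m(1)[OF t] m(2)[OF t]], of t x0] by simp
    qed
  qed
  ultimately show "(L2_norm \<nu> H)\<^sup>2 + 2 * \<beta> * (LINT t:{0<..<T}|lborel. rfac T \<beta> t * vec_variance M (\<lambda>\<omega>. G (t, x0 + W t \<omega>)))
      = vec_variance M (\<lambda>\<omega>. D\<eta> (x0 + W T \<omega>))
        - 2 * (LINT t:{0<..<T}|lborel. rfac T \<beta> t * (LINT x|mu M W x0 t. F (t, x) * A (t, x)))"
    unfolding VM by simp
  show "L2_norm \<nu> H \<le> 2 * sqrt 2 * L2_norm \<nu> F + sqrt (vec_variance M (\<lambda>\<omega>. D\<eta> (x0 + W T \<omega>)))"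
    unfolding VM
  proof (rule LIMSEQ_le[OF L2_converges_norm[OF H]])
    show "(\<lambda>k. 2 * sqrt 2 * L2_norm \<nu> (Fs k) + sqrt (vec_variance gauss (\<lambda>z. grad (\<eta>s k) (x0 + sqrt T *\<^sub>R z))))
        \<longlonglongrightarrow> 2 * sqrt 2 * L2_norm \<nu> F + sqrt ?V"
      by (intro tendsto_intros V L2_converges_norm[OF FC])
  qed (use L2_norm_hess_le[OF T \<beta> d] in blast)
qed

end

text \<open>Convergence along one approximating sequence is enough: the operators along any other
  sequence differ from it by the sum of the two gaps, up to a constant.\<close>

lemma AQ_limitI:
  assumes ap: "approximates Fs \<eta>s" and A: "L2_converges \<nu> (\<lambda>k. AQ T (Fs k) (\<eta>s k) x0) A"
  shows "AQ_limit M W T x0 \<beta> F \<eta> D\<eta> A"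
  unfolding AQ_limit_def
proof (intro conjI allI impI)
  show "L2 \<nu> A" by (rule L2_convergesD(1)[OF A])
  fix Gs \<zeta>s
  assume "(\<forall>k. test_function (cylinder T) (Gs k)) \<and> (\<forall>k. test_function UNIV (\<zeta>s k)) \<and> L2_converges \<nu> Gs F \<and>
     L2_converges \<mu>\<^sub>T \<zeta>s \<eta> \<and> L2_converges \<mu>\<^sub>T (\<lambda>k. grad (\<zeta>s k)) D\<eta>"
  then have ap': "approximates Gs \<zeta>s" by (simp add: approximates_def test_data_def)
  have "(\<lambda>k. jet_const * (gap (Gs k) (\<zeta>s k) + gap (Fs k) (\<eta>s k))) \<longlonglongrightarrow> 0"
    using tendsto_mult_left[OF tendsto_add[OF gap_tendsto[OF ap'] gap_tendsto[OF ap]], of jet_const] by simp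
  from L2_converges_trans[OF A sqint_nu_AQ[OF T \<beta> approximating_data(1,3)[OF ap']]
      jet_difference_bounds(2)[OF approximatesD(1)[OF ap'] approximatesD(1)[OF ap]] this]
  show "L2_converges \<nu> (\<lambda>k. AQ_classical M W x0 (mild_map M W T (Gs k) (\<zeta>s k))) A"
    unfolding AQ_converges_iff[OF ap'] .
qed

lemma jet_exists: "\<exists>Dw D2w. occupation_mild_jet T x0 \<beta> (mild_map M W T F \<eta>) Dw D2w"
proof -
  obtain Fs \<eta>s where ap: "approximates Fs \<eta>s" using approximates_exists by blast
  from jet_limits(1,2)[OF ap] limit_jet[OF ap] show ?thesis by blast
qed

lemma AQ_limit_exists: "\<exists>A. AQ_limit M W T x0 \<beta> F \<eta> D\<eta> A"
proof -
  obtain Fs \<eta>s where ap: "approximates Fs \<eta>s" using approximates_exists by blast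
  from jet_limits(3)[OF ap] AQ_limitI[OF ap] show ?thesis by blast
qed

text \<open>The constructed limits form a jet, so by uniqueness any given jet agrees with them
  almost everywhere and is itself a limit of the smooth jets.\<close>

lemma jet_approximated:
  assumes jet: "occupation_mild_jet T x0 \<beta> (mild_map M W T F \<eta>) Dw D2w" and ap: "approximates Fs \<eta>s"
  shows "L2_converges \<nu> (\<lambda>k. Grad T (Fs k) (\<eta>s k)) Dw"
    and "L2_converges \<nu> (\<lambda>k. Hess T (Fs k) (\<eta>s k)) D2w"
proof -
  obtain G H where G: "L2_converges \<nu> (\<lambda>k. Grad T (Fs k) (\<eta>s k)) G"
    and H: "L2_converges \<nu> (\<lambda>k. Hess T (Fs k) (\<eta>s k)) H"
    using jet_limits(1,2)[OF ap] by blast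
  have S: "L2_converges \<nu> (\<lambda>k. Hess T (Fs k) (\<eta>s k)) (\<lambda>q. \<chi> i j. (1/2) *\<^sub>R (H q $ i $ j + H q $ j $ i))"
    by (rule L2_converges_symmetrize[OF H mild_hess_symmetric[OF T approximating_data(1,3)[OF ap]]])
  have sq: "L2 \<nu> Dw" "L2 \<nu> D2w" using jet by (simp_all add: occupation_mild_jet_def)
  note u = jet_unique[OF T \<beta> limit_jet[OF ap G H] jet]
  show "L2_converges \<nu> (\<lambda>k. Grad T (Fs k) (\<eta>s k)) Dw"
    using u by (intro L2_converges_AE_cong[OF G sq(1)]) (rule eventually_mono, assumption, blast)
  show "L2_converges \<nu> (\<lambda>k. Hess T (Fs k) (\<eta>s k)) D2w"
    using u by (intro L2_converges_AE_cong[OF S sq(2)]) (rule eventually_mono, assumption, blast)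
qed

end

end

theorem theorem4p2:
  fixes M :: "'w measure"
    and W :: "real \<Rightarrow> 'w \<Rightarrow> real^'n::finite"
    and x0 :: "real^'n"
    and T \<beta> :: real
    and F :: "real \<times> (real^'n) \<Rightarrow> real"
    and \<eta> :: "real^'n \<Rightarrow> real"
    and D\<eta> :: "real^'n \<Rightarrow> real^'n"
  assumes "T > 0" and "\<beta> > 0"
    and "brownian_motion M W"
    and "square_integrable (nu T x0 \<beta>) F"
    and "gaussian_H1 (mu M W x0 T) \<eta> D\<eta>"
  shows "(\<exists>Dw D2w. occupation_mild_jet T x0 \<beta> (mild_map M W T F \<eta>) Dw D2w) \<and>
    (\<exists>G. AQ_limit M W T x0 \<beta> F \<eta> D\<eta> G) \<and>
    (\<forall>Dw D2w. occupation_mild_jet T x0 \<beta> (mild_map M W T F \<eta>) Dw D2w \<longrightarrow>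
       (\<forall>G. AQ_limit M W T x0 \<beta> F \<eta> D\<eta> G \<longrightarrow>
          (L2_norm (nu T x0 \<beta>) D2w)\<^sup>2
            + 2 * \<beta> * (LINT t:{0<..<T}|lborel.
                rfac T \<beta> t * vec_variance M (\<lambda>\<omega>. Dw (t, x0 + W t \<omega>)))
          = vec_variance M (\<lambda>\<omega>. D\<eta> (x0 + W T \<omega>))
            - 2 * (LINT t:{0<..<T}|lborel.
                rfac T \<beta> t * (LINT x|mu M W x0 t. F (t, x) * G (t, x)))) \<and>
       L2_norm (nu T x0 \<beta>) D2w
         \<le> 2 * sqrt 2 * L2_norm (nu T x0 \<beta>) F + sqrt (vec_variance M (\<lambda>\<omega>. D\<eta> (x0 + W T \<omega>))))"
proof -
  note h = assms
  obtain Fs \<eta>s where ap: "approximates T \<beta> x0 M W F \<eta> D\<eta> Fs \<eta>s" using approximates_exists[OF h] by blast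
  \<comment> \<open>The norm bound mentions no limit of the operator, but it comes from a lemma
    stated with one; \<open>A\<close> fills that place, while the identity is instantiated with the
    arbitrary limit of the statement.\<close>
  obtain A where A: "AQ_limit M W T x0 \<beta> F \<eta> D\<eta> A" using AQ_limit_exists[OF h] by blast
  note lim = limit_identity[OF h ap jet_approximated[OF h _ ap]]
  show ?thesis
    using jet_exists[OF h] A lim(1)[OF _ _ AQ_limitD[OF h ap]] lim(2)[OF _ _ AQ_limitD[OF h ap A]]
    by blast
qed

end
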